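(* Let $\alpha\in[0,2)\setminus\{1\}$ and $\mu\le\mu(\alpha):=\frac{(1-\alpha)^2}{4}$, and let $T_\alpha:=\frac{4}{2-\alpha}$. Then, for every $T>T_\alpha$ and for any $(y_0,y_1)\in L^2(0,1)\times H^{-1,\mu}_{\alpha,0}(0,1)$, there exists a control $f\in L^2(0,T)$ such that the solution by transposition $y$ of $$\begin{cases}y_{tt}-(x^\alpha y_x)_x-\frac{\mu}{x^{2-\alpha}}y=0,&(t,x)\in(0,T)\times(0,1),\\ y(t,1)=f(t),&t\in(0,T),\\ y(t,0)=0\ \text{ if }0\le\alpha<1,\qquad (x^\alpha y_x)(t,0)=0\ \text{ if }1<\alpha<2,&t\in(0,T),\\ y(0,x)=y_0(x),\quad y_t(0,x)=y_1(x),&x\in(0,1),\end{cases}$$ satisfies $(y,y_t)(T,\cdot)=(0,0)$.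
   Context: Function spaces. Let $\alpha\in[0,2)\setminus\{1\}$, $\mu\le\mu(\alpha)=\frac{(1-\alpha)^2}{4}$. By the Hardy inequality $\mu(\alpha)\int_0^1 x^{\alpha-2}u^2dx\le\int_0^1x^\alpha u_x^2dx$, the form $a_\mu(u,v)=\int_0^1\big(x^\alpha u_xv_x-\frac{\mu}{x^{2-\alpha}}uv\big)dx$ is nonnegative on $C_c^\infty(0,1)$, and moreover $\int_0^1u^2dx\le\frac{16}{(2-\alpha)^2}a_\mu(u,u)$ there. The space $H^{1,\mu}_{\alpha,0}(0,1)$ is the closure of $C^\infty_c(0,1)$ for the norm $a_\mu(u,u)^{1/2}$; it consists of functions of $L^2(0,1)\cap H^1_{loc}((0,1])$ vanishing at $x=1$ (and at $x=0$ if $\alpha<1$). It is a Hilbert space for the form $a_\mu$ extended by continuity, still written as the integral above, with norm $\|u\|_{H^{1,\mu}_{\alpha,0}}=a_\mu(u,u)^{1/2}$. $H^{-1,\mu}_{\alpha,0}(0,1)$ is the dual of $H^{1,\mu}_{\alpha,0}(0,1)$ with respect to the pivot space $L^2(0,1)$. Operator. $A^\mu_\alpha u=(x^\alpha u_x)_x+\frac{\mu}{x^{2-\alpha}}u$ (distributions on $(0,1)$), with domain $D^\mu_\alpha=\{u\in H^{1,\mu}_{\alpha,0}(0,1)\cap H^2_{loc}((0,1]): A^\mu_\alpha u\in L^2(0,1)\}$. The operator $\mathcal A(u,v)=(v,A^\mu_\alpha u)$ with domain $D^\mu_\alpha\times H^{1,\mu}_{\alpha,0}(0,1)$ generates a $C_0$-group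 of isometries on $\mathcal H=H^{1,\mu}_{\alpha,0}(0,1)\times L^2(0,1)$. Backward problem. For $\tau\in(0,T]$ and $(w^0,w^1)\in\mathcal H$, $w\in C([0,\tau];H^{1,\mu}_{\alpha,0}(0,1))\cap C^1([0,\tau];L^2(0,1))$ denotes the mild solution (given by the group) of $w_{tt}=A^\mu_\alpha w$ on $(0,\tau)$ with $w(\tau)=w^0$, $w_t(\tau)=w^1$ (boundary conditions $w(t,1)=0$; $w(t,0)=0$ if $0\le\alpha<1$, $(x^\alpha w_x)(t,0)=0$ if $1<\alpha<2$). The trace $w_x(\cdot,1)\in L^2(0,\tau)$ is the classical one when $(w^0,w^1)\in D^\mu_\alpha\times H^{1,\mu}_{\alpha,0}(0,1)$, and in general is the $L^2(0,\tau)$-limit of the traces for such data approximating $(w^0,w^1)$ in $\mathcal H$ (this extension is well defined and continuous from $\mathcal H$ to $L^2(0,\tau)$). Solution by transposition. Given $f\in L^2(0,T)$ and $(y_0,y_1)\in L^2(0,1)\times H^{-1,\mu}_{\alpha,0}(0,1)$, a solution by transposition of the control problem is a $y\in C^1([0,T];H^{-1,\mu}_{\alpha,0}(0,1))\cap C([0,T];L^2(0,1))$ such that for all $\tau\in(0,T]$ and all $(w^0,w^1)\in\mathcal H$, with $w$ the corresponding solution of the backward problem, $$\langle y_t(\tau),w^0\rangle-\int_0^1y(\tau)w^1dx=\langle y_1,w(0)\rangle-\int_0^1y_0\,w_t(0)\,dx-\int_0^\tau f(t)w_x(t,1)\,dt,$$ where $\langle\cdot,\cdot\rangle$ is the duality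 between $H^{-1,\mu}_{\alpha,0}(0,1)$ and $H^{1,\mu}_{\alpha,0}(0,1)$. Such a solution exists and is unique. *)

theory Defs
  imports "HOL-Analysis.Analysis"
begin

definition square_integrable :: "real set \<Rightarrow> (real \<Rightarrow> real) set" where
  "square_integrable S =
     {f \<in> borel_measurable (lebesgue_on S). integrable (lebesgue_on S) (\<lambda>x. (f x)\<^sup>2)}"

lemma square_integrable_mult:
  assumes "f \<in> square_integrable S" "g \<in> square_integrable S"
  shows "integrable (lebesgue_on S) (\<lambda>x. f x * g x)"
proof (rule Bochner_Integration.integrable_bound)
  show "integrable (lebesgue_on S) (\<lambda>x. (f x)\<^sup>2 + (g x)\<^sup>2)"
    using assms by (auto simp: square_integrable_def)
  show "(\<lambda>x. f x * g x) \<in> borel_measurable (lebesgue_on S)"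
    using assms by (auto simp: square_integrable_def)
  have "\<bar>a * b\<bar> \<le> a\<^sup>2 + b\<^sup>2" for a b :: real
  proof -
    have "2 * (\<bar>a\<bar> * \<bar>b\<bar>) \<le> a\<^sup>2 + b\<^sup>2"
      using sum_squares_bound[of "\<bar>a\<bar>" "\<bar>b\<bar>"] by (simp add: mult.assoc)
    moreover have "0 \<le> \<bar>a\<bar> * \<bar>b\<bar>" by simp
    ultimately show ?thesis unfolding abs_mult by linarith
  qed
  then show "AE x in lebesgue_on S. norm (f x * g x) \<le> norm ((f x)\<^sup>2 + (g x)\<^sup>2)"
    by (auto intro!: AE_I2)
qed

lemma square_integrable_0: "(\<lambda>x. 0) \<in> square_integrable S"
  by (simp add: square_integrable_def)

lemma square_integrable_add:
  assumes "f \<in> square_integrable S" "g \<in> square_integrable S"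
  shows "(\<lambda>x. f x + g x) \<in> square_integrable S"
  using assms square_integrable_mult[OF assms]
  by (auto simp: square_integrable_def power2_sum mult.assoc)

lemma square_integrable_cmult:
  "f \<in> square_integrable S \<Longrightarrow> (\<lambda>x. c * f x) \<in> square_integrable S"
  by (auto simp: square_integrable_def power_mult_distrib)

lemma square_integrable_uminus:
  "f \<in> square_integrable S \<Longrightarrow> (\<lambda>x. - f x) \<in> square_integrable S"
  by (auto simp: square_integrable_def)

lemma square_integrable_diff:
  "f \<in> square_integrable S \<Longrightarrow> g \<in> square_integrable S \<Longrightarrow>
    (\<lambda>x. f x - g x) \<in> square_integrable S"
  using square_integrable_add[OF _ square_integrable_uminus, of f S g] by simp

definition L2_rel :: "(real \<Rightarrow> real) \<Rightarrow> (real \<Rightarrow> real) \<Rightarrow> bool" where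
  "L2_rel f g \<longleftrightarrow> f \<in> square_integrable {0<..<1} \<and> g \<in> square_integrable {0<..<1} \<and>
     (AE x in lebesgue_on {0<..<1}. f x = g x)"

quotient_type L2 = "real \<Rightarrow> real" / partial: L2_rel
proof (rule part_equivpI)
  show "\<exists>f. L2_rel f f"
    using square_integrable_0 by (auto simp: L2_rel_def)
  show "symp L2_rel"
    by (auto simp: symp_def L2_rel_def elim: AE_mp)
  show "transp L2_rel"
    unfolding transp_def L2_rel_def by (auto elim: AE_mp)
qed

instantiation L2 :: real_inner
begin

lift_definition zero_L2 :: L2 is "\<lambda>x. 0"
  by (simp add: L2_rel_def square_integrable_0)

lift_definition plus_L2 :: "L2 \<Rightarrow> L2 \<Rightarrow> L2" is "\<lambda>f g x. f x + g x"
  by (auto simp: L2_rel_def square_integrable_add elim: AE_mp)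

lift_definition minus_L2 :: "L2 \<Rightarrow> L2 \<Rightarrow> L2" is "\<lambda>f g x. f x - g x"
  by (auto simp: L2_rel_def square_integrable_diff elim: AE_mp)

lift_definition uminus_L2 :: "L2 \<Rightarrow> L2" is "\<lambda>f x. - f x"
  by (auto simp: L2_rel_def square_integrable_uminus elim: AE_mp)

lift_definition scaleR_L2 :: "real \<Rightarrow> L2 \<Rightarrow> L2" is "\<lambda>c f x. c * f x"
  by (auto simp: L2_rel_def square_integrable_cmult elim: AE_mp)

lift_definition inner_L2 :: "L2 \<Rightarrow> L2 \<Rightarrow> real"
  is "\<lambda>f g. LINT x|lebesgue_on {0<..<1}. f x * g x"
proof -
  fix f f' g g' assume "L2_rel f f'" "L2_rel g g'"
  then have m: "f \<in> borel_measurable (lebesgue_on {0<..<1})"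
      "f' \<in> borel_measurable (lebesgue_on {0<..<1})"
      "g \<in> borel_measurable (lebesgue_on {0<..<1})"
      "g' \<in> borel_measurable (lebesgue_on {0<..<1})"
    and "AE x in lebesgue_on {0<..<1}. f x = f' x" "AE x in lebesgue_on {0<..<1}. g x = g' x"
    by (simp_all add: L2_rel_def square_integrable_def)
  from this(5,6) have "AE x in lebesgue_on {0<..<1}. f x * g x = f' x * g' x"
    by eventually_elim simp
  then show "(LINT x|lebesgue_on {0<..<1}. f x * g x) = (LINT x|lebesgue_on {0<..<1}. f' x * g' x)"
    by (intro integral_cong_AE borel_measurable_times m)
qed

definition norm_L2 :: "L2 \<Rightarrow> real" where
  "norm_L2 u = sqrt (inner u u)"

definition sgn_L2 :: "L2 \<Rightarrow> L2" where
  "sgn_L2 u = scaleR (inverse (norm u)) u"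

definition dist_L2 :: "L2 \<Rightarrow> L2 \<Rightarrow> real" where
  "dist_L2 u v = norm (u - v)"

definition uniformity_L2 :: "(L2 \<times> L2) filter" where
  "uniformity_L2 = (INF e\<in>{0<..}. principal {(u, v). dist u v < e})"

definition open_L2 :: "L2 set \<Rightarrow> bool" where
  "open_L2 U \<longleftrightarrow> (\<forall>u\<in>U. eventually (\<lambda>(u', v). u' = u \<longrightarrow> v \<in> U) uniformity)"

instance
proof
  fix u v w :: L2 and a b :: real
  show "u + v + w = u + (v + w)"
    by transfer (auto simp: L2_rel_def add.assoc intro!: square_integrable_add)
  show "u + v = v + u"
    by transfer (auto simp: L2_rel_def add.commute intro!: square_integrable_add)
  show "0 + u = u"
    by transfer (auto simp: L2_rel_def)
  show "- u + u = 0"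
    by transfer (auto simp: L2_rel_def square_integrable_0)
  show "u - v = u + - v"
    by transfer (auto simp: L2_rel_def intro!: square_integrable_diff)
  show "a *\<^sub>R (u + v) = a *\<^sub>R u + a *\<^sub>R v"
    by transfer (auto simp: L2_rel_def algebra_simps
        intro!: square_integrable_add square_integrable_cmult)
  show "(a + b) *\<^sub>R u = a *\<^sub>R u + b *\<^sub>R u"
    by transfer (auto simp: L2_rel_def algebra_simps
        intro!: square_integrable_add square_integrable_cmult)
  show "a *\<^sub>R b *\<^sub>R u = (a * b) *\<^sub>R u"
    by transfer (auto simp: L2_rel_def algebra_simps intro!: square_integrable_cmult)
  show "1 *\<^sub>R u = u"
    by transfer (auto simp: L2_rel_def)
  show "dist u v = norm (u - v)"
    by (fact dist_L2_def)
  show "sgn u = scaleR (inverse (norm u)) u"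
    by (fact sgn_L2_def)
  show "(uniformity :: (L2 \<times> L2) filter) = (INF e\<in>{0<..}. principal {(u, v). dist u v < e})"
    by (fact uniformity_L2_def)
  show "open U \<longleftrightarrow> (\<forall>u\<in>U. eventually (\<lambda>(u', v). u' = u \<longrightarrow> v \<in> U) uniformity)" for U :: "L2 set"
    by (fact open_L2_def)
  show "inner u v = inner v u"
    by transfer (simp add: mult.commute)
  show "inner (u + v) w = inner u w + inner v w"
    by transfer (auto simp: L2_rel_def distrib_right square_integrable_mult)
  show "inner (a *\<^sub>R u) v = a * inner u v"
    by transfer (auto simp: mult.assoc)
  show "0 \<le> inner u u"
    by transfer simp
  show "inner u u = 0 \<longleftrightarrow> u = 0"
  proof transfer
    fix f assume f: "L2_rel f f"
    then have "integrable (lebesgue_on {0<..<1}) (\<lambda>x. f x * f x)"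
      by (auto simp: L2_rel_def square_integrable_mult)
    then have "(LINT x|lebesgue_on {0<..<1}. f x * f x) = 0
        \<longleftrightarrow> (AE x in lebesgue_on {0<..<1}. f x * f x = 0)"
      by (intro integral_nonneg_eq_0_iff_AE) auto
    then show "(LINT x|lebesgue_on {0<..<1}. f x * f x) = 0 \<longleftrightarrow> L2_rel f (\<lambda>x. 0)"
      using f by (auto simp: L2_rel_def square_integrable_0)
  qed
  show "norm u = sqrt (inner u u)"
    by (fact norm_L2_def)
qed

end

definition test_function :: "(real \<Rightarrow> real) \<Rightarrow> bool" where
  "test_function \<phi> \<longleftrightarrow> (\<forall>n x. (deriv ^^ n) \<phi> differentiable (at x)) \<and>
     compact (closure {x. \<phi> x \<noteq> 0}) \<and> closure {x. \<phi> x \<noteq> 0} \<subseteq> {0<..<1}"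

definition hardy_form :: "real \<Rightarrow> real \<Rightarrow> (real \<Rightarrow> real) \<Rightarrow> (real \<Rightarrow> real) \<Rightarrow> real" where
  "hardy_form \<alpha> \<mu> \<phi> \<psi> = (LINT x|lebesgue_on {0<..<1}.
     x powr \<alpha> * deriv \<phi> x * deriv \<psi> x - \<mu> / x powr (2 - \<alpha>) * \<phi> x * \<psi> x)"

(* The form dominates a multiple of the squared L2 norm and is closable in L2, so its
   abstract completion is the following subspace of L2. *)
definition H1_approx :: "real \<Rightarrow> real \<Rightarrow> (nat \<Rightarrow> real \<Rightarrow> real) \<Rightarrow> L2 \<Rightarrow> bool" where
  "H1_approx \<alpha> \<mu> \<phi> u \<longleftrightarrow> (\<forall>n. test_function (\<phi> n)) \<and>
     (\<forall>e>0. \<exists>N. \<forall>m\<ge>N. \<forall>n\<ge>N.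
        sqrt (hardy_form \<alpha> \<mu> (\<lambda>x. \<phi> m x - \<phi> n x) (\<lambda>x. \<phi> m x - \<phi> n x)) < e) \<and>
     (\<lambda>n. abs_L2 (\<phi> n)) \<longlonglongrightarrow> u"

definition H1 :: "real \<Rightarrow> real \<Rightarrow> L2 set" where
  "H1 \<alpha> \<mu> = {u. \<exists>\<phi>. H1_approx \<alpha> \<mu> \<phi> u}"

definition H1_form :: "real \<Rightarrow> real \<Rightarrow> L2 \<Rightarrow> L2 \<Rightarrow> real" where
  "H1_form \<alpha> \<mu> u v = (THE l. \<forall>\<phi> \<psi>. H1_approx \<alpha> \<mu> \<phi> u \<longrightarrow> H1_approx \<alpha> \<mu> \<psi> v \<longrightarrow>
     (\<lambda>n. hardy_form \<alpha> \<mu> (\<phi> n) (\<psi> n)) \<longlonglongrightarrow> l)"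

definition H1_norm :: "real \<Rightarrow> real \<Rightarrow> L2 \<Rightarrow> real" where
  "H1_norm \<alpha> \<mu> u = sqrt (H1_form \<alpha> \<mu> u u)"

(* Only the values of a functional on H1 matter; two functionals agreeing on H1 denote
   the same element of the dual. *)
definition H1_dual :: "real \<Rightarrow> real \<Rightarrow> (L2 \<Rightarrow> real) set" where
  "H1_dual \<alpha> \<mu> = {F.
     (\<forall>u\<in>H1 \<alpha> \<mu>. \<forall>v\<in>H1 \<alpha> \<mu>. F (u + v) = F u + F v) \<and>
     (\<forall>c. \<forall>u\<in>H1 \<alpha> \<mu>. F (c *\<^sub>R u) = c * F u) \<and>
     (\<exists>C. \<forall>u\<in>H1 \<alpha> \<mu>. \<bar>F u\<bar> \<le> C * H1_norm \<alpha> \<mu> u)}"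

definition H1_dual_norm :: "real \<Rightarrow> real \<Rightarrow> (L2 \<Rightarrow> real) \<Rightarrow> real" where
  "H1_dual_norm \<alpha> \<mu> F = (SUP v\<in>{v \<in> H1 \<alpha> \<mu>. H1_norm \<alpha> \<mu> v \<le> 1}. \<bar>F v\<bar>)"

definition weak_derivative :: "(real \<Rightarrow> real) \<Rightarrow> (real \<Rightarrow> real) \<Rightarrow> bool" where
  "weak_derivative f g \<longleftrightarrow>
     (\<forall>a b. 0 < a \<longrightarrow> b < 1 \<longrightarrow>
        integrable (lebesgue_on {a..b}) f \<and> integrable (lebesgue_on {a..b}) g) \<and>
     (\<forall>\<phi>. test_function \<phi> \<longrightarrow>
        (LINT x|lebesgue_on {0<..<1}. f x * deriv \<phi> x) =
        - (LINT x|lebesgue_on {0<..<1}. g x * \<phi> x))"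

definition H2_loc :: "L2 \<Rightarrow> bool" where
  "H2_loc u \<longleftrightarrow> (\<exists>g h. weak_derivative (rep_L2 u) g \<and> weak_derivative g h \<and>
     (\<forall>\<epsilon>. 0 < \<epsilon> \<and> \<epsilon> < 1 \<longrightarrow> g \<in> square_integrable {\<epsilon><..<1} \<and> h \<in> square_integrable {\<epsilon><..<1}))"

(* The distribution (x^alpha u_x)_x + mu / x^(2 - alpha) u equals the L2 function h. *)
definition op_A_rel :: "real \<Rightarrow> real \<Rightarrow> L2 \<Rightarrow> L2 \<Rightarrow> bool" where
  "op_A_rel \<alpha> \<mu> u h \<longleftrightarrow> (\<exists>g k. weak_derivative (rep_L2 u) g \<and>
     weak_derivative (\<lambda>x. x powr \<alpha> * g x) k \<and>
     (AE x in lebesgue_on {0<..<1}.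
        rep_L2 h x = k x + \<mu> / x powr (2 - \<alpha>) * rep_L2 u x))"

definition op_D :: "real \<Rightarrow> real \<Rightarrow> L2 set" where
  "op_D \<alpha> \<mu> = {u \<in> H1 \<alpha> \<mu>. H2_loc u \<and> (\<exists>h. op_A_rel \<alpha> \<mu> u h)}"

definition op_A :: "real \<Rightarrow> real \<Rightarrow> L2 \<Rightarrow> L2" where
  "op_A \<alpha> \<mu> u = (THE h. op_A_rel \<alpha> \<mu> u h)"

definition C0_group :: "'a::real_vector set \<Rightarrow> ('a \<Rightarrow> real) \<Rightarrow> (real \<Rightarrow> 'a \<Rightarrow> 'a) \<Rightarrow> bool" where
  "C0_group X N S \<longleftrightarrow>
     (\<forall>t. \<forall>U\<in>X. S t U \<in> X) \<and>
     (\<forall>t. \<forall>U\<in>X. \<forall>V\<in>X. S t (U + V) = S t U + S t V) \<and>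
     (\<forall>t c. \<forall>U\<in>X. S t (c *\<^sub>R U) = c *\<^sub>R S t U) \<and>
     (\<forall>t. \<exists>C. \<forall>U\<in>X. N (S t U) \<le> C * N U) \<and>
     (\<forall>U\<in>X. S 0 U = U) \<and>
     (\<forall>s t. \<forall>U\<in>X. S (s + t) U = S s (S t U)) \<and>
     (\<forall>U\<in>X. ((\<lambda>t. N (S t U - U)) \<longlongrightarrow> 0) (at 0))"

(* By the equivalence, an orbit starting outside D is not differentiable at time 0, so
   that the infinitesimal generator is B with domain exactly D. *)
definition generates_C0_group ::
  "'a::real_vector set \<Rightarrow> ('a \<Rightarrow> real) \<Rightarrow> 'a set \<Rightarrow> ('a \<Rightarrow> 'a) \<Rightarrow> (real \<Rightarrow> 'a \<Rightarrow> 'a) \<Rightarrow> bool" where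
  "generates_C0_group X N D B S \<longleftrightarrow> C0_group X N S \<and>
     (\<forall>U\<in>X. \<forall>V\<in>X. ((\<lambda>h. N ((S h U - U) /\<^sub>R h - V)) \<longlongrightarrow> 0) (at 0) \<longleftrightarrow> U \<in> D \<and> V = B U)"

definition energy_space :: "real \<Rightarrow> real \<Rightarrow> (L2 \<times> L2) set" where
  "energy_space \<alpha> \<mu> = H1 \<alpha> \<mu> \<times> UNIV"

definition energy_norm :: "real \<Rightarrow> real \<Rightarrow> L2 \<times> L2 \<Rightarrow> real" where
  "energy_norm \<alpha> \<mu> U = sqrt ((H1_norm \<alpha> \<mu> (fst U))\<^sup>2 + (norm (snd U))\<^sup>2)"

definition wave_group :: "real \<Rightarrow> real \<Rightarrow> (real \<Rightarrow> L2 \<times> L2 \<Rightarrow> L2 \<times> L2) \<Rightarrow> bool" where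
  "wave_group \<alpha> \<mu> S \<longleftrightarrow>
     generates_C0_group (energy_space \<alpha> \<mu>) (energy_norm \<alpha> \<mu>)
       (op_D \<alpha> \<mu> \<times> H1 \<alpha> \<mu>) (\<lambda>(u, v). (v, op_A \<alpha> \<mu> u)) S"

(* W t is the pair (w(t), w_t(t)), with terminal value U at time tau.  The boundary
   conditions are built into H1 and op_D. *)
definition backward_solution ::
  "real \<Rightarrow> real \<Rightarrow> real \<Rightarrow> L2 \<times> L2 \<Rightarrow> (real \<Rightarrow> L2 \<times> L2) \<Rightarrow> bool" where
  "backward_solution \<alpha> \<mu> \<tau> U W \<longleftrightarrow>
     (\<exists>S. wave_group \<alpha> \<mu> S \<and> (\<forall>t\<in>{0..\<tau>}. W t = S (t - \<tau>) U))"

(* d = u_x(1), computed from the representative of u that is C^1 on (0,1]. *)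
definition has_trace_at_1 :: "L2 \<Rightarrow> real \<Rightarrow> bool" where
  "has_trace_at_1 u d \<longleftrightarrow> (\<exists>v v'.
     (AE x in lebesgue_on {0<..<1}. rep_L2 u x = v x) \<and>
     (\<forall>x\<in>{0<..1}. (v has_real_derivative v' x) (at x within {0<..1})) \<and>
     continuous_on {0<..1} v' \<and> v' 1 = d)"

definition classical_trace ::
  "real \<Rightarrow> real \<Rightarrow> real \<Rightarrow> L2 \<times> L2 \<Rightarrow> (real \<Rightarrow> real) \<Rightarrow> bool" where
  "classical_trace \<alpha> \<mu> \<tau> U g \<longleftrightarrow> U \<in> op_D \<alpha> \<mu> \<times> H1 \<alpha> \<mu> \<and> g \<in> square_integrable {0<..<\<tau>} \<and>
     (\<exists>W. backward_solution \<alpha> \<mu> \<tau> U W \<and> (\<forall>t\<in>{0<..<\<tau>}. has_trace_at_1 (fst (W t)) (g t)))"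

definition boundary_trace ::
  "real \<Rightarrow> real \<Rightarrow> real \<Rightarrow> L2 \<times> L2 \<Rightarrow> (real \<Rightarrow> real) \<Rightarrow> bool" where
  "boundary_trace \<alpha> \<mu> \<tau> U g \<longleftrightarrow> g \<in> square_integrable {0<..<\<tau>} \<and>
     (\<exists>Us gs. (\<forall>n. classical_trace \<alpha> \<mu> \<tau> (Us n) (gs n)) \<and>
        (\<lambda>n. energy_norm \<alpha> \<mu> (Us n - U)) \<longlonglongrightarrow> 0 \<and>
        (\<lambda>n. LINT t|lebesgue_on {0<..<\<tau>}. (gs n t - g t)\<^sup>2) \<longlonglongrightarrow> 0)"

(* y is in C^1([0,T]; dual of H1) with derivative y', where an element u of L2 is
   identified with the functional inner u. *)
definition C1_dual :: "real \<Rightarrow> real \<Rightarrow> real \<Rightarrow> (real \<Rightarrow> L2) \<Rightarrow> (real \<Rightarrow> L2 \<Rightarrow> real) \<Rightarrow> bool" where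
  "C1_dual \<alpha> \<mu> T y y' \<longleftrightarrow> (\<forall>t\<in>{0..T}. y' t \<in> H1_dual \<alpha> \<mu> \<and>
     ((\<lambda>s. H1_dual_norm \<alpha> \<mu> (\<lambda>v. inner ((y s - y t) /\<^sub>R (s - t)) v - y' t v)) \<longlongrightarrow> 0)
       (at t within {0..T}) \<and>
     ((\<lambda>s. H1_dual_norm \<alpha> \<mu> (\<lambda>v. y' s v - y' t v)) \<longlongrightarrow> 0) (at t within {0..T}))"

definition transposition_solution ::
  "real \<Rightarrow> real \<Rightarrow> real \<Rightarrow> (real \<Rightarrow> real) \<Rightarrow> L2 \<Rightarrow> (L2 \<Rightarrow> real) \<Rightarrow>
   (real \<Rightarrow> L2) \<Rightarrow> (real \<Rightarrow> L2 \<Rightarrow> real) \<Rightarrow> bool" where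
  "transposition_solution \<alpha> \<mu> T f y\<^sub>0 y\<^sub>1 y y' \<longleftrightarrow>
     continuous_on {0..T} y \<and> C1_dual \<alpha> \<mu> T y y' \<and>
     (\<forall>\<tau> w\<^sub>0 w\<^sub>1 W g. 0 < \<tau> \<longrightarrow> \<tau> \<le> T \<longrightarrow> (w\<^sub>0, w\<^sub>1) \<in> energy_space \<alpha> \<mu> \<longrightarrow>
        backward_solution \<alpha> \<mu> \<tau> (w\<^sub>0, w\<^sub>1) W \<longrightarrow> boundary_trace \<alpha> \<mu> \<tau> (w\<^sub>0, w\<^sub>1) g \<longrightarrow>
        y' \<tau> w\<^sub>0 - inner (y \<tau>) w\<^sub>1 =
          y\<^sub>1 (fst (W 0)) - inner y\<^sub>0 (snd (W 0)) - (LINT t|lebesgue_on {0<..<\<tau>}. f t * g t))"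

end

theory Submission
  imports Defs "HOL-Complex_Analysis.Great_Picard"
begin

text \<open>Let \<open>\<sigma>\<close> be the larger root of \<open>\<sigma> (1 - \<alpha> - \<sigma>) = \<mu>\<close>. On test functions the form \<open>a\<^sub>\<mu>\<close> is the
  squared L2 norm of \<open>x\<^bsup>\<alpha>/2\<^esup> u' - \<sigma> x\<^bsup>\<alpha>/2-1\<^esup> u\<close>, and this first-order operator has an explicit compact inverse \<open>G\<close>,
  an integral operator. Hence \<open>H\<^sup>1 = range G\<close> isometrically, the operator \<open>A\<close> is the negative inverse
  of \<open>G G\<^sup>*\<close>, an eigenbasis of \<open>G G\<^sup>*\<close> diagonalizes the wave group, and traces at \<open>x = 1\<close> are read off
  from the kernel.

  The multiplier \<open>x u' + (\<alpha>/4) u\<close> has norm at most one from \<open>H\<^sup>1\<close> to \<open>L\<^sup>2\<close>. Together with the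
  Pohozaev identity it shows that the integral of \<open>w\<^sub>x(t,1)\<^sup>2\<close> over an interval of length \<open>T\<close> is at least
  \<open>2 \<kappa> T - 2\<close> times the squared energy norm, where \<open>\<kappa> = (2 - \<alpha>)/4\<close>; so waves are observable for
  \<open>T > 1/\<kappa>\<close>. The Hilbert uniqueness method turns observability into a control, whose solution by
  transposition is given by Duhamel's formula for the coefficients in the eigenbasis. A solution by
  transposition vanishes at time \<open>T\<close> because its identity can be tested with finite combinations of
  eigenfunctions.\<close>

text \<open>The larger root is \<sigma> = b - \<alpha>/2 with b = 1/2 + sqrt((1 - \<alpha>)^2/4 -
  \<mu>), so b \<ge> 1/2, and this choice makes the factorization exact. An L2 function orthogonal
  to the images of test functions under the first-order operator is a multiple of x powr (-b). Since
  b \<ge> 1/2 this power is not square integrable, so the images are dense and the completion of the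
  test functions is all of \<open>range G\<close>, including the critical value of \<mu>.

  The constant \<alpha>/4 in the multiplier is chosen so that kinetic and potential energy enter the
  multiplier identity with the same factor -\<kappa>. The identity then contains the conserved
  energy itself and no lower-order remainder has to be absorbed; bounding the pairing by half the
  energy at each end of the time interval produces exactly the time 1/\<kappa> = 4/(2 - \<alpha>).

  Computations with the singular weights are done on test functions, which vanish near 0, and
  extended by density, so no boundary term at 0 has to be discussed. Differentiation in time is
  likewise done on finitely many coordinates.\<close>

section \<open>Restriction and completeness of spaces of square-integrable functions\<close>

lemma square_integrable_restrict:
  assumes f: "f \<in> square_integrable S'" and S: "S' \<in> sets lebesgue" "S \<in> sets lebesgue" "S \<subseteq> S'"
  shows "f \<in> square_integrable S"
proof -
  have "f \<in> borel_measurable (lebesgue_on S)"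
    by (rule measurable_restrict_mono[OF _ S(3)]) (use f in \<open>simp add: square_integrable_def\<close>)
  moreover have "set_integrable lebesgue S' (\<lambda>x. (f x)\<^sup>2)"
    using f unfolding set_integrable_def square_integrable_def by (subst integrable_restrict_space[symmetric]) (use S in auto)
  then have "set_integrable lebesgue S (\<lambda>x. (f x)\<^sup>2)" by (rule set_integrable_subset) (use S in auto)
  then have "integrable (lebesgue_on S) (\<lambda>x. (f x)\<^sup>2)"
    unfolding set_integrable_def by (subst integrable_restrict_space) (use S in auto)
  ultimately show ?thesis by (simp add: square_integrable_def)
qed

text \<open>Riesz-Fischer. Along a subsequence with squared distances below (1/16)^k the squares of
  the increments, weighted by 4^k, have a finite sum almost everywhere; the increments are then
  dominated by a geometric series and the subsequence converges pointwise. Fatou's lemma controls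
  the distance of the whole sequence to that limit.\<close>

lemma square_integrable_complete:
  fixes f :: "nat \<Rightarrow> real \<Rightarrow> real"
  assumes f: "\<And>n. f n \<in> square_integrable S"
    and cau: "\<And>e. e > 0 \<Longrightarrow> \<exists>N. \<forall>m\<ge>N. \<forall>n\<ge>N. (LINT x|lebesgue_on S. (f m x - f n x)\<^sup>2) < e"
  shows "\<exists>g\<in>square_integrable S. (\<lambda>n. LINT x|lebesgue_on S. (f n x - g x)\<^sup>2) \<longlonglongrightarrow> 0"
proof -
  let ?M = "lebesgue_on S"
  have m[measurable]: "f n \<in> borel_measurable ?M" for n
    using f by (simp add: square_integrable_def)
  have int: "integrable ?M (\<lambda>x. (f m x - f n x)\<^sup>2)" for m n
    using square_integrable_diff[OF f f] by (simp add: square_integrable_def)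
  have nn: "(\<integral>\<^sup>+x. ennreal ((f m x - f n x)\<^sup>2) \<partial>?M) = ennreal (LINT x|?M. (f m x - f n x)\<^sup>2)" for m n
    by (rule nn_integral_eq_integral[OF int]) auto
  have "\<exists>N. \<forall>m\<ge>N. \<forall>n\<ge>N. (LINT x|?M. (f m x - f n x)\<^sup>2) < (1/16)^k" for k :: nat
    using cau[of "(1/16)^k"] by simp
  then obtain N where N: "\<And>k m n. N k \<le> m \<Longrightarrow> N k \<le> n \<Longrightarrow> (LINT x|?M. (f m x - f n x)\<^sup>2) < (1/16)^k"
    by metis
  \<comment> \<open>Summing the thresholds makes \<open>r\<close> monotone and keeps it above both
    \<open>N k\<close> and k.\<close>
  define r where "r k = k + (\<Sum>i\<le>k. N i)" for k
  have rN: "N k \<le> r k" for k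
    unfolding r_def using member_le_sum[of k "{..k}" N] by simp
  have rmono: "k \<le> l \<Longrightarrow> r k \<le> r l" for k l
    unfolding r_def by (auto intro!: add_mono sum_mono2)
  have rk: "k \<le> r k" for k by (simp add: r_def)
  define d where "d k x = f (r (Suc k)) x - f (r k) x" for k x
  have [measurable]: "d k \<in> borel_measurable ?M" for k unfolding d_def by measurable
  have dk: "(\<integral>\<^sup>+x. ennreal (4^k * (d k x)\<^sup>2) \<partial>?M) \<le> ennreal ((1/4)^k)" for k
  proof -
    have "(LINT x|?M. (d k x)\<^sup>2) \<le> (1/16)^k"
      unfolding d_def using N[of k "r (Suc k)" "r k"] rN[of k] rmono[of k "Suc k"] by simp
    then have "4^k * (LINT x|?M. (d k x)\<^sup>2) \<le> 4^k * (1/16)^k"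
      by (intro mult_left_mono) auto
    also have "\<dots> = (1/4)^k" by (simp flip: power_mult_distrib)
    finally have a: "4^k * (LINT x|?M. (d k x)\<^sup>2) \<le> (1/4)^k" .
    have "(\<integral>\<^sup>+x. ennreal (4^k * (d k x)\<^sup>2) \<partial>?M) = ennreal (LINT x|?M. 4^k * (d k x)\<^sup>2)"
      unfolding d_def by (rule nn_integral_eq_integral) (use int in auto)
    with a show ?thesis by (simp add: ennreal_leI)
  qed
  have "(\<integral>\<^sup>+x. (\<Sum>k. ennreal (4^k * (d k x)\<^sup>2)) \<partial>?M) = (\<Sum>k. \<integral>\<^sup>+x. ennreal (4^k * (d k x)\<^sup>2) \<partial>?M)"
    by (rule nn_integral_suminf) auto
  also have "\<dots> \<le> (\<Sum>k. ennreal ((1/4)^k))"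
    by (rule suminf_le) (use dk in auto)
  also have "\<dots> = ennreal (\<Sum>k. (1/4)^k)"
    by (rule suminf_ennreal2) (auto simp: summable_geometric)
  finally have "(\<integral>\<^sup>+x. (\<Sum>k. ennreal (4^k * (d k x)\<^sup>2)) \<partial>?M) \<noteq> \<infinity>"
    by (auto simp: top_unique)
  then have ae: "AE x in ?M. (\<Sum>k. ennreal (4^k * (d k x)\<^sup>2)) \<noteq> \<infinity>"
    by (rule nn_integral_noteq_infinite[rotated]) (intro borel_measurable_suminf_order measurable_compose[OF _ measurable_ennreal] borel_measurable_times borel_measurable_power borel_measurable_const; measurable)
  define g where "g = (\<lambda>x. lim (\<lambda>k. f (r k) x))"
  have gm[measurable]: "g \<in> borel_measurable ?M"
    unfolding g_def using borel_measurable_lim_metric[of "\<lambda>k. f (r k)", OF m] .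
  have conv: "(\<lambda>k. f (r k) x) \<longlonglongrightarrow> g x" if x: "(\<Sum>k. ennreal (4^k * (d k x)\<^sup>2)) \<noteq> \<infinity>" for x
  proof -
    obtain C where C: "(\<Sum>k. ennreal (4^k * (d k x)\<^sup>2)) = ennreal C" "C \<ge> 0"
      using x by (metis ennreal_cases infinity_ennreal_def)
    have dle: "norm (d k x) \<le> sqrt C * (1/2)^k" for k
    proof -
      have "ennreal (4^k * (d k x)\<^sup>2) \<le> (\<Sum>k. ennreal (4^k * (d k x)\<^sup>2))"
        by (metis ennreal_suminf_lessD linorder_not_less order_refl)
      then have "4^k * (d k x)\<^sup>2 \<le> C" unfolding C(1) using C(2) by (simp only: ennreal_le_iff)
      then have "sqrt (4^k * (d k x)\<^sup>2) \<le> sqrt C" by simp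
      moreover have "(2::real)^k * 2^k = 4^k" by (simp flip: power_mult_distrib)
      then have "4^k * (d k x)\<^sup>2 = (2^k * d k x)\<^sup>2"
        by (simp add: power2_eq_square algebra_simps)
      then have "sqrt (4^k * (d k x)\<^sup>2) = 2^k * \<bar>d k x\<bar>"
        by (simp add: abs_mult)
      ultimately show ?thesis by (simp add: field_simps)
    qed
    have "summable (\<lambda>k. sqrt C * (1/2)^k)"
      by (intro summable_mult summable_geometric) simp
    then have "summable (\<lambda>k. d k x)"
      by (rule summable_comparison_test'[where N=0]) (rule dle)
    then have "convergent (\<lambda>n. \<Sum>k<n. d k x)" by (simp add: summable_iff_convergent)
    moreover have "(\<Sum>k<n. d k x) = f (r n) x - f (r 0) x" for n
      unfolding d_def using sum_lessThan_telescope[of "\<lambda>k. f (r k) x" n] by simp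
    ultimately have "convergent (\<lambda>n. f (r n) x - f (r 0) x + f (r 0) x)"
      by (intro convergent_add) (auto simp: convergent_const)
    then show ?thesis unfolding g_def by (simp add: convergent_LIMSEQ_iff)
  qed
  have key: "(\<integral>\<^sup>+x. ennreal ((f n x - g x)\<^sup>2) \<partial>?M) \<le> ennreal e"
    if e: "e > 0" and NN: "\<And>m. m \<ge> N' \<Longrightarrow> (LINT x|?M. (f n x - f m x)\<^sup>2) < e" for n e N'
  proof -
    have "(\<integral>\<^sup>+x. ennreal ((f n x - g x)\<^sup>2) \<partial>?M) = (\<integral>\<^sup>+x. liminf (\<lambda>k. ennreal ((f n x - f (r k) x)\<^sup>2)) \<partial>?M)"
    proof (rule nn_integral_cong_AE, use ae in eventually_elim)
      fix x assume "(\<Sum>k. ennreal (4^k * (d k x)\<^sup>2)) \<noteq> \<infinity>"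
      from conv[OF this] have "(\<lambda>k. ennreal ((f n x - f (r k) x)\<^sup>2)) \<longlonglongrightarrow> ennreal ((f n x - g x)\<^sup>2)"
        by (intro tendsto_intros)
      then show "ennreal ((f n x - g x)\<^sup>2) = liminf (\<lambda>k. ennreal ((f n x - f (r k) x)\<^sup>2))"
        by (metis lim_imp_Liminf trivial_limit_sequentially)
    qed
    also have "\<dots> \<le> liminf (\<lambda>k. \<integral>\<^sup>+x. ennreal ((f n x - f (r k) x)\<^sup>2) \<partial>?M)"
      by (rule nn_integral_liminf) measurable
    also have "\<dots> \<le> ennreal e"
    proof (rule order_trans[OF Liminf_le_Limsup], simp, rule Limsup_bounded)
      show "\<forall>\<^sub>F k in sequentially. (\<integral>\<^sup>+x. ennreal ((f n x - f (r k) x)\<^sup>2) \<partial>?M) \<le> ennreal e"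
      proof (rule eventually_sequentiallyI[of N'])
        fix k assume "N' \<le> k"
        then have "N' \<le> r k" using rk[of k] by linarith
        from NN[OF this] show "(\<integral>\<^sup>+x. ennreal ((f n x - f (r k) x)\<^sup>2) \<partial>?M) \<le> ennreal e"
          unfolding nn by (intro ennreal_leI) simp
      qed
    qed
    finally show ?thesis .
  qed
  have intd: "integrable ?M (\<lambda>x. (f n x - g x)\<^sup>2) \<and> (LINT x|?M. (f n x - g x)\<^sup>2) \<le> e"
    if e: "e > 0" and NN: "\<And>m. m \<ge> N' \<Longrightarrow> (LINT x|?M. (f n x - f m x)\<^sup>2) < e" for n e N'
  proof -
    have le: "(\<integral>\<^sup>+x. ennreal ((f n x - g x)\<^sup>2) \<partial>?M) \<le> ennreal e" by (rule key[OF e NN])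
    then have i: "integrable ?M (\<lambda>x. (f n x - g x)\<^sup>2)"
      by (intro integrableI_nonneg) (auto simp: top_unique less_top[symmetric])
    with le nn_integral_eq_integral[OF i] e show ?thesis by (auto simp: ennreal_le_iff)
  qed
  obtain N1 where N1: "\<And>m n. m \<ge> N1 \<Longrightarrow> n \<ge> N1 \<Longrightarrow> (LINT x|?M. (f m x - f n x)\<^sup>2) < 1"
    using cau[of 1] by auto
  have "(\<lambda>x. f N1 x - g x) \<in> square_integrable S"
    using intd[of 1 N1 N1] N1 by (auto simp: square_integrable_def)
  from square_integrable_diff[OF f[of N1] this] have gs: "g \<in> square_integrable S" by simp
  have "(\<lambda>n. LINT x|?M. (f n x - g x)\<^sup>2) \<longlonglongrightarrow> 0"
  proof (rule LIMSEQ_I)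
    fix e :: real assume e: "e > 0"
    then obtain N' where N': "\<And>m n. m \<ge> N' \<Longrightarrow> n \<ge> N' \<Longrightarrow> (LINT x|?M. (f m x - f n x)\<^sup>2) < e/2"
      using cau[of "e/2"] by auto
    have "norm ((LINT x|?M. (f n x - g x)\<^sup>2) - 0) < e" if "n \<ge> N'" for n
      using intd[of "e/2" N' n] N' that e by (auto simp: abs_of_nonneg)
    then show "\<exists>no. \<forall>n\<ge>no. norm ((LINT x|?M. (f n x - g x)\<^sup>2) - 0) < e" by blast
  qed
  with gs show ?thesis by blast
qed

section \<open>The space L2\<close>

lemma rep_L2_square_integrable: "rep_L2 u \<in> square_integrable {0<..<1}"
  using Quotient3_rel_rep[OF Quotient3_L2, of u u] Quotient3_rep_reflp[OF Quotient3_L2, of u] by (simp add: L2_rel_def)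

lemma L2_rel_refl: "f \<in> square_integrable {0<..<1} \<Longrightarrow> L2_rel f f"
  by (simp add: L2_rel_def)

lemma abs_rep_L2: "abs_L2 (rep_L2 u) = u"
  using Quotient3_L2 by (rule Quotient3_abs_rep)

lemma abs_L2_eq_iff:
  assumes "f \<in> square_integrable {0<..<1}" "g \<in> square_integrable {0<..<1}"
  shows "abs_L2 f = abs_L2 g \<longleftrightarrow> (AE x in lebesgue_on {0<..<1}. f x = g x)"
  using assms Quotient3_rel[OF Quotient3_L2, of f g] by (auto simp: L2_rel_def)

lemma rep_abs_L2:
  assumes "f \<in> square_integrable {0<..<1}"
  shows "AE x in lebesgue_on {0<..<1}. rep_L2 (abs_L2 f) x = f x"
  using abs_L2_eq_iff[OF rep_L2_square_integrable assms, of "abs_L2 f"] by (simp add: abs_rep_L2)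

lemma L2_cases: obtains f where "f \<in> square_integrable {0<..<1}" "u = abs_L2 f"
  using rep_L2_square_integrable abs_rep_L2 by metis

lemma abs_L2_arith:
  assumes "f \<in> square_integrable {0<..<1}" "g \<in> square_integrable {0<..<1}"
  shows "abs_L2 f + abs_L2 g = abs_L2 (\<lambda>x. f x + g x)"
    and "abs_L2 f - abs_L2 g = abs_L2 (\<lambda>x. f x - g x)"
    and "- abs_L2 f = abs_L2 (\<lambda>x. - f x)"
    and "c *\<^sub>R abs_L2 f = abs_L2 (\<lambda>x. c * f x)"
    and "inner (abs_L2 f) (abs_L2 g) = (LINT x|lebesgue_on {0<..<1}. f x * g x)"
  using assms by (simp_all add: plus_L2.abs_eq minus_L2.abs_eq uminus_L2.abs_eq scaleR_L2.abs_eq inner_L2.abs_eq L2_rel_refl)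

lemma norm_abs_L2:
  assumes "f \<in> square_integrable {0<..<1}"
  shows "(norm (abs_L2 f))\<^sup>2 = (LINT x|lebesgue_on {0<..<1}. (f x)\<^sup>2)"
  unfolding power2_norm_eq_inner abs_L2_arith(5)[OF assms assms] by (simp add: power2_eq_square)

lemma zero_L2_abs: "0 = abs_L2 (\<lambda>x. 0)" by (rule zero_L2.abs_eq)

instance L2 :: complete_space
proof
  fix X :: "nat \<Rightarrow> L2" assume X: "Cauchy X"
  define f where "f n = rep_L2 (X n)" for n
  have f: "f n \<in> square_integrable {0<..<1}" for n by (simp add: f_def rep_L2_square_integrable)
  have Xf: "X n = abs_L2 (f n)" for n by (simp add: f_def abs_rep_L2)
  have nd: "(norm (X m - X n))\<^sup>2 = (LINT x|lebesgue_on {0<..<1}. (f m x - f n x)\<^sup>2)" for m n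
    unfolding Xf abs_L2_arith(2)[OF f f] by (rule norm_abs_L2[OF square_integrable_diff[OF f f]])
  have "\<exists>g\<in>square_integrable {0<..<1}. (\<lambda>n. LINT x|lebesgue_on {0<..<1}. (f n x - g x)\<^sup>2) \<longlonglongrightarrow> 0"
  proof (rule square_integrable_complete[OF f])
    fix e :: real assume "e > 0"
    then obtain N where "\<And>m n. m \<ge> N \<Longrightarrow> n \<ge> N \<Longrightarrow> norm (X m - X n) < sqrt e"
      using CauchyD[OF X, of "sqrt e"] by auto
    then have "\<And>m n. m \<ge> N \<Longrightarrow> n \<ge> N \<Longrightarrow> (norm (X m - X n))\<^sup>2 < e"
      using \<open>e > 0\<close> by (metis abs_of_nonneg norm_ge_zero real_less_rsqrt real_sqrt_abs real_sqrt_less_iff)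
    then show "\<exists>N. \<forall>m\<ge>N. \<forall>n\<ge>N. (LINT x|lebesgue_on {0<..<1}. (f m x - f n x)\<^sup>2) < e"
      unfolding nd by blast
  qed
  then obtain g where g: "g \<in> square_integrable {0<..<1}"
      and lim: "(\<lambda>n. LINT x|lebesgue_on {0<..<1}. (f n x - g x)\<^sup>2) \<longlonglongrightarrow> 0" by blast
  have "(norm (X n - abs_L2 g))\<^sup>2 = (LINT x|lebesgue_on {0<..<1}. (f n x - g x)\<^sup>2)" for n
    unfolding Xf abs_L2_arith(2)[OF f g] by (rule norm_abs_L2[OF square_integrable_diff[OF f g]])
  with lim have "(\<lambda>n. (norm (X n - abs_L2 g))\<^sup>2) \<longlonglongrightarrow> 0" by simp
  then have "(\<lambda>n. sqrt ((norm (X n - abs_L2 g))\<^sup>2)) \<longlonglongrightarrow> sqrt 0" by (rule tendsto_real_sqrt)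
  then have "(\<lambda>n. norm (X n - abs_L2 g)) \<longlonglongrightarrow> 0" by simp
  then have "X \<longlonglongrightarrow> abs_L2 g" by (simp add: LIM_zero_iff tendsto_norm_zero_iff)
  then show "convergent X" by (auto simp: convergent_def)
qed

section \<open>Hilbert space tools\<close>

text \<open>Minimizes the quadratic functional \<open>J u = \<beta> u u - 2 * \<Psi> u\<close>. As
  \<beta> may be degenerate and P incomplete, there may be no minimizer; the minimizing sequence
  itself is delivered, Cauchy by the parallelogram law and asymptotically a solution of the Euler
  equation. This form serves both the inner product of a Hilbert space and the form given by the
  boundary traces of states.\<close>

lemma riesz_minimizing_sequence:
  fixes P :: "'a::real_vector set" and \<beta> :: "'a \<Rightarrow> 'a \<Rightarrow> real" and \<Psi> :: "'a \<Rightarrow> real"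
  assumes P: "subspace P"
    and add: "\<And>u v w. u \<in> P \<Longrightarrow> v \<in> P \<Longrightarrow> w \<in> P \<Longrightarrow> \<beta> (u + v) w = \<beta> u w + \<beta> v w"
    and scale: "\<And>c u w. u \<in> P \<Longrightarrow> w \<in> P \<Longrightarrow> \<beta> (c *\<^sub>R u) w = c * \<beta> u w"
    and sym: "\<And>u v. u \<in> P \<Longrightarrow> v \<in> P \<Longrightarrow> \<beta> u v = \<beta> v u"
    and nonneg: "\<And>u. u \<in> P \<Longrightarrow> 0 \<le> \<beta> u u"
    and \<Psi>add: "\<And>u v. u \<in> P \<Longrightarrow> v \<in> P \<Longrightarrow> \<Psi> (u + v) = \<Psi> u + \<Psi> v"
    and \<Psi>scale: "\<And>c u. u \<in> P \<Longrightarrow> \<Psi> (c *\<^sub>R u) = c * \<Psi> u"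
    and bd: "\<And>u. u \<in> P \<Longrightarrow> (\<Psi> u)\<^sup>2 \<le> C * \<beta> u u"
  obtains U :: "nat \<Rightarrow> 'a" where "\<And>n. U n \<in> P"
    and "\<And>e. e > 0 \<Longrightarrow> \<exists>N. \<forall>m\<ge>N. \<forall>n\<ge>N. \<beta> (U m - U n) (U m - U n) < e"
    and "\<And>u. u \<in> P \<Longrightarrow> (\<lambda>n. \<beta> (U n) u) \<longlonglongrightarrow> \<Psi> u"
proof -
  note mem = subspace_add[OF P] subspace_scale[OF P] subspace_diff[OF P]
  have add': "\<beta> w (u + v) = \<beta> w u + \<beta> w v" if "u \<in> P" "v \<in> P" "w \<in> P" for u v w
    using that add[of u v w] sym[of w "u + v"] sym[of w u] sym[of w v] mem by simp
  have scale': "\<beta> w (c *\<^sub>R u) = c * \<beta> w u" if "u \<in> P" "w \<in> P" for c u w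
    using that scale[of u w c] sym[of w "c *\<^sub>R u"] sym[of w u] mem by simp
  define J where "J u = \<beta> u u - 2 * \<Psi> u" for u
  define C' where "C' = \<bar>C\<bar> + 1"
  have C': "C' > 0" by (simp add: C'_def)
  have Jlow: "J u \<ge> - C'" if u: "u \<in> P" for u
  proof -
    have "(\<Psi> u)\<^sup>2 \<le> C' * \<beta> u u"
      using bd[OF u] mult_right_mono[of C C', OF _ nonneg[OF u]] by (simp add: C'_def abs_ge_self add_increasing2)
    moreover have "0 \<le> (\<Psi> u - C')\<^sup>2" by simp
    ultimately have "C' * (2 * \<Psi> u) \<le> C' * (\<beta> u u + C')"
      by (simp add: power2_eq_square algebra_simps)
    then show ?thesis using C' by (simp add: J_def)
  qed
  define m where "m = Inf (J ` P)"
  have ne: "J ` P \<noteq> {}" using subspace_0[OF P] by blast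
  have bb: "bdd_below (J ` P)" using Jlow by (intro bdd_belowI2[of _ "- C'"]) auto
  have mJ: "m \<le> J u" if "u \<in> P" for u unfolding m_def using that bb by (auto intro: cInf_lower)
  have "\<exists>u\<in>P. J u < m + 1 / real (Suc n)" for n
  proof -
    have "Inf (J ` P) < m + 1 / real (Suc n)" unfolding m_def by simp
    then show ?thesis using cInf_lessD[OF ne] by auto
  qed
  then obtain U where U: "\<And>n. U n \<in> P" and JU: "\<And>n. J (U n) < m + 1 / real (Suc n)"
    by metis
  \<comment> \<open>Parallelogram law, with \<open>J\<close> at the midpoint bounded below by
    m.\<close>
  have par: "\<beta> (u - v) (u - v) \<le> 2 * (J u - m) + 2 * (J v - m)" if u: "u \<in> P" and v: "v \<in> P" for u v
  proof -
    have h: "(1/2) *\<^sub>R (u + v) \<in> P" using u v mem by blast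
    define v' where "v' = (-1) *\<^sub>R v"
    have v': "v' \<in> P" unfolding v'_def using v mem by blast
    have "\<beta> u v' = - \<beta> u v" "\<beta> v' u = - \<beta> u v" "\<beta> v' v' = \<beta> v v"
      unfolding v'_def using u v v' sym[OF u v] scale[of v v' "-1"] scale'[of v v "-1"] scale[of v u "-1"] scale'[of v u "-1"]
      by (simp_all add: v'_def)
    then have e1: "\<beta> (u + v') (u + v') = \<beta> u u - 2 * \<beta> u v + \<beta> v v"
      using u v' mem by (simp add: add add')
    have e2: "\<beta> (u + v) (u + v) = \<beta> u u + 2 * \<beta> u v + \<beta> v v"
      using u v mem sym[OF u v] by (simp add: add add')
    have e3: "\<beta> ((1/2) *\<^sub>R (u + v)) ((1/2) *\<^sub>R (u + v)) = \<beta> (u + v) (u + v) / 4"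
      using u v mem by (simp add: scale scale' del: scaleR_add_right)
    have e4: "\<Psi> ((1/2) *\<^sub>R (u + v)) = (\<Psi> u + \<Psi> v) / 2"
      using u v mem by (simp add: \<Psi>scale \<Psi>add del: scaleR_add_right)
    have "u - v = u + v'" by (simp add: v'_def)
    then have e5: "\<beta> (u - v) (u - v) = \<beta> u u - 2 * \<beta> u v + \<beta> v v" using e1 by metis
    show ?thesis using mJ[OF h] unfolding J_def e3 e4 e2 e5 by (simp add: field_simps)
  qed
  show ?thesis
  proof
    show "U n \<in> P" for n by (rule U)
    show "\<exists>N. \<forall>m\<ge>N. \<forall>n\<ge>N. \<beta> (U m - U n) (U m - U n) < e" if e: "e > 0" for e
    proof -
      have aux: "a \<le> c \<Longrightarrow> b \<le> c \<Longrightarrow> 4 * c < e \<Longrightarrow> z \<le> 2 * (x - m) + 2 * (y - m) \<Longrightarrow> x < m + a \<Longrightarrow> y < m + b \<Longrightarrow> z < e"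
        for a b c x y z :: real by argo
      obtain N where N: "4 / e < real (Suc N)" using reals_Archimedean2[of "4/e"] by (meson less_Suc_eq less_trans of_nat_less_iff)
      have "\<beta> (U k - U n) (U k - U n) < e" if "k \<ge> N" "n \<ge> N" for k n
      proof -
        have "1 / real (Suc k) \<le> 1 / real (Suc N)" "1 / real (Suc n) \<le> 1 / real (Suc N)"
          using that by (auto intro!: divide_left_mono)
        moreover have "4 * (1 / real (Suc N)) < e" using N e by (simp add: field_simps)
        ultimately show ?thesis using par[OF U[of k] U[of n]] JU[of k] JU[of n] by (rule aux)
      qed
      then show ?thesis by blast
    qed
    show "(\<lambda>n. \<beta> (U n) u) \<longlonglongrightarrow> \<Psi> u" if u: "u \<in> P" for u
    proof -
      define B where "B = \<beta> u u"
      have B: "B \<ge> 0" using nonneg[OF u] by (simp add: B_def)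
      have q: "(\<beta> (U n) u - \<Psi> u)\<^sup>2 \<le> (B + 1) * (1 / real (Suc n))" for n
      proof -
        define q where "q = \<beta> (U n) u - \<Psi> u"
        \<comment> \<open>Near-optimal step in the direction u; the optimal denominator would be B,
          and B + 1 keeps the step defined when \<open>\<beta> u u = 0\<close>.\<close>
        define t where "t = - q / (B + 1)"
        have cert: "- (2 * (- q / D) * q) - (- q / D)\<^sup>2 * (D - 1) = q\<^sup>2 * (D + 1) / D\<^sup>2" if "D \<noteq> 0" for D
          using that by (simp add: field_simps power2_eq_square)
        have tu: "t *\<^sub>R u \<in> P" using u mem by blast
        have "J (U n + t *\<^sub>R u) = J (U n) + 2 * t * q + t\<^sup>2 * B"
          unfolding J_def q_def B_def using U[of n] u tu mem sym[OF u U[of n]]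
          by (simp add: add add' scale scale' \<Psi>add \<Psi>scale algebra_simps power2_eq_square)
        then have "- (2 * t * q) - t\<^sup>2 * B \<le> 1 / real (Suc n)"
          using mJ[of "U n + t *\<^sub>R u"] JU[of n] U[of n] tu mem by fastforce
        moreover have "- (2 * t * q) - t\<^sup>2 * B = q\<^sup>2 * (B + 2) / (B + 1)\<^sup>2"
        proof -
          have "B + 2 = (B + 1) + 1" "B = (B + 1) - 1" "B + 1 \<noteq> 0" using B by auto
          then show ?thesis unfolding t_def
            by (metis (no_types, opaque_lifting) cert)
        qed
        moreover have "q\<^sup>2 / (B + 1) \<le> q\<^sup>2 * (B + 2) / (B + 1)\<^sup>2"
        proof -
          have "q\<^sup>2 / (B + 1) = q\<^sup>2 * (B + 1) / (B + 1)\<^sup>2" using B by (simp add: power2_eq_square)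
          also have "\<dots> \<le> q\<^sup>2 * (B + 2) / (B + 1)\<^sup>2" by (intro divide_right_mono mult_left_mono) auto
          finally show ?thesis .
        qed
        ultimately have "q\<^sup>2 / (B + 1) \<le> 1 / real (Suc n)" by linarith
        then show ?thesis using B unfolding q_def by (simp add: field_simps)
      qed
      have "(\<lambda>n. (B + 1) * (1 / real (Suc n))) \<longlonglongrightarrow> (B + 1) * 0"
        by (intro tendsto_intros LIMSEQ_Suc lim_1_over_n)
      then have "(\<lambda>n. (\<beta> (U n) u - \<Psi> u)\<^sup>2) \<longlonglongrightarrow> 0"
        by (intro tendsto_sandwich[of "\<lambda>n. 0" "\<lambda>n. (\<beta> (U n) u - \<Psi> u)\<^sup>2" sequentially "\<lambda>n. (B + 1) * (1 / real (Suc n))"])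
          (use q in \<open>auto intro!: always_eventually simp del: of_nat_Suc\<close>)
      then have "(\<lambda>n. sqrt ((\<beta> (U n) u - \<Psi> u)\<^sup>2)) \<longlonglongrightarrow> sqrt 0" by (rule tendsto_real_sqrt)
      then show ?thesis by (simp add: tendsto_rabs_zero_iff LIM_zero_iff)
    qed
  qed
qed

text \<open>The minimizing sequence is Cauchy in norm and converges in the ambient space, so P may
  fail to be closed; the price is that the representer lies in the closure of P.\<close>

lemma riesz_representation:
  fixes \<Psi> :: "'a::{real_inner, complete_space} \<Rightarrow> real"
  assumes P: "subspace P"
    and \<Psi>add: "\<And>u v. u \<in> P \<Longrightarrow> v \<in> P \<Longrightarrow> \<Psi> (u + v) = \<Psi> u + \<Psi> v"
    and \<Psi>scale: "\<And>c u. u \<in> P \<Longrightarrow> \<Psi> (c *\<^sub>R u) = c * \<Psi> u"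
    and bd: "\<And>u. u \<in> P \<Longrightarrow> (\<Psi> u)\<^sup>2 \<le> C * (norm u)\<^sup>2"
  obtains w where "w \<in> closure P" "\<And>u. u \<in> P \<Longrightarrow> inner w u = \<Psi> u"
proof -
  obtain U where U: "\<And>n. U n \<in> P"
    and cau: "\<And>e. e > 0 \<Longrightarrow> \<exists>N. \<forall>m\<ge>N. \<forall>n\<ge>N. inner (U m - U n) (U m - U n) < e"
    and lim: "\<And>u. u \<in> P \<Longrightarrow> (\<lambda>n. inner (U n) u) \<longlonglongrightarrow> \<Psi> u"
  proof (rule riesz_minimizing_sequence[OF P, of inner \<Psi> C])
    show "(\<Psi> u)\<^sup>2 \<le> C * inner u u" if "u \<in> P" for u using bd[OF that] by (simp add: power2_norm_eq_inner)
    show "inner u v = inner v u" for u v :: 'a by (rule inner_commute)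
  qed (auto simp: inner_add_left \<Psi>add \<Psi>scale)
  have "Cauchy U"
  proof (rule CauchyI)
    fix e :: real assume e: "0 < e"
    then obtain N where "\<And>m n. m \<ge> N \<Longrightarrow> n \<ge> N \<Longrightarrow> (norm (U m - U n))\<^sup>2 < e\<^sup>2"
      using cau[of "e\<^sup>2"] by (auto simp: power2_norm_eq_inner)
    then show "\<exists>M. \<forall>m\<ge>M. \<forall>n\<ge>M. norm (U m - U n) < e"
      using e by (meson less_imp_le power_less_imp_less_base)
  qed
  then obtain w where w: "U \<longlonglongrightarrow> w" by (meson Cauchy_convergent_iff convergent_def)
  show ?thesis
  proof
    show "w \<in> closure P" using w U closure_sequential by blast
    show "inner w u = \<Psi> u" if "u \<in> P" for u
      using LIMSEQ_unique[OF tendsto_inner[OF w tendsto_const[of u]] lim[OF that]] .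
  qed
qed

text \<open>The Riesz representer of \<open>inner f\<close> restricted to P is the projection of f
  onto the closure of P. Its difference to f is orthogonal to P and hence zero.\<close>

lemma dense_if_trivial_orthogonal:
  fixes P :: "'a::{real_inner, complete_space} set"
  assumes P: "subspace P" and orth: "\<And>w. (\<And>u. u \<in> P \<Longrightarrow> inner w u = 0) \<Longrightarrow> w = 0"
  shows "closure P = UNIV"
proof -
  have "f \<in> closure P" for f
  proof -
    have cs: "(inner f u)\<^sup>2 \<le> (norm f)\<^sup>2 * (norm u)\<^sup>2" for u
      using Cauchy_Schwarz_ineq[of f u] by (simp add: power2_norm_eq_inner)
    obtain w where w: "w \<in> closure P" "\<And>u. u \<in> P \<Longrightarrow> inner w u = inner f u"
      using riesz_representation[OF P, of "inner f" "(norm f)\<^sup>2"] cs by (auto simp: inner_add_right)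
    have "w - f = 0" by (rule orth) (simp add: inner_diff_left w(2))
    with w show ?thesis by simp
  qed
  then show ?thesis by blast
qed

section \<open>Unordered sums and orthonormal bases\<close>

lemma square_summable_product:
  fixes f g :: "'a \<Rightarrow> real"
  assumes f: "(\<lambda>x. (f x)\<^sup>2) summable_on A" and g: "(\<lambda>x. (g x)\<^sup>2) summable_on A"
  shows "(\<lambda>x. f x * g x) summable_on A"
    and "(infsum (\<lambda>x. f x * g x) A)\<^sup>2 \<le> infsum (\<lambda>x. (f x)\<^sup>2) A * infsum (\<lambda>x. (g x)\<^sup>2) A"
proof -
  have "(\<lambda>x. norm (f x * g x)) summable_on A"
    by (rule abs_summable_product) (use f g in \<open>auto simp: power2_eq_square\<close>)
  then show s: "(\<lambda>x. f x * g x) summable_on A" by (rule abs_summable_summable)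
  have "(sum (\<lambda>x. f x * g x) F)\<^sup>2 \<le> infsum (\<lambda>x. (f x)\<^sup>2) A * infsum (\<lambda>x. (g x)\<^sup>2) A"
    if F: "finite F" "F \<subseteq> A" for F
  proof -
    have "(sum (\<lambda>x. f x * g x) F)\<^sup>2 \<le> sum (\<lambda>x. (f x)\<^sup>2) F * sum (\<lambda>x. (g x)\<^sup>2) F"
      by (rule Cauchy_Schwarz_ineq_sum)
    also have "\<dots> \<le> infsum (\<lambda>x. (f x)\<^sup>2) A * infsum (\<lambda>x. (g x)\<^sup>2) A"
      by (intro mult_mono finite_sum_le_infsum f g F sum_nonneg infsum_nonneg) auto
    finally show ?thesis .
  qed
  then show "(infsum (\<lambda>x. f x * g x) A)\<^sup>2 \<le> infsum (\<lambda>x. (f x)\<^sup>2) A * infsum (\<lambda>x. (g x)\<^sup>2) A"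
    by (intro tendsto_upperbound[OF tendsto_power[OF infsum_tendsto[OF s]]])
      (auto intro: eventually_finite_subsets_at_top_weakI)
qed

lemma summable_on_real_comparison:
  fixes f g :: "'a \<Rightarrow> real"
  assumes "g summable_on A" "\<And>x. x \<in> A \<Longrightarrow> \<bar>f x\<bar> \<le> g x"
  shows "f summable_on A"
proof -
  have "(\<lambda>x. norm (f x)) summable_on A"
    by (rule Infinite_Sum.abs_summable_on_comparison_test'[OF assms(1)]) (use assms(2) in auto)
  then show ?thesis by (rule abs_summable_summable)
qed

text \<open>Dominated convergence for unordered sums: a finite set carries the majorant up to e/3,
  and on that set convergence is termwise.\<close>

lemma infsum_dominated_tendsto_0:
  fixes f :: "'h \<Rightarrow> 'a \<Rightarrow> real"
  assumes g: "g summable_on A" and le: "\<And>h x. x \<in> A \<Longrightarrow> \<bar>f h x\<bar> \<le> g x"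
    and lim: "\<And>x. x \<in> A \<Longrightarrow> ((\<lambda>h. f h x) \<longlongrightarrow> 0) Fl"
  shows "((\<lambda>h. infsum (f h) A) \<longlongrightarrow> 0) Fl"
proof (rule tendstoI)
  fix e :: real assume e: "e > 0"
  have fs: "f h summable_on A" for h by (rule summable_on_real_comparison[OF g le])
  obtain F where F: "finite F" "F \<subseteq> A" "dist (sum g F) (infsum g A) \<le> e/3"
    using infsum_finite_approximation[OF g, of "e/3"] e by auto
  have gF: "g summable_on F" "g summable_on (A - F)"
    using F by (auto intro: summable_on_subset_banach[OF g])
  have split: "infsum k A = sum k F + infsum k (A - F)" if "k summable_on A" for k :: "'a \<Rightarrow> real"
    using infsum_Un_disjoint[of k F "A - F"] F that summable_on_subset_banach[OF that, of "A - F"]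
    by (simp add: Un_absorb1 infsum_finite)
  have g0: "g x \<ge> 0" if "x \<in> A" for x using le[OF that, of undefined] by linarith
  have gt: "infsum g (A - F) \<le> e/3" using F(3) split[OF g] by (simp add: dist_real_def)
  have ft: "\<bar>infsum (f h) (A - F)\<bar> \<le> e/3" for h
  proof -
    have fsF: "f h summable_on (A - F)" using fs summable_on_subset_banach by blast
    have "infsum (f h) (A - F) \<le> infsum g (A - F)"
      by (intro infsum_mono fsF gF) (use le in \<open>auto simp: abs_le_iff\<close>)
    moreover have "- infsum (f h) (A - F) \<le> infsum g (A - F)"
      unfolding infsum_uminus[symmetric]
      by (intro infsum_mono gF summable_on_uminus[THEN iffD2] fsF) (use le in \<open>auto simp: abs_le_iff\<close>)
    ultimately show ?thesis using gt by linarith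
  qed
  have "((\<lambda>h. sum (f h) F) \<longlongrightarrow> 0) Fl" using tendsto_sum[of F "\<lambda>x h. f h x" "\<lambda>x. 0" Fl] lim F by auto
  then have "\<forall>\<^sub>F h in Fl. \<bar>sum (f h) F\<bar> < e/3" using e tendstoD[of "\<lambda>h. sum (f h) F" 0 Fl "e/3"] by (simp add: dist_real_def)
  then show "\<forall>\<^sub>F h in Fl. dist (infsum (f h) A) 0 < e"
  proof eventually_elim
    case (elim h)
    then show ?case using split[OF fs[of h]] ft[of h] e by (simp add: dist_real_def)
  qed
qed

text \<open>The basis is a set indexed by its own elements. Sums over it are unordered, so no
  enumeration of eigenvectors and no ordering of eigenvalues enters.\<close>

locale orthonormal_basis =
  fixes E :: "'a::{real_inner, complete_space} set"
  assumes unit: "e \<in> E \<Longrightarrow> inner e e = 1"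
    and orth: "e \<in> E \<Longrightarrow> e' \<in> E \<Longrightarrow> e \<noteq> e' \<Longrightarrow> inner e e' = 0"
    and total: "(\<And>e. e \<in> E \<Longrightarrow> inner u e = 0) \<Longrightarrow> u = 0"
begin

lemma eqI: "(\<And>e. e \<in> E \<Longrightarrow> inner u e = inner v e) \<Longrightarrow> u = v"
  using total[of "u - v"] by (simp add: inner_diff_left)

lemma inner_sum:
  assumes "finite F" "F \<subseteq> E" "e \<in> E"
  shows "inner (\<Sum>x\<in>F. c x *\<^sub>R x) e = (if e \<in> F then c e else 0)"
proof -
  have "inner (\<Sum>x\<in>F. c x *\<^sub>R x) e = (\<Sum>x\<in>F. if x = e then c e else 0)"
    unfolding inner_sum_left by (rule sum.cong) (use assms unit orth in auto)
  then show ?thesis using assms by simp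
qed

lemma norm_sum:
  assumes "finite F" "F \<subseteq> E"
  shows "(norm (\<Sum>x\<in>F. c x *\<^sub>R x))\<^sup>2 = (\<Sum>x\<in>F. (c x)\<^sup>2)"
proof -
  have "(norm (\<Sum>x\<in>F. c x *\<^sub>R x))\<^sup>2 = (\<Sum>y\<in>F. c y * inner (\<Sum>x\<in>F. c x *\<^sub>R x) y)"
    by (simp add: power2_norm_eq_inner inner_sum_right)
  also have "\<dots> = (\<Sum>x\<in>F. (c x)\<^sup>2)"
    by (rule sum.cong) (use assms inner_sum in \<open>auto simp: power2_eq_square subset_iff\<close>)
  finally show ?thesis .
qed

lemma bessel:
  assumes F: "finite F" "F \<subseteq> E"
  shows "(\<Sum>x\<in>F. (inner u x)\<^sup>2) \<le> (norm u)\<^sup>2"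
proof -
  let ?p = "\<Sum>x\<in>F. inner u x *\<^sub>R x"
  have "inner u ?p = (\<Sum>x\<in>F. (inner u x)\<^sup>2)" by (simp add: inner_sum_right power2_eq_square)
  moreover have "inner ?p ?p = (\<Sum>x\<in>F. (inner u x)\<^sup>2)" using norm_sum[OF F] by (simp add: power2_norm_eq_inner)
  moreover have "0 \<le> inner (u - ?p) (u - ?p)" by simp
  ultimately show ?thesis by (simp add: inner_diff_left inner_diff_right inner_commute power2_norm_eq_inner)
qed

lemma coeff_summable: "(\<lambda>e. (inner u e)\<^sup>2) summable_on E"
  by (rule nonneg_bdd_above_summable_on) (auto intro!: bdd_aboveI[of _ "(norm u)\<^sup>2"] bessel)

text \<open>The vector is the Riesz representer of v \<mapsto> sum of
  \<open>c e * inner v e\<close>, which Cauchy-Schwarz and Bessel's inequality bound by a multiple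
  of the norm of v.\<close>

lemma synthesis:
  assumes c: "(\<lambda>e. (c e)\<^sup>2) summable_on E"
  obtains u where "\<And>v. ((\<lambda>e. c e * inner v e) has_sum inner u v) E"
proof -
  define \<Psi> where "\<Psi> v = infsum (\<lambda>e. c e * inner v e) E" for v
  have s: "(\<lambda>e. c e * inner v e) summable_on E" for v
    by (rule square_summable_product[OF c coeff_summable])
  have le: "infsum (\<lambda>e. (inner v e)\<^sup>2) E \<le> (norm v)\<^sup>2" for v
    by (rule infsum_le_finite_sums[OF coeff_summable bessel])
  obtain w where w: "\<And>u. inner w u = \<Psi> u"
  proof (rule riesz_representation[of UNIV \<Psi> "infsum (\<lambda>e. (c e)\<^sup>2) E"])
    show "\<Psi> (u + v) = \<Psi> u + \<Psi> v" for u v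
      unfolding \<Psi>_def by (subst infsum_add[OF s s, symmetric]) (simp add: inner_add_left distrib_left)
    show "\<Psi> (k *\<^sub>R u) = k * \<Psi> u" for k u
      unfolding \<Psi>_def by (subst infsum_cmult_right[OF s, symmetric]) (simp add: mult.left_commute)
    show "(\<Psi> u)\<^sup>2 \<le> infsum (\<lambda>e. (c e)\<^sup>2) E * (norm u)\<^sup>2" for u
    proof -
      have "(\<Psi> u)\<^sup>2 \<le> infsum (\<lambda>e. (c e)\<^sup>2) E * infsum (\<lambda>e. (inner u e)\<^sup>2) E"
        unfolding \<Psi>_def by (rule square_summable_product[OF c coeff_summable])
      also have "\<dots> \<le> infsum (\<lambda>e. (c e)\<^sup>2) E * (norm u)\<^sup>2"
        by (intro mult_left_mono le infsum_nonneg) auto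
      finally show ?thesis .
    qed
  qed auto
  show ?thesis
  proof
    show "((\<lambda>e. c e * inner v e) has_sum inner w v) E" for v
      unfolding w \<Psi>_def by (rule has_sum_infsum[OF s])
  qed
qed

lemma coeff_of_synthesis:
  assumes u: "\<And>v. ((\<lambda>e. c e * inner v e) has_sum inner u v) E" and e: "e \<in> E"
  shows "inner u e = c e"
proof -
  have "((\<lambda>x. c x * inner e x) has_sum (\<Sum>x\<in>{e}. c x * inner e x)) E"
    by (subst has_sum_cong_neutral[of "{e}" E _ "\<lambda>x. c x * inner e x"]) (use e orth in \<open>auto intro!: has_sum_finiteI\<close>)
  then have "((\<lambda>x. c x * inner e x) has_sum c e) E" using unit[OF e] by simp
  from has_sum_unique[OF u[of e] this] show ?thesis .
qed

lemma synthesis_coeff: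
  assumes "(\<lambda>e. (c e)\<^sup>2) summable_on E"
  shows "\<exists>!u. \<forall>e\<in>E. inner u e = c e"
proof -
  from synthesis[OF assms] obtain u where "\<And>v. ((\<lambda>e. c e * inner v e) has_sum inner u v) E" by blast
  then have "\<forall>e\<in>E. inner u e = c e" using coeff_of_synthesis by blast
  then show ?thesis using eqI by (metis (no_types, lifting))
qed

text \<open>The vector synthesized from the coefficients of u has the same coefficients as u, so
  totality identifies the two.\<close>

lemma parseval: "((\<lambda>e. inner u e * inner v e) has_sum inner u v) E"
proof -
  from synthesis[OF coeff_summable[of u]] obtain w
    where w: "\<And>v. ((\<lambda>e. inner u e * inner v e) has_sum inner w v) E" by blast
  have "w = u" by (rule eqI) (rule coeff_of_synthesis[OF w])
  with w show ?thesis by simp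
qed

lemma parseval_norm: "((\<lambda>e. (inner u e)\<^sup>2) has_sum (norm u)\<^sup>2) E"
  using parseval[of u u] by (simp add: power2_eq_square power2_norm_eq_inner[unfolded power2_eq_square])

end

section \<open>Spectral theorem for compact positive operators\<close>

text \<open>The supremum m of the Rayleigh quotient on W is attained. Along a maximizing sequence K
  X - m X tends to 0; compactness makes a subsequence of K X converge, hence also X because m > 0.
  The invariant subspace W is there so that the lemma applies to the orthogonal complement of
  eigenvectors already found.\<close>

lemma compact_selfadjoint_eigenvector:
  fixes K :: "'a::{real_inner, complete_space} \<Rightarrow> 'a"
  assumes K: "bounded_linear K" and sa: "\<And>u v. inner (K u) v = inner u (K v)"
    and pos: "\<And>u. u \<noteq> 0 \<Longrightarrow> 0 < inner (K u) u"
    and cpt: "\<And>X :: nat \<Rightarrow> 'a. (\<And>n. norm (X n) \<le> 1) \<Longrightarrow> \<exists>r w. strict_mono r \<and> (\<lambda>n. K (X (r n))) \<longlonglongrightarrow> w"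
    and W: "subspace W" "closed W" "\<And>w. w \<in> W \<Longrightarrow> K w \<in> W" and w0: "w0 \<in> W" "w0 \<noteq> 0"
  obtains y k where "y \<in> W" "y \<noteq> 0" "K y = k *\<^sub>R y"
proof -
  interpret K: bounded_linear K by (rule K)
  define Q where "Q = (\<lambda>w. inner (K w) w) ` {w \<in> W. norm w \<le> 1}"
  have pos0: "0 \<le> inner (K u) u" for u using pos[of u] by (cases "u = 0") (auto simp: K.zero)
  have bdd: "bdd_above Q"
  proof (rule bdd_aboveI)
    fix q assume "q \<in> Q"
    then obtain w where w: "norm w \<le> 1" "q = inner (K w) w" by (auto simp: Q_def)
    have "inner (K w) w \<le> norm (K w) * norm w" by (rule norm_cauchy_schwarz)
    also have "\<dots> \<le> (onorm K * norm w) * norm w" by (intro mult_right_mono onorm[OF K]) auto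
    also have "\<dots> = onorm K * (norm w * norm w)" by simp
    also have "\<dots> \<le> onorm K * 1"
      using w by (intro mult_left_mono onorm_pos_le[OF K] mult_le_one) auto
    finally show "q \<le> onorm K" using w by simp
  qed
  define m where "m = Sup Q"
  have upper: "inner (K w) w \<le> m" if "w \<in> W" "norm w \<le> 1" for w
    unfolding m_def using that bdd by (auto intro!: cSup_upper simp: Q_def)
  have upper2: "inner (K w) w \<le> m * (norm w)\<^sup>2" if "w \<in> W" for w
  proof (cases "w = 0")
    case False
    have "(1 / norm w) *\<^sub>R w \<in> W" using that W(1) subspace_scale by blast
    from upper[OF this] have "inner (K w) w / (norm w)\<^sup>2 \<le> m"
      using False by (simp add: K.scaleR power2_eq_square)
    then show ?thesis using False by (simp add: field_simps)
  qed (simp add: K.zero)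
  have m: "0 < m"
  proof -
    have "0 < inner (K w0) w0" using w0 pos by blast
    then have "0 < m * (norm w0)\<^sup>2" using upper2[OF w0(1)] by linarith
    then show ?thesis using w0 by (simp add: zero_less_mult_iff)
  qed
  \<comment> \<open>Positivity of the form at w - K w / m, expanded, with the Rayleigh bound applied
    to K w.\<close>
  have Kle: "(norm (K w))\<^sup>2 \<le> m * inner (K w) w" if w: "w \<in> W" for w
  proof -
    let ?v = "K w"
    have "0 \<le> inner (K (w - (1/m) *\<^sub>R ?v)) (w - (1/m) *\<^sub>R ?v)" by (rule pos0)
    also have "\<dots> = inner (K w) w - 2 / m * inner ?v ?v + (1/m)\<^sup>2 * inner (K ?v) ?v"
      using sa[of "K w" w] m by (simp add: K.diff K.scaleR inner_diff_left inner_diff_right power2_eq_square field_simps)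
    also have "\<dots> \<le> inner (K w) w - 2 / m * inner ?v ?v + (1/m)\<^sup>2 * (m * (norm ?v)\<^sup>2)"
      by (intro add_left_mono mult_left_mono upper2 W(3) w) auto
    also have "\<dots> = inner (K w) w - (norm ?v)\<^sup>2 / m"
      using m by (simp add: power2_norm_eq_inner[symmetric] field_simps power2_eq_square)
    finally show ?thesis using m by (simp add: field_simps)
  qed
  have Qne: "Q \<noteq> {}" using subspace_0[OF W(1)] by (auto simp: Q_def intro!: exI[of _ 0])
  have "\<exists>w. w \<in> W \<and> norm w \<le> 1 \<and> m - 1 / real (Suc n) < inner (K w) w" for n
  proof -
    have "m - 1 / real (Suc n) < Sup Q" unfolding m_def by simp
    then show ?thesis using less_cSupD[OF Qne] by (fastforce simp: Q_def)
  qed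
  then obtain X where X: "\<And>n. X n \<in> W" "\<And>n. norm (X n) \<le> 1"
    and Xm: "\<And>n. m - 1 / real (Suc n) < inner (K (X n)) (X n)" by metis
  obtain r z where r: "strict_mono r" and z: "(\<lambda>n. K (X (r n))) \<longlonglongrightarrow> z" using cpt X(2) by blast
  have est: "(norm (K (X n) - m *\<^sub>R X n))\<^sup>2 \<le> m * (1 / real (Suc n))" for n
  proof -
    have "(norm (K (X n) - m *\<^sub>R X n))\<^sup>2 = (norm (K (X n)))\<^sup>2 - 2 * m * inner (K (X n)) (X n) + m\<^sup>2 * (norm (X n))\<^sup>2"
      unfolding power2_norm_eq_inner
      by (simp add: inner_diff_left inner_diff_right inner_commute[of "X n" "K (X n)"] algebra_simps power2_eq_square)
    also have "\<dots> \<le> m * inner (K (X n)) (X n) - 2 * m * inner (K (X n)) (X n) + m\<^sup>2 * 1"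
      using X Kle m by (intro add_mono diff_mono mult_left_mono) (auto simp: power_le_one)
    also have "\<dots> = m * (m - inner (K (X n)) (X n))" by (simp add: algebra_simps power2_eq_square)
    also have "\<dots> \<le> m * (1 / real (Suc n))" using Xm[of n] m by (intro mult_left_mono) auto
    finally show ?thesis .
  qed
  have "(\<lambda>n. m * (1 / real (Suc n))) \<longlonglongrightarrow> m * 0"
    by (intro tendsto_intros LIMSEQ_Suc lim_1_over_n)
  then have "(\<lambda>n. (norm (K (X n) - m *\<^sub>R X n))\<^sup>2) \<longlonglongrightarrow> 0"
    by (intro tendsto_sandwich[of "\<lambda>n. 0" "\<lambda>n. (norm (K (X n) - m *\<^sub>R X n))\<^sup>2" sequentially "\<lambda>n. m * (1 / real (Suc n))"])
      (use est in \<open>auto intro!: always_eventually simp del: of_nat_Suc\<close>)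
  then have "(\<lambda>n. sqrt ((norm (K (X n) - m *\<^sub>R X n))\<^sup>2)) \<longlonglongrightarrow> sqrt 0" by (rule tendsto_real_sqrt)
  then have "(\<lambda>n. K (X n) - m *\<^sub>R X n) \<longlonglongrightarrow> 0" by (simp add: tendsto_norm_zero_iff)
  then have "(\<lambda>n. K (X (r n)) - m *\<^sub>R X (r n)) \<longlonglongrightarrow> 0"
    using LIMSEQ_subseq_LIMSEQ[OF _ r] by (auto simp: o_def)
  from tendsto_diff[OF z this] have "(\<lambda>n. m *\<^sub>R X (r n)) \<longlonglongrightarrow> z" by simp
  from tendsto_scaleR[OF tendsto_const[of "1/m"] this]
  have y: "(\<lambda>n. X (r n)) \<longlonglongrightarrow> (1/m) *\<^sub>R z" using m by simp
  let ?y = "(1/m) *\<^sub>R z"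
  have Ky: "(\<lambda>n. K (X (r n))) \<longlonglongrightarrow> K ?y" by (rule K.tendsto[OF y])
  have "K ?y = z" by (rule LIMSEQ_unique[OF Ky z])
  then have eig: "K ?y = m *\<^sub>R ?y" using m by simp
  have yW: "?y \<in> W" by (rule closed_sequentially[OF W(2) _ y]) (rule X(1))
  have "(\<lambda>n. inner (K (X (r n))) (X (r n))) \<longlonglongrightarrow> inner (K ?y) ?y" by (intro tendsto_inner Ky y)
  moreover have "(\<lambda>n. m - 1 / real (Suc n)) \<longlonglongrightarrow> m - 0"
    by (intro tendsto_intros LIMSEQ_Suc lim_1_over_n)
  from LIMSEQ_subseq_LIMSEQ[OF this r] have "(\<lambda>n. m - 1 / real (Suc (r n))) \<longlonglongrightarrow> m"
    by (simp add: o_def)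
  ultimately have "m \<le> inner (K ?y) ?y"
    by (intro LIMSEQ_le[where X="\<lambda>n. m - 1 / real (Suc (r n))" and Y="\<lambda>n. inner (K (X (r n))) (X (r n))"])
      (auto intro!: exI[of _ 0] less_imp_le Xm simp del: of_nat_Suc)
  then have "?y \<noteq> 0" using m by (auto simp: K.zero)
  with yW eig that show ?thesis by blast
qed

text \<open>Zorn's lemma provides a maximal orthonormal set of eigenvectors. Its orthogonal
  complement is closed and invariant by self-adjointness, so a nonzero vector in it would yield a
  further eigenvector.\<close>

lemma compact_selfadjoint_eigenbasis:
  fixes K :: "'a::{real_inner, complete_space} \<Rightarrow> 'a"
  assumes K: "bounded_linear K" and sa: "\<And>u v. inner (K u) v = inner u (K v)"
    and pos: "\<And>u. u \<noteq> 0 \<Longrightarrow> 0 < inner (K u) u"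
    and cpt: "\<And>X :: nat \<Rightarrow> 'a. (\<And>n. norm (X n) \<le> 1) \<Longrightarrow> \<exists>r w. strict_mono r \<and> (\<lambda>n. K (X (r n))) \<longlonglongrightarrow> w"
  obtains E where "orthonormal_basis E" "\<And>e. e \<in> E \<Longrightarrow> \<exists>k>0. K e = k *\<^sub>R e"
proof -
  define \<A> where "\<A> = {E. (\<forall>e\<in>E. inner e e = 1 \<and> (\<exists>k. K e = k *\<^sub>R e)) \<and>
    (\<forall>e\<in>E. \<forall>e'\<in>E. e \<noteq> e' \<longrightarrow> inner e e' = 0)}"
  have "\<exists>M\<in>\<A>. \<forall>X\<in>\<A>. M \<subseteq> X \<longrightarrow> X = M"
  proof (rule subset_Zorn_nonempty)
    have "{} \<in> \<A>" by (simp add: \<A>_def)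
    then show "\<A> \<noteq> {}" by blast
    fix \<C> assume "\<C> \<noteq> {}" and c: "subset.chain \<A> \<C>"
    have sub: "\<C> \<subseteq> \<A>" using c by (simp add: subset.chain_def)
    show "\<Union>\<C> \<in> \<A>"
      unfolding \<A>_def
    proof (intro CollectI conjI ballI impI)
      fix e assume "e \<in> \<Union>\<C>"
      then show "inner e e = 1" "\<exists>k. K e = k *\<^sub>R e" using sub unfolding \<A>_def by blast+
      fix e' assume "e' \<in> \<Union>\<C>" "e \<noteq> e'"
      from \<open>e \<in> \<Union>\<C>\<close> \<open>e' \<in> \<Union>\<C>\<close> obtain A B where AB: "A \<in> \<C>" "B \<in> \<C>" "e \<in> A" "e' \<in> B" by blast
      then have "A \<subseteq> B \<or> B \<subseteq> A" using c by (auto simp: subset.chain_def)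
      then obtain D where "D \<in> \<C>" "e \<in> D" "e' \<in> D" using AB by blast
      then show "inner e e' = 0" using sub \<open>e \<noteq> e'\<close> unfolding \<A>_def by blast
    qed
  qed
  then obtain M where M: "M \<in> \<A>" and max: "\<And>X. X \<in> \<A> \<Longrightarrow> M \<subseteq> X \<Longrightarrow> X = M" by blast
  interpret K: bounded_linear K by (rule K)
  define W where "W = {w. \<forall>e\<in>M. inner w e = 0}"
  have W1: "subspace W" by (auto simp: subspace_def W_def inner_add_left)
  have "W = (\<Inter>e\<in>M. {w. inner w e = 0})" by (auto simp: W_def)
  then have W2: "closed W" by (auto intro!: closed_INT closed_Collect_eq continuous_intros)
  have W3: "K w \<in> W" if "w \<in> W" for w
    unfolding W_def
  proof (intro CollectI ballI)
    fix e assume e: "e \<in> M"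
    then obtain k where "K e = k *\<^sub>R e" using M unfolding \<A>_def by blast
    then show "inner (K w) e = 0" using that e by (simp add: sa W_def)
  qed
  have tot: "w = 0" if w: "w \<in> W" for w
  proof (rule ccontr)
    assume "w \<noteq> 0"
    obtain y k where y: "y \<in> W" "y \<noteq> 0" "K y = k *\<^sub>R y"
      by (rule compact_selfadjoint_eigenvector[OF K sa pos cpt W1 W2 W3 w \<open>w \<noteq> 0\<close>]) auto
    define e where "e = (1 / norm y) *\<^sub>R y"
    have ee: "inner e e = 1" using y by (simp add: e_def power2_norm_eq_inner[symmetric] power2_eq_square)
    have eW: "e \<in> W" using y W1 subspace_scale e_def by blast
    have "K e = k *\<^sub>R e" using y by (simp add: e_def K.scaleR)
    then have "insert e M \<in> \<A>" using M ee eW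
      unfolding \<A>_def W_def by (auto simp: inner_commute)
    from max[OF this] have "e \<in> M" by blast
    then show False using eW ee by (auto simp: W_def)
  qed
  show ?thesis
  proof
    show "orthonormal_basis M"
    proof
      show "u = 0" if "\<And>e. e \<in> M \<Longrightarrow> inner u e = 0" for u using tot that by (simp add: W_def)
    qed (use M in \<open>auto simp: \<A>_def\<close>)
    fix e assume e: "e \<in> M"
    then obtain k where k: "K e = k *\<^sub>R e" "inner e e = 1" using M unfolding \<A>_def by blast
    then have "k = inner (K e) e" by simp
    moreover have "e \<noteq> 0" using k by auto
    ultimately have "k > 0" using pos by simp
    with k show "\<exists>k>0. K e = k *\<^sub>R e" by blast
  qed
qed

section \<open>Test functions\<close>

definition smooth :: "(real \<Rightarrow> real) \<Rightarrow> bool" where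
  "smooth f \<longleftrightarrow> (\<forall>n x. (deriv ^^ n) f differentiable (at x))"

lemma smooth_DERIV: "smooth f \<Longrightarrow> (f has_real_derivative deriv f x) (at x)"
  unfolding smooth_def DERIV_deriv_iff_real_differentiable by (metis funpow_0)

lemma smooth_deriv: "smooth f \<Longrightarrow> smooth (deriv f)"
  unfolding smooth_def by (metis funpow_Suc_right o_apply)

lemma smooth_continuous: "smooth f \<Longrightarrow> continuous_on S f"
  using smooth_DERIV DERIV_continuous_on by (metis DERIV_isCont continuous_at_imp_continuous_on)

text \<open>A device for proving smoothness without computing higher derivatives: if each member of
  \<open>B\<close> has a derivative in the algebra generated by \<open>B\<close> and the smooth
  functions, this algebra is closed under differentiation, so all its members are smooth.\<close>

inductive_set smooth_algebra :: "(real \<Rightarrow> real) set \<Rightarrow> (real \<Rightarrow> real) set" for B where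
  smooth: "smooth f \<Longrightarrow> f \<in> smooth_algebra B"
| base: "f \<in> B \<Longrightarrow> f \<in> smooth_algebra B"
| add: "f \<in> smooth_algebra B \<Longrightarrow> g \<in> smooth_algebra B \<Longrightarrow> (\<lambda>x. f x + g x) \<in> smooth_algebra B"
| mult: "f \<in> smooth_algebra B \<Longrightarrow> g \<in> smooth_algebra B \<Longrightarrow> (\<lambda>x. f x * g x) \<in> smooth_algebra B"

lemma smooth_algebra_smooth:
  assumes B: "\<And>f. f \<in> B \<Longrightarrow> \<exists>f'\<in>smooth_algebra B. \<forall>x. (f has_real_derivative f' x) (at x)"
    and f: "f \<in> smooth_algebra B"
  shows "smooth f"
proof -
  have D: "\<exists>f'\<in>smooth_algebra B. \<forall>x. (f has_real_derivative f' x) (at x)" if "f \<in> smooth_algebra B" for f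
    using that
  proof induction
    case (smooth f)
    then show ?case using smooth_DERIV smooth_deriv smooth_algebra.smooth by blast
  next
    case (base f)
    then show ?case by (rule B)
  next
    case (add f g)
    then obtain f' g' where "f' \<in> smooth_algebra B" "g' \<in> smooth_algebra B"
      "\<And>x. (f has_real_derivative f' x) (at x)" "\<And>x. (g has_real_derivative g' x) (at x)" by blast
    then show ?case
      by (intro bexI[of _ "\<lambda>x. f' x + g' x"]) (auto intro!: DERIV_add smooth_algebra.add)
  next
    case (mult f g)
    then obtain f' g' where "f' \<in> smooth_algebra B" "g' \<in> smooth_algebra B"
      "\<And>x. (f has_real_derivative f' x) (at x)" "\<And>x. (g has_real_derivative g' x) (at x)" by blast
    with mult show ?case
      by (intro bexI[of _ "\<lambda>x. f' x * g x + g' x * f x"])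
        (auto intro!: DERIV_mult smooth_algebra.add smooth_algebra.mult)
  qed
  have "(deriv ^^ n) f \<in> smooth_algebra B" for n
  proof (induction n)
    case (Suc n)
    then obtain f' where f': "f' \<in> smooth_algebra B" "\<And>x. ((deriv ^^ n) f has_real_derivative f' x) (at x)"
      using D by blast
    then have "deriv ((deriv ^^ n) f) = f'" using DERIV_imp_deriv by blast
    then show ?case using f' by simp
  qed (simp add: f)
  then show ?thesis unfolding smooth_def using D real_differentiable_def by blast
qed

lemma smooth_if_DERIV:
  assumes "\<And>x. (f has_real_derivative f' x) (at x)" "smooth f'"
  shows "smooth f"
  by (rule smooth_algebra_smooth[of "{f}"]) (use assms smooth_algebra.smooth smooth_algebra.base in auto)

lemma smooth_add: "smooth f \<Longrightarrow> smooth g \<Longrightarrow> smooth (\<lambda>x. f x + g x)"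
  by (rule smooth_algebra_smooth[of "{}"]) (auto intro: smooth_algebra.intros)

lemma smooth_mult: "smooth f \<Longrightarrow> smooth g \<Longrightarrow> smooth (\<lambda>x. f x * g x)"
  by (rule smooth_algebra_smooth[of "{}"]) (auto intro: smooth_algebra.intros)

lemma smooth_const: "smooth (\<lambda>x. c)"
proof -
  have "(deriv ^^ n) (\<lambda>x::real. c) = (\<lambda>x. if n = 0 then c else 0)" for n :: nat
    by (induction n) auto
  then show ?thesis by (simp add: smooth_def)
qed

lemma smooth_ident: "smooth (\<lambda>x. x)"
  by (rule smooth_if_DERIV[where f'="\<lambda>x. 1"]) (auto intro!: smooth_const derivative_eq_intros)

lemma smooth_affine:
  assumes f: "smooth f" shows "smooth (\<lambda>x. f (c * x + d))"
proof (rule smooth_algebra_smooth[of "{\<lambda>x. f (c * x + d) | f. smooth f}"])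
  fix g assume "g \<in> {\<lambda>x. f (c * x + d) | f. smooth f}"
  then obtain f where f: "g = (\<lambda>x. f (c * x + d))" "smooth f" by blast
  show "\<exists>g'\<in>smooth_algebra {\<lambda>x. f (c * x + d) | f. smooth f}. \<forall>x. (g has_real_derivative g' x) (at x)"
  proof (intro bexI allI)
    show "(g has_real_derivative deriv f (c * x + d) * c) (at x)" for x
      unfolding f(1) by (rule DERIV_chain2[OF smooth_DERIV[OF f(2)]]) (auto intro!: derivative_eq_intros)
    show "(\<lambda>x. deriv f (c * x + d) * c) \<in> smooth_algebra {\<lambda>x. f (c * x + d) | f. smooth f}"
      by (intro smooth_algebra.mult smooth_algebra.smooth[OF smooth_const] smooth_algebra.base)
        (use smooth_deriv[OF f(2)] in blast)
  qed
qed (use f in \<open>auto intro!: smooth_algebra.base\<close>)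

text \<open>The factor f vanishes left of some e > 0, which hides the singularity of the power at 0.
  The exponent varies within the generating family because differentiation lowers it by one.\<close>

lemma smooth_powr_mult:
  assumes f: "smooth f" and e: "e > 0" and z: "\<And>x. x < e \<Longrightarrow> f x = 0"
  shows "smooth (\<lambda>x. x powr a * f x)"
proof -
  define B where "B = {\<lambda>x. x powr a * f x | a f. smooth f \<and> (\<forall>x<e. f x = 0)}"
  show ?thesis
  proof (rule smooth_algebra_smooth[of B])
    fix g assume "g \<in> B"
    then obtain a f where f: "g = (\<lambda>x. x powr a * f x)" "smooth f" "\<And>x. x < e \<Longrightarrow> f x = 0"
      unfolding B_def by blast
    have ev: "\<forall>\<^sub>F y in nhds x. y < e" if "x < e" for x
      using that by (intro eventually_nhds_in_open[of "{..<e}", simplified]) auto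
    have z': "deriv f x = 0" if "x < e" for x
    proof -
      have "\<forall>\<^sub>F y in nhds x. f y = 0" using ev[OF that] by eventually_elim (rule f(3))
      then have "(f has_real_derivative 0) (at x)"
        by (subst DERIV_cong_ev[OF refl _ refl, of _ "\<lambda>x. 0"]) auto
      then show ?thesis by (rule DERIV_imp_deriv)
    qed
    show "\<exists>g'\<in>smooth_algebra B. \<forall>x. (g has_real_derivative g' x) (at x)"
    proof (intro bexI allI)
      fix x
      show "(g has_real_derivative a * (x powr (a - 1) * f x) + x powr a * deriv f x) (at x)"
      proof (cases "x < e")
        case True
        have "\<forall>\<^sub>F y in nhds x. g y = 0" using ev[OF True] by eventually_elim (simp add: f)
        then have "(g has_real_derivative 0) (at x)"
          by (subst DERIV_cong_ev[OF refl _ refl, of _ "\<lambda>x. 0"]) auto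
        then show ?thesis using z'[OF True] f(3)[OF True] by simp
      next
        case False
        then have "x > 0" using e by linarith
        then have "((\<lambda>x. x powr a * f x) has_real_derivative a * x powr (a - 1) * f x + deriv f x * x powr a) (at x)"
          by (intro DERIV_mult has_real_derivative_powr smooth_DERIV f(2))
        then show ?thesis unfolding f(1) by (simp add: algebra_simps)
      qed
    next
      have "(\<lambda>x. x powr (a - 1) * f x) \<in> B" unfolding B_def using f by blast
      moreover have "(\<lambda>x. x powr a * deriv f x) \<in> B" unfolding B_def using smooth_deriv[OF f(2)] z' by blast
      ultimately show "(\<lambda>x. a * (x powr (a - 1) * f x) + x powr a * deriv f x) \<in> smooth_algebra B"
        by (intro smooth_algebra.add smooth_algebra.mult smooth_algebra.smooth[OF smooth_const] smooth_algebra.base)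
    qed
  qed (use assms in \<open>auto intro!: smooth_algebra.base simp: B_def\<close>)
qed

definition smooth_step :: "real \<Rightarrow> real" where
  "smooth_step x = (if 0 < x then exp (- 1 / x) else 0)"

text \<open>All derivatives are combinations of (1/x)^k exp(-1/x) continued by 0. This family is
  closed under differentiation, at 0 because the exponential beats every power.\<close>

lemma smooth_smooth_step: "smooth smooth_step"
proof -
  define s where "s k x = (if 0 < x then (1/x)^k * exp (- 1 / x) else 0)" for k :: nat and x :: real
  show ?thesis
  proof (rule smooth_algebra_smooth[of "range s"])
    fix f assume "f \<in> range s"
    then obtain k where k: "f = s k" by blast
    show "\<exists>f'\<in>smooth_algebra (range s). \<forall>x. (f has_real_derivative f' x) (at x)"
    proof (intro bexI allI)
      fix x
      show "(f has_real_derivative (- real k) * s (k + 1) x + s (k + 2) x) (at x)"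
      proof (cases "x > 0 \<or> x < 0")
        case False
        then have x: "x = 0" by simp
        have "((\<lambda>t. t ^ Suc k / exp t) \<longlongrightarrow> 0) (at_top :: real filter)" by (rule tendsto_power_div_exp_0)
        then have "((\<lambda>h. inverse h ^ Suc k / exp (inverse h)) \<longlongrightarrow> 0) (at_right (0::real))"
          by (rule filterlim_compose[OF _ filterlim_inverse_at_top_right])
        moreover have "\<forall>\<^sub>F h in at_right (0::real). inverse h ^ Suc k / exp (inverse h) = (s k (0 + h) - s k 0) / h"
          unfolding eventually_at_right_field
          by (intro exI[of _ 1]) (auto simp: s_def exp_minus field_simps inverse_eq_divide)
        ultimately have r: "((\<lambda>h. (s k (0 + h) - s k 0) / h) \<longlongrightarrow> 0) (at_right 0)"
          by (rule Lim_transform_eventually)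
        have "((\<lambda>h. (s k (0 + h) - s k 0) / h) \<longlongrightarrow> 0) (at_left 0)"
        proof (rule Lim_transform_eventually[OF tendsto_const])
          show "\<forall>\<^sub>F h in at_left (0::real). 0 = (s k (0 + h) - s k 0) / h"
            unfolding eventually_at_left_field by (intro exI[of _ "-1"]) (auto simp: s_def)
        qed
        with r have "((\<lambda>h. (s k (0 + h) - s k 0) / h) \<longlongrightarrow> 0) (at 0)"
          by (simp add: filterlim_split_at)
        then show ?thesis unfolding k x DERIV_def by (simp add: s_def)
      next
        case True
        then show ?thesis
        proof
          assume x: "x > 0"
          have "\<forall>\<^sub>F y in nhds x. s k y = (1/y)^k * exp (- 1 / y)"
            using eventually_nhds_in_open[of "{0<..}" x] x by (auto elim!: eventually_mono simp: s_def)
          moreover have "((\<lambda>y. (1/y)^k * exp (- 1 / y)) has_real_derivative (- real k) * s (k + 1) x + s (k + 2) x) (at x)"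
            using x by (auto intro!: derivative_eq_intros simp: s_def field_simps power2_eq_square power_diff
                split: nat.splits) (cases k; simp add: field_simps)
          ultimately show ?thesis unfolding k by (subst DERIV_cong_ev[OF refl _ refl]) auto
        next
          assume x: "x < 0"
          have "\<forall>\<^sub>F y in nhds x. s k y = 0"
            using eventually_nhds_in_open[of "{..<0}" x] x by (auto elim!: eventually_mono simp: s_def)
          then show ?thesis unfolding k using x by (subst DERIV_cong_ev[OF refl _ refl, of _ "\<lambda>x. 0"]) (auto simp: s_def)
        qed
      qed
    next
      show "(\<lambda>x. (- real k) * s (k + 1) x + s (k + 2) x) \<in> smooth_algebra (range s)"
        by (intro smooth_algebra.add smooth_algebra.mult smooth_algebra.smooth[OF smooth_const] smooth_algebra.base) auto
    qed
  next
    have "smooth_step = s 0" by (auto simp: smooth_step_def s_def)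
    then show "smooth_step \<in> smooth_algebra (range s)" by (auto intro!: smooth_algebra.base)
  qed
qed

section \<open>Test functions and cutoffs\<close>

lemma test_functionD:
  assumes "test_function \<phi>"
  obtains a b where "smooth \<phi>" "0 < a" "a < b" "b < 1" "\<And>x. x \<notin> {a..b} \<Longrightarrow> \<phi> x = 0"
proof -
  \<comment> \<open>The two extra points make the compact set nonempty and force
    \<open>a < b\<close> even when \<phi> is zero.\<close>
  let ?K = "closure {x. \<phi> x \<noteq> 0} \<union> {1/3, 2/3}"
  have K: "compact ?K" "?K \<subseteq> {0<..<1}" "?K \<noteq> {}" using assms by (auto simp: test_function_def)
  obtain a where a: "a \<in> ?K" "\<And>x. x \<in> ?K \<Longrightarrow> a \<le> x" using compact_attains_inf[OF K(1,3)] by blast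
  obtain b where b: "b \<in> ?K" "\<And>x. x \<in> ?K \<Longrightarrow> x \<le> b" using compact_attains_sup[OF K(1,3)] by blast
  show ?thesis
  proof
    show "smooth \<phi>" using assms by (simp add: test_function_def smooth_def)
    show "0 < a" "b < 1" using a(1) b(1) K(2) by auto
    show "a < b" using a(2)[of "1/3"] b(2)[of "2/3"] by simp
    show "\<phi> x = 0" if "x \<notin> {a..b}" for x
      using that a(2)[of x] b(2)[of x] closure_subset[of "{x. \<phi> x \<noteq> 0}"] by auto
  qed
qed

lemma test_functionI:
  assumes "smooth \<phi>" "0 < a" "b < 1" "\<And>x. x \<notin> {a..b} \<Longrightarrow> \<phi> x = 0"
  shows "test_function \<phi>"
proof -
  have "{x. \<phi> x \<noteq> 0} \<subseteq> {a..b}" using assms(4) by blast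
  then have "closure {x. \<phi> x \<noteq> 0} \<subseteq> {a..b}" by (rule closure_minimal) simp
  moreover from this have "compact (closure {x. \<phi> x \<noteq> 0})"
    using compact_Icc bounded_subset[of "{a..b}"] by (simp add: compact_eq_bounded_closed)
  ultimately show ?thesis using assms(1-3) by (auto simp: test_function_def smooth_def)
qed

lemma test_function_mult:
  assumes "test_function \<phi>" "smooth f" shows "test_function (\<lambda>x. f x * \<phi> x)"
proof -
  obtain a b where "smooth \<phi>" "0 < a" "a < b" "b < 1" "\<And>x. x \<notin> {a..b} \<Longrightarrow> \<phi> x = 0"
    using test_functionD[OF assms(1)] by metis
  with assms(2) show ?thesis by (intro test_functionI[of _ a b] smooth_mult) auto
qed

lemma test_function_add:
  assumes "test_function \<phi>" "test_function \<psi>" shows "test_function (\<lambda>x. \<phi> x + \<psi> x)"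
proof -
  obtain a b where 1: "smooth \<phi>" "0 < a" "a < b" "b < 1" "\<And>x. x \<notin> {a..b} \<Longrightarrow> \<phi> x = 0"
    using test_functionD[OF assms(1)] by metis
  obtain c d where 2: "smooth \<psi>" "0 < c" "c < d" "d < 1" "\<And>x. x \<notin> {c..d} \<Longrightarrow> \<psi> x = 0"
    using test_functionD[OF assms(2)] by metis
  show ?thesis
  proof (rule test_functionI)
    show "smooth (\<lambda>x. \<phi> x + \<psi> x)" by (intro smooth_add 1 2)
    show "0 < min a c" "max b d < 1" using 1 2 by auto
    fix x assume "x \<notin> {min a c..max b d}"
    then have "x \<notin> {a..b}" "x \<notin> {c..d}" by auto
    then show "\<phi> x + \<psi> x = 0" using 1(5) 2(5) by simp
  qed
qed

lemma test_function_cmult: "test_function \<phi> \<Longrightarrow> test_function (\<lambda>x. c * \<phi> x)"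
  by (rule test_function_mult) (auto intro: smooth_const)

lemma test_function_diff: "test_function \<phi> \<Longrightarrow> test_function \<psi> \<Longrightarrow> test_function (\<lambda>x. \<phi> x - \<psi> x)"
  using test_function_add[OF _ test_function_cmult[of \<psi> "-1"], of \<phi>] by simp

lemma test_function_powr: "test_function \<phi> \<Longrightarrow> test_function (\<lambda>x. x powr c * \<phi> x)"
  by (elim test_functionD, rule test_functionI, rule smooth_powr_mult) auto

lemma test_function_deriv:
  assumes "test_function \<phi>" shows "test_function (deriv \<phi>)"
proof -
  obtain a b where 1: "smooth \<phi>" "0 < a" "a < b" "b < 1" "\<And>x. x \<notin> {a..b} \<Longrightarrow> \<phi> x = 0"
    using test_functionD[OF assms(1)] by metis
  show ?thesis
  proof (rule test_functionI[OF smooth_deriv[OF 1(1)] 1(2) 1(4)])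
    fix x assume "x \<notin> {a..b}"
    then have "\<forall>\<^sub>F y in nhds x. y \<in> - {a..b}" by (intro eventually_nhds_in_open) auto
    then have "\<forall>\<^sub>F y in nhds x. \<phi> y = 0" by eventually_elim (use 1(5) in auto)
    then have "(\<phi> has_real_derivative 0) (at x)"
      by (subst DERIV_cong_ev[OF refl _ refl, of _ "\<lambda>x. 0"]) auto
    then show "deriv \<phi> x = 0" by (rule DERIV_imp_deriv)
  qed
qed

lemma test_function_smooth: "test_function \<phi> \<Longrightarrow> smooth \<phi>"
  by (simp add: test_function_def smooth_def)

lemma test_function_DERIV: "test_function \<phi> \<Longrightarrow> (\<phi> has_real_derivative deriv \<phi> x) (at x)"
  by (rule smooth_DERIV) (rule test_function_smooth)

lemma test_function_continuous: "test_function \<phi> \<Longrightarrow> continuous_on S \<phi>"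
  by (rule smooth_continuous) (rule test_function_smooth)

lemma continuous_borel_measurable_lebesgue_on:
  fixes f :: "real \<Rightarrow> real"
  assumes "continuous_on {0<..<1} f" shows "f \<in> borel_measurable (lebesgue_on {0<..<1})"
  by (rule continuous_imp_measurable_on_sets_lebesgue[OF assms]) auto

lemma integrable_const_01: "integrable (lebesgue_on {0<..<1::real}) (\<lambda>x. c :: real)"
  by (intro finite_measure.integrable_const finite_measure_lebesgue_on) auto

lemma square_integrable_const: "(\<lambda>x. c) \<in> square_integrable {0<..<1}"
  by (simp add: square_integrable_def integrable_const_01)

lemma bounded_square_integrable:
  assumes "f \<in> borel_measurable (lebesgue_on {0<..<1})" "\<And>x. x \<in> {0<..<1} \<Longrightarrow> \<bar>f x\<bar> \<le> C"
  shows "f \<in> square_integrable {0<..<1}"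
proof -
  have "integrable (lebesgue_on {0<..<1}) (\<lambda>x. (f x)\<^sup>2)"
  proof (rule Bochner_Integration.integrable_bound[OF integrable_const_01[of "C\<^sup>2"]])
    show "AE x in lebesgue_on {0<..<1}. norm ((f x)\<^sup>2) \<le> norm (C\<^sup>2)"
      using order_trans[OF assms(2) abs_ge_self] by (intro AE_I2) (auto simp: abs_le_square_iff[symmetric])
  qed (use assms(1) in measurable)
  then show ?thesis using assms(1) by (simp add: square_integrable_def)
qed

lemma test_function_bounded:
  assumes "test_function \<phi>" obtains C where "\<And>x. \<bar>\<phi> x\<bar> \<le> C"
proof -
  obtain a b where 1: "smooth \<phi>" "0 < a" "a < b" "b < 1" "\<And>x. x \<notin> {a..b} \<Longrightarrow> \<phi> x = 0"
    using test_functionD[OF assms(1)] by metis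
  have "compact (\<phi> ` {a..b})" by (rule compact_continuous_image[OF smooth_continuous[OF 1(1)]]) simp
  then obtain C where C: "\<And>x. x \<in> {a..b} \<Longrightarrow> norm (\<phi> x) \<le> C" by (metis bounded_iff compact_imp_bounded imageI)
  have "\<bar>\<phi> x\<bar> \<le> \<bar>C\<bar>" for x using C[of x] 1(5)[of x] by (cases "x \<in> {a..b}") auto
  then show ?thesis by (rule that)
qed

lemma test_function_square_integrable:
  assumes "test_function \<phi>" shows "\<phi> \<in> square_integrable {0<..<1}"
proof -
  obtain C where "\<And>x. \<bar>\<phi> x\<bar> \<le> C" using test_function_bounded[OF assms] by blast
  then show ?thesis
    by (intro bounded_square_integrable continuous_borel_measurable_lebesgue_on test_function_continuous assms)
qed

lemma square_integrable_integrable: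
  "f \<in> square_integrable {0<..<1} \<Longrightarrow> integrable (lebesgue_on {0<..<1}) f"
  using square_integrable_mult[OF _ square_integrable_const, of f 1] by simp

lemma smooth_real_polynomial_function: "real_polynomial_function p \<Longrightarrow> smooth p"
proof (induction rule: real_polynomial_function.induct)
  case (linear f)
  have "f x = x * f 1" for x using linear_scale[OF bounded_linear.linear[OF linear], of x 1] by simp
  then have "f = (\<lambda>x. x * f 1)" by blast
  then show ?case using smooth_mult[OF smooth_ident smooth_const] by metis
qed (auto intro: smooth_const smooth_add smooth_mult)

text \<open>No plateau is built: the arguments of the two steps tend to infinity at each interior
  point, so the product tends to 1 without ever attaining it. A uniform bound and pointwise
  convergence are what dominated convergence asks for.\<close>

lemma test_function_cutoff:
  obtains cut :: "nat \<Rightarrow> real \<Rightarrow> real" where "\<And>n. test_function (cut n)" "\<And>n x. \<bar>cut n x\<bar> \<le> 1"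
    "\<And>x. x \<in> {0<..<1} \<Longrightarrow> (\<lambda>n. cut n x) \<longlonglongrightarrow> 1"
proof
  define cut where "cut n x = smooth_step (real (n + 3) * x + (-1)) * smooth_step (- real (n + 3) * x + (real (n + 3) - 1))"
    for n x
  show "test_function (cut n)" for n
  proof (rule test_functionI)
    show "smooth (cut n)" unfolding cut_def by (intro smooth_mult smooth_affine smooth_smooth_step)
    show "0 < 1 / real (n + 3)" "1 - 1 / real (n + 3) < 1" by auto
    show "cut n x = 0" if "x \<notin> {1 / real (n + 3)..1 - 1 / real (n + 3)}" for x
      using that by (auto simp: cut_def smooth_step_def field_simps)
  qed
  have le1: "\<bar>smooth_step x\<bar> \<le> 1" for x by (auto simp: smooth_step_def)
  show "\<bar>cut n x\<bar> \<le> 1" for n x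
    unfolding cut_def abs_mult by (intro mult_le_one le1) auto
  have lim: "((\<lambda>n. smooth_step (f n)) \<longlongrightarrow> 1) sequentially" if "filterlim f at_top sequentially" for f
  proof -
    have "((\<lambda>n. exp (- 1 / f n)) \<longlongrightarrow> exp 0) sequentially"
      by (intro tendsto_exp tendsto_divide_0[OF tendsto_const] filterlim_at_top_imp_at_infinity that)
    moreover have "\<forall>\<^sub>F n in sequentially. exp (- 1 / f n) = smooth_step (f n)"
      using that[unfolded filterlim_at_top_dense, rule_format, of 0] by eventually_elim (simp add: smooth_step_def)
    ultimately have "((\<lambda>n. smooth_step (f n)) \<longlongrightarrow> exp 0) sequentially" by (rule Lim_transform_eventually)
    then show ?thesis by simp
  qed
  show "(\<lambda>n. cut n x) \<longlonglongrightarrow> 1" if x: "x \<in> {0<..<1}" for x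
  proof -
    have n3: "filterlim (\<lambda>n. real (n + 3)) at_top sequentially"
      by (rule filterlim_compose[OF filterlim_real_sequentially]) (rule filterlim_add_const_nat_at_top)
    have lin: "filterlim (\<lambda>n. (-1) + real (n + 3) * y) at_top sequentially" if "y > 0" for y
      by (intro filterlim_tendsto_add_at_top[OF tendsto_const]
          filterlim_at_top_mult_tendsto_pos[OF tendsto_const _ n3] that)
    have 1: "filterlim (\<lambda>n. real (n + 3) * x + (-1)) at_top sequentially"
      using lin[of x] x by (simp add: add.commute)
    have 2: "filterlim (\<lambda>n. - real (n + 3) * x + (real (n + 3) - 1)) at_top sequentially"
      using lin[of "1 - x"] x by (simp add: algebra_simps)
    show ?thesis unfolding cut_def using tendsto_mult[OF lim[OF 1] lim[OF 2]] by simp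
  qed
qed

section \<open>Density of the test functions in L2\<close>

text \<open>Orthogonality passes from test functions to smooth functions by cutoffs, to continuous
  functions by the Weierstrass theorem, and by dominated convergence to a clipped version of f
  itself, which is an almost everywhere limit of continuous functions. Testing f against its own
  clipping forces f to vanish.\<close>

lemma fundamental_lemma:
  assumes f: "f \<in> square_integrable {0<..<1}"
    and orth: "\<And>\<phi>. test_function \<phi> \<Longrightarrow> (LINT x|lebesgue_on {0<..<1}. f x * \<phi> x) = 0"
  shows "AE x in lebesgue_on {0<..<1}. f x = 0"
proof -
  let ?M = "lebesgue_on {0<..<1::real}"
  have fm: "f \<in> borel_measurable ?M" using f by (simp add: square_integrable_def)
  have fi: "integrable ?M f" by (rule square_integrable_integrable[OF f])
  then have fa: "integrable ?M (\<lambda>x. \<bar>f x\<bar>)" by (rule integrable_abs)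
  obtain cut :: "nat \<Rightarrow> real \<Rightarrow> real" where chi: "\<And>n. test_function (cut n)" "\<And>n x. \<bar>cut n x\<bar> \<le> 1"
    "\<And>x. x \<in> {0<..<1} \<Longrightarrow> (\<lambda>n. cut n x) \<longlonglongrightarrow> 1" by (rule test_function_cutoff) (rule that)
  have sm: "p \<in> borel_measurable ?M" if "smooth p" for p
    by (rule continuous_borel_measurable_lebesgue_on) (rule smooth_continuous[OF that])
  have poly: "(LINT x|?M. f x * p x) = 0" if p: "smooth p" for p
  proof -
    have "compact (p ` {0..1})" by (rule compact_continuous_image[OF smooth_continuous[OF p]]) simp
    then obtain C where C: "\<And>x. x \<in> {0..1} \<Longrightarrow> norm (p x) \<le> C" by (metis bounded_iff compact_imp_bounded imageI)
    have "(\<lambda>n. LINT x|?M. f x * (p x * cut n x)) \<longlonglongrightarrow> (LINT x|?M. f x * (p x * 1))"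
    proof (rule integral_dominated_convergence[where w="\<lambda>x. \<bar>f x\<bar> * C"])
      show "(\<lambda>x. f x * (p x * 1)) \<in> borel_measurable ?M" by (intro borel_measurable_times fm sm p smooth_const)
      show "(\<lambda>x. f x * (p x * cut n x)) \<in> borel_measurable ?M" for n
        by (intro borel_measurable_times fm sm p test_function_smooth chi)
      show "integrable ?M (\<lambda>x. \<bar>f x\<bar> * C)" using fa by (rule integrable_mult_left)
      show "AE x in ?M. (\<lambda>n. f x * (p x * cut n x)) \<longlonglongrightarrow> f x * (p x * 1)"
        by (rule AE_I2) (auto intro!: tendsto_mult tendsto_const chi(3) simp del: mult_1_right)
      show "AE x in ?M. norm (f x * (p x * cut n x)) \<le> \<bar>f x\<bar> * C" for n
      proof (rule AE_I2)
        fix x assume "x \<in> space ?M"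
        then have "\<bar>p x\<bar> * \<bar>cut n x\<bar> \<le> C * 1" using C[of x] by (intro mult_mono chi) auto
        then show "norm (f x * (p x * cut n x)) \<le> \<bar>f x\<bar> * C" by (simp add: abs_mult mult_left_mono)
      qed
    qed
    moreover have "(LINT x|?M. f x * (p x * cut n x)) = 0" for n
      by (intro orth test_function_mult chi p)
    ultimately show ?thesis by (simp add: LIMSEQ_const_iff)
  qed
  have cont: "(LINT x|?M. f x * c x) = 0" if c: "continuous_on UNIV c" for c
  proof -
    have cb: "continuous_on {0..1} c" using c continuous_on_subset by blast
    have cm: "c \<in> borel_measurable ?M" by (rule continuous_borel_measurable_lebesgue_on) (use c continuous_on_subset in blast)
    define I where "I = (LINT x|?M. \<bar>f x\<bar>)"
    have I: "I \<ge> 0" by (simp add: I_def)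
    have small: "\<bar>LINT x|?M. f x * c x\<bar> \<le> e * I" if e: "e > 0" for e
    proof -
      obtain p where p: "real_polynomial_function p" "\<And>x. x \<in> {0..1} \<Longrightarrow> \<bar>c x - p x\<bar> < e"
        using Stone_Weierstrass_real_polynomial_function[OF compact_Icc cb e] by blast
      note ps = smooth_real_polynomial_function[OF p(1)]
      have mm: "(\<lambda>x. f x * (c x - p x)) \<in> borel_measurable ?M" by (intro borel_measurable_times borel_measurable_diff fm cm sm ps)
      have ib: "integrable ?M (\<lambda>x. f x * (c x - p x))"
      proof (rule Bochner_Integration.integrable_bound[OF integrable_mult_right[OF fa, of e] mm])
        show "AE x in ?M. norm (f x * (c x - p x)) \<le> norm (e * \<bar>f x\<bar>)"
        proof (rule AE_I2)
          fix x assume "x \<in> space ?M"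
          then have "\<bar>c x - p x\<bar> \<le> e" using p(2)[of x] by simp
          then show "norm (f x * (c x - p x)) \<le> norm (e * \<bar>f x\<bar>)"
            using e by (simp add: abs_mult mult.commute[of e] mult_left_mono)
        qed
      qed
      have ip: "integrable ?M (\<lambda>x. f x * p x)"
      proof -
        have "compact (p ` {0..1})" by (rule compact_continuous_image[OF smooth_continuous[OF ps]]) simp
        then obtain C where C: "\<And>x. x \<in> {0..1} \<Longrightarrow> norm (p x) \<le> C" by (metis bounded_iff compact_imp_bounded imageI)
        show ?thesis
          by (intro square_integrable_mult f bounded_square_integrable[where C=C] sm ps) (use C in auto)
      qed
      have "(LINT x|?M. f x * c x) = (LINT x|?M. f x * (c x - p x) + f x * p x)" by (simp add: algebra_simps)
      also have "\<dots> = (LINT x|?M. f x * (c x - p x))" using poly[OF ps] ib ip by simp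
      finally have "\<bar>LINT x|?M. f x * c x\<bar> \<le> (LINT x|?M. \<bar>f x * (c x - p x)\<bar>)"
        using integral_abs_bound[of ?M "\<lambda>x. f x * (c x - p x)"] by simp
      also have "\<dots> \<le> (LINT x|?M. e * \<bar>f x\<bar>)"
      proof (rule integral_mono)
        show "integrable ?M (\<lambda>x. \<bar>f x * (c x - p x)\<bar>)" using ib by (rule integrable_abs)
        show "integrable ?M (\<lambda>x. e * \<bar>f x\<bar>)" using fa by (rule integrable_mult_right)
        show "\<bar>f x * (c x - p x)\<bar> \<le> e * \<bar>f x\<bar>" if "x \<in> space ?M" for x
          using p(2)[of x] that by (simp add: abs_mult mult.commute[of e] mult_left_mono)
      qed
      finally show ?thesis by (simp add: I_def)
    qed
    show ?thesis
    proof (rule ccontr)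
      assume n: "(LINT x|?M. f x * c x) \<noteq> 0"
      let ?J = "\<bar>LINT x|?M. f x * c x\<bar>"
      obtain K where K: "K > 0" "I \<le> K" using I by (metis gt_ex less_imp_le order_le_less_trans)
      have "?J \<le> ?J / (2 * K) * I" using n K by (intro small) auto
      also have "\<dots> \<le> ?J / (2 * K) * K" using K by (intro mult_left_mono) auto
      also have "\<dots> = ?J / 2" using K by simp
      finally show False using n by simp
    qed
  qed
  define f1 where "f1 x = (if x \<in> {0<..<1} then f x else 0)" for x
  have "f1 \<in> borel_measurable lebesgue"
    unfolding f1_def using fm by (intro borel_measurable_if_I) auto
  then have "f1 measurable_on UNIV" by (intro lebesgue_measurable_imp_measurable_on) auto
  then obtain N g where N: "negligible N" and g: "\<And>n::nat. continuous_on UNIV (g n)"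
    and gl: "\<And>x. x \<notin> N \<Longrightarrow> (\<lambda>n. g n x) \<longlonglongrightarrow> f1 x"
    unfolding measurable_on_def by auto
  \<comment> \<open>Clipping keeps the integrands below the absolute value of f, while t times its
    clipping is nonnegative and vanishes at t = 0 only.\<close>
  define cl where "cl t = max (-1) (min 1 t)" for t :: real
  have clc: "isCont cl t" for t unfolding cl_def by (intro continuous_intros)
  have cl1: "\<bar>cl t\<bar> \<le> 1" for t by (auto simp: cl_def)
  have clm: "cl \<in> borel_measurable borel" using clc by (intro borel_measurable_continuous_onI continuous_at_imp_continuous_on) auto
  have cg: "continuous_on UNIV (\<lambda>x. cl (g n x))" for n
    by (rule continuous_on_compose2[of UNIV cl]) (use clc g in \<open>auto intro: continuous_at_imp_continuous_on\<close>)
  have "(\<lambda>n. LINT x|?M. f x * cl (g n x)) \<longlonglongrightarrow> (LINT x|?M. f x * cl (f x))"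
  proof (rule integral_dominated_convergence[where w="\<lambda>x. \<bar>f x\<bar>"])
    show "(\<lambda>x. f x * cl (f x)) \<in> borel_measurable ?M"
      by (intro borel_measurable_times fm measurable_compose[OF fm clm])
    show "(\<lambda>x. f x * cl (g n x)) \<in> borel_measurable ?M" for n
      by (intro borel_measurable_times fm continuous_borel_measurable_lebesgue_on continuous_on_subset[OF cg]) auto
    have "AE x in lebesgue. x \<notin> N" using N by (simp add: negligible_iff_null_sets AE_not_in)
    then have "AE x in ?M. x \<notin> N" by (subst AE_restrict_space_iff) auto
    then show "AE x in ?M. (\<lambda>n. f x * cl (g n x)) \<longlonglongrightarrow> f x * cl (f x)"
    proof (rule AE_mp, intro AE_I2 impI)
      fix x assume "x \<in> space ?M" "x \<notin> N"
      then have "(\<lambda>n. g n x) \<longlonglongrightarrow> f x" using gl[of x] by (simp add: f1_def)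
      then show "(\<lambda>n. f x * cl (g n x)) \<longlonglongrightarrow> f x * cl (f x)"
        by (intro tendsto_mult tendsto_const isCont_tendsto_compose[OF clc])
    qed
    show "AE x in ?M. norm (f x * cl (g n x)) \<le> \<bar>f x\<bar>" for n
      using cl1 by (intro AE_I2) (simp add: abs_mult mult_left_le)
  qed (rule fa)
  then have "(LINT x|?M. f x * cl (f x)) = 0" by (simp add: cont[OF cg] LIMSEQ_const_iff)
  moreover have "integrable ?M (\<lambda>x. f x * cl (f x))"
  proof (rule Bochner_Integration.integrable_bound[OF fa])
    show "(\<lambda>x. f x * cl (f x)) \<in> borel_measurable ?M"
      by (intro borel_measurable_times fm measurable_compose[OF fm clm])
    show "AE x in ?M. norm (f x * cl (f x)) \<le> norm \<bar>f x\<bar>"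
      using cl1 by (intro AE_I2) (simp add: abs_mult mult_left_le)
  qed
  moreover have "0 \<le> t * cl t" for t by (auto simp: cl_def zero_le_mult_iff)
  ultimately have "AE x in ?M. f x * cl (f x) = 0"
    by (subst (asm) integral_nonneg_eq_0_iff_AE) auto
  then show ?thesis by eventually_elim (auto simp: cl_def split: if_splits)
qed

lemma test_functions_subspace: "subspace (abs_L2 ` {\<phi>. test_function \<phi>})"
  unfolding subspace_def
proof (intro conjI ballI allI)
  have "test_function (\<lambda>x. 0)" by (rule test_functionI[of _ "1/2" "1/2"]) (auto intro: smooth_const)
  then show "0 \<in> abs_L2 ` {\<phi>. test_function \<phi>}" unfolding zero_L2_abs by blast
  show "u + v \<in> abs_L2 ` {\<phi>. test_function \<phi>}"
    if "u \<in> abs_L2 ` {\<phi>. test_function \<phi>}" "v \<in> abs_L2 ` {\<phi>. test_function \<phi>}" for u v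
    using that by (auto simp: abs_L2_arith test_function_square_integrable intro!: imageI test_function_add)
  show "c *\<^sub>R u \<in> abs_L2 ` {\<phi>. test_function \<phi>}" if "u \<in> abs_L2 ` {\<phi>. test_function \<phi>}" for c u
    using that by (auto simp: abs_L2_arith[OF _ square_integrable_0] test_function_square_integrable intro!: imageI test_function_cmult)
qed

lemma L2_orthogonal_test_functions:
  assumes "\<And>\<phi>. test_function \<phi> \<Longrightarrow> inner u (abs_L2 \<phi>) = 0" shows "u = 0"
proof -
  obtain f where f: "f \<in> square_integrable {0<..<1}" "u = abs_L2 f" by (rule L2_cases)
  have "AE x in lebesgue_on {0<..<1}. f x = 0"
    by (rule fundamental_lemma[OF f(1)]) (use assms f in \<open>auto simp: abs_L2_arith test_function_square_integrable\<close>)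
  then show ?thesis unfolding f(2) zero_L2_abs using abs_L2_eq_iff[OF f(1) square_integrable_0] by simp
qed

lemma test_functions_dense: "closure (abs_L2 ` {\<phi>. test_function \<phi>}) = UNIV"
  by (rule dense_if_trivial_orthogonal[OF test_functions_subspace]) (use L2_orthogonal_test_functions in blast)

section \<open>Integration on the unit interval\<close>

abbreviation M01 :: "real measure" where "M01 \<equiv> lebesgue_on {0<..<1}"

lemma integrable_M01_iff: "integrable M01 f \<longleftrightarrow> set_integrable lebesgue {0<..<1} (f :: real \<Rightarrow> real)"
  unfolding set_integrable_def by (rule integrable_restrict_space) auto

lemma integral_M01: "(LINT x|M01. f x) = (LINT x:{0<..<1}|lebesgue. (f x :: real))"
  unfolding set_lebesgue_integral_def by (rule integral_restrict_space) auto

lemma powr_integral: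
  assumes c: "c > -1"
  shows "integrable M01 (\<lambda>x. x powr c)" and "(LINT x|M01. x powr c) = 1 / (c + 1)"
proof -
  have h: "((\<lambda>x. x powr c) has_integral 1 / (c + 1)) {0<..<1}"
    using has_integral_powr_from_0[OF c, of 1] by (simp add: has_integral_Icc_iff_Ioo)
  then have "(\<lambda>x. x powr c) absolutely_integrable_on {0<..<1}"
    by (intro nonnegative_absolutely_integrable_1) auto
  then show "integrable M01 (\<lambda>x. x powr c)" by (simp add: integrable_M01_iff)
  show "(LINT x|M01. x powr c) = 1 / (c + 1)"
    unfolding integral_M01 using set_lebesgue_integral_eq_integral(2)[OF \<open>(\<lambda>x. x powr c) absolutely_integrable_on {0<..<1}\<close>]
      integral_unique[OF h] by simp
qed

lemma measurable_powr: "(\<lambda>x. x powr c) \<in> borel_measurable M01"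
  by (rule continuous_borel_measurable_lebesgue_on) (auto intro!: continuous_intros)

lemma powr_square_integrable:
  assumes "c > -1/2" shows "(\<lambda>x. x powr c) \<in> square_integrable {0<..<1}"
proof -
  have "(\<lambda>x. (x powr c)\<^sup>2) = (\<lambda>x. x powr (2 * c))" by (simp add: power2_eq_square powr_add[symmetric])
  then show ?thesis using powr_integral(1)[of "2 * c"] assms by (simp add: square_integrable_def measurable_powr)
qed

lemma measurable_indicator_M01: "S \<in> sets borel \<Longrightarrow> indicator S \<in> borel_measurable M01"
  by (intro measurable_restrict_space1 borel_measurable_indicator) auto

lemma square_integrable_bound:
  assumes "f \<in> borel_measurable (lebesgue_on S)" "integrable (lebesgue_on S) g" "\<And>x. x \<in> S \<Longrightarrow> (f x)\<^sup>2 \<le> g x"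
  shows "f \<in> square_integrable S"
proof -
  have "integrable (lebesgue_on S) (\<lambda>x. (f x)\<^sup>2)"
  proof (rule Bochner_Integration.integrable_bound[OF assms(2)])
    show "AE x in lebesgue_on S. norm ((f x)\<^sup>2) \<le> norm (g x)"
      using order_trans[OF assms(3) abs_ge_self] by (intro AE_I2) auto
  qed (use assms(1) in measurable)
  then show ?thesis using assms(1) by (simp add: square_integrable_def)
qed

lemma square_integrable_bounded_mult:
  assumes f: "f \<in> square_integrable S" and g: "g \<in> borel_measurable (lebesgue_on S)"
    and C: "\<And>x. x \<in> S \<Longrightarrow> \<bar>g x\<bar> \<le> C"
  shows "(\<lambda>x. g x * f x) \<in> square_integrable S"
proof (rule square_integrable_bound)
  show "(\<lambda>x. g x * f x) \<in> borel_measurable (lebesgue_on S)"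
    using f g by (auto simp: square_integrable_def intro!: borel_measurable_times)
  show "integrable (lebesgue_on S) (\<lambda>x. C\<^sup>2 * (f x)\<^sup>2)" using f by (auto simp: square_integrable_def)
  show "(g x * f x)\<^sup>2 \<le> C\<^sup>2 * (f x)\<^sup>2" if "x \<in> S" for x
    unfolding power_mult_distrib using order_trans[OF C[OF that] abs_ge_self] by (intro mult_right_mono) (auto simp: abs_le_square_iff[symmetric])
qed

text \<open>The fundamental theorem on [x, 1], with the integral written over the unit interval by
  means of an indicator: this is the shape in which inner products with \<open>kern\<close>
  appear.\<close>

lemma ftc_tail:
  assumes x: "0 < x" "x < 1"
    and D: "\<And>y. y \<in> {x..1} \<Longrightarrow> (F has_real_derivative F' y) (at y within {x..1})"
    and c: "continuous_on {x..1} F'"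
  shows "integrable M01 (\<lambda>y. indicator {x<..} y * F' y)"
    and "(LINT y|M01. indicator {x<..} y * F' y) = F 1 - F x"
proof -
  have ai: "F' absolutely_integrable_on {x..1}" by (rule absolutely_integrable_continuous_real[OF c])
  then have ai': "F' absolutely_integrable_on {x<..<1}"
    by (rule set_integrable_subset) auto
  have eq: "(\<lambda>y. indicator {0<..<1} y *\<^sub>R (indicator {x<..} y * F' y)) = (\<lambda>y. indicator {x<..<1} y *\<^sub>R F' y)"
    using x by (auto simp: fun_eq_iff indicator_def)
  show "integrable M01 (\<lambda>y. indicator {x<..} y * F' y)"
    using ai' unfolding integrable_M01_iff set_integrable_def eq .
  have "(F' has_integral (F 1 - F x)) {x..1}"
    by (rule fundamental_theorem_of_calculus) (use x D in \<open>auto simp: has_real_derivative_iff_has_vector_derivative\<close>)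
  then have "integral {x<..<1} F' = F 1 - F x"
    by (simp add: integral_open_interval_real[symmetric] integral_unique)
  then show "(LINT y|M01. indicator {x<..} y * F' y) = F 1 - F x"
    using set_lebesgue_integral_eq_integral(2)[OF ai'] unfolding integral_M01 set_lebesgue_integral_def eq by simp
qed

lemma test_function_integral_derivative:
  assumes t: "test_function \<phi>" and D: "\<And>x. x \<in> {0<..<1} \<Longrightarrow> (\<phi> has_real_derivative D x) (at x)"
  shows "(LINT x|M01. D x) = 0"
proof -
  obtain a b where ab: "smooth \<phi>" "0 < a" "a < b" "b < 1" "\<And>x. x \<notin> {a..b} \<Longrightarrow> \<phi> x = 0"
    using test_functionD[OF t] by metis
  have De: "D x = deriv \<phi> x" if "x \<in> {0<..<1}" for x using DERIV_imp_deriv[OF D[OF that]] by simp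
  have z: "deriv \<phi> x = 0" if "x \<notin> {a..b}" for x
  proof -
    have "\<forall>\<^sub>F y in nhds x. y \<in> - {a..b}" using that by (intro eventually_nhds_in_open) auto
    then have "\<forall>\<^sub>F y in nhds x. \<phi> y = 0" by eventually_elim (use ab(5) in auto)
    then have "(\<phi> has_real_derivative 0) (at x)"
      by (subst DERIV_cong_ev[OF refl _ refl, of _ "\<lambda>x. 0"]) auto
    then show ?thesis by (rule DERIV_imp_deriv)
  qed
  have a2: "0 < a/2" "a/2 < 1" "a/2 \<notin> {a..b}" "1 \<notin> {a..b}" using ab by auto
  have "(LINT x|M01. D x) = (LINT y|M01. indicator {a/2<..} y * deriv \<phi> y)"
    by (rule Bochner_Integration.integral_cong) (use De z ab in \<open>auto simp: indicator_def\<close>)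
  also have "\<dots> = \<phi> 1 - \<phi> (a/2)"
    by (rule ftc_tail(2)[OF a2(1,2)])
      (auto intro!: has_field_derivative_at_within[OF test_function_DERIV[OF t]] test_function_continuous test_function_deriv t)
  also have "\<dots> = 0" using ab(5)[OF a2(3)] ab(5)[OF a2(4)] by simp
  finally show ?thesis .
qed

section \<open>Tail integrals\<close>

definition kern :: "real \<Rightarrow> real \<Rightarrow> real \<Rightarrow> real" where
  "kern c x y = indicator {x<..} y * y powr c"

text \<open>The integral of \<open>y powr c * p y\<close> over (x, 1). Written as an inner product
  it depends only on the class p, and yet it is defined at every single x in (0, 1]; this gives
  elements of the range of \<open>G\<close> canonical continuous representatives.\<close>

definition tail :: "L2 \<Rightarrow> real \<Rightarrow> real \<Rightarrow> real" where
  "tail p c x = inner p (abs_L2 (kern c x))"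

lemma kern_measurable: "kern c x \<in> borel_measurable M01"
  unfolding kern_def[abs_def] by (intro borel_measurable_times measurable_indicator_M01 measurable_powr) auto

lemma powr_le_bound: "0 < x \<Longrightarrow> x \<le> y \<Longrightarrow> y \<le> 1 \<Longrightarrow> y powr c \<le> 1 + x powr c" for x y c :: real
proof (cases "c \<ge> 0")
  case True
  assume "0 < x" "x \<le> y" "y \<le> 1"
  then have "y powr c \<le> 1 powr c" using True by (intro powr_mono2) auto
  then show ?thesis by (simp add: add_increasing2)
next
  case False
  assume "0 < x" "x \<le> y" "y \<le> 1"
  then have "y powr c \<le> x powr c" using False by (intro powr_mono2') auto
  then show ?thesis by simp
qed

lemma kern_square_integrable: "0 < x \<Longrightarrow> kern c x \<in> square_integrable {0<..<1}"
  by (rule bounded_square_integrable[OF kern_measurable, of _ _ "1 + x powr c"])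
    (auto simp: kern_def indicator_def powr_le_bound abs_of_nonneg add_nonneg_nonneg)

lemma tail_add: "tail (p + q) c x = tail p c x + tail q c x"
  and tail_scale: "tail (k *\<^sub>R p) c x = k * tail p c x"
  by (simp_all add: tail_def inner_add_left inner_diff_left)

lemma tail_abs:
  assumes "f \<in> square_integrable {0<..<1}" "0 < x"
  shows "tail (abs_L2 f) c x = (LINT y|M01. indicator {x<..} y * (y powr c * f y))"
  unfolding tail_def abs_L2_arith(5)[OF assms(1) kern_square_integrable[OF assms(2)]]
  by (simp add: kern_def mult_ac)

lemma tail_1: "tail p c 1 = 0"
proof -
  have "abs_L2 (kern c 1) = abs_L2 (\<lambda>x. 0)"
    by (subst abs_L2_eq_iff[OF kern_square_integrable square_integrable_0]) (auto intro!: AE_I2 simp: kern_def)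
  then show ?thesis by (simp add: tail_def zero_L2_abs[symmetric])
qed

lemma kern_diff_norm:
  assumes x: "0 < x" "x \<le> x'"
  shows "(norm (abs_L2 (kern c x) - abs_L2 (kern c x')))\<^sup>2 \<le> (1 + x powr c)\<^sup>2 * (x' - x)"
proof -
  have x': "0 < x'" using x by simp
  note k = kern_square_integrable[OF x(1), of c] kern_square_integrable[OF x', of c]
  have fin: "{x<..x'} \<inter> {0<..<1} \<in> lmeasurable"
    by (intro bounded_set_imp_lmeasurable) (auto intro: bounded_subset[of "{x..x'}"])
  have i: "integrable M01 (\<lambda>y. indicator {x<..x'} y :: real)"
    by (rule square_integrable_integrable, rule bounded_square_integrable[where C=1], rule measurable_indicator_M01)
      (auto simp: indicator_def)
  have "(norm (abs_L2 (kern c x) - abs_L2 (kern c x')))\<^sup>2 = (LINT y|M01. (kern c x y - kern c x' y)\<^sup>2)"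
    unfolding abs_L2_arith(2)[OF k] by (rule norm_abs_L2[OF square_integrable_diff[OF k]])
  also have "\<dots> \<le> (LINT y|M01. (1 + x powr c)\<^sup>2 * indicator {x<..x'} y)"
  proof (rule integral_mono)
    show "integrable M01 (\<lambda>y. (kern c x y - kern c x' y)\<^sup>2)"
      using square_integrable_diff[OF k] by (simp add: square_integrable_def)
    show "integrable M01 (\<lambda>y. (1 + x powr c)\<^sup>2 * indicator {x<..x'} y)" using i by simp
    show "(kern c x y - kern c x' y)\<^sup>2 \<le> (1 + x powr c)\<^sup>2 * indicator {x<..x'} y" if "y \<in> space M01" for y
    proof -
      have "0 \<le> y powr c" "y powr c \<le> 1 + x powr c" if "x < y"
        using powr_le_bound[of x y c] x that \<open>y \<in> space M01\<close> by auto
      then show ?thesis using x by (auto simp: kern_def indicator_def intro!: power_mono)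
    qed
  qed
  also have "\<dots> = (1 + x powr c)\<^sup>2 * (LINT y|M01. indicator {x<..x'} y)" by simp
  also have "(LINT y|M01. indicator {x<..x'} y :: real) \<le> x' - x"
  proof -
    have "(LINT y|M01. indicator {x<..x'} y :: real) = (LINT y|lebesgue. indicator ({x<..x'} \<inter> {0<..<1}) y)"
      unfolding integral_M01 set_lebesgue_integral_def by (rule Bochner_Integration.integral_cong) (auto simp: indicator_def)
    also have "\<dots> = measure lebesgue ({x<..x'} \<inter> {0<..<1})" using fin by simp
    also have "\<dots> \<le> measure lebesgue {x..x'}"
      by (rule measure_mono_fmeasurable) (use fin in auto)
    finally show ?thesis using x by simp
  qed
  then have "(1 + x powr c)\<^sup>2 * (LINT y|M01. indicator {x<..x'} y) \<le> (1 + x powr c)\<^sup>2 * (x' - x)"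
    by (intro mult_left_mono) auto
  finally show ?thesis .
qed

text \<open>Hoelder continuity of exponent 1/2, from Cauchy-Schwarz against the difference of two
  kernels. The constant involves p through its norm only and the points through their lower bound
  \<epsilon>: this is the equicontinuity behind the compactness of \<open>G\<close>.\<close>

lemma tail_lipschitz:
  assumes x: "0 < \<epsilon>" "\<epsilon> \<le> x" "\<epsilon> \<le> x'" "x \<le> 1" "x' \<le> 1"
  shows "\<bar>tail p c x - tail p c x'\<bar> \<le> norm p * ((2 + \<epsilon> powr c) * sqrt \<bar>x' - x\<bar>)"
proof -
  have *: "\<bar>tail p c x - tail p c x'\<bar> \<le> norm p * ((2 + \<epsilon> powr c) * sqrt \<bar>x' - x\<bar>)"
    if x: "\<epsilon> \<le> x" "x \<le> x'" "x \<le> 1" for x x'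
  proof -
    have x0: "0 < x" using x \<open>0 < \<epsilon>\<close> by simp
    have "\<bar>tail p c x - tail p c x'\<bar> = \<bar>inner p (abs_L2 (kern c x) - abs_L2 (kern c x'))\<bar>"
      by (simp add: tail_def inner_diff_right)
    also have "\<dots> \<le> norm p * norm (abs_L2 (kern c x) - abs_L2 (kern c x'))" by (rule Cauchy_Schwarz_ineq2)
    also have "norm (abs_L2 (kern c x) - abs_L2 (kern c x')) \<le> sqrt ((1 + x powr c)\<^sup>2 * (x' - x))"
      by (rule real_le_rsqrt[OF kern_diff_norm[OF x0 x(2)]])
    also have "\<dots> = (1 + x powr c) * sqrt \<bar>x' - x\<bar>" using x by (simp add: real_sqrt_mult add_nonneg_nonneg)
    also have "\<dots> \<le> (2 + \<epsilon> powr c) * sqrt \<bar>x' - x\<bar>"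
      using powr_le_bound[OF \<open>0 < \<epsilon>\<close> x(1) x(3), of c] by (intro mult_right_mono) auto
    finally show ?thesis by (simp add: mult_left_mono)
  qed
  show ?thesis
  proof (cases "x \<le> x'")
    case False
    then show ?thesis using *[of x' x] x by (simp add: abs_minus_commute)
  qed (use * x in simp)
qed

lemma tail_continuous: "continuous_on {0<..1} (tail p c)"
  unfolding continuous_on_def
proof
  fix x :: real assume x: "x \<in> {0<..1}"
  let ?F = "at x within {0<..1}"
  have "((\<lambda>y. norm p * ((2 + (x/2) powr c) * sqrt \<bar>x - y\<bar>)) \<longlongrightarrow> norm p * ((2 + (x/2) powr c) * sqrt \<bar>x - x\<bar>)) ?F"
    by (intro tendsto_intros)
  then have l: "((\<lambda>y. norm p * ((2 + (x/2) powr c) * sqrt \<bar>x - y\<bar>)) \<longlongrightarrow> 0) ?F" by simp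
  have "\<forall>\<^sub>F y in ?F. x/2 < y" by (rule order_tendstoD(1)[OF tendsto_ident_at]) (use x in auto)
  moreover have "\<forall>\<^sub>F y in ?F. y \<in> {0<..1}" by (auto simp: eventually_at_filter)
  ultimately have "\<forall>\<^sub>F y in ?F. norm (tail p c y - tail p c x) \<le> norm p * ((2 + (x/2) powr c) * sqrt \<bar>x - y\<bar>)"
    by eventually_elim (use x in \<open>auto intro!: tail_lipschitz\<close>)
  then have "((\<lambda>y. tail p c y - tail p c x) \<longlongrightarrow> 0) ?F" by (rule Lim_null_comparison[OF _ l])
  then show "(tail p c \<longlongrightarrow> tail p c x) ?F" by (simp add: LIM_zero_iff)
qed

lemma tail_derivative:
  assumes f: "f \<in> square_integrable {0<..<1}" and c: "continuous_on {0<..1} f" and x: "x \<in> {0<..1}"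
  shows "(tail (abs_L2 f) c has_real_derivative - (x powr c * f x)) (at x within {0<..1})"
proof -
  define q where "q y = y powr c * f y" for y
  have qc: "continuous_on {x/2..1} q"
    unfolding q_def by (intro continuous_intros continuous_on_subset[OF c]) (use x in auto)
  obtain g where g: "\<And>y. y \<in> {x/2..1} \<Longrightarrow> (g has_vector_derivative q y) (at y within {x/2..1})"
    using antiderivative_continuous[OF qc] by blast
  have gd: "(g has_real_derivative q y) (at y within {z..1})" if "y \<in> {z..1}" "x/2 \<le> z" for y z
    using g[of y] that unfolding has_real_derivative_iff_has_vector_derivative
    by (intro has_vector_derivative_within_subset[OF g]) auto
  have eq: "tail (abs_L2 f) c z = g 1 - g z" if "z \<in> {x/2..1}" for z
  proof (cases "z = 1")
    case False
    then have z: "0 < z" "z < 1" using that x by auto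
    show ?thesis unfolding tail_abs[OF f z(1)] q_def[symmetric]
      by (rule ftc_tail(2)[OF z]) (use that gd in \<open>auto intro!: continuous_on_subset[OF qc]\<close>)
  qed (simp add: tail_1)
  have "((\<lambda>z. g 1 - g z) has_real_derivative 0 - q x) (at x within {x/2..1})"
    by (intro DERIV_diff DERIV_const gd) (use x in auto)
  then have "(tail (abs_L2 f) c has_real_derivative - q x) (at x within {x/2..1})"
    by (subst (asm) diff_0, elim has_field_derivative_transform_within[OF _ zero_less_one]) (use eq x in auto)
  moreover have "at x within {x/2..1} = at x within {0<..1}"
    by (rule at_within_nhd[of _ "{x/2<..<2}"]) (use x in auto)
  ultimately show ?thesis by (simp add: q_def)
qed

section \<open>Factorization of the Hardy form\<close>

lemma L2_test_induct:
  assumes "closed {u. Q u}" "\<And>\<phi>. test_function \<phi> \<Longrightarrow> Q (abs_L2 \<phi>)"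
  shows "Q u"
proof -
  have "closure (abs_L2 ` {\<phi>. test_function \<phi>}) \<subseteq> {u. Q u}"
    by (rule closure_minimal) (use assms in auto)
  then show ?thesis unfolding test_functions_dense by auto
qed

text \<open>The integral over (e, 1) is - ln e, which is unbounded. This excludes the powers x powr
  (-b), b \<ge> 1/2, from L2.\<close>

lemma inverse_not_integrable: "\<not> integrable M01 (\<lambda>x. x powr (-1))"
proof
  assume i: "integrable M01 (\<lambda>x. x powr (-1))"
  define I where "I = (LINT x|M01. x powr (-1))"
  have I: "- ln e \<le> I" if e: "0 < e" "e < 1" for e
  proof -
    have D: "(ln has_real_derivative y powr (-1)) (at y within {e..1})" if "y \<in> {e..1}" for y
      using that e by (auto intro!: derivative_eq_intros simp: powr_minus_divide)
    have c: "continuous_on {e..1} (\<lambda>y. y powr (-1))" using e by (auto intro!: continuous_intros)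
    have "- ln e = (LINT y|M01. indicator {e<..} y * y powr (-1))"
      using ftc_tail(2)[OF e D c] by simp
    also have "\<dots> \<le> I" unfolding I_def
      by (rule integral_mono[OF ftc_tail(1)[OF e D c] i]) (auto simp: indicator_def)
    finally show ?thesis .
  qed
  have "-1 < \<bar>I\<bar>" by (rule less_le_trans[of _ 0]) auto
  then have "\<bar>I\<bar> + 1 \<le> I" using I[of "exp (- (\<bar>I\<bar> + 1))"] by simp
  then show False by simp
qed

text \<open>Zero mean is what makes the primitive vanish again to the right of the support.\<close>

lemma test_function_primitive:
  assumes t: "test_function \<psi>" and z: "(LINT x|M01. \<psi> x) = 0"
  obtains \<zeta> where "test_function \<zeta>" "\<And>x. (\<zeta> has_real_derivative \<psi> x) (at x)"
proof -
  obtain a c where ac: "smooth \<psi>" "0 < a" "a < c" "c < 1" "\<And>x. x \<notin> {a..c} \<Longrightarrow> \<psi> x = 0"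
    using test_functionD[OF t] by metis
  define \<zeta> where "\<zeta> x = integral {-1..x} \<psi>" for x
  have hi: "(\<psi> has_integral integral {a..c} \<psi>) T" if "{a..c} \<subseteq> T" for T
    by (rule has_integral_on_superset[OF integrable_integral]) (use that ac smooth_continuous in \<open>auto intro!: integrable_continuous_interval\<close>)
  have "(LINT x|M01. \<psi> x) = integral {0<..<1} \<psi>"
    by (rule lebesgue_integral_eq_integral) (auto intro!: square_integrable_integrable test_function_square_integrable t)
  also have "\<dots> = integral {a..c} \<psi>" by (rule integral_unique[OF hi]) (use ac in auto)
  finally have I0: "integral {a..c} \<psi> = 0" using z by simp
  have z0: "\<zeta> x = 0" if x: "x \<notin> {a..c}" for x
  proof (cases "x < a")
    case True
    then have "integral {-1..x} \<psi> = integral {-1..x} (\<lambda>x. 0)" by (intro integral_cong ac(5)) auto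
    then show ?thesis by (simp add: \<zeta>_def)
  next
    case False
    then have "{a..c} \<subseteq> {-1..x}" using x ac by auto
    from integral_unique[OF hi[OF this]] show ?thesis using I0 by (simp add: \<zeta>_def)
  qed
  have D: "(\<zeta> has_real_derivative \<psi> x) (at x)" for x
  proof (cases "x \<in> {a..c}")
    case True
    have "(\<zeta> has_vector_derivative \<psi> x) (at x within {-1..2})"
      unfolding \<zeta>_def by (rule integral_has_vector_derivative) (use smooth_continuous[OF ac(1)] True ac in auto)
    moreover have "at x within {-1..2} = at x" by (rule at_within_interior) (use True ac in auto)
    ultimately show ?thesis by (simp add: has_real_derivative_iff_has_vector_derivative)
  next
    case False
    then have "\<forall>\<^sub>F y in nhds x. y \<in> - {a..c}" by (intro eventually_nhds_in_open) auto
    then have "\<forall>\<^sub>F y in nhds x. \<zeta> y = 0" by eventually_elim (use z0 in auto)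
    then have "(\<zeta> has_real_derivative 0) (at x)"
      by (subst DERIV_cong_ev[OF refl _ refl, of _ "\<lambda>x. 0"]) auto
    then show ?thesis using ac(5)[OF False] by simp
  qed
  have "test_function \<zeta>"
    by (rule test_functionI[OF smooth_if_DERIV[OF D ac(1)] ac(2) ac(4) z0])
  then show ?thesis using D that by blast
qed

section \<open>The integral operators inverting the first-order factor, and their bounds\<close>

text \<open>The form is parametrized by b instead of \<mu>: b = 1/2 is the critical Hardy constant,
  and larger b correspond to smaller \<mu>. The powers x powr \<sigma> and x powr (-b) are
  annihilated by the first-order operator and by its formal adjoint respectively.\<close>

locale hardy_factorization =
  fixes \<alpha> b :: real
  assumes \<alpha>: "0 \<le> \<alpha>" "\<alpha> < 2" and b: "1/2 \<le> b"
begin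

abbreviation "\<sigma> \<equiv> b - \<alpha> / 2"
abbreviation "\<delta> \<equiv> (2 - \<alpha>) / 2"

text \<open>The operator \<open>G\<close> inverts \<open>u \<mapsto> x\<^bsup>\<alpha>/2\<^esup> u' - \<sigma> x\<^bsup>\<alpha>/2-1\<^esup> u\<close> (the operator \<open>Lfun\<close> below) with \<open>u(1) = 0\<close>,
  and \<open>Gs\<close> is the adjoint of \<open>G\<close>.\<close>

definition \<mu> :: real where "\<mu> = \<sigma> * (1 - \<alpha> - \<sigma>)"

text \<open>The power that solves the homogeneous equation. It represents the trace at 1: the
  derivative of \<open>G (Gs f)\<close> there is \<open>- inner f \<theta>\<close>.\<close>

definition \<theta> :: L2 where "\<theta> = abs_L2 (\<lambda>y. y powr \<sigma>)"
text \<open>The integral of \<open>y powr \<sigma> * f y\<close> over (0, x], taken as the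
  complement of a tail integral so that continuity and derivatives are inherited.\<close>

definition head :: "L2 \<Rightarrow> real \<Rightarrow> real" where "head f x = inner f \<theta> - tail f \<sigma> x"
definition Gfun :: "L2 \<Rightarrow> real \<Rightarrow> real" where "Gfun p x = - (x powr \<sigma> * tail p (-b) x)"
definition Gsfun :: "L2 \<Rightarrow> real \<Rightarrow> real" where "Gsfun f x = - (x powr (-b) * head f x)"
definition G :: "L2 \<Rightarrow> L2" where "G p = abs_L2 (Gfun p)"
definition Gs :: "L2 \<Rightarrow> L2" where "Gs f = abs_L2 (Gsfun f)"

lemma \<theta>_square_integrable: "(\<lambda>y. y powr \<sigma>) \<in> square_integrable {0<..<1}"
  by (rule powr_square_integrable) (use \<alpha> b in simp)

lemma head_eq:
  assumes "0 < x" shows "head f x = inner f (abs_L2 (\<lambda>y. y powr \<sigma> - kern \<sigma> x y))"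
  unfolding head_def \<theta>_def tail_def
  using abs_L2_arith(2)[OF \<theta>_square_integrable kern_square_integrable[OF assms]]
  by (simp add: inner_diff_right[symmetric])

lemma head_abs:
  assumes "f \<in> square_integrable {0<..<1}" "0 < x"
  shows "head (abs_L2 f) x = (LINT y|M01. indicator {..x} y * (y powr \<sigma> * f y))"
  unfolding head_eq[OF assms(2)]
    abs_L2_arith(5)[OF assms(1) square_integrable_diff[OF \<theta>_square_integrable kern_square_integrable[OF assms(2)]]]
  by (rule Bochner_Integration.integral_cong) (auto simp: kern_def indicator_def)

lemma powr_minus_half_integral:
  "integrable M01 (\<lambda>x. x powr (- \<alpha> / 2))" "(LINT x|M01. x powr (- \<alpha> / 2)) = 1 / \<delta>"
proof -
  have e: "- \<alpha> / 2 + 1 = \<delta>" by (simp add: field_simps)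
  have "- \<alpha> / 2 > -1" using \<alpha> by simp
  from powr_integral[OF this] show "integrable M01 (\<lambda>x. x powr (- \<alpha> / 2))" "(LINT x|M01. x powr (- \<alpha> / 2)) = 1 / \<delta>"
    unfolding e by auto
qed

text \<open>In y powr (-2b) = y powr (1 - 2b - \<delta>) * y powr (\<delta> - 1) the first factor is
  decreasing and is replaced by its value at x; the second has integral 1/\<delta>. Direct
  integration would produce a logarithm for b = 1/2, whereas this splitting treats all b
  alike.\<close>

lemma tail_bound:
  assumes x: "x \<in> {0<..<1}"
  shows "(tail p (-b) x)\<^sup>2 \<le> (norm p)\<^sup>2 * (x powr (1 - 2 * b - \<delta>) / \<delta>)"
proof -
  have x0: "0 < x" using x by simp
  note k = kern_square_integrable[OF x0, of "-b"]
  have pi: "integrable M01 (\<lambda>y. x powr (1 - 2 * b - \<delta>) * y powr (\<delta> - 1))"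
    using powr_integral(1)[of "\<delta> - 1"] \<alpha> by simp
  have "(norm (abs_L2 (kern (-b) x)))\<^sup>2 = (LINT y|M01. (kern (-b) x y)\<^sup>2)" by (rule norm_abs_L2[OF k])
  also have "\<dots> \<le> (LINT y|M01. x powr (1 - 2 * b - \<delta>) * y powr (\<delta> - 1))"
  proof (rule integral_mono[OF _ pi])
    show "integrable M01 (\<lambda>y. (kern (-b) x y)\<^sup>2)" using k by (simp add: square_integrable_def)
    fix y assume y: "y \<in> space M01"
    have "y powr (-b) * y powr (-b) \<le> x powr (1 - 2 * b - \<delta>) * y powr (\<delta> - 1)" if "x < y"
    proof -
      have "y powr (-b) * y powr (-b) = y powr (1 - 2 * b - \<delta>) * y powr (\<delta> - 1)"
        by (simp add: powr_add[symmetric])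
      also have "\<dots> \<le> x powr (1 - 2 * b - \<delta>) * y powr (\<delta> - 1)"
        using that x b \<alpha> by (intro mult_right_mono powr_mono2') (auto simp: field_simps)
      finally show ?thesis .
    qed
    then show "(kern (-b) x y)\<^sup>2 \<le> x powr (1 - 2 * b - \<delta>) * y powr (\<delta> - 1)"
      by (auto simp: kern_def indicator_def power2_eq_square)
  qed
  also have "\<dots> = x powr (1 - 2 * b - \<delta>) / \<delta>" using powr_integral(2)[of "\<delta> - 1"] \<alpha> by simp
  finally have kn: "(norm (abs_L2 (kern (-b) x)))\<^sup>2 \<le> x powr (1 - 2 * b - \<delta>) / \<delta>" .
  have "(tail p (-b) x)\<^sup>2 \<le> (norm p)\<^sup>2 * (norm (abs_L2 (kern (-b) x)))\<^sup>2"
    unfolding tail_def power2_norm_eq_inner by (rule Cauchy_Schwarz_ineq)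
  also have "\<dots> \<le> (norm p)\<^sup>2 * (x powr (1 - 2 * b - \<delta>) / \<delta>)" by (intro mult_left_mono kn) simp
  finally show ?thesis .
qed

text \<open>The mirror image of \<open>tail_bound\<close>: the factor y powr (2b - \<alpha>/2) is
  increasing and is replaced by its value at x, and y powr (-\<alpha>/2) is integrable.\<close>

lemma head_bound:
  assumes x: "x \<in> {0<..<1}"
  shows "(head f x)\<^sup>2 \<le> (norm f)\<^sup>2 * (x powr (2 * b - \<alpha> / 2) / \<delta>)"
proof -
  have x0: "0 < x" using x by simp
  note k = square_integrable_diff[OF \<theta>_square_integrable kern_square_integrable[OF x0, of \<sigma>]]
  have pi: "integrable M01 (\<lambda>y. x powr (2 * b - \<alpha> / 2) * y powr (- \<alpha> / 2))"
    using powr_minus_half_integral(1) by (rule integrable_mult_right)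
  let ?k = "\<lambda>y. y powr \<sigma> - kern \<sigma> x y"
  have "(norm (abs_L2 ?k))\<^sup>2 = (LINT y|M01. (?k y)\<^sup>2)" by (rule norm_abs_L2[OF k])
  also have "\<dots> \<le> (LINT y|M01. x powr (2 * b - \<alpha> / 2) * y powr (- \<alpha> / 2))"
  proof (rule integral_mono[OF _ pi])
    show "integrable M01 (\<lambda>y. (?k y)\<^sup>2)" using k by (simp add: square_integrable_def)
    fix y assume y: "y \<in> space M01"
    have "y powr \<sigma> * y powr \<sigma> \<le> x powr (2 * b - \<alpha> / 2) * y powr (- \<alpha> / 2)" if "y \<le> x"
    proof -
      have "y powr \<sigma> * y powr \<sigma> = y powr (2 * b - \<alpha> / 2) * y powr (- \<alpha> / 2)"
        by (simp add: powr_add[symmetric])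
      also have "\<dots> \<le> x powr (2 * b - \<alpha> / 2) * y powr (- \<alpha> / 2)"
        using that y b \<alpha> by (intro mult_right_mono powr_mono2) auto
      finally show ?thesis .
    qed
    then show "(?k y)\<^sup>2 \<le> x powr (2 * b - \<alpha> / 2) * y powr (- \<alpha> / 2)"
      by (auto simp: kern_def indicator_def power2_eq_square)
  qed
  also have "\<dots> = x powr (2 * b - \<alpha> / 2) / \<delta>" unfolding integral_mult_right_zero powr_minus_half_integral(2) by simp
  finally have kn: "(norm (abs_L2 ?k))\<^sup>2 \<le> x powr (2 * b - \<alpha> / 2) / \<delta>" .
  have "(head f x)\<^sup>2 \<le> (norm f)\<^sup>2 * (norm (abs_L2 ?k))\<^sup>2"
    unfolding head_eq[OF x0] power2_norm_eq_inner by (rule Cauchy_Schwarz_ineq)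
  also have "\<dots> \<le> (norm f)\<^sup>2 * (x powr (2 * b - \<alpha> / 2) / \<delta>)" by (intro mult_left_mono kn) simp
  finally show ?thesis .
qed

text \<open>The singular factors combine to a majorant independent of b, integrable because \<alpha>
  < 2. It gives the boundedness of \<open>G\<close> and, later, the dominating function in the
  compactness proof.\<close>

lemma Gfun_bound:
  assumes x: "x \<in> {0<..<1}" shows "(Gfun p x)\<^sup>2 \<le> (norm p)\<^sup>2 / \<delta> * x powr (- \<alpha> / 2)"
proof -
  have "(Gfun p x)\<^sup>2 = (x powr \<sigma> * x powr \<sigma>) * (tail p (-b) x)\<^sup>2"
    by (simp add: Gfun_def power2_eq_square)
  also have "\<dots> \<le> (x powr \<sigma> * x powr \<sigma>) * ((norm p)\<^sup>2 * (x powr (1 - 2 * b - \<delta>) / \<delta>))"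
    by (intro mult_left_mono tail_bound x) auto
  also have "\<dots> = (norm p)\<^sup>2 / \<delta> * (x powr \<sigma> * x powr \<sigma> * x powr (1 - 2 * b - \<delta>))" by simp
  also have "x powr \<sigma> * x powr \<sigma> * x powr (1 - 2 * b - \<delta>) = x powr (- \<alpha> / 2)"
    unfolding powr_add[symmetric] by (rule arg_cong[where f="(powr) x"]) (simp add: field_simps)
  finally show ?thesis .
qed

lemma Gsfun_bound:
  assumes x: "x \<in> {0<..<1}" shows "(Gsfun p x)\<^sup>2 \<le> (norm p)\<^sup>2 / \<delta> * x powr (- \<alpha> / 2)"
proof -
  have "(Gsfun p x)\<^sup>2 = (x powr (-b) * x powr (-b)) * (head p x)\<^sup>2"
    by (simp add: Gsfun_def power2_eq_square)
  also have "\<dots> \<le> (x powr (-b) * x powr (-b)) * ((norm p)\<^sup>2 * (x powr (2 * b - \<alpha> / 2) / \<delta>))"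
    by (intro mult_left_mono head_bound x) auto
  also have "\<dots> = (norm p)\<^sup>2 / \<delta> * (x powr (-b) * x powr (-b) * x powr (2 * b - \<alpha> / 2))" by simp
  also have "x powr (-b) * x powr (-b) * x powr (2 * b - \<alpha> / 2) = x powr (- \<alpha> / 2)"
    unfolding powr_add[symmetric] by (rule arg_cong[where f="(powr) x"]) (simp add: field_simps)
  finally show ?thesis .
qed

lemma Gfun_continuous: "continuous_on {0<..1} (Gfun p)"
  unfolding Gfun_def[abs_def] by (intro continuous_intros tail_continuous) auto

lemma Gsfun_continuous: "continuous_on {0<..1} (Gsfun p)"
  unfolding Gsfun_def[abs_def] head_def[abs_def] by (intro continuous_intros tail_continuous) auto

lemma bound_integral:
  "integrable M01 (\<lambda>x. C / \<delta> * x powr (- \<alpha> / 2))" "(LINT x|M01. C / \<delta> * x powr (- \<alpha> / 2)) = C / \<delta>\<^sup>2"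
  using integrable_mult_right[OF powr_minus_half_integral(1)]
  unfolding integral_mult_right_zero powr_minus_half_integral(2) by (simp_all add: power2_eq_square)

lemma Gfun_square_integrable: "Gfun p \<in> square_integrable {0<..<1}"
  by (rule square_integrable_bound[OF continuous_borel_measurable_lebesgue_on[OF continuous_on_subset[OF Gfun_continuous]] bound_integral(1) Gfun_bound]) auto

lemma Gsfun_square_integrable: "Gsfun p \<in> square_integrable {0<..<1}"
  by (rule square_integrable_bound[OF continuous_borel_measurable_lebesgue_on[OF continuous_on_subset[OF Gsfun_continuous]] bound_integral(1) Gsfun_bound]) auto

lemma G_norm: "norm (G p) \<le> norm p / \<delta>"
proof -
  have "(norm (G p))\<^sup>2 = (LINT x|M01. (Gfun p x)\<^sup>2)"
    unfolding G_def by (rule norm_abs_L2[OF Gfun_square_integrable])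
  also have "\<dots> \<le> (LINT x|M01. (norm p)\<^sup>2 / \<delta> * x powr (- \<alpha> / 2))"
    using Gfun_square_integrable by (intro integral_mono bound_integral Gfun_bound) (auto simp: square_integrable_def)
  also have "\<dots> = (norm p / \<delta>)\<^sup>2" unfolding bound_integral by (simp add: power_divide)
  finally show ?thesis by (rule power2_le_imp_le) (use \<alpha> in simp)
qed

lemma Gs_norm: "norm (Gs p) \<le> norm p / \<delta>"
proof -
  have "(norm (Gs p))\<^sup>2 = (LINT x|M01. (Gsfun p x)\<^sup>2)"
    unfolding Gs_def by (rule norm_abs_L2[OF Gsfun_square_integrable])
  also have "\<dots> \<le> (LINT x|M01. (norm p)\<^sup>2 / \<delta> * x powr (- \<alpha> / 2))"
    using Gsfun_square_integrable by (intro integral_mono bound_integral Gsfun_bound) (auto simp: square_integrable_def)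
  also have "\<dots> = (norm p / \<delta>)\<^sup>2" unfolding bound_integral by (simp add: power_divide)
  finally show ?thesis by (rule power2_le_imp_le) (use \<alpha> in simp)
qed

lemma bounded_linear_G: "bounded_linear G"
proof (rule bounded_linear_intro[where K="1 / \<delta>"])
  show "G (p + q) = G p + G q" for p q
    unfolding G_def abs_L2_arith(1)[OF Gfun_square_integrable Gfun_square_integrable]
    by (rule arg_cong[where f=abs_L2]) (simp add: fun_eq_iff Gfun_def tail_add algebra_simps)
  show "G (r *\<^sub>R p) = r *\<^sub>R G p" for r p
    unfolding G_def abs_L2_arith(4)[OF Gfun_square_integrable Gfun_square_integrable]
    by (rule arg_cong[where f=abs_L2]) (simp add: fun_eq_iff Gfun_def tail_scale algebra_simps)
qed (use G_norm in simp)

lemma bounded_linear_Gs: "bounded_linear Gs"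
proof (rule bounded_linear_intro[where K="1 / \<delta>"])
  show "Gs (p + q) = Gs p + Gs q" for p q
    unfolding Gs_def abs_L2_arith(1)[OF Gsfun_square_integrable Gsfun_square_integrable]
    by (rule arg_cong[where f=abs_L2]) (simp add: fun_eq_iff Gsfun_def head_def inner_add_left tail_add algebra_simps)
  show "Gs (r *\<^sub>R p) = r *\<^sub>R Gs p" for r p
    unfolding Gs_def abs_L2_arith(4)[OF Gsfun_square_integrable Gsfun_square_integrable]
    by (rule arg_cong[where f=abs_L2]) (simp add: fun_eq_iff Gsfun_def head_def tail_scale algebra_simps)
qed (use Gs_norm in simp)

lemmas continuous_on_G [continuous_intros] = bounded_linear.continuous_on[OF bounded_linear_G]
lemmas continuous_on_Gs [continuous_intros] = bounded_linear.continuous_on[OF bounded_linear_Gs]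

lemma head_derivative:
  assumes f: "f \<in> square_integrable {0<..<1}" and c: "continuous_on {0<..1} f" and x: "x \<in> {0<..1}"
  shows "(head (abs_L2 f) has_real_derivative x powr \<sigma> * f x) (at x within {0<..1})"
  unfolding head_def[abs_def]
  using DERIV_diff[OF DERIV_const tail_derivative[OF f c x, of \<sigma>]] by simp

lemma head_test_zero:
  assumes g: "test_function g" and z: "\<And>y. y \<le> a \<Longrightarrow> g y = 0" and x: "0 < x" "x \<le> a"
  shows "head (abs_L2 g) x = 0"
proof -
  have "head (abs_L2 g) x = (LINT y|M01. 0)"
    unfolding head_abs[OF test_function_square_integrable[OF g] x(1)]
    by (rule Bochner_Integration.integral_cong) (use z x in \<open>auto simp: indicator_def\<close>)
  then show ?thesis by simp
qed

text \<open>Exchanging the order of integration, done as an integration by parts: the difference of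
  the two integrands is minus the derivative of tail times head, and this product vanishes at 1
  because of the tail and near 0 because of the head.\<close>

lemma adjoint_test:
  assumes f: "test_function f" and g: "test_function g"
  shows "inner (G (abs_L2 f)) (abs_L2 g) = inner (abs_L2 f) (Gs (abs_L2 g))"
proof -
  obtain a c where ac: "smooth g" "0 < a" "a < c" "c < 1" "\<And>x. x \<notin> {a..c} \<Longrightarrow> g x = 0"
    using test_functionD[OF g] by metis
  define a' where "a' = a/2"
  have a': "0 < a'" "a' < 1" "\<And>y. y \<le> a' \<Longrightarrow> g y = 0" using ac by (auto simp: a'_def)
  note fs = test_function_square_integrable[OF f] and gs = test_function_square_integrable[OF g]
  define I where "I = tail (abs_L2 f) (-b)"
  define J where "J = head (abs_L2 g)"
  define H' where "H' x = - (x powr (-b) * f x) * J x + x powr \<sigma> * g x * I x" for x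
  have ID: "(I has_real_derivative - (x powr (-b) * f x)) (at x within {0<..1})" if "x \<in> {0<..1}" for x
    unfolding I_def by (rule tail_derivative[OF fs test_function_continuous[OF f] that])
  have JD: "(J has_real_derivative x powr \<sigma> * g x) (at x within {0<..1})" if "x \<in> {0<..1}" for x
    unfolding J_def by (rule head_derivative[OF gs test_function_continuous[OF g] that])
  have IJD: "((\<lambda>x. I x * J x) has_real_derivative H' x) (at x within {0<..1})" if "x \<in> {0<..1}" for x
    using DERIV_mult[OF ID[OF that] JD[OF that]] by (simp add: H'_def)
  have sub: "{a'..1} \<subseteq> {0<..1}" using a' by auto
  have Jz: "J x = 0" if "0 < x" "x \<le> a'" for x
    unfolding J_def by (rule head_test_zero[OF g a'(3) that])
  have cI: "continuous_on {a'..1} I" "continuous_on {a'..1} J"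
    using sub by (auto intro!: DERIV_continuous_on DERIV_subset[OF ID] DERIV_subset[OF JD])
  have cH: "continuous_on {a'..1} H'"
    unfolding H'_def by (intro continuous_intros cI test_function_continuous f g) (use a' in auto)
  have F0: "(LINT y|M01. indicator {a'<..} y * H' y) = 0"
    using ftc_tail(2)[OF a'(1,2) DERIV_subset[OF IJD sub] cH] Jz[of a'] a' sub tail_1
    by (auto simp: I_def)
  have "inner (G (abs_L2 f)) (abs_L2 g) - inner (abs_L2 f) (Gs (abs_L2 g))
      = (LINT y|M01. Gfun (abs_L2 f) y * g y - f y * Gsfun (abs_L2 g) y)"
    unfolding G_def Gs_def
    by (simp add: abs_L2_arith(5)[OF Gfun_square_integrable gs] abs_L2_arith(5)[OF fs Gsfun_square_integrable]
        square_integrable_mult[OF Gfun_square_integrable gs] square_integrable_mult[OF fs Gsfun_square_integrable])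
  also have "\<dots> = (LINT y|M01. - (indicator {a'<..} y * H' y))"
  proof (rule Bochner_Integration.integral_cong[OF refl])
    fix y assume y: "y \<in> space M01"
    show "Gfun (abs_L2 f) y * g y - f y * Gsfun (abs_L2 g) y = - (indicator {a'<..} y * H' y)"
    proof (cases "y \<le> a'")
      case True
      then show ?thesis using Jz[of y] a'(3)[of y] y by (simp add: Gfun_def Gsfun_def J_def)
    next
      case False
      then show ?thesis by (simp add: Gfun_def Gsfun_def H'_def I_def J_def algebra_simps)
    qed
  qed
  also have "\<dots> = 0" using F0 by simp
  finally show ?thesis by simp
qed

lemma adjoint: "inner (G p) f = inner p (Gs f)"
proof (rule L2_test_induct[of "\<lambda>p. inner (G p) f = inner p (Gs f)"])
  show "closed {p. inner (G p) f = inner p (Gs f)}"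
    by (intro closed_Collect_eq continuous_intros)
  fix \<phi> assume \<phi>: "test_function \<phi>"
  show "inner (G (abs_L2 \<phi>)) f = inner (abs_L2 \<phi>) (Gs f)"
  proof (rule L2_test_induct[of "\<lambda>f. inner (G (abs_L2 \<phi>)) f = inner (abs_L2 \<phi>) (Gs f)"])
    show "closed {f. inner (G (abs_L2 \<phi>)) f = inner (abs_L2 \<phi>) (Gs f)}"
      by (intro closed_Collect_eq continuous_intros)
  qed (rule adjoint_test[OF \<phi>])
qed

section \<open>Factorization on test functions and density of the images\<close>

definition Lfun :: "(real \<Rightarrow> real) \<Rightarrow> real \<Rightarrow> real" where
  "Lfun \<phi> y = y powr (\<alpha> / 2) * deriv \<phi> y - \<sigma> * (y powr (\<alpha> / 2 - 1) * \<phi> y)"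

lemma Lfun_test: "test_function \<phi> \<Longrightarrow> test_function (Lfun \<phi>)"
  unfolding Lfun_def[abs_def]
  by (intro test_function_diff test_function_cmult test_function_powr test_function_deriv)

lemmas Lfun_square_integrable = test_function_square_integrable[OF Lfun_test]

text \<open>\<open>y powr (-b) * Lfun \<phi> y\<close> is the derivative of
  \<open>y powr (-\<sigma>) * \<phi> y\<close>, so the tail integral can be evaluated.\<close>

lemma Gfun_Lfun:
  assumes t: "test_function \<phi>" and x: "x \<in> {0<..<1}"
  shows "Gfun (abs_L2 (Lfun \<phi>)) x = \<phi> x"
proof -
  have x01: "0 < x" "x < 1" using x by auto
  have F: "((\<lambda>y. y powr (-\<sigma>) * \<phi> y) has_real_derivative y powr (-b) * Lfun \<phi> y) (at y within {x..1})"
    if "y \<in> {x..1}" for y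
  proof -
    have y: "y > 0" using that x by auto
    have p: "y powr (-b) * y powr (\<alpha>/2) = y powr (-\<sigma>)" "y powr (-b) * y powr (\<alpha>/2 - 1) = y powr (-\<sigma> - 1)"
      unfolding powr_add[symmetric] by (auto intro!: arg_cong[where f="(powr) y"])
    have "((\<lambda>y. y powr (-\<sigma>) * \<phi> y) has_real_derivative (-\<sigma>) * y powr (-\<sigma> - 1) * \<phi> y + deriv \<phi> y * y powr (-\<sigma>)) (at y)"
      by (intro DERIV_mult has_real_derivative_powr y test_function_DERIV t)
    also have "(-\<sigma>) * y powr (-\<sigma> - 1) * \<phi> y + deriv \<phi> y * y powr (-\<sigma>) = y powr (-b) * Lfun \<phi> y"
      unfolding Lfun_def p(1)[symmetric] p(2)[symmetric] by (simp add: algebra_simps)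
    finally show ?thesis by (rule has_field_derivative_at_within)
  qed
  have "tail (abs_L2 (Lfun \<phi>)) (-b) x = (LINT y|M01. indicator {x<..} y * (y powr (-b) * Lfun \<phi> y))"
    by (rule tail_abs[OF Lfun_square_integrable[OF t] x01(1)])
  also have "\<dots> = 1 powr (-\<sigma>) * \<phi> 1 - x powr (-\<sigma>) * \<phi> x"
  proof (rule ftc_tail(2)[OF x01 F])
    have "continuous_on {x..1} (Lfun \<phi>)" by (rule test_function_continuous[OF Lfun_test[OF t]])
    then show "continuous_on {x..1} (\<lambda>y. y powr (-b) * Lfun \<phi> y)"
      by (intro continuous_on_mult continuous_on_powr continuous_on_id continuous_on_const) (use x in auto)
  qed
  also have "\<phi> 1 = 0" by (rule test_functionD[OF t]) auto
  finally have "Gfun (abs_L2 (Lfun \<phi>)) x = (x powr \<sigma> * x powr (-\<sigma>)) * \<phi> x" by (simp add: Gfun_def)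
  also have "x powr \<sigma> * x powr (-\<sigma>) = 1" using x by (simp add: powr_add[symmetric])
  finally show ?thesis by simp
qed

lemma G_Lfun: "test_function \<phi> \<Longrightarrow> G (abs_L2 (Lfun \<phi>)) = abs_L2 \<phi>"
  unfolding G_def
  by (subst abs_L2_eq_iff[OF Gfun_square_integrable test_function_square_integrable]) (auto intro!: AE_I2 simp: Gfun_Lfun)

text \<open>Expresses every power of the form through x powr (\<alpha>/2) and x, which turns
  identities between integrands into rational ones.\<close>

lemma powr_alpha:
  fixes x :: real assumes "x > 0"
  shows "x powr \<alpha> = x powr (\<alpha>/2) * x powr (\<alpha>/2)" "x powr (\<alpha>/2 - 1) = x powr (\<alpha>/2) / x"
    "x powr (2 - \<alpha>) = x * x / (x powr (\<alpha>/2) * x powr (\<alpha>/2))"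
    "x powr (\<alpha> - 1) = x powr (\<alpha>/2) * x powr (\<alpha>/2) / x"
    "x powr (\<alpha> - 2) = x powr (\<alpha>/2) * x powr (\<alpha>/2) / (x * x)"
    "x powr (\<alpha> - 1 - 1) = x powr (\<alpha>/2) * x powr (\<alpha>/2) / (x * x)"
proof -
  show 1: "x powr \<alpha> = x powr (\<alpha>/2) * x powr (\<alpha>/2)" by (simp add: powr_add[symmetric])
  have 2: "x powr 2 = x * x" using assms by (simp add: powr_numeral power2_eq_square)
  show "x powr (\<alpha>/2 - 1) = x powr (\<alpha>/2) / x" using assms by (simp add: powr_diff)
  show "x powr (2 - \<alpha>) = x * x / (x powr (\<alpha>/2) * x powr (\<alpha>/2))" unfolding powr_diff 2 1 ..
  show "x powr (\<alpha> - 1) = x powr (\<alpha>/2) * x powr (\<alpha>/2) / x" unfolding powr_diff 1 using assms by simp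
  show 3: "x powr (\<alpha> - 2) = x powr (\<alpha>/2) * x powr (\<alpha>/2) / (x * x)" unfolding powr_diff 2 1 ..
  have "\<alpha> - 1 - 1 = \<alpha> - 2" by simp
  then show "x powr (\<alpha> - 1 - 1) = x powr (\<alpha>/2) * x powr (\<alpha>/2) / (x * x)" using 3 by simp
qed

text \<open>The integrands differ by \<sigma> times the derivative of x powr (\<alpha> - 1) \<phi>
  \<psi>, which integrates to zero. The zero-order terms combine to \<sigma>^2 + \<sigma>(\<alpha> -
  1) = -\<mu>.\<close>

lemma hardy_form_Lfun:
  assumes f: "test_function \<phi>" and g: "test_function \<psi>"
  shows "hardy_form \<alpha> \<mu> \<phi> \<psi> = inner (abs_L2 (Lfun \<phi>)) (abs_L2 (Lfun \<psi>))"
proof -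
  define \<Phi> where "\<Phi> x = x powr (\<alpha> - 1) * (\<phi> x * \<psi> x)" for x
  have \<Phi>: "test_function \<Phi>" unfolding \<Phi>_def
    by (intro test_function_powr test_function_mult[OF g test_function_smooth[OF f]])
  have D: "deriv \<Phi> x = (\<alpha> - 1) * x powr (\<alpha> - 1 - 1) * (\<phi> x * \<psi> x) + (deriv \<phi> x * \<psi> x + deriv \<psi> x * \<phi> x) * x powr (\<alpha> - 1)"
    if "x \<in> {0<..<1}" for x
    unfolding \<Phi>_def by (rule DERIV_imp_deriv, intro DERIV_mult has_real_derivative_powr test_function_DERIV f g) (use that in auto)
  have "hardy_form \<alpha> \<mu> \<phi> \<psi> = (LINT x|M01. Lfun \<phi> x * Lfun \<psi> x + \<sigma> * deriv \<Phi> x)"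
    unfolding hardy_form_def
  proof (rule Bochner_Integration.integral_cong[OF refl])
    fix x assume x: "x \<in> space M01"
    then have x0: "x > 0" "x powr (\<alpha>/2) \<noteq> 0" by auto
    show "x powr \<alpha> * deriv \<phi> x * deriv \<psi> x - \<mu> / x powr (2 - \<alpha>) * \<phi> x * \<psi> x = Lfun \<phi> x * Lfun \<psi> x + \<sigma> * deriv \<Phi> x"
      using x0 x unfolding Lfun_def \<mu>_def by (simp only: D space_lebesgue_on powr_alpha) (simp add: field_simps)
  qed
  also have "\<dots> = (LINT x|M01. Lfun \<phi> x * Lfun \<psi> x) + \<sigma> * (LINT x|M01. deriv \<Phi> x)"
    by (simp add: square_integrable_mult Lfun_square_integrable f g square_integrable_integrable
        test_function_square_integrable test_function_deriv \<Phi>)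
  also have "(LINT x|M01. deriv \<Phi> x) = 0"
    by (rule test_function_integral_derivative[OF \<Phi> test_function_DERIV[OF \<Phi>]])
  finally show ?thesis by (simp add: abs_L2_arith Lfun_square_integrable f g)
qed

lemma Lfun_subspace: "subspace ((\<lambda>\<phi>. abs_L2 (Lfun \<phi>)) ` {\<phi>. test_function \<phi>})"
  unfolding subspace_def
proof (intro conjI ballI allI)
  let ?P = "(\<lambda>\<phi>. abs_L2 (Lfun \<phi>)) ` {\<phi>. test_function \<phi>}"
  have t0: "test_function (\<lambda>x. 0)" by (rule test_functionI[of _ "1/2" "1/2"]) (auto intro: smooth_const)
  have "Lfun (\<lambda>x. 0) = (\<lambda>x. 0)" by (simp add: Lfun_def fun_eq_iff)
  then show "0 \<in> ?P" using t0 unfolding zero_L2_abs by (metis (mono_tags, lifting) imageI mem_Collect_eq)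
  have "Lfun (\<lambda>x. \<phi> x + \<psi> x) = (\<lambda>x. Lfun \<phi> x + Lfun \<psi> x)" if "test_function \<phi>" "test_function \<psi>" for \<phi> \<psi>
    using DERIV_imp_deriv[OF DERIV_add[OF test_function_DERIV[OF that(1)] test_function_DERIV[OF that(2)]]]
    by (simp add: Lfun_def fun_eq_iff algebra_simps)
  then have a: "abs_L2 (Lfun \<phi>) + abs_L2 (Lfun \<psi>) = abs_L2 (Lfun (\<lambda>x. \<phi> x + \<psi> x))" if "test_function \<phi>" "test_function \<psi>" for \<phi> \<psi>
    using that by (simp add: abs_L2_arith(1) Lfun_square_integrable)
  show "u + v \<in> ?P" if "u \<in> ?P" "v \<in> ?P" for u v
    using that by clarsimp (metis (mono_tags, lifting) a test_function_add image_eqI mem_Collect_eq)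
  have "Lfun (\<lambda>x. c * \<phi> x) = (\<lambda>x. c * Lfun \<phi> x)" if "test_function \<phi>" for \<phi> c
    using DERIV_imp_deriv[OF DERIV_cmult[OF test_function_DERIV[OF that]]]
    by (simp add: Lfun_def fun_eq_iff algebra_simps)
  then have s: "c *\<^sub>R abs_L2 (Lfun \<phi>) = abs_L2 (Lfun (\<lambda>x. c * \<phi> x))" if "test_function \<phi>" for \<phi> c
    using that by (simp add: abs_L2_arith(4)[OF _ square_integrable_0] Lfun_square_integrable)
  show "c *\<^sub>R u \<in> ?P" if "u \<in> ?P" for c u
    using that by clarsimp (metis (mono_tags, lifting) s test_function_cmult image_eqI mem_Collect_eq)
qed

text \<open>Orthogonality is the adjoint first-order equation in the weak sense: x powr b times p
  has zero derivative, so p is C x powr (-b). As 2b \<ge> 1 this is square integrable for C = 0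
  only.\<close>

lemma Lfun_orthogonal:
  assumes orth: "\<And>\<phi>. test_function \<phi> \<Longrightarrow> inner p (abs_L2 (Lfun \<phi>)) = 0"
  shows "p = 0"
proof -
  obtain f where f: "f \<in> square_integrable {0<..<1}" "p = abs_L2 f" by (rule L2_cases)
  have fm: "f \<in> borel_measurable M01" using f(1) by (simp add: square_integrable_def)
  have pp: "inner p (abs_L2 \<psi>) = (LINT x|M01. f x * \<psi> x)" if "test_function \<psi>" for \<psi>
    using abs_L2_arith(5)[OF f(1) test_function_square_integrable[OF that]] f(2) by simp
  have 1: "(LINT x|M01. f x * (x powr b * \<psi> x)) = 0" if t: "test_function \<psi>" and z: "(LINT x|M01. \<psi> x) = 0" for \<psi>
  proof -
    obtain \<zeta> where \<zeta>: "test_function \<zeta>" "\<And>x. (\<zeta> has_real_derivative \<psi> x) (at x)"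
      using test_function_primitive[OF t z] by blast
    \<comment> \<open>\<open>Lfun\<close> turns x powr \<sigma> \<zeta> into x powr b \<zeta>',
      since it annihilates the power; with \<zeta>' = \<psi> any test function of zero mean is
      reached.\<close>
    have t2: "test_function (\<lambda>x. x powr \<sigma> * \<zeta> x)" by (rule test_function_powr[OF \<zeta>(1)])
    have L: "Lfun (\<lambda>x. x powr \<sigma> * \<zeta> x) x = x powr b * \<psi> x" if x: "x \<in> {0<..<1}" for x
    proof -
      have D: "deriv (\<lambda>x. x powr \<sigma> * \<zeta> x) x = \<sigma> * x powr (\<sigma> - 1) * \<zeta> x + \<psi> x * x powr \<sigma>"
        by (rule DERIV_imp_deriv, intro DERIV_mult has_real_derivative_powr \<zeta>(2)) (use x in auto)
      have p: "x powr (\<alpha>/2) * x powr \<sigma> = x powr b" "x powr (\<alpha>/2) * x powr (\<sigma> - 1) = x powr (\<alpha>/2 - 1) * x powr \<sigma>"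
        unfolding powr_add[symmetric] by (auto intro!: arg_cong[where f="(powr) x"])
      have "Lfun (\<lambda>x. x powr \<sigma> * \<zeta> x) x = (x powr (\<alpha>/2) * x powr \<sigma>) * \<psi> x
         + \<sigma> * \<zeta> x * (x powr (\<alpha>/2) * x powr (\<sigma> - 1)) - \<sigma> * \<zeta> x * (x powr (\<alpha>/2 - 1) * x powr \<sigma>)"
        unfolding Lfun_def D by (simp add: algebra_simps)
      then show ?thesis unfolding p by simp
    qed
    have "(LINT x|M01. f x * (x powr b * \<psi> x)) = (LINT x|M01. f x * Lfun (\<lambda>x. x powr \<sigma> * \<zeta> x) x)"
      by (rule Bochner_Integration.integral_cong) (use L in auto)
    also have "\<dots> = 0" using orth[OF t2] pp[OF Lfun_test[OF t2]] by simp
    finally show ?thesis .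
  qed
  \<comment> \<open>If all test functions had integral zero, the fundamental lemma would make the
    constant 1 vanish.\<close>
  obtain \<psi>0 where \<psi>0: "test_function \<psi>0" "(LINT x|M01. \<psi>0 x) = 1"
  proof -
    have "\<exists>\<psi>. test_function \<psi> \<and> (LINT x|M01. \<psi> x) \<noteq> 0"
    proof (rule ccontr)
      assume "\<not> ?thesis"
      then have "AE x in M01. (1::real) = 0" by (intro fundamental_lemma[OF square_integrable_const]) auto
      then have "(LINT x|M01. (1::real)) = (LINT x|M01. 0)" by (intro integral_cong_AE) auto
      moreover have "(LINT x|M01. (1::real)) = 1"
        by (simp add: measure_restrict_space)
      ultimately show False by simp
    qed
    then obtain \<psi> where "test_function \<psi>" "(LINT x|M01. \<psi> x) \<noteq> 0" by blast
    then show ?thesis by (intro that[of "\<lambda>x. (1 / (LINT x|M01. \<psi> x)) * \<psi> x"] test_function_cmult) auto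
  qed
  define C where "C = (LINT x|M01. f x * (x powr b * \<psi>0 x))"
  define q where "q x = x powr b * f x - C" for x
  have xb: "x powr b \<le> 1" if "x \<in> {0<..<1}" for x
    using that b by (intro powr_le1) auto
  have q: "q \<in> square_integrable {0<..<1}"
    unfolding q_def
    by (intro square_integrable_diff square_integrable_const square_integrable_bounded_mult[where C=1] f measurable_powr)
      (use xb in auto)
  have "AE x in M01. q x = 0"
  proof (rule fundamental_lemma[OF q])
    fix \<psi> assume t: "test_function \<psi>"
    define k where "k = (LINT x|M01. \<psi> x)"
    note int = square_integrable_integrable[OF test_function_square_integrable]
    have t2: "test_function (\<lambda>x. \<psi> x - k * \<psi>0 x)" by (intro test_function_diff test_function_cmult t \<psi>0)
    have "(LINT x|M01. \<psi> x - k * \<psi>0 x) = 0" using int[OF t] int[OF \<psi>0(1)] \<psi>0(2) by (simp add: k_def)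
    from 1[OF t2 this] have e: "(LINT x|M01. f x * (x powr b * (\<psi> x - k * \<psi>0 x))) = 0" .
    have i1: "integrable M01 (\<lambda>x. f x * (x powr b * \<psi> x))" "integrable M01 (\<lambda>x. f x * (x powr b * \<psi>0 x))"
      by (intro square_integrable_mult f test_function_square_integrable test_function_powr t \<psi>0)+
    have "(LINT x|M01. f x * (x powr b * (\<psi> x - k * \<psi>0 x))) = (LINT x|M01. f x * (x powr b * \<psi> x) - k * (f x * (x powr b * \<psi>0 x)))"
      by (simp add: algebra_simps)
    also have "\<dots> = (LINT x|M01. f x * (x powr b * \<psi> x)) - k * C" using i1 by (simp add: C_def)
    finally have e2: "(LINT x|M01. f x * (x powr b * \<psi> x)) = k * C" using e by simp
    have "(LINT x|M01. q x * \<psi> x) = (LINT x|M01. f x * (x powr b * \<psi> x) - C * \<psi> x)"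
      by (simp add: q_def algebra_simps)
    also have "\<dots> = k * C - C * k" using i1 int[OF t] e2 by (simp add: k_def)
    finally show "(LINT x|M01. q x * \<psi> x) = 0" by simp
  qed
  then have ae: "AE x in M01. f x = C * x powr (-b)"
  proof (rule AE_mp, intro AE_I2 impI)
    fix x assume x: "x \<in> space M01" "q x = 0"
    then have 1: "x powr b * f x = C" by (simp add: q_def)
    have "x powr (-b) * x powr b = 1" using x by (simp add: powr_add[symmetric])
    then have "f x = (x powr (-b) * x powr b) * f x" by simp
    also have "\<dots> = C * x powr (-b)" unfolding 1[symmetric] by (simp only: mult_ac)
    finally show "f x = C * x powr (-b)" .
  qed
  have "C = 0"
  proof (rule ccontr)
    assume C: "C \<noteq> 0"
    have "integrable M01 (\<lambda>x. x powr (-1))"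
    proof (rule Bochner_Integration.integrable_bound[where f="\<lambda>x. (f x)\<^sup>2 / C\<^sup>2"])
      show "integrable M01 (\<lambda>x. (f x)\<^sup>2 / C\<^sup>2)" using f(1) by (simp add: square_integrable_def)
      show "(\<lambda>x. x powr (-1)) \<in> borel_measurable M01" by (rule measurable_powr)
      show "AE x in M01. norm (x powr (-1)) \<le> norm ((f x)\<^sup>2 / C\<^sup>2)"
        using ae
      proof (rule AE_mp, intro AE_I2 impI)
        fix x assume x: "x \<in> space M01" "f x = C * x powr (-b)"
        \<comment> \<open>Here 2b \<ge> 1 enters: on the unit interval the square of x powr (-b)
          dominates 1/x.\<close>
        have "x powr (-1) \<le> x powr (-b + -b)" using x b by (intro powr_mono') auto
        then show "norm (x powr (-1)) \<le> norm ((f x)\<^sup>2 / C\<^sup>2)"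
          unfolding x(2) power_mult_distrib power2_eq_square[of "x powr (-b)"] powr_add[symmetric] using C by simp
      qed
    qed
    then show False using inverse_not_integrable by blast
  qed
  then have "AE x in M01. f x = 0" using ae by simp
  then show ?thesis unfolding f(2) zero_L2_abs using abs_L2_eq_iff[OF f(1) square_integrable_0] by simp
qed

lemma Lfun_dense: "closure ((\<lambda>\<phi>. abs_L2 (Lfun \<phi>)) ` {\<phi>. test_function \<phi>}) = UNIV"
  by (rule dense_if_trivial_orthogonal[OF Lfun_subspace]) (use Lfun_orthogonal in blast)

lemma L2_Lfun_induct:
  assumes "closed {u. Q u}" "\<And>\<phi>. test_function \<phi> \<Longrightarrow> Q (abs_L2 (Lfun \<phi>))"
  shows "Q u"
proof -
  have "closure ((\<lambda>\<phi>. abs_L2 (Lfun \<phi>)) ` {\<phi>. test_function \<phi>}) \<subseteq> {u. Q u}"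
    by (rule closure_minimal) (use assms in auto)
  then show ?thesis unfolding Lfun_dense by auto
qed

end

section \<open>The second-order operator on test functions and injectivity\<close>

context hardy_factorization
begin

definition Afun :: "(real \<Rightarrow> real) \<Rightarrow> real \<Rightarrow> real" where
  "Afun \<phi> x = deriv (\<lambda>x. x powr \<alpha> * deriv \<phi> x) x + \<mu> * (x powr (\<alpha> - 2) * \<phi> x)"

lemma Afun_test: "test_function \<phi> \<Longrightarrow> test_function (Afun \<phi>)"
  unfolding Afun_def[abs_def]
  by (intro test_function_add test_function_cmult test_function_powr test_function_deriv)

lemma inner_Lfun_Lfun:
  assumes f: "test_function \<phi>" and g: "test_function \<psi>"
  shows "inner (abs_L2 (Lfun \<psi>)) (abs_L2 (Lfun \<phi>)) = - inner (abs_L2 \<psi>) (abs_L2 (Afun \<phi>))"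
proof -
  define \<eta> where "\<eta> x = x powr \<alpha> * deriv \<phi> x" for x
  have \<eta>: "test_function \<eta>" unfolding \<eta>_def by (intro test_function_powr test_function_deriv f)
  have t: "test_function (\<lambda>x. \<psi> x * \<eta> x)" by (rule test_function_mult[OF \<eta> test_function_smooth[OF g]])
  have "hardy_form \<alpha> \<mu> \<psi> \<phi> = (LINT x|M01. (deriv \<psi> x * \<eta> x + deriv \<eta> x * \<psi> x) - \<psi> x * Afun \<phi> x)"
    unfolding hardy_form_def
  proof (rule Bochner_Integration.integral_cong[OF refl])
    fix x assume x: "x \<in> space M01"
    then have x0: "x > 0" "x powr (\<alpha>/2) \<noteq> 0" by auto
    show "x powr \<alpha> * deriv \<psi> x * deriv \<phi> x - \<mu> / x powr (2 - \<alpha>) * \<psi> x * \<phi> x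
       = (deriv \<psi> x * \<eta> x + deriv \<eta> x * \<psi> x) - \<psi> x * Afun \<phi> x"
      unfolding Afun_def \<eta>_def[symmetric] unfolding powr_alpha(3)[OF x0(1)] powr_alpha(5)[OF x0(1)] unfolding \<eta>_def
      using x0 by (simp add: algebra_simps)
  qed
  also have "\<dots> = (LINT x|M01. deriv \<psi> x * \<eta> x + deriv \<eta> x * \<psi> x) - (LINT x|M01. \<psi> x * Afun \<phi> x)"
    by (intro Bochner_Integration.integral_diff Bochner_Integration.integrable_add square_integrable_mult test_function_square_integrable
        test_function_deriv Afun_test f g \<eta>)
  also have "(LINT x|M01. deriv \<psi> x * \<eta> x + deriv \<eta> x * \<psi> x) = 0"
    by (rule test_function_integral_derivative[OF t]) (intro DERIV_mult test_function_DERIV g \<eta>)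
  finally show ?thesis
    using hardy_form_Lfun[OF g f] by (simp add: abs_L2_arith(5) test_function_square_integrable Afun_test f g)
qed

text \<open>Integration by parts, extended by density to all p. It recovers p from
  \<open>G p\<close> by testing, which yields the injectivity of \<open>G\<close> and later
  identifies distributional solutions.\<close>

lemma inner_Lfun: "test_function \<phi> \<Longrightarrow> inner p (abs_L2 (Lfun \<phi>)) = - inner (G p) (abs_L2 (Afun \<phi>))"
  by (rule L2_Lfun_induct[of "\<lambda>p. inner p (abs_L2 (Lfun \<phi>)) = - inner (G p) (abs_L2 (Afun \<phi>))"])
    (auto intro!: closed_Collect_eq continuous_intros simp: inner_Lfun_Lfun G_Lfun)

lemma G_eq_0: "G p = 0 \<Longrightarrow> p = 0"
  by (rule Lfun_orthogonal) (simp add: inner_Lfun)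

lemma Gs_eq_0: assumes "Gs f = 0" shows "f = 0"
proof (rule L2_orthogonal_test_functions)
  fix \<phi> assume "test_function \<phi>"
  then have "inner f (abs_L2 \<phi>) = inner (G (abs_L2 (Lfun \<phi>))) f" by (simp add: G_Lfun inner_commute)
  then show "inner f (abs_L2 \<phi>) = 0" by (simp add: adjoint assms)
qed

lemma G_inject: "G p = G q \<longleftrightarrow> p = q"
  using G_eq_0[of "p - q"] by (auto simp: bounded_linear.linear[OF bounded_linear_G, THEN linear_diff])

lemma inner_Gs_Lfun: "test_function \<phi> \<Longrightarrow> inner (Gs f) (abs_L2 (Lfun \<phi>)) = inner f (abs_L2 \<phi>)"
  using adjoint[of "abs_L2 (Lfun \<phi>)" f] by (simp add: G_Lfun inner_commute)

section \<open>The form domain\<close>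

lemma Lfun_diff:
  assumes "test_function \<phi>" "test_function \<psi>"
  shows "abs_L2 (Lfun (\<lambda>x. \<phi> x - \<psi> x)) = abs_L2 (Lfun \<phi>) - abs_L2 (Lfun \<psi>)"
proof -
  have "deriv (\<lambda>x. \<phi> x - \<psi> x) x = deriv \<phi> x - deriv \<psi> x" for x
    by (intro DERIV_imp_deriv DERIV_diff test_function_DERIV assms)
  then have "Lfun (\<lambda>x. \<phi> x - \<psi> x) = (\<lambda>x. Lfun \<phi> x - Lfun \<psi> x)"
    by (simp add: Lfun_def fun_eq_iff right_diff_distrib)
  then show ?thesis using assms by (simp add: abs_L2_arith(2) Lfun_square_integrable)
qed

lemma hardy_form_diff:
  assumes "test_function \<phi>" "test_function \<psi>"
  shows "sqrt (hardy_form \<alpha> \<mu> (\<lambda>x. \<phi> x - \<psi> x) (\<lambda>x. \<phi> x - \<psi> x)) = norm (abs_L2 (Lfun \<phi>) - abs_L2 (Lfun \<psi>))"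
  using assms by (simp add: hardy_form_Lfun test_function_diff Lfun_diff norm_eq_sqrt_inner)

text \<open>The form distance of test functions is the L2 distance of their images under
  \<open>Lfun\<close>. Completeness of L2 provides p, and continuity of \<open>G\<close> identifies
  the limit u. Closability of the form thus becomes injectivity of \<open>G\<close>.\<close>

lemma H1_approxD:
  assumes "H1_approx \<alpha> \<mu> \<phi> u"
  obtains p where "(\<lambda>n. abs_L2 (Lfun (\<phi> n))) \<longlonglongrightarrow> p" "u = G p"
proof -
  have t: "test_function (\<phi> n)" for n using assms by (simp add: H1_approx_def)
  have "Cauchy (\<lambda>n. abs_L2 (Lfun (\<phi> n)))"
    unfolding Cauchy_def dist_norm hardy_form_diff[OF t t, symmetric]
    using assms by (simp add: H1_approx_def)
  then obtain p where p: "(\<lambda>n. abs_L2 (Lfun (\<phi> n))) \<longlonglongrightarrow> p" by (meson Cauchy_convergent_iff convergent_def)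
  from bounded_linear.tendsto[OF bounded_linear_G this] have "(\<lambda>n. abs_L2 (\<phi> n)) \<longlonglongrightarrow> G p"
    by (simp add: G_Lfun t)
  moreover have "(\<lambda>n. abs_L2 (\<phi> n)) \<longlonglongrightarrow> u" using assms by (simp add: H1_approx_def)
  ultimately have "u = G p" using LIMSEQ_unique by blast
  with p show ?thesis by (rule that)
qed

lemma H1_approx_exists: "\<exists>\<phi>. H1_approx \<alpha> \<mu> \<phi> (G p)"
proof -
  have "p \<in> closure ((\<lambda>\<phi>. abs_L2 (Lfun \<phi>)) ` {\<phi>. test_function \<phi>})" by (simp add: Lfun_dense)
  then obtain x where x: "\<And>n. x n \<in> (\<lambda>\<phi>. abs_L2 (Lfun \<phi>)) ` {\<phi>. test_function \<phi>}" "x \<longlonglongrightarrow> p"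
    unfolding closure_sequential by blast
  then have "\<forall>n. \<exists>\<phi>. test_function \<phi> \<and> x n = abs_L2 (Lfun \<phi>)" by blast
  then obtain \<phi> where \<phi>: "\<And>n. test_function (\<phi> n)" "\<And>n. x n = abs_L2 (Lfun (\<phi> n))" by metis
  have lim: "(\<lambda>n. abs_L2 (Lfun (\<phi> n))) \<longlonglongrightarrow> p" using x(2) unfolding \<phi>(2)[symmetric] .
  then have "Cauchy (\<lambda>n. abs_L2 (Lfun (\<phi> n)))" by (rule LIMSEQ_imp_Cauchy)
  then have c: "\<forall>e>0. \<exists>M. \<forall>m\<ge>M. \<forall>n\<ge>M. sqrt (hardy_form \<alpha> \<mu> (\<lambda>x. \<phi> m x - \<phi> n x) (\<lambda>x. \<phi> m x - \<phi> n x)) < e"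
    unfolding Cauchy_def dist_norm hardy_form_diff[OF \<phi>(1) \<phi>(1)] .
  from bounded_linear.tendsto[OF bounded_linear_G lim] have "(\<lambda>n. abs_L2 (\<phi> n)) \<longlonglongrightarrow> G p"
    by (simp add: G_Lfun \<phi>(1))
  with c \<phi>(1) show ?thesis unfolding H1_approx_def by blast
qed

lemma H1_eq: "H1 \<alpha> \<mu> = range G"
proof
  show "H1 \<alpha> \<mu> \<subseteq> range G" unfolding H1_def using H1_approxD by blast
  show "range G \<subseteq> H1 \<alpha> \<mu>" unfolding H1_def using H1_approx_exists by blast
qed

lemma H1_form_G: "H1_form \<alpha> \<mu> (G p) (G q) = inner p q"
proof -
  have lim: "(\<lambda>n. hardy_form \<alpha> \<mu> (\<phi> n) (\<psi> n)) \<longlonglongrightarrow> inner p q"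
    if a: "H1_approx \<alpha> \<mu> \<phi> (G p)" "H1_approx \<alpha> \<mu> \<psi> (G q)" for \<phi> \<psi>
  proof -
    obtain p' where p': "(\<lambda>n. abs_L2 (Lfun (\<phi> n))) \<longlonglongrightarrow> p'" "G p = G p'" by (rule H1_approxD[OF a(1)])
    obtain q' where q': "(\<lambda>n. abs_L2 (Lfun (\<psi> n))) \<longlonglongrightarrow> q'" "G q = G q'" by (rule H1_approxD[OF a(2)])
    have "p' = p" "q' = q" using p'(2) q'(2) by (simp_all add: G_inject)
    moreover have "hardy_form \<alpha> \<mu> (\<phi> n) (\<psi> n) = inner (abs_L2 (Lfun (\<phi> n))) (abs_L2 (Lfun (\<psi> n)))" for n
      using a by (intro hardy_form_Lfun) (auto simp: H1_approx_def)
    ultimately show ?thesis using tendsto_inner[OF p'(1) q'(1)] by simp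
  qed
  show ?thesis unfolding H1_form_def
  proof (rule the_equality)
    show "\<forall>\<phi> \<psi>. H1_approx \<alpha> \<mu> \<phi> (G p) \<longrightarrow> H1_approx \<alpha> \<mu> \<psi> (G q) \<longrightarrow> (\<lambda>n. hardy_form \<alpha> \<mu> (\<phi> n) (\<psi> n)) \<longlonglongrightarrow> inner p q"
      using lim by blast
    fix l assume l: "\<forall>\<phi> \<psi>. H1_approx \<alpha> \<mu> \<phi> (G p) \<longrightarrow> H1_approx \<alpha> \<mu> \<psi> (G q) \<longrightarrow> (\<lambda>n. hardy_form \<alpha> \<mu> (\<phi> n) (\<psi> n)) \<longlonglongrightarrow> l"
    obtain \<phi> \<psi> where "H1_approx \<alpha> \<mu> \<phi> (G p)" "H1_approx \<alpha> \<mu> \<psi> (G q)" using H1_approx_exists by blast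
    then show "l = inner p q" using l lim LIMSEQ_unique by blast
  qed
qed

lemma H1_norm_G: "H1_norm \<alpha> \<mu> (G p) = norm p"
  by (simp add: H1_norm_def H1_form_G norm_eq_sqrt_inner)

end

section \<open>Weak derivatives\<close>

lemma integrable_Icc_subset:
  assumes f: "integrable M01 f" and ab: "0 < a" "b < (1::real)"
  shows "integrable (lebesgue_on {a..b}) (f :: real \<Rightarrow> real)"
proof -
  have "set_integrable lebesgue {a..b} f"
    by (rule set_integrable_subset[OF f[unfolded integrable_M01_iff]]) (use ab in auto)
  then show ?thesis unfolding set_integrable_def by (subst integrable_restrict_space) auto
qed

lemma integrable_bounded_mult:
  fixes f g :: "real \<Rightarrow> real"
  assumes f: "integrable (lebesgue_on S) f" and g: "g \<in> borel_measurable (lebesgue_on S)"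
    and C: "\<And>x. x \<in> S \<Longrightarrow> \<bar>g x\<bar> \<le> C"
  shows "integrable (lebesgue_on S) (\<lambda>x. g x * f x)"
proof (rule Bochner_Integration.integrable_bound[where f="\<lambda>x. C * f x"])
  show "integrable (lebesgue_on S) (\<lambda>x. C * f x)" using f by simp
  show "(\<lambda>x. g x * f x) \<in> borel_measurable (lebesgue_on S)" using f g by (intro borel_measurable_times) auto
  show "AE x in lebesgue_on S. norm (g x * f x) \<le> norm (C * f x)"
    using order_trans[OF C abs_ge_self] by (intro AE_I2) (auto simp: abs_mult intro!: mult_right_mono)
qed

lemma integrable_Icc_continuous_mult:
  fixes f g :: "real \<Rightarrow> real"
  assumes f: "integrable (lebesgue_on {a..b}) f" and g: "continuous_on {a..b} g"
  shows "integrable (lebesgue_on {a..b}) (\<lambda>x. g x * f x)"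
proof -
  have "compact (g ` {a..b})" by (rule compact_continuous_image[OF g]) simp
  then obtain C where "\<And>x. x \<in> {a..b} \<Longrightarrow> norm (g x) \<le> C" by (metis bounded_iff compact_imp_bounded imageI)
  then show ?thesis
    by (intro integrable_bounded_mult[OF f continuous_imp_measurable_on_sets_lebesgue[OF g], of C]) auto
qed

lemma locally_integrable_test_mult:
  assumes f: "\<And>a b. 0 < a \<Longrightarrow> b < 1 \<Longrightarrow> integrable (lebesgue_on {a..b}) (f :: real \<Rightarrow> real)" and t: "test_function \<phi>"
  shows "integrable M01 (\<lambda>x. f x * \<phi> x)"
proof -
  obtain a b where ab: "smooth \<phi>" "0 < a" "a < b" "b < 1" "\<And>x. x \<notin> {a..b} \<Longrightarrow> \<phi> x = 0"
    using test_functionD[OF t] by metis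
  have "integrable (lebesgue_on {a..b}) (\<lambda>x. \<phi> x * f x)"
    by (rule integrable_Icc_continuous_mult[OF f smooth_continuous]) (use ab in auto)
  then have "integrable lebesgue (\<lambda>x. indicator {a..b} x *\<^sub>R (\<phi> x * f x))"
    by (subst (asm) integrable_restrict_space) auto
  moreover have "(\<lambda>x. indicator {a..b} x *\<^sub>R (\<phi> x * f x)) = (\<lambda>x. indicator {0<..<1} x *\<^sub>R (f x * \<phi> x))"
    using ab by (auto simp: fun_eq_iff indicator_def)
  ultimately show ?thesis by (simp add: integrable_M01_iff set_integrable_def)
qed

lemma weak_derivative_locally_integrable:
  assumes "weak_derivative f g"
  shows "0 < a \<Longrightarrow> b < 1 \<Longrightarrow> integrable (lebesgue_on {a..b}) f" "0 < a \<Longrightarrow> b < 1 \<Longrightarrow> integrable (lebesgue_on {a..b}) g"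
  using assms by (auto simp: weak_derivative_def)

text \<open>Testing with \<phi> is testing F with x powr c \<phi>, which is again a test function
  because \<phi> vanishes near 0.\<close>

lemma weak_derivative_powr_mult:
  assumes w: "weak_derivative F k"
  shows "weak_derivative (\<lambda>x. x powr c * F x) (\<lambda>x. x powr c * k x + c * (x powr (c - 1) * F x))"
  unfolding weak_derivative_def
proof (intro conjI allI impI)
  fix a b :: real assume ab: "0 < a" "b < 1"
  note F = weak_derivative_locally_integrable(1)[OF w ab] and k = weak_derivative_locally_integrable(2)[OF w ab]
  have c: "continuous_on {a..b} (\<lambda>x. x powr c)" for c using ab by (auto intro!: continuous_intros)
  show "integrable (lebesgue_on {a..b}) (\<lambda>x. x powr c * F x)"
    by (rule integrable_Icc_continuous_mult[OF F c])
  show "integrable (lebesgue_on {a..b}) (\<lambda>x. x powr c * k x + c * (x powr (c - 1) * F x))"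
    by (intro Bochner_Integration.integrable_add integrable_mult_right integrable_Icc_continuous_mult F k) (use c in auto)
next
  fix \<phi> assume t: "test_function \<phi>"
  define \<eta> where "\<eta> x = x powr c * \<phi> x" for x
  have \<eta>: "test_function \<eta>" unfolding \<eta>_def by (rule test_function_powr[OF t])
  have D: "deriv \<eta> x = c * (x powr (c - 1) * \<phi> x) + x powr c * deriv \<phi> x" if "x \<in> {0<..<1}" for x
  proof -
    have "(\<eta> has_real_derivative c * x powr (c - 1) * \<phi> x + deriv \<phi> x * x powr c) (at x)"
      unfolding \<eta>_def by (intro DERIV_mult has_real_derivative_powr test_function_DERIV t) (use that in auto)
    then show ?thesis using DERIV_imp_deriv by fastforce
  qed
  have iF: "integrable M01 (\<lambda>x. F x * \<psi> x)" if "test_function \<psi>" for \<psi>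
    by (rule locally_integrable_test_mult[OF _ that]) (rule weak_derivative_locally_integrable(1)[OF w])
  have ik: "integrable M01 (\<lambda>x. k x * \<psi> x)" if "test_function \<psi>" for \<psi>
    by (rule locally_integrable_test_mult[OF _ that]) (rule weak_derivative_locally_integrable(2)[OF w])
  have i1: "integrable M01 (\<lambda>x. F x * deriv \<eta> x)" by (rule iF[OF test_function_deriv[OF \<eta>]])
  have i2: "integrable M01 (\<lambda>x. F x * (x powr (c - 1) * \<phi> x))" by (rule iF[OF test_function_powr[OF t]])
  have i3: "integrable M01 (\<lambda>x. k x * \<eta> x)" by (rule ik[OF \<eta>])
  have "(LINT x|M01. x powr c * F x * deriv \<phi> x) = (LINT x|M01. F x * deriv \<eta> x - c * (F x * (x powr (c - 1) * \<phi> x)))"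
    by (rule Bochner_Integration.integral_cong) (auto simp: D algebra_simps)
  also have "\<dots> = (LINT x|M01. F x * deriv \<eta> x) - c * (LINT x|M01. F x * (x powr (c - 1) * \<phi> x))"
    using i1 i2 by simp
  also have "(LINT x|M01. F x * deriv \<eta> x) = - (LINT x|M01. k x * \<eta> x)"
    using w \<eta> by (simp add: weak_derivative_def)
  also have "- (LINT x|M01. k x * \<eta> x) - c * (LINT x|M01. F x * (x powr (c - 1) * \<phi> x))
     = - (LINT x|M01. k x * \<eta> x + c * (F x * (x powr (c - 1) * \<phi> x)))"
    using i2 i3 by simp
  also have "(LINT x|M01. k x * \<eta> x + c * (F x * (x powr (c - 1) * \<phi> x))) = (LINT x|M01. (x powr c * k x + c * (x powr (c - 1) * F x)) * \<phi> x)"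
    by (rule Bochner_Integration.integral_cong) (auto simp: \<eta>_def algebra_simps)
  finally show "(LINT x|M01. x powr c * F x * deriv \<phi> x) = - (LINT x|M01. (x powr c * k x + c * (x powr (c - 1) * F x)) * \<phi> x)" .
qed

lemma weak_derivative_cong:
  assumes "weak_derivative f g" "\<And>x. x \<in> {0<..<1} \<Longrightarrow> f x = f' x" "\<And>x. x \<in> {0<..<1} \<Longrightarrow> g x = g' x"
  shows "weak_derivative f' g'"
proof -
  have i: "integrable (lebesgue_on {a..b}) h \<longleftrightarrow> integrable (lebesgue_on {a..b}) h'"
    if "0 < a" "b < 1" "\<And>x. x \<in> {0<..<1} \<Longrightarrow> h x = h' x" for a b and h h' :: "real \<Rightarrow> real"
    by (rule Bochner_Integration.integrable_cong) (use that in auto)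
  have l: "(LINT x|M01. h x * k x) = (LINT x|M01. h' x * k x)" if "\<And>x. x \<in> {0<..<1} \<Longrightarrow> h x = h' x" for h h' k :: "real \<Rightarrow> real"
    by (rule Bochner_Integration.integral_cong) (use that in auto)
  show ?thesis
    using assms(1) i[OF _ _ assms(2)] i[OF _ _ assms(3)] l[OF assms(2)] l[OF assms(3)]
    unfolding weak_derivative_def by auto
qed

lemma square_integrable_cong:
  assumes "\<And>x. x \<in> S \<Longrightarrow> f x = g x" shows "f \<in> square_integrable S \<longleftrightarrow> g \<in> square_integrable S"
proof -
  have "f \<in> borel_measurable (lebesgue_on S) \<longleftrightarrow> g \<in> borel_measurable (lebesgue_on S)"
    by (rule measurable_cong) (use assms in auto)
  moreover have "integrable (lebesgue_on S) (\<lambda>x. (f x)\<^sup>2) \<longleftrightarrow> integrable (lebesgue_on S) (\<lambda>x. (g x)\<^sup>2)"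
    by (rule Bochner_Integration.integrable_cong) (use assms in auto)
  ultimately show ?thesis by (simp add: square_integrable_def)
qed

lemma powr_bounded_Ioo:
  fixes c \<epsilon> :: real assumes "0 < \<epsilon>" "x \<in> {\<epsilon><..<1}" shows "\<bar>x powr c\<bar> \<le> 1 + \<epsilon> powr c"
  using powr_le_bound[of \<epsilon> x c] assms by (simp add: less_imp_le)

lemma powr_mult_square_integrable_Ioo:
  assumes \<epsilon>: "0 < \<epsilon>" and f: "f \<in> square_integrable {\<epsilon><..<1}"
  shows "(\<lambda>x. x powr c * f x) \<in> square_integrable {\<epsilon><..<1}"
proof (rule square_integrable_bounded_mult[OF f _ powr_bounded_Ioo[OF \<epsilon>]])
  have "continuous_on {\<epsilon><..<1} (\<lambda>x. x powr c)" using \<epsilon> by (auto intro!: continuous_intros)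
  then show "(\<lambda>x. x powr c) \<in> borel_measurable (lebesgue_on {\<epsilon><..<1})"
    by (rule continuous_imp_measurable_on_sets_lebesgue) auto
qed

text \<open>Continuity upgrades almost everywhere equality of two representatives to equality on (0,
  1], and one-sided derivatives at 1 are unique. Every classical trace is thereby the one computed
  from the kernel.\<close>

lemma has_trace_at_1_unique:
  assumes "has_trace_at_1 u d" "has_trace_at_1 u d'" shows "d = d'"
proof -
  obtain v v' where v: "AE x in M01. rep_L2 u x = v x"
    "\<And>x. x \<in> {0<..1} \<Longrightarrow> (v has_real_derivative v' x) (at x within {0<..1})" "v' 1 = d"
    using assms(1) unfolding has_trace_at_1_def by blast
  obtain w w' where w: "AE x in M01. rep_L2 u x = w x"
    "\<And>x. x \<in> {0<..1} \<Longrightarrow> (w has_real_derivative w' x) (at x within {0<..1})" "w' 1 = d'"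
    using assms(2) unfolding has_trace_at_1_def by blast
  define h where "h x = \<bar>v x - w x\<bar>" for x
  have hc: "continuous_on {0<..1} h" unfolding h_def
    by (intro continuous_intros DERIV_continuous_on[OF v(2)] DERIV_continuous_on[OF w(2)])
  have ae: "AE x in M01. h x = 0" using v(1) w(1) by eventually_elim (simp add: h_def)
  have h0: "h x = 0" if x: "x \<in> {0<..<1}" for x
  proof -
    define a c where "a = x/2" and "c = (1+x)/2"
    have ac: "0 < a" "c < 1" "x \<in> {a..c}" "a < c" using x by (auto simp: a_def c_def)
    have sub: "{a..c} \<subseteq> {0<..1}" "{a..c} \<subseteq> {0<..<1}" using ac by auto
    have "AE x in lebesgue_on {0<..<1}. h x = 0" by (rule ae)
    then have "AE x in lebesgue. x \<in> {0<..<1} \<longrightarrow> h x = 0" by (subst (asm) AE_restrict_space_iff) auto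
    then obtain N where N: "N \<in> null_sets lebesgue" "{x. \<not> (x \<in> {0<..<1} \<longrightarrow> h x = 0)} \<subseteq> N"
      by (auto simp: eventually_ae_filter)
    have "(h has_integral 0) {a..c}"
    proof (rule has_integral_spike[where f="\<lambda>x. 0" and S=N])
      show "negligible N" using N(1) by (simp add: negligible_iff_null_sets)
      show "h y = 0" if "y \<in> {a..c} - N" for y using that N(2) sub by blast
    qed simp
    moreover have "continuous_on {a..c} h" by (rule continuous_on_subset[OF hc sub(1)])
    ultimately show ?thesis
      using has_integral_0_cbox_imp_0[of a c h x] ac by (auto simp: h_def)
  qed
  have eq: "v x = w x" if x: "x \<in> {0<..1}" for x
  proof (cases "x = 1")
    case True
    have nb: "at (1::real) within {0<..<1} \<noteq> bot" by (simp add: at_within_eq_bot_iff)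
    have "(h \<longlongrightarrow> h 1) (at 1 within {0<..1})" using hc by (simp add: continuous_on_def)
    then have "(h \<longlongrightarrow> h 1) (at 1 within {0<..<1})" by (rule tendsto_within_subset) auto
    moreover have "(h \<longlongrightarrow> 0) (at 1 within {0<..<1})"
      by (rule tendsto_eventually) (auto simp: eventually_at_filter h0)
    ultimately have "h 1 = 0" using tendsto_unique[OF nb] by blast
    then show ?thesis using True by (simp add: h_def)
  qed (use h0[of x] x in \<open>simp add: h_def\<close>)
  have "(v has_real_derivative w' 1) (at 1 within {0<..1})"
    by (rule has_field_derivative_transform_within[OF w(2) zero_less_one]) (use eq in auto)
  moreover have "(v has_real_derivative v' 1) (at 1 within {0<..1})" by (rule v(2)) simp
  moreover have "{0<..1} - {1} = {0<..<1::real}" by auto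
  then have "at (1::real) within {0<..1} \<noteq> bot" by (simp add: at_within_eq_bot_iff)
  ultimately have "w' 1 = v' 1"
    by (intro vector_derivative_unique_within[of 1 "{0<..1}" v]) (auto simp: has_real_derivative_iff_has_vector_derivative)
  then show ?thesis using v(3) w(3) by simp
qed

section \<open>The operator domain\<close>

context hardy_factorization
begin

text \<open>The derivative of u = \<open>G (Gs f)\<close>, obtained by solving x powr (\<alpha>/2)
  u' - \<sigma> x powr (\<alpha>/2 - 1) u = \<open>Gs f\<close> for u'.\<close>

definition dfun :: "L2 \<Rightarrow> real \<Rightarrow> real" where
  "dfun f x = \<sigma> * (x powr (-1) * Gfun (Gs f) x) + x powr (- \<alpha> / 2) * Gsfun f x"

lemma Gfun_Gs_derivative:
  assumes x: "x \<in> {0<..1}"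
  shows "(Gfun (Gs f) has_real_derivative dfun f x) (at x within {0<..1})"
proof -
  have x0: "x > 0" using x by auto
  have t: "(tail (Gs f) (-b) has_real_derivative - (x powr (-b) * Gsfun f x)) (at x within {0<..1})"
    unfolding Gs_def by (rule tail_derivative[OF Gsfun_square_integrable Gsfun_continuous x])
  have p: "x powr (\<sigma> - 1) = x powr (-1) * x powr \<sigma>" "x powr (- \<alpha> / 2) = x powr \<sigma> * x powr (-b)"
    unfolding powr_add[symmetric] by (auto intro!: arg_cong[where f="(powr) x"])
  have "(Gfun (Gs f) has_real_derivative
      - (\<sigma> * x powr (\<sigma> - 1) * tail (Gs f) (-b) x + - (x powr (-b) * Gsfun f x) * x powr \<sigma>)) (at x within {0<..1})"
    unfolding Gfun_def[abs_def]
    by (intro DERIV_minus DERIV_mult t has_field_derivative_at_within[OF has_real_derivative_powr[OF x0]])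
  also have "- (\<sigma> * x powr (\<sigma> - 1) * tail (Gs f) (-b) x + - (x powr (-b) * Gsfun f x) * x powr \<sigma>) = dfun f x"
    unfolding dfun_def p Gfun_def by (simp add: algebra_simps)
  finally show ?thesis .
qed

lemma dfun_continuous: "continuous_on {0<..1} (dfun f)"
  unfolding dfun_def[abs_def] by (intro continuous_intros Gfun_continuous Gsfun_continuous) auto

lemma rep_G: "AE x in M01. rep_L2 (G p) x = Gfun p x"
  unfolding G_def by (rule rep_abs_L2[OF Gfun_square_integrable])

text \<open>At x = 1 the tail integrals vanish, hence u(1) = 0 and only the full integral of x powr
  \<sigma> f survives in the derivative.\<close>

lemma trace_G_Gs: "has_trace_at_1 (G (Gs f)) (- inner f \<theta>)"
  unfolding has_trace_at_1_def
proof (intro exI conjI ballI)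
  show "AE x in M01. rep_L2 (G (Gs f)) x = Gfun (Gs f) x" by (rule rep_G)
  show "(Gfun (Gs f) has_real_derivative dfun f x) (at x within {0<..1})" if "x \<in> {0<..1}" for x
    by (rule Gfun_Gs_derivative[OF that])
  show "continuous_on {0<..1} (dfun f)" by (rule dfun_continuous)
  show "dfun f 1 = - inner f \<theta>" by (simp add: dfun_def Gfun_def Gsfun_def head_def tail_1)
qed

lemma weak_derivative_Gfun:
  "weak_derivative (Gfun (Gs f)) (dfun f)"
  unfolding weak_derivative_def
proof (intro conjI allI impI)
  fix a b :: real assume ab: "0 < a" "b < 1"
  show "integrable (lebesgue_on {a..b}) (Gfun (Gs f))"
    by (rule integrable_Icc_subset[OF square_integrable_integrable[OF Gfun_square_integrable] ab])
  show "integrable (lebesgue_on {a..b}) (dfun f)"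
    by (rule continuous_imp_integrable_real) (rule continuous_on_subset[OF dfun_continuous], use ab in auto)
next
  fix \<phi> assume t: "test_function \<phi>"
  obtain a c where ac: "smooth \<phi>" "0 < a" "a < c" "c < 1" "\<And>x. x \<notin> {a..c} \<Longrightarrow> \<phi> x = 0"
    using test_functionD[OF t] by metis
  define e where "e = a/2"
  have e: "0 < e" "e < 1" "\<phi> e = 0" "\<phi> 1 = 0" using ac by (auto simp: e_def)
  have dz: "deriv \<phi> x = 0" if "x \<le> e" for x
  proof -
    have "\<forall>\<^sub>F y in nhds x. y \<in> {..<a}" using that ac by (intro eventually_nhds_in_open) (auto simp: e_def)
    then have "\<forall>\<^sub>F y in nhds x. \<phi> y = 0" by eventually_elim (use ac(5) in auto)
    then have "(\<phi> has_real_derivative 0) (at x)"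
      by (subst DERIV_cong_ev[OF refl _ refl, of _ "\<lambda>x. 0"]) auto
    then show ?thesis by (rule DERIV_imp_deriv)
  qed
  let ?v = "Gfun (Gs f)"
  define H where "H x = dfun f x * \<phi> x + deriv \<phi> x * ?v x" for x
  have sub: "{e..1} \<subseteq> {0<..1}" using e by auto
  have D: "((\<lambda>x. ?v x * \<phi> x) has_real_derivative H x) (at x within {e..1})" if "x \<in> {e..1}" for x
    unfolding H_def
    by (intro DERIV_mult DERIV_subset[OF Gfun_Gs_derivative sub] has_field_derivative_at_within[OF test_function_DERIV[OF t]])
      (use that sub in auto)
  have Hc: "continuous_on {e..1} H"
    unfolding H_def
    by (intro continuous_on_add continuous_on_mult continuous_on_subset[OF dfun_continuous sub] continuous_on_subset[OF Gfun_continuous sub]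
        test_function_continuous test_function_deriv t)
  have "(LINT x|M01. H x) = (LINT x|M01. indicator {e<..} x * H x)"
    by (rule Bochner_Integration.integral_cong) (use dz ac(5) in \<open>auto simp: indicator_def H_def e_def\<close>)
  also have "\<dots> = 0" using ftc_tail(2)[OF e(1,2) D Hc] e by simp
  finally have H0: "(LINT x|M01. H x) = 0" .
  have loc: "integrable (lebesgue_on {a..b}) (dfun f)" if "0 < a" "b < 1" for a b
    by (rule continuous_imp_integrable_real) (rule continuous_on_subset[OF dfun_continuous], use that in auto)
  have i1: "integrable M01 (\<lambda>x. dfun f x * \<phi> x)" by (rule locally_integrable_test_mult[OF loc t])
  have i2: "integrable M01 (\<lambda>x. ?v x * deriv \<phi> x)"
    by (intro square_integrable_mult Gfun_square_integrable test_function_square_integrable test_function_deriv t)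
  have "(LINT x|M01. H x) = (LINT x|M01. dfun f x * \<phi> x + ?v x * deriv \<phi> x)" by (simp add: H_def mult.commute)
  also have "\<dots> = (LINT x|M01. dfun f x * \<phi> x) + (LINT x|M01. ?v x * deriv \<phi> x)" using i1 i2 by simp
  finally show "(LINT x|M01. ?v x * deriv \<phi> x) = - (LINT x|M01. dfun f x * \<phi> x)" using H0 by simp
qed

text \<open>The value that A u = -f prescribes for the derivative of the flux x powr \<alpha> u',
  where u = \<open>G (Gs f)\<close>.\<close>

definition kfun :: "L2 \<Rightarrow> real \<Rightarrow> real" where
  "kfun f x = rep_L2 (- f) x - \<mu> / x powr (2 - \<alpha>) * rep_L2 (G (Gs f)) x"

lemma integral_rep_G:
  assumes "test_function \<psi>"
  shows "(LINT x|M01. rep_L2 (G p) x * \<psi> x) = (LINT x|M01. Gfun p x * \<psi> x)"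
proof -
  have m: "rep_L2 (G p) \<in> borel_measurable M01" "Gfun p \<in> borel_measurable M01" "\<psi> \<in> borel_measurable M01"
    using rep_L2_square_integrable Gfun_square_integrable test_function_square_integrable[OF assms]
    by (auto simp: square_integrable_def)
  show ?thesis
    by (rule integral_cong_AE) (use m rep_G[of p] in \<open>auto intro!: borel_measurable_times elim!: eventually_mono\<close>)
qed

lemma inner_rep:
  assumes "test_function \<psi>" shows "inner f (abs_L2 \<psi>) = (LINT x|M01. rep_L2 f x * \<psi> x)"
  using abs_L2_arith(5)[OF rep_L2_square_integrable test_function_square_integrable[OF assms]]
  by (simp add: abs_rep_L2)

lemma weak_derivative_rep:
  "weak_derivative (rep_L2 (G (Gs f))) (dfun f)"
  using weak_derivative_Gfun[of f] unfolding weak_derivative_def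
  by (auto simp: integral_rep_G test_function_deriv
      intro!: integrable_Icc_subset square_integrable_integrable rep_L2_square_integrable)

lemma integral_Gfun_deriv:
  assumes t: "test_function xi"
  shows "(LINT x|M01. Gfun (Gs f) x * deriv xi x) = - \<sigma> * (LINT x|M01. Gfun (Gs f) x * (x powr (-1) * xi x))
     - (LINT x|M01. Gsfun f x * (x powr (- \<alpha> / 2) * xi x))"
proof -
  have i: "integrable M01 (\<lambda>x. Gfun (Gs f) x * (x powr (-1) * xi x))" "integrable M01 (\<lambda>x. Gsfun f x * (x powr (- \<alpha> / 2) * xi x))"
    by (intro square_integrable_mult Gfun_square_integrable Gsfun_square_integrable test_function_square_integrable test_function_powr t)+
  have "(LINT x|M01. Gfun (Gs f) x * deriv xi x) = - (LINT x|M01. dfun f x * xi x)"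
    using weak_derivative_Gfun[of f] t by (simp add: weak_derivative_def)
  also have "(LINT x|M01. dfun f x * xi x) = (LINT x|M01. \<sigma> * (Gfun (Gs f) x * (x powr (-1) * xi x)) + Gsfun f x * (x powr (- \<alpha> / 2) * xi x))"
    by (rule Bochner_Integration.integral_cong) (auto simp: dfun_def algebra_simps)
  also have "\<dots> = \<sigma> * (LINT x|M01. Gfun (Gs f) x * (x powr (-1) * xi x)) + (LINT x|M01. Gsfun f x * (x powr (- \<alpha> / 2) * xi x))"
    unfolding Bochner_Integration.integral_add[OF integrable_mult_right[OF i(1)] i(2)] integral_mult_right_zero ..
  also have "- (s * A + B) = - s * A - B" for s A B :: real by simp
  finally show ?thesis .
qed

text \<open>The flux is \<sigma> x powr (\<alpha> - 1) u + x powr (\<alpha>/2) p with p =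
  \<open>Gs f\<close>. After testing, the contributions of p cancel and u is left with the
  coefficient \<sigma>(1 - \<alpha> - \<sigma>) = \<mu>.\<close>

lemma weak_derivative_flux:
  "weak_derivative (\<lambda>x. x powr \<alpha> * dfun f x) (kfun f)"
  unfolding weak_derivative_def
proof (intro conjI allI impI)
  fix a b :: real assume ab: "0 < a" "b < 1"
  show "integrable (lebesgue_on {a..b}) (\<lambda>x. x powr \<alpha> * dfun f x)"
    by (rule continuous_imp_integrable_real)
      (intro continuous_on_mult continuous_on_subset[OF dfun_continuous] continuous_on_powr continuous_on_id continuous_on_const, use ab in auto)
  have i: "integrable (lebesgue_on {a..b}) (rep_L2 h)" for h
    by (rule integrable_Icc_subset[OF square_integrable_integrable[OF rep_L2_square_integrable] ab])
  show "integrable (lebesgue_on {a..b}) (kfun f)"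
    unfolding kfun_def
    by (intro Bochner_Integration.integrable_diff integrable_Icc_continuous_mult i continuous_intros) (use ab in auto)
next
  fix \<phi> assume t: "test_function \<phi>"
  let ?v = "Gfun (Gs f)" and ?p = "Gsfun f"
  define xi' where "xi' x = x powr (\<alpha> - 1) * \<phi> x" for x
  have xi: "test_function xi'" unfolding xi'_def by (rule test_function_powr[OF t])
  have D: "deriv xi' x = (\<alpha> - 1) * (x powr (\<alpha> - 2) * \<phi> x) + x powr (\<alpha> - 1) * deriv \<phi> x" if "x \<in> {0<..<1}" for x
  proof -
    have e: "\<alpha> - 1 - 1 = \<alpha> - 2" by simp
    have "(xi' has_real_derivative (\<alpha> - 1) * x powr (\<alpha> - 1 - 1) * \<phi> x + deriv \<phi> x * x powr (\<alpha> - 1)) (at x)"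
      unfolding xi'_def by (intro DERIV_mult has_real_derivative_powr test_function_DERIV t) (use that in auto)
    then show ?thesis unfolding e by (simp add: DERIV_imp_deriv algebra_simps)
  qed
  note iv = square_integrable_mult[OF Gfun_square_integrable test_function_square_integrable]
  note ip = square_integrable_mult[OF Gsfun_square_integrable test_function_square_integrable]
  have pw: "x powr (\<alpha> - 1) = x powr \<alpha> * x powr (-1)" "x powr (\<alpha>/2) = x powr \<alpha> * x powr (- \<alpha>/2)"
    "x powr (-1) * x powr (\<alpha> - 1) = x powr (\<alpha> - 2)" "x powr (- \<alpha> / 2) * x powr (\<alpha> - 1) = x powr (\<alpha>/2 - 1)" for x :: real
    unfolding powr_add[symmetric] by (auto intro!: arg_cong[where f="(powr) x"])
  have q: "x powr (-1) * (x powr (\<alpha> - 1) * \<phi> x) = x powr (\<alpha> - 2) * \<phi> x"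
    "x powr (- \<alpha> / 2) * (x powr (\<alpha> - 1) * \<phi> x) = x powr (\<alpha>/2 - 1) * \<phi> x" for x
    unfolding pw(3,4)[symmetric] by (simp_all only: mult.assoc)
  define P where "P = (LINT x|M01. ?p x * (x powr (\<alpha>/2 - 1) * \<phi> x))"
  define V where "V = (LINT x|M01. ?v x * (x powr (\<alpha> - 2) * \<phi> x))"
  \<comment> \<open>Adjointness: \<open>Gs f\<close> tested with \<open>Lfun \<phi>\<close> is f
    tested with \<phi>.\<close>
  have A1: "(LINT x|M01. ?p x * (x powr (\<alpha>/2) * deriv \<phi> x)) = inner f (abs_L2 \<phi>) + \<sigma> * P"
  proof -
    have "inner f (abs_L2 \<phi>) = (LINT x|M01. ?p x * Lfun \<phi> x)"
      unfolding inner_Gs_Lfun[OF t, symmetric] Gs_def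
      by (rule abs_L2_arith(5)[OF Gsfun_square_integrable Lfun_square_integrable[OF t]])
    also have "\<dots> = (LINT x|M01. ?p x * (x powr (\<alpha>/2) * deriv \<phi> x) - \<sigma> * (?p x * (x powr (\<alpha>/2 - 1) * \<phi> x)))"
      by (simp add: Lfun_def algebra_simps)
    also have "\<dots> = (LINT x|M01. ?p x * (x powr (\<alpha>/2) * deriv \<phi> x)) - \<sigma> * P"
      unfolding P_def using ip[OF test_function_powr[OF test_function_deriv[OF t]]] ip[OF test_function_powr[OF t]] by simp
    finally show ?thesis by simp
  qed
  \<comment> \<open>The weak derivative of u, tested with x powr (\<alpha> - 1) \<phi>.\<close>
  have A2: "(LINT x|M01. ?v x * (x powr (\<alpha> - 1) * deriv \<phi> x)) = (1 - \<alpha> - \<sigma>) * V - P"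
  proof -
    have "(LINT x|M01. ?v x * (x powr (\<alpha> - 1) * deriv \<phi> x)) = (LINT x|M01. ?v x * deriv xi' x - (\<alpha> - 1) * (?v x * (x powr (\<alpha> - 2) * \<phi> x)))"
      by (rule Bochner_Integration.integral_cong) (auto simp: D algebra_simps)
    also have "\<dots> = (LINT x|M01. ?v x * deriv xi' x) - (\<alpha> - 1) * V"
      unfolding V_def using iv[OF test_function_deriv[OF xi]] iv[OF test_function_powr[OF t]] by simp
    also have "(LINT x|M01. ?v x * deriv xi' x) = - \<sigma> * V - P"
      unfolding integral_Gfun_deriv[OF xi] V_def P_def xi'_def q ..
    finally show ?thesis by (simp add: algebra_simps)
  qed
  have "(LINT x|M01. x powr \<alpha> * dfun f x * deriv \<phi> x)
     = (LINT x|M01. \<sigma> * (?v x * (x powr (\<alpha> - 1) * deriv \<phi> x)) + ?p x * (x powr (\<alpha>/2) * deriv \<phi> x))"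
    by (rule Bochner_Integration.integral_cong[OF refl]) (simp only: pw(1,2) dfun_def algebra_simps)
  also have "\<dots> = \<sigma> * ((1 - \<alpha> - \<sigma>) * V - P) + (inner f (abs_L2 \<phi>) + \<sigma> * P)"
    unfolding A1[symmetric] A2[symmetric]
    using ip[OF test_function_powr[OF test_function_deriv[OF t]]] iv[OF test_function_powr[OF test_function_deriv[OF t]]] by simp
  also have "s * ((1 - \<alpha> - s) * V - P) + (F + s * P) = F + (s * (1 - \<alpha> - s)) * V" for s F :: real
    by (simp add: algebra_simps)
  also have "inner f (abs_L2 \<phi>) + (\<sigma> * (1 - \<alpha> - \<sigma>)) * V = inner f (abs_L2 \<phi>) + \<mu> * V" unfolding \<mu>_def ..
  finally have L: "(LINT x|M01. x powr \<alpha> * dfun f x * deriv \<phi> x) = inner f (abs_L2 \<phi>) + \<mu> * V" .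
  note ir = square_integrable_mult[OF rep_L2_square_integrable test_function_square_integrable]
  have "(LINT x|M01. kfun f x * \<phi> x) = (LINT x|M01. rep_L2 (- f) x * \<phi> x - \<mu> * (rep_L2 (G (Gs f)) x * (x powr (\<alpha> - 2) * \<phi> x)))"
    by (rule Bochner_Integration.integral_cong) (auto simp: kfun_def powr_alpha(3,5) field_simps)
  also have "\<dots> = inner (- f) (abs_L2 \<phi>) - \<mu> * V"
    unfolding V_def integral_rep_G[OF test_function_powr[OF t], symmetric] inner_rep[OF t]
    using ir[OF t] ir[OF test_function_powr[OF t]] by simp
  finally show "(LINT x|M01. x powr \<alpha> * dfun f x * deriv \<phi> x) = - (LINT x|M01. kfun f x * \<phi> x)"
    using L by simp
qed

lemma op_A_rel_G_Gs: "op_A_rel \<alpha> \<mu> (G (Gs f)) (- f)"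
  unfolding op_A_rel_def
  by (intro exI conjI, rule weak_derivative_rep, rule weak_derivative_flux) (simp add: kfun_def)

text \<open>Away from 0 the flux can be divided by x powr \<alpha>, and the product rule transfers
  its weak derivative to u'.\<close>

lemma H2_loc_G_Gs: "H2_loc (G (Gs f))"
proof -
  define h where "h x = x powr (-\<alpha>) * kfun f x + (-\<alpha>) * (x powr (-\<alpha> - 1) * (x powr \<alpha> * dfun f x))" for x
  have "weak_derivative (\<lambda>x. x powr (-\<alpha>) * (x powr \<alpha> * dfun f x)) h"
    unfolding h_def by (rule weak_derivative_powr_mult[OF weak_derivative_flux])
  then have w: "weak_derivative (dfun f) h"
    by (rule weak_derivative_cong) (auto simp: mult.assoc[symmetric] powr_add[symmetric])
  have sq: "dfun f \<in> square_integrable {\<epsilon><..<1}" "h \<in> square_integrable {\<epsilon><..<1}" if e: "0 < \<epsilon>" "\<epsilon> < 1" for \<epsilon>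
  proof -
    have "compact (dfun f ` {\<epsilon>..1})"
      by (rule compact_continuous_image[OF continuous_on_subset[OF dfun_continuous]]) (use e in auto)
    then obtain C where C: "\<And>x. x \<in> {\<epsilon>..1} \<Longrightarrow> norm (dfun f x) \<le> C" by (metis bounded_iff compact_imp_bounded imageI)
    have sub: "{\<epsilon><..<1} \<subseteq> {0<..<1}" using e by auto
    have m: "dfun f \<in> borel_measurable (lebesgue_on {\<epsilon><..<1})"
      by (rule continuous_imp_measurable_on_sets_lebesgue[OF continuous_on_subset[OF dfun_continuous]]) (use e in auto)
    have "(\<lambda>x. 1) \<in> square_integrable {\<epsilon><..<1}"
      by (rule square_integrable_restrict[OF square_integrable_const _ _ sub]) auto
    from square_integrable_bounded_mult[OF this m, of C] C
    show d: "dfun f \<in> square_integrable {\<epsilon><..<1}" by simp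
    have r: "rep_L2 u \<in> square_integrable {\<epsilon><..<1}" for u
      by (rule square_integrable_restrict[OF rep_L2_square_integrable _ _ sub]) auto
    have "(\<lambda>x. rep_L2 (- f) x - \<mu> * (x powr (\<alpha> - 2) * rep_L2 (G (Gs f)) x)) \<in> square_integrable {\<epsilon><..<1}"
      by (intro square_integrable_diff square_integrable_cmult powr_mult_square_integrable_Ioo r e)
    also have "?this \<longleftrightarrow> kfun f \<in> square_integrable {\<epsilon><..<1}"
    proof -
      have eq: "rep_L2 (- f) x - \<mu> * (x powr (\<alpha> - 2) * rep_L2 (G (Gs f)) x) = kfun f x" if "x \<in> {\<epsilon><..<1}" for x
        using that e by (simp add: kfun_def powr_alpha(3,5))
      show ?thesis by (rule square_integrable_cong) (rule eq)
    qed
    finally have k: "kfun f \<in> square_integrable {\<epsilon><..<1}" .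
    show "h \<in> square_integrable {\<epsilon><..<1}"
      unfolding h_def
      by (intro square_integrable_add square_integrable_cmult powr_mult_square_integrable_Ioo k d e)
  qed
  show ?thesis unfolding H2_loc_def
    using weak_derivative_rep w sq by blast
qed

text \<open>A distributional solution of A u = h in the form domain satisfies the same identity
  against all \<open>Lfun \<phi>\<close> as \<open>Gs (- h)\<close> does, and these tests separate
  L2. So the domain defined by distributions is no larger than the range of \<open>G\<close> after
  \<open>Gs\<close>.\<close>

lemma op_A_rel_G:
  assumes "op_A_rel \<alpha> \<mu> (G p) h" shows "p = Gs (- h)"
proof -
  obtain g k where g: "weak_derivative (rep_L2 (G p)) g" and k: "weak_derivative (\<lambda>x. x powr \<alpha> * g x) k"
    and ae: "AE x in M01. rep_L2 h x = k x + \<mu> / x powr (2 - \<alpha>) * rep_L2 (G p) x"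
    using assms unfolding op_A_rel_def by blast
  have "p - Gs (- h) = 0"
  proof (rule Lfun_orthogonal)
    fix \<phi> assume t: "test_function \<phi>"
    define \<eta> where "\<eta> x = x powr \<alpha> * deriv \<phi> x" for x
    have \<eta>: "test_function \<eta>" unfolding \<eta>_def by (intro test_function_powr test_function_deriv t)
    note ir = square_integrable_mult[OF rep_L2_square_integrable test_function_square_integrable]
    have kt: "integrable M01 (\<lambda>x. k x * \<phi> x)"
      by (rule locally_integrable_test_mult[OF weak_derivative_locally_integrable(2)[OF k] t])
    have "inner (G p) (abs_L2 (Afun \<phi>)) = (LINT x|M01. rep_L2 (G p) x * deriv \<eta> x + \<mu> * (rep_L2 (G p) x * (x powr (\<alpha> - 2) * \<phi> x)))"
      unfolding inner_rep[OF Afun_test[OF t]] by (simp add: Afun_def \<eta>_def[abs_def] algebra_simps)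
    also have "\<dots> = (LINT x|M01. rep_L2 (G p) x * deriv \<eta> x) + \<mu> * (LINT x|M01. rep_L2 (G p) x * (x powr (\<alpha> - 2) * \<phi> x))"
      using ir[OF test_function_deriv[OF \<eta>]] ir[OF test_function_powr[OF t]] by simp
    also have "(LINT x|M01. rep_L2 (G p) x * deriv \<eta> x) = - (LINT x|M01. g x * \<eta> x)"
      using g \<eta> by (simp add: weak_derivative_def)
    also have "(LINT x|M01. g x * \<eta> x) = (LINT x|M01. x powr \<alpha> * g x * deriv \<phi> x)"
      by (simp add: \<eta>_def algebra_simps)
    also have "\<dots> = - (LINT x|M01. k x * \<phi> x)"
      using k t by (simp add: weak_derivative_def)
    also have "(LINT x|M01. k x * \<phi> x) = (LINT x|M01. rep_L2 h x * \<phi> x - \<mu> * (rep_L2 (G p) x * (x powr (\<alpha> - 2) * \<phi> x)))"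
    proof (rule integral_cong_AE)
      show "(\<lambda>x. k x * \<phi> x) \<in> borel_measurable M01" using kt by auto
      show "(\<lambda>x. rep_L2 h x * \<phi> x - \<mu> * (rep_L2 (G p) x * (x powr (\<alpha> - 2) * \<phi> x))) \<in> borel_measurable M01"
        using ir[OF t, of h] ir[OF test_function_powr[OF t], of "G p"] by auto
      have "AE x in M01. x \<in> {0<..<1}" by (rule AE_I2) simp
      with ae show "AE x in M01. k x * \<phi> x = rep_L2 h x * \<phi> x - \<mu> * (rep_L2 (G p) x * (x powr (\<alpha> - 2) * \<phi> x))"
        by eventually_elim (auto simp: powr_alpha(3,5) algebra_simps)
    qed
    also have "\<dots> = inner h (abs_L2 \<phi>) - \<mu> * (LINT x|M01. rep_L2 (G p) x * (x powr (\<alpha> - 2) * \<phi> x))"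
      unfolding inner_rep[OF t] using ir[OF t, of h] ir[OF test_function_powr[OF t], of "G p"] by simp
    finally have "inner (G p) (abs_L2 (Afun \<phi>)) = inner h (abs_L2 \<phi>)" by simp
    then show "inner (p - Gs (- h)) (abs_L2 (Lfun \<phi>)) = 0"
      unfolding inner_diff_left inner_Gs_Lfun[OF t] inner_Lfun[OF t, of p] by simp
  qed
  then show ?thesis by simp
qed

lemma Gs_inject: "Gs f = Gs g \<longleftrightarrow> f = g"
  using Gs_eq_0[of "f - g"] by (auto simp: bounded_linear.linear[OF bounded_linear_Gs, THEN linear_diff])

lemma op_D_eq: "op_D \<alpha> \<mu> = range (\<lambda>f. G (Gs f))"
proof
  show "op_D \<alpha> \<mu> \<subseteq> range (\<lambda>f. G (Gs f))"
  proof
    fix u assume "u \<in> op_D \<alpha> \<mu>"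
    then obtain p h where "u = G p" "op_A_rel \<alpha> \<mu> u h" by (auto simp: op_D_def H1_eq)
    then show "u \<in> range (\<lambda>f. G (Gs f))" using op_A_rel_G by blast
  qed
  show "range (\<lambda>f. G (Gs f)) \<subseteq> op_D \<alpha> \<mu>"
    using H2_loc_G_Gs op_A_rel_G_Gs by (auto simp: op_D_def H1_eq)
qed

lemma op_A_G_Gs: "op_A \<alpha> \<mu> (G (Gs f)) = - f"
  unfolding op_A_def
proof (rule the_equality)
  show "op_A_rel \<alpha> \<mu> (G (Gs f)) (- f)" by (rule op_A_rel_G_Gs)
  fix h assume "op_A_rel \<alpha> \<mu> (G (Gs f)) h"
  from op_A_rel_G[OF this] show "h = - f" by (simp add: Gs_inject)
qed

end

section \<open>The multiplier\<close>

context hardy_factorization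
begin

abbreviation "\<kappa> \<equiv> (2 - \<alpha>) / 4"

text \<open>Multiplication by the power that turns \<open>Lfun \<phi>\<close> into x \<phi>' -
  \<sigma> \<phi>. It is at most 1 on the unit interval, so it is a contraction of L2.\<close>

definition Xop :: "L2 \<Rightarrow> L2" where
  "Xop p = abs_L2 (\<lambda>x. x powr (1 - \<alpha> / 2) * rep_L2 p x)"

lemma powr_X_le: "x \<in> {0<..<1} \<Longrightarrow> \<bar>x powr (1 - \<alpha> / 2)\<bar> \<le> 1"
  using \<alpha> by (auto intro!: powr_le1)

lemma X_square_integrable:
  "f \<in> square_integrable {0<..<1} \<Longrightarrow> (\<lambda>x. x powr (1 - \<alpha> / 2) * f x) \<in> square_integrable {0<..<1}"
  by (rule square_integrable_bounded_mult[OF _ measurable_powr powr_X_le])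

lemma Xop_abs:
  assumes f: "f \<in> square_integrable {0<..<1}"
  shows "Xop (abs_L2 f) = abs_L2 (\<lambda>x. x powr (1 - \<alpha> / 2) * f x)"
  unfolding Xop_def
  by (subst abs_L2_eq_iff[OF X_square_integrable[OF rep_L2_square_integrable] X_square_integrable[OF f]])
    (use rep_abs_L2[OF f] in \<open>auto elim: eventually_mono\<close>)

lemma Xop_norm: "norm (Xop p) \<le> norm p"
proof -
  have "(norm (Xop p))\<^sup>2 = (LINT x|M01. (x powr (1 - \<alpha> / 2) * rep_L2 p x)\<^sup>2)"
    unfolding Xop_def by (rule norm_abs_L2[OF X_square_integrable[OF rep_L2_square_integrable]])
  also have "\<dots> \<le> (LINT x|M01. (rep_L2 p x)\<^sup>2)"
  proof (rule integral_mono)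
    show "integrable M01 (\<lambda>x. (x powr (1 - \<alpha> / 2) * rep_L2 p x)\<^sup>2)"
      using X_square_integrable[OF rep_L2_square_integrable] by (simp add: square_integrable_def)
    show "integrable M01 (\<lambda>x. (rep_L2 p x)\<^sup>2)"
      using rep_L2_square_integrable by (simp add: square_integrable_def)
    show "(x powr (1 - \<alpha> / 2) * rep_L2 p x)\<^sup>2 \<le> (rep_L2 p x)\<^sup>2" if "x \<in> space M01" for x
    proof -
      have "\<bar>x powr (1 - \<alpha> / 2) * rep_L2 p x\<bar> \<le> 1 * \<bar>rep_L2 p x\<bar>"
        unfolding abs_mult using powr_X_le[of x] that by (intro mult_right_mono) auto
      then show ?thesis by (simp add: abs_le_square_iff)
    qed
  qed
  also have "\<dots> = (norm p)\<^sup>2"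
    using norm_abs_L2[OF rep_L2_square_integrable, of p] by (simp add: abs_rep_L2)
  finally show ?thesis by (rule power2_le_imp_le) simp
qed

lemma bounded_linear_Xop: "bounded_linear Xop"
proof (rule bounded_linear_intro[where K=1])
  show "Xop (p + q) = Xop p + Xop q" for p q
  proof -
    obtain f g where f: "f \<in> square_integrable {0<..<1}" "p = abs_L2 f" and g: "g \<in> square_integrable {0<..<1}" "q = abs_L2 g"
      using L2_cases by metis
    show ?thesis unfolding f(2) g(2)
      by (simp add: abs_L2_arith(1) Xop_abs X_square_integrable square_integrable_add f g distrib_left)
  qed
  show "Xop (r *\<^sub>R p) = r *\<^sub>R Xop p" for r p
  proof -
    obtain f where f: "f \<in> square_integrable {0<..<1}" "p = abs_L2 f" using L2_cases by metis
    show ?thesis unfolding f(2)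
      by (simp add: abs_L2_arith(4)[OF _ square_integrable_0] Xop_abs X_square_integrable square_integrable_cmult f mult.left_commute)
  qed
qed (use Xop_norm in simp)

lemmas continuous_on_Xop [continuous_intros] = bounded_linear.continuous_on[OF bounded_linear_Xop]

text \<open>On test functions this is the integral of \<phi> (x \<phi>' - \<sigma> \<phi>), and x
  \<phi> \<phi>' integrates to half of -\<phi>^2 because the derivative of x \<phi>^2 has integral
  zero.\<close>

lemma inner_G_Xop: "inner (G p) (Xop p) = - (1/2 + \<sigma>) * (norm (G p))\<^sup>2"
proof (rule L2_Lfun_induct[of "\<lambda>p. inner (G p) (Xop p) = - (1/2 + \<sigma>) * (norm (G p))\<^sup>2"])
  show "closed {p. inner (G p) (Xop p) = - (1/2 + \<sigma>) * (norm (G p))\<^sup>2}"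
    by (intro closed_Collect_eq continuous_intros)
  fix \<phi> assume t: "test_function \<phi>"
  note sq = test_function_square_integrable
  have s: "smooth \<phi>" by (rule test_function_smooth[OF t])
  have t2: "test_function (\<lambda>x. x * (\<phi> x * \<phi> x))" by (intro test_function_mult smooth_ident t s)
  have td: "test_function (\<lambda>x. x * deriv \<phi> x)" by (intro test_function_mult smooth_ident test_function_deriv t)
  have "(LINT x|M01. 1 * (\<phi> x * \<phi> x) + (deriv \<phi> x * \<phi> x + deriv \<phi> x * \<phi> x) * x) = 0"
    by (rule test_function_integral_derivative[OF t2]) (intro DERIV_mult DERIV_ident test_function_DERIV t)
  also have "(LINT x|M01. 1 * (\<phi> x * \<phi> x) + (deriv \<phi> x * \<phi> x + deriv \<phi> x * \<phi> x) * x)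
     = (LINT x|M01. \<phi> x * \<phi> x + 2 * (\<phi> x * (x * deriv \<phi> x)))" by (simp add: algebra_simps)
  also have "\<dots> = inner (abs_L2 \<phi>) (abs_L2 \<phi>) + 2 * (LINT x|M01. \<phi> x * (x * deriv \<phi> x))"
    using square_integrable_mult[OF sq[OF t] sq[OF t]] square_integrable_mult[OF sq[OF t] sq[OF td]]
    by (simp add: abs_L2_arith(5) sq t)
  finally have h: "(LINT x|M01. \<phi> x * (x * deriv \<phi> x)) = - (1/2) * inner (abs_L2 \<phi>) (abs_L2 \<phi>)" by simp
  have XL: "Xop (abs_L2 (Lfun \<phi>)) = abs_L2 (\<lambda>x. x * deriv \<phi> x - \<sigma> * \<phi> x)"
    unfolding Xop_abs[OF Lfun_square_integrable[OF t]]
  proof (subst abs_L2_eq_iff)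
    show "AE x in M01. x powr (1 - \<alpha> / 2) * Lfun \<phi> x = x * deriv \<phi> x - \<sigma> * \<phi> x"
    proof (rule AE_I2)
      fix x assume x: "x \<in> space M01"
      have p: "x powr (1 - \<alpha>/2) * x powr (\<alpha>/2) = x" "x powr (1 - \<alpha>/2) * x powr (\<alpha>/2 - 1) = 1"
        using x by (simp_all add: powr_add[symmetric])
      have "x powr (1 - \<alpha> / 2) * Lfun \<phi> x = (x powr (1 - \<alpha>/2) * x powr (\<alpha>/2)) * deriv \<phi> x
        - \<sigma> * ((x powr (1 - \<alpha>/2) * x powr (\<alpha>/2 - 1)) * \<phi> x)"
        unfolding Lfun_def right_diff_distrib by (simp only: mult_ac)
      then show "x powr (1 - \<alpha> / 2) * Lfun \<phi> x = x * deriv \<phi> x - \<sigma> * \<phi> x" unfolding p by simp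
    qed
  qed (intro X_square_integrable Lfun_square_integrable t square_integrable_diff square_integrable_cmult sq[OF t] sq[OF td])+
  have "inner (abs_L2 \<phi>) (Xop (abs_L2 (Lfun \<phi>))) = (LINT x|M01. \<phi> x * (x * deriv \<phi> x - \<sigma> * \<phi> x))"
    unfolding XL by (rule abs_L2_arith(5)) (intro square_integrable_diff square_integrable_cmult sq[OF t] sq[OF td])+
  also have "\<dots> = (LINT x|M01. \<phi> x * (x * deriv \<phi> x) - \<sigma> * (\<phi> x * \<phi> x))"
    by (rule Bochner_Integration.integral_cong[OF refl]) (simp add: algebra_simps)
  also have "\<dots> = (LINT x|M01. \<phi> x * (x * deriv \<phi> x)) - \<sigma> * inner (abs_L2 \<phi>) (abs_L2 \<phi>)"
    using square_integrable_mult[OF sq[OF t] sq[OF t]] square_integrable_mult[OF sq[OF t] sq[OF td]]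
    by (simp add: abs_L2_arith(5) sq t)
  also have "\<dots> = - (1/2 + \<sigma>) * (norm (abs_L2 \<phi>))\<^sup>2"
    unfolding h power2_norm_eq_inner by (simp add: algebra_simps)
  finally show "inner (G (abs_L2 (Lfun \<phi>))) (Xop (abs_L2 (Lfun \<phi>))) = - (1/2 + \<sigma>) * (norm (G (abs_L2 (Lfun \<phi>))))\<^sup>2"
    unfolding G_Lfun[OF t] .
qed

text \<open>With J the head integral, the integrand is the derivative of x powr (1 - 2b) J^2 / 2.
  For test functions J vanishes near 0, so only the value at 1 is left: this is where the squared
  trace comes from.\<close>

lemma inner_Xop_Gs: "- inner f (Xop (Gs f)) = (inner f \<theta>)\<^sup>2 / 2 + (b - 1/2) * (norm (Gs f))\<^sup>2"
proof (rule L2_test_induct[of "\<lambda>f. - inner f (Xop (Gs f)) = (inner f \<theta>)\<^sup>2 / 2 + (b - 1/2) * (norm (Gs f))\<^sup>2"])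
  show "closed {f. - inner f (Xop (Gs f)) = (inner f \<theta>)\<^sup>2 / 2 + (b - 1/2) * (norm (Gs f))\<^sup>2}"
    by (intro closed_Collect_eq continuous_intros) auto
  fix f assume t: "test_function f"
  obtain a c where ac: "smooth f" "0 < a" "a < c" "c < 1" "\<And>x. x \<notin> {a..c} \<Longrightarrow> f x = 0"
    using test_functionD[OF t] by metis
  define e where "e = a/2"
  have e: "0 < e" "e < 1" "\<And>y. y \<le> e \<Longrightarrow> f y = 0" using ac by (auto simp: e_def)
  note fs = test_function_square_integrable[OF t]
  define J where "J = head (abs_L2 f)"
  have JD: "(J has_real_derivative x powr \<sigma> * f x) (at x within {0<..1})" if "x \<in> {0<..1}" for x
    unfolding J_def by (rule head_derivative[OF fs test_function_continuous[OF t] that])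
  have Jz: "J x = 0" if "0 < x" "x \<le> e" for x
    unfolding J_def by (rule head_test_zero[OF t e(3) that])
  have J1: "J 1 = inner (abs_L2 f) \<theta>" by (simp add: J_def head_def tail_1)
  have sub: "{e..1} \<subseteq> {0<..1}" using e by auto
  define D where "D x = (1 - 2 * b) * x powr (1 - 2 * b - 1) * (J x * J x / 2) + (x powr \<sigma> * f x) * J x * x powr (1 - 2 * b)" for x
  have FD: "((\<lambda>x. x powr (1 - 2 * b) * (J x * J x / 2)) has_real_derivative D x) (at x within {e..1})" if "x \<in> {e..1}" for x
  proof -
    have x: "x \<in> {0<..1}" "x > 0" using that sub by auto
    have "((\<lambda>x. J x * J x / 2) has_real_derivative ((x powr \<sigma> * f x) * J x + (x powr \<sigma> * f x) * J x) / 2) (at x within {e..1})"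
      by (intro DERIV_cdivide DERIV_mult DERIV_subset[OF JD[OF x(1)] sub])
    then have "((\<lambda>x. J x * J x / 2) has_real_derivative (x powr \<sigma> * f x) * J x) (at x within {e..1})"
      by (rule DERIV_cong) simp
    then show ?thesis unfolding D_def
      by (intro DERIV_mult has_field_derivative_at_within[OF has_real_derivative_powr[OF x(2)]])
  qed
  have cJ: "continuous_on {e..1} J"
    using sub by (auto intro!: DERIV_continuous_on DERIV_subset[OF JD])
  have cD: "continuous_on {e..1} D"
    unfolding D_def by (intro continuous_intros cJ test_function_continuous t) (use e in auto)
  have "(LINT x|M01. indicator {e<..} x * D x) = (inner (abs_L2 f) \<theta>)\<^sup>2 / 2"
    using ftc_tail(2)[OF e(1,2) FD cD] Jz[of e] e by (simp add: J1 power2_eq_square)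
  moreover have "(LINT x|M01. indicator {e<..} x * D x) = (LINT x|M01. D x)"
    by (rule Bochner_Integration.integral_cong) (use Jz in \<open>auto simp: indicator_def D_def\<close>)
  ultimately have D1: "(LINT x|M01. D x) = (inner (abs_L2 f) \<theta>)\<^sup>2 / 2" by simp
  have eq: "- (f x * (x powr (1 - \<alpha> / 2) * Gsfun (abs_L2 f) x)) - (b - 1/2) * (Gsfun (abs_L2 f) x)\<^sup>2 = D x" for x
  proof -
    have p: "x powr (1 - \<alpha>/2) * x powr (-b) = x powr \<sigma> * x powr (1 - 2 * b)" "x powr (1 - 2 * b - 1) = x powr (-b) * x powr (-b)"
      unfolding powr_add[symmetric] by (auto intro!: arg_cong[where f="(powr) x"] simp: field_simps)
    have "- (f x * (x powr (1 - \<alpha> / 2) * Gsfun (abs_L2 f) x)) = f x * J x * (x powr (1 - \<alpha>/2) * x powr (-b))"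
      by (simp add: Gsfun_def J_def)
    moreover have "(Gsfun (abs_L2 f) x)\<^sup>2 = (x powr (-b) * x powr (-b)) * (J x * J x)"
      by (simp add: Gsfun_def J_def power2_eq_square)
    ultimately show ?thesis unfolding D_def p by (simp add: algebra_simps)
  qed
  have i1: "integrable M01 (\<lambda>x. f x * (x powr (1 - \<alpha> / 2) * Gsfun (abs_L2 f) x))"
    by (intro square_integrable_mult fs X_square_integrable Gsfun_square_integrable)
  have i2: "integrable M01 (\<lambda>x. (Gsfun (abs_L2 f) x)\<^sup>2)"
    using Gsfun_square_integrable by (simp add: square_integrable_def)
  have a1: "inner (abs_L2 f) (Xop (Gs (abs_L2 f))) = (LINT x|M01. f x * (x powr (1 - \<alpha> / 2) * Gsfun (abs_L2 f) x))"
    unfolding Gs_def Xop_abs[OF Gsfun_square_integrable] by (rule abs_L2_arith(5)[OF fs X_square_integrable[OF Gsfun_square_integrable]])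
  have a2: "(norm (Gs (abs_L2 f)))\<^sup>2 = (LINT x|M01. (Gsfun (abs_L2 f) x)\<^sup>2)"
    unfolding Gs_def by (rule norm_abs_L2[OF Gsfun_square_integrable])
  have "(LINT x|M01. D x) = - (LINT x|M01. f x * (x powr (1 - \<alpha> / 2) * Gsfun (abs_L2 f) x)) - (b - 1/2) * (LINT x|M01. (Gsfun (abs_L2 f) x)\<^sup>2)"
    unfolding eq[symmetric] using i1 i2 by simp
  then show "- inner (abs_L2 f) (Xop (Gs (abs_L2 f))) = (inner (abs_L2 f) \<theta>)\<^sup>2 / 2 + (b - 1/2) * (norm (Gs (abs_L2 f)))\<^sup>2"
    unfolding a1 a2 using D1 by linarith
qed

text \<open>For \<open>u = G p\<close> the element \<open>Bop p\<close> represents \<open>x u' + (\<alpha> / 4) u\<close>.\<close>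

definition Bop :: "L2 \<Rightarrow> L2" where "Bop p = (b - \<alpha> / 4) *\<^sub>R G p + Xop p"

lemma linear_Bop: "linear Bop"
proof -
  interpret G: bounded_linear G by (rule bounded_linear_G)
  interpret X: bounded_linear Xop by (rule bounded_linear_Xop)
  show ?thesis by (rule linearI) (simp_all add: Bop_def G.add G.scaleR X.add X.scaleR algebra_simps)
qed

text \<open>With c = b - \<alpha>/4 \<ge> 0, \<open>inner_G_Xop\<close> reduces the square to that
  of \<open>Xop p\<close> plus c (c - 1 - 2\<sigma>) times that of \<open>G p\<close>. The factor c
  - 1 - 2\<sigma> is 3\<alpha>/4 - 1 - b, nonpositive for \<alpha> < 2 and b \<ge> 1/2.\<close>

lemma norm_Bop: "norm (Bop p) \<le> norm p"
proof -
  define c where "c = b - \<alpha> / 4"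
  have c: "c \<ge> 0" "c - 1 - 2 * \<sigma> \<le> 0" using \<alpha> b by (simp_all add: c_def)
  have "(norm (Bop p))\<^sup>2 = c\<^sup>2 * (norm (G p))\<^sup>2 + 2 * c * inner (G p) (Xop p) + (norm (Xop p))\<^sup>2"
    unfolding power2_norm_eq_inner Bop_def c_def[symmetric]
    by (simp add: inner_add_left inner_add_right inner_commute power2_eq_square algebra_simps)
  also have "\<dots> = c * (c - 1 - 2 * \<sigma>) * (norm (G p))\<^sup>2 + (norm (Xop p))\<^sup>2"
    unfolding inner_G_Xop by (simp add: algebra_simps power2_eq_square)
  also have "\<dots> \<le> (norm (Xop p))\<^sup>2"
    using c by (simp add: mult_nonneg_nonpos mult_nonpos_nonneg)
  also have "\<dots> \<le> (norm p)\<^sup>2" using Xop_norm by (intro power_mono) auto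
  finally show ?thesis by (rule power2_le_imp_le) simp
qed

lemma inner_G_Bop: "inner (G p) (Bop p) = - \<kappa> * (norm (G p))\<^sup>2"
proof -
  have "inner (G p) (Bop p) = (b - \<alpha> / 4) * (norm (G p))\<^sup>2 + - (1/2 + \<sigma>) * (norm (G p))\<^sup>2"
    unfolding Bop_def inner_add_right inner_G_Xop by (simp add: power2_norm_eq_inner)
  also have "\<dots> = ((b - \<alpha> / 4) + - (1/2 + \<sigma>)) * (norm (G p))\<^sup>2" by (rule distrib_right[symmetric])
  also have "(b - \<alpha> / 4) + - (1/2 + \<sigma>) = - \<kappa>" by (simp add: field_simps)
  finally show ?thesis .
qed

text \<open>The left-hand side pairs A u with the multiplier for u = \<open>G (Gs f)\<close>, as A u
  = -f. The contributions b - 1/2 and -(b - \<alpha>/4) add up to -\<kappa>, the factor that also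
  occurs in \<open>inner_G_Bop\<close>.\<close>

lemma pohozaev: "- inner f (Bop (Gs f)) = (inner f \<theta>)\<^sup>2 / 2 - \<kappa> * (norm (Gs f))\<^sup>2"
proof -
  have "inner f (G (Gs f)) = (norm (Gs f))\<^sup>2"
    using adjoint[of "Gs f" f] by (simp add: power2_norm_eq_inner inner_commute)
  then have "- inner f (Bop (Gs f)) = - (b - \<alpha> / 4) * (norm (Gs f))\<^sup>2 + ((inner f \<theta>)\<^sup>2 / 2 + (b - 1/2) * (norm (Gs f))\<^sup>2)"
    unfolding inner_Xop_Gs[symmetric] by (simp only: Bop_def inner_add_right inner_scaleR_right minus_add_distrib mult_minus_left)
  also have "\<dots> = (inner f \<theta>)\<^sup>2 / 2 + (- (b - \<alpha> / 4) + (b - 1/2)) * (norm (Gs f))\<^sup>2"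
    by (simp add: algebra_simps)
  also have "- (b - \<alpha> / 4) + (b - 1/2) = - \<kappa>" by (simp add: field_simps)
  finally show ?thesis by simp
qed

section \<open>Compactness\<close>

lemma tail_abs_le: "\<bar>tail p c x\<bar> \<le> norm p * norm (abs_L2 (kern c x))"
  unfolding tail_def by (rule Cauchy_Schwarz_ineq2)

text \<open>A diagonal argument gives convergence of the tails at rational points, equicontinuity
  extends it to all points, and the common majorant of \<open>Gfun_bound\<close> turns pointwise
  into L2 convergence.\<close>

lemma G_compact:
  assumes X: "\<And>n::nat. norm (X n) \<le> M"
  shows "\<exists>r w. strict_mono r \<and> (\<lambda>n. G (X (r n))) \<longlonglongrightarrow> w"
proof -
  have M: "M \<ge> 0" using X[of 0] norm_ge_zero order_trans by blast
  \<comment> \<open>The diagonal argument asks for one bound valid at all points, whereas the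
    natural bound of the tails depends on x; hence the normalization.\<close>
  define N where "N x = M * norm (abs_L2 (kern (-b) x)) + 1" for x
  have N: "N x > 0" for x using M by (simp add: N_def add_nonneg_pos)
  have tN: "\<bar>tail (X n) (-b) x\<bar> \<le> N x" for n x
    using order_trans[OF tail_abs_le[of "X n" "-b" x] mult_right_mono[OF X[of n] norm_ge_zero]] by (simp add: N_def add_increasing2)
  define Q where "Q = \<rat> \<inter> {0<..<1::real}"
  have Qc: "countable Q" unfolding Q_def by (intro countable_Int1 countable_rat)
  obtain r where r: "strict_mono (r :: nat \<Rightarrow> nat)"
    and rl: "\<And>x. x \<in> Q \<Longrightarrow> \<exists>l. (\<lambda>n. tail (X (r n)) (-b) x / N x) \<longlonglongrightarrow> l"
  proof (rule function_convergent_subsequence[OF Qc, of "\<lambda>n x. tail (X n) (-b) x / N x" 1])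
    show "norm (tail (X n) (-b) x / N x) \<le> 1" for n x using tN[of n x] N[of x] by (simp add: field_simps)
  qed auto
  have cau: "Cauchy (\<lambda>n. tail (X (r n)) (-b) x)" if x: "x \<in> {0<..<1}" for x
  proof (rule metric_CauchyI)
    fix e :: real assume e: "e > 0"
    define C where "C = M * (2 + (x/2) powr (-b)) + 1"
    have C: "C > 0" using M by (simp add: C_def add_nonneg_pos add_nonneg_nonneg)
    \<comment> \<open>A rational point so close to x that all tails of the sequence change by at
      most e/3.\<close>
    obtain q where q: "q \<in> \<rat>" "x < q" "q < min 1 (x + (e / (3 * C))\<^sup>2)"
      using Rats_dense_in_real[of x "min 1 (x + (e / (3 * C))\<^sup>2)"] x e C by auto
    have qQ: "q \<in> Q" using q x by (auto simp: Q_def)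
    have close: "\<bar>tail (X n) (-b) x - tail (X n) (-b) q\<bar> \<le> e / 3" for n
    proof -
      have "sqrt \<bar>q - x\<bar> \<le> sqrt ((e / (3 * C))\<^sup>2)" using q by (intro real_sqrt_le_mono) auto
      then have s: "sqrt \<bar>q - x\<bar> \<le> e / (3 * C)" using e C by simp
      have "\<bar>tail (X n) (-b) x - tail (X n) (-b) q\<bar> \<le> norm (X n) * ((2 + (x/2) powr (-b)) * sqrt \<bar>q - x\<bar>)"
        by (rule tail_lipschitz) (use x q in auto)
      also have "\<dots> \<le> M * ((2 + (x/2) powr (-b)) * sqrt \<bar>q - x\<bar>)"
        by (intro mult_right_mono X mult_nonneg_nonneg add_nonneg_nonneg) auto
      also have "\<dots> \<le> C * sqrt \<bar>q - x\<bar>" by (simp add: C_def algebra_simps)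
      also have "\<dots> \<le> C * (e / (3 * C))" using s C by (intro mult_left_mono) auto
      also have "\<dots> = e / 3" using C by simp
      finally show ?thesis .
    qed
    obtain l where "(\<lambda>n. tail (X (r n)) (-b) q / N q) \<longlonglongrightarrow> l" using rl[OF qQ] by blast
    from tendsto_mult_right[OF this, of "N q"] have "(\<lambda>n. tail (X (r n)) (-b) q) \<longlonglongrightarrow> l * N q"
      using N[of q] by simp
    then have cq: "Cauchy (\<lambda>n. tail (X (r n)) (-b) q)" by (rule LIMSEQ_imp_Cauchy)
    have "e / 3 > 0" using e by simp
    from metric_CauchyD[OF cq this] obtain K where K: "\<And>m n. m \<ge> K \<Longrightarrow> n \<ge> K \<Longrightarrow> \<bar>tail (X (r m)) (-b) q - tail (X (r n)) (-b) q\<bar> < e / 3"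
      unfolding dist_real_def by blast
    have "dist (tail (X (r m)) (-b) x) (tail (X (r n)) (-b) x) < e" if "m \<ge> K" "n \<ge> K" for m n
      using close[of "r m"] close[of "r n"] K[OF that] by (simp add: dist_real_def abs_if split: if_splits)
    then show "\<exists>K. \<forall>m\<ge>K. \<forall>n\<ge>K. dist (tail (X (r m)) (-b) x) (tail (X (r n)) (-b) x) < e" by blast
  qed
  define g where "g = (\<lambda>x. lim (\<lambda>n. Gfun (X (r n)) x))"
  have gl: "(\<lambda>n. Gfun (X (r n)) x) \<longlonglongrightarrow> g x" if x: "x \<in> {0<..<1}" for x
  proof -
    obtain l where "(\<lambda>n. tail (X (r n)) (-b) x) \<longlonglongrightarrow> l" using cau[OF x] by (meson Cauchy_convergent_iff convergent_def)
    then have "(\<lambda>n. Gfun (X (r n)) x) \<longlonglongrightarrow> - (x powr \<sigma> * l)" unfolding Gfun_def by (intro tendsto_intros)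
    then show ?thesis unfolding g_def by (simp add: limI)
  qed
  have Gm: "Gfun p \<in> borel_measurable M01" for p using Gfun_square_integrable by (simp add: square_integrable_def)
  have gm: "g \<in> borel_measurable M01"
    by (rule borel_measurable_LIMSEQ_real[of M01 "\<lambda>n. Gfun (X (r n))"]) (use gl Gm in auto)
  let ?w = "\<lambda>x. M\<^sup>2 / \<delta> * x powr (- \<alpha> / 2)"
  have Gb: "(Gfun (X n) x)\<^sup>2 \<le> ?w x" if "x \<in> {0<..<1}" for n x
    using Gfun_bound[OF that, of "X n"] mult_right_mono[OF divide_right_mono[OF power_mono[OF X norm_ge_zero], of \<delta> n 2], of "x powr (- \<alpha> / 2)"] \<alpha>
    by simp
  have gb: "(g x)\<^sup>2 \<le> ?w x" if "x \<in> {0<..<1}" for x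
    by (rule tendsto_upperbound[OF tendsto_power[OF gl[OF that]]]) (use Gb[OF that] in auto)
  have gs: "g \<in> square_integrable {0<..<1}"
    by (rule square_integrable_bound[OF gm bound_integral(1) gb])
  have "(\<lambda>n. LINT x|M01. (Gfun (X (r n)) x - g x)\<^sup>2) \<longlonglongrightarrow> (LINT x|M01. 0)"
  proof (rule integral_dominated_convergence[where w="\<lambda>x. 4 * ?w x"])
    show "(\<lambda>x. (Gfun (X (r n)) x - g x)\<^sup>2) \<in> borel_measurable M01" for n
      by (intro borel_measurable_power borel_measurable_diff Gm gm)
    show "integrable M01 (\<lambda>x. 4 * ?w x)" by (rule integrable_mult_right[OF bound_integral(1)])
    show "AE x in M01. (\<lambda>n. (Gfun (X (r n)) x - g x)\<^sup>2) \<longlonglongrightarrow> 0"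
    proof (rule AE_I2)
      fix x assume "x \<in> space M01"
      then have "(\<lambda>n. (Gfun (X (r n)) x - g x)\<^sup>2) \<longlonglongrightarrow> (g x - g x)\<^sup>2" by (intro tendsto_intros gl) simp
      then show "(\<lambda>n. (Gfun (X (r n)) x - g x)\<^sup>2) \<longlonglongrightarrow> 0" by simp
    qed
    show "AE x in M01. norm ((Gfun (X (r n)) x - g x)\<^sup>2) \<le> 4 * ?w x" for n
    proof (rule AE_I2)
      fix x assume x: "x \<in> space M01"
      have "(u - v)\<^sup>2 \<le> 2 * u\<^sup>2 + 2 * v\<^sup>2" for u v :: real
        using zero_le_power2[of "u + v"] by (simp add: power2_eq_square algebra_simps)
      from this[of "Gfun (X (r n)) x" "g x"] show "norm ((Gfun (X (r n)) x - g x)\<^sup>2) \<le> 4 * ?w x"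
        using Gb[of x "r n"] gb[of x] x by simp
    qed
  qed simp
  moreover have "(norm (G (X (r n)) - abs_L2 g))\<^sup>2 = (LINT x|M01. (Gfun (X (r n)) x - g x)\<^sup>2)" for n
    unfolding G_def abs_L2_arith(2)[OF Gfun_square_integrable gs]
    by (rule norm_abs_L2[OF square_integrable_diff[OF Gfun_square_integrable gs]])
  ultimately have "(\<lambda>n. (norm (G (X (r n)) - abs_L2 g))\<^sup>2) \<longlonglongrightarrow> 0" by simp
  then have "(\<lambda>n. sqrt ((norm (G (X (r n)) - abs_L2 g))\<^sup>2)) \<longlonglongrightarrow> sqrt 0" by (rule tendsto_real_sqrt)
  then have "(\<lambda>n. G (X (r n))) \<longlonglongrightarrow> abs_L2 g" by (simp add: tendsto_norm_zero_iff LIM_zero_iff)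
  with r show ?thesis by blast
qed

lemma eigenbasis:
  obtains E where "orthonormal_basis E" "\<And>e. e \<in> E \<Longrightarrow> \<exists>k>0. G (Gs e) = k *\<^sub>R e"
proof (rule compact_selfadjoint_eigenbasis[of "\<lambda>u. G (Gs u)"])
  show "bounded_linear (\<lambda>u. G (Gs u))"
    by (rule bounded_linear_compose[OF bounded_linear_G bounded_linear_Gs])
  show "inner (G (Gs u)) v = inner u (G (Gs v))" for u v
    by (metis adjoint inner_commute)
  show "0 < inner (G (Gs u)) u" if "u \<noteq> 0" for u
    using that Gs_eq_0[of u] by (auto simp: adjoint)
  show "\<exists>r w. strict_mono r \<and> (\<lambda>n. G (Gs (X (r n)))) \<longlonglongrightarrow> w" if "\<And>n. norm (X n) \<le> 1" for X :: "nat \<Rightarrow> L2"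
  proof (rule G_compact[of "\<lambda>n. Gs (X n)"])
    show "norm (Gs (X n)) \<le> 1 / \<delta>" for n
      using Gs_norm[of "X n"] divide_right_mono[OF that[of n], of \<delta>] \<alpha> by simp
  qed
qed (rule that)

end

section \<open>The wave group in an eigenbasis\<close>

lemma has_vector_derivative_quotient:
  fixes f :: "real \<Rightarrow> complex"
  shows "(f has_vector_derivative d) (at t) \<longleftrightarrow> ((\<lambda>h. (f (t + h) - f t) /\<^sub>R h) \<longlongrightarrow> d) (at 0)"
proof -
  have "(f has_vector_derivative d) (at t) \<longleftrightarrow> ((\<lambda>h. norm (f (t + h) - f t - h *\<^sub>R d) / norm h) \<longlongrightarrow> 0) (at 0)"
    unfolding has_vector_derivative_def has_derivative_at by (simp add: bounded_linear_scaleR_left)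
  also have "\<dots> \<longleftrightarrow> ((\<lambda>h. norm ((f (t + h) - f t) /\<^sub>R h - d)) \<longlongrightarrow> 0) (at 0)"
  proof (rule filterlim_cong[OF refl refl])
    show "\<forall>\<^sub>F h in at 0. norm (f (t + h) - f t - h *\<^sub>R d) / norm h = norm ((f (t + h) - f t) /\<^sub>R h - d)"
      unfolding eventually_at_filter
    proof (intro always_eventually allI impI)
      fix h :: real assume "h \<noteq> 0"
      then have "(f (t + h) - f t) /\<^sub>R h - d = (f (t + h) - f t - h *\<^sub>R d) /\<^sub>R h" by (simp add: scaleR_diff_right)
      then show "norm (f (t + h) - f t - h *\<^sub>R d) / norm h = norm ((f (t + h) - f t) /\<^sub>R h - d)"
        by (simp add: divide_inverse)
    qed
  qed
  also have "\<dots> \<longleftrightarrow> ((\<lambda>h. (f (t + h) - f t) /\<^sub>R h) \<longlongrightarrow> d) (at 0)"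
    by (simp add: tendsto_norm_zero_iff LIM_zero_iff)
  finally show ?thesis .
qed

lemma cmod_cis_diff: "cmod (cis x - 1) \<le> \<bar>x\<bar>"
proof -
  have "(cmod (cis x - 1))\<^sup>2 = 2 - 2 * cos x"
    by (simp add: cmod_power2 power2_diff sin_squared_eq)
  also have "\<dots> = (2 * sin (x/2))\<^sup>2" using cos_double_sin[of "x/2"] by (simp add: power2_eq_square)
  also have "\<dots> \<le> \<bar>x\<bar>\<^sup>2"
    using abs_sin_x_le_abs_x[of "x/2"] by (intro power2_le_iff_abs_le[THEN iffD2]) auto
  finally show ?thesis by (rule power2_le_imp_le) simp
qed

lemma cis_has_vector_derivative:
  "((\<lambda>t. cis (w * t)) has_vector_derivative of_real w * (\<i> * cis (w * t))) (at t within S)"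
proof -
  have "((\<lambda>z. exp (\<i> * (of_real w * z))) has_field_derivative exp (\<i> * (of_real w * of_real t)) * (\<i> * of_real w)) (at (of_real t))"
    by (auto intro!: derivative_eq_intros)
  from has_vector_derivative_real_field[OF this] show ?thesis
    by (simp add: cis_conv_exp mult_ac)
qed

lemma cis_derivative_0: "((\<lambda>h. (cis (- w * h) - 1) / of_real h) \<longlongrightarrow> - \<i> * of_real w) (at (0::real))"
proof -
  have "((\<lambda>h. cis (- w * h)) has_vector_derivative of_real (- w) * (\<i> * cis (- w * 0))) (at 0)"
    by (rule cis_has_vector_derivative)
  then have "((\<lambda>h. (cis (- w * (0 + h)) - cis (- w * 0)) /\<^sub>R h) \<longlongrightarrow> of_real (- w) * (\<i> * cis (- w * 0))) (at 0)"
    by (rule has_vector_derivative_quotient[THEN iffD1])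
  then show ?thesis by (simp add: scaleR_conv_of_real divide_inverse mult.commute)
qed

text \<open>Of the equation only an orthonormal basis and the eigenvalues are retained. The lower
  bound \<open>c0\<close> allows division by the frequencies and makes the operator domain part of
  the form domain.\<close>

locale wave_system = orthonormal_basis E for E :: "'a::{real_inner, complete_space} set" +
  fixes lam :: "'a \<Rightarrow> real" and c0 :: real
  assumes c0: "0 < c0" and lam: "e \<in> E \<Longrightarrow> c0 \<le> lam e"
begin

definition om :: "'a \<Rightarrow> real" where "om e = sqrt (lam e)"

lemma lam_pos: "e \<in> E \<Longrightarrow> 0 < lam e" using lam c0 by (rule order_less_le_trans[rotated])
lemma om_pos: "e \<in> E \<Longrightarrow> 0 < om e" using lam_pos by (simp add: om_def)
lemma om_sq: "e \<in> E \<Longrightarrow> (om e)\<^sup>2 = lam e" using lam_pos[of e] by (simp add: om_def)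

section \<open>Square-summable families of complex coordinates\<close>

text \<open>Families are total functions of which only the values on \<open>E\<close> matter; hence
  the congruence rules below.\<close>

definition l2 :: "('a \<Rightarrow> complex) \<Rightarrow> bool" where "l2 c \<longleftrightarrow> (\<lambda>e. (cmod (c e))\<^sup>2) summable_on E"
definition nrm :: "('a \<Rightarrow> complex) \<Rightarrow> real" where "nrm c = sqrt (infsum (\<lambda>e. (cmod (c e))\<^sup>2) E)"
definition pr :: "('a \<Rightarrow> complex) \<Rightarrow> ('a \<Rightarrow> complex) \<Rightarrow> real" where
  "pr a c = infsum (\<lambda>e. Re (cnj (a e) * c e)) E"

lemma nrm_nonneg: "0 \<le> nrm c" by (simp add: nrm_def infsum_nonneg)
lemma nrm_sq: "(nrm c)\<^sup>2 = infsum (\<lambda>e. (cmod (c e))\<^sup>2) E"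
  by (simp add: nrm_def infsum_nonneg)

lemma l2_cong: "(\<And>e. e \<in> E \<Longrightarrow> a e = c e) \<Longrightarrow> l2 a \<longleftrightarrow> l2 c"
  unfolding l2_def by (rule summable_on_cong) simp
lemma nrm_cong: "(\<And>e. e \<in> E \<Longrightarrow> a e = c e) \<Longrightarrow> nrm a = nrm c"
  unfolding nrm_def by (rule arg_cong[where f=sqrt], rule infsum_cong) simp
lemma pr_cong: "(\<And>e. e \<in> E \<Longrightarrow> a e = a' e) \<Longrightarrow> (\<And>e. e \<in> E \<Longrightarrow> c e = c' e) \<Longrightarrow> pr a c = pr a' c'"
  unfolding pr_def by (rule infsum_cong) simp

lemma l2_comparison:
  assumes "l2 c" "\<And>e. e \<in> E \<Longrightarrow> cmod (a e) \<le> K * cmod (c e)"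
  shows "l2 a"
  unfolding l2_def
proof (rule summable_on_real_comparison)
  show "(\<lambda>e. K\<^sup>2 * (cmod (c e))\<^sup>2) summable_on E"
    using assms(1) unfolding l2_def by (rule summable_on_cmult_right)
  show "\<bar>(cmod (a e))\<^sup>2\<bar> \<le> K\<^sup>2 * (cmod (c e))\<^sup>2" if "e \<in> E" for e
    using power_mono[OF assms(2)[OF that], of 2] by (simp add: power_mult_distrib)
qed

lemma l2_mult: "l2 c \<Longrightarrow> (\<And>e. e \<in> E \<Longrightarrow> cmod (m e) \<le> K) \<Longrightarrow> l2 (\<lambda>e. m e * c e)"
  by (rule l2_comparison[where K=K]) (auto simp: norm_mult intro: mult_right_mono)

lemma l2_add:
  assumes "l2 a" "l2 c" shows "l2 (\<lambda>e. a e + c e)"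
  unfolding l2_def
proof (rule summable_on_real_comparison)
  show "(\<lambda>e. 2 * (cmod (a e))\<^sup>2 + 2 * (cmod (c e))\<^sup>2) summable_on E"
    using assms unfolding l2_def by (intro summable_on_add summable_on_cmult_right)
  show "\<bar>(cmod (a e + c e))\<^sup>2\<bar> \<le> 2 * (cmod (a e))\<^sup>2 + 2 * (cmod (c e))\<^sup>2" for e
  proof -
    have "(cmod (a e + c e))\<^sup>2 \<le> (cmod (a e) + cmod (c e))\<^sup>2" by (intro power_mono norm_triangle_ineq) auto
    also have "\<dots> \<le> 2 * (cmod (a e))\<^sup>2 + 2 * (cmod (c e))\<^sup>2"
      using zero_le_power2[of "cmod (a e) - cmod (c e)"] by (simp add: power2_eq_square algebra_simps)
    finally show ?thesis by simp
  qed
qed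

lemma l2_scale: "l2 c \<Longrightarrow> l2 (\<lambda>e. k * c e)"
  by (rule l2_mult[where K="cmod k"]) auto

lemma l2_diff: "l2 a \<Longrightarrow> l2 c \<Longrightarrow> l2 (\<lambda>e. a e - c e)"
  using l2_add[OF _ l2_scale[of c "-1"], of a] by simp

lemma l2_finite:
  assumes "finite F" "F \<subseteq> E" "\<And>e. e \<in> E - F \<Longrightarrow> c e = 0" shows "l2 c"
proof -
  have "(\<lambda>e. (cmod (c e))\<^sup>2) summable_on F" using assms(1) by simp
  then show ?thesis unfolding l2_def
    by (rule summable_on_cong_neutral[THEN iffD1, rotated -1]) (use assms in auto)
qed

lemma cmod_le_nrm:
  assumes "l2 c" "e \<in> E" shows "cmod (c e) \<le> nrm c"
proof -
  have "(\<Sum>e\<in>{e}. (cmod (c e))\<^sup>2) \<le> infsum (\<lambda>e. (cmod (c e))\<^sup>2) E"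
    using assms unfolding l2_def by (intro finite_sum_le_infsum) auto
  then have "(cmod (c e))\<^sup>2 \<le> (nrm c)\<^sup>2" by (simp add: nrm_sq)
  then show ?thesis by (rule power2_le_imp_le[OF _ nrm_nonneg])
qed

lemma nrm_mono:
  assumes "l2 c" "\<And>e. e \<in> E \<Longrightarrow> cmod (a e) \<le> cmod (c e)" shows "nrm a \<le> nrm c"
proof -
  have "l2 a" by (rule l2_comparison[OF assms(1), of _ 1]) (use assms(2) in simp)
  then show ?thesis using assms unfolding nrm_def l2_def
    by (intro real_sqrt_le_mono infsum_mono power_mono) auto
qed

lemma pr_summable:
  assumes "l2 a" "l2 c" shows "(\<lambda>e. Re (cnj (a e) * c e)) summable_on E"
proof (rule summable_on_real_comparison)
  show "(\<lambda>e. cmod (a e) * cmod (c e)) summable_on E"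
    using assms unfolding l2_def by (rule square_summable_product(1))
  show "\<bar>Re (cnj (a e) * c e)\<bar> \<le> cmod (a e) * cmod (c e)" for e
    using abs_Re_le_cmod[of "cnj (a e) * c e"] by (simp add: norm_mult)
qed

lemma pr_bound:
  assumes "l2 a" "l2 c" shows "\<bar>pr a c\<bar> \<le> nrm a * nrm c"
proof -
  let ?P = "infsum (\<lambda>e. cmod (a e) * cmod (c e)) E"
  have s: "(\<lambda>e. cmod (a e) * cmod (c e)) summable_on E"
    using assms unfolding l2_def by (rule square_summable_product(1))
  have ab: "\<bar>Re (cnj (a e) * c e)\<bar> \<le> cmod (a e) * cmod (c e)" for e
    using abs_Re_le_cmod[of "cnj (a e) * c e"] by (simp add: norm_mult)
  have 1: "pr a c \<le> ?P" unfolding pr_def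
    by (rule infsum_mono[OF pr_summable[OF assms] s]) (use ab in \<open>simp add: abs_le_iff\<close>)
  have 2: "- pr a c \<le> ?P" unfolding pr_def infsum_uminus[symmetric]
    by (rule infsum_mono[OF summable_on_uminus[THEN iffD2, OF pr_summable[OF assms]] s]) (use ab in \<open>simp add: abs_le_iff\<close>)
  have "?P\<^sup>2 \<le> (nrm a * nrm c)\<^sup>2"
    unfolding power_mult_distrib nrm_sq using assms unfolding l2_def by (rule square_summable_product(2))
  then have "?P \<le> nrm a * nrm c" by (rule power2_le_imp_le) (simp add: nrm_nonneg)
  with 1 2 show ?thesis by linarith
qed

lemma pr_add_right:
  assumes "l2 a" "l2 c" "l2 d" shows "pr a (\<lambda>e. c e + d e) = pr a c + pr a d"
proof -
  have "pr a (\<lambda>e. c e + d e) = infsum (\<lambda>e. Re (cnj (a e) * c e) + Re (cnj (a e) * d e)) E"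
    unfolding pr_def by (rule infsum_cong) (simp add: algebra_simps)
  also have "\<dots> = pr a c + pr a d" unfolding pr_def by (intro infsum_add pr_summable assms)
  finally show ?thesis .
qed

lemma pr_add_left:
  assumes "l2 a" "l2 c" "l2 d" shows "pr (\<lambda>e. a e + c e) d = pr a d + pr c d"
proof -
  have "pr (\<lambda>e. a e + c e) d = infsum (\<lambda>e. Re (cnj (a e) * d e) + Re (cnj (c e) * d e)) E"
    unfolding pr_def by (rule infsum_cong) (simp add: algebra_simps)
  also have "\<dots> = pr a d + pr c d" unfolding pr_def by (intro infsum_add pr_summable assms)
  finally show ?thesis .
qed

lemma pr_scale_right:
  assumes "l2 a" "l2 c" shows "pr a (\<lambda>e. of_real k * c e) = k * pr a c"
proof -
  have "pr a (\<lambda>e. of_real k * c e) = infsum (\<lambda>e. k * Re (cnj (a e) * c e)) E"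
    unfolding pr_def by (rule infsum_cong) (simp add: algebra_simps)
  also have "\<dots> = k * pr a c" unfolding pr_def by (intro infsum_cmult_right pr_summable assms)
  finally show ?thesis .
qed

lemma nrm_triangle:
  assumes "l2 a" "l2 c" shows "nrm (\<lambda>e. a e + c e) \<le> nrm a + nrm c"
proof -
  have s: "(\<lambda>e. (cmod (a e))\<^sup>2) summable_on E" "(\<lambda>e. (cmod (c e))\<^sup>2) summable_on E" using assms by (auto simp: l2_def)
  have "(nrm (\<lambda>e. a e + c e))\<^sup>2 = infsum (\<lambda>e. ((cmod (a e))\<^sup>2 + (cmod (c e))\<^sup>2) + 2 * Re (cnj (a e) * c e)) E"
    unfolding nrm_sq by (rule infsum_cong, simp only: cmod_power2) (simp add: power2_eq_square algebra_simps)
  also have "\<dots> = (nrm a)\<^sup>2 + (nrm c)\<^sup>2 + 2 * pr a c"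
    unfolding infsum_add[OF summable_on_add[OF s] summable_on_cmult_right[OF pr_summable[OF assms]]] infsum_add[OF s] nrm_sq pr_def
    by (simp only: infsum_cmult_right[OF pr_summable[OF assms]])
  also have "\<dots> \<le> (nrm a + nrm c)\<^sup>2" using pr_bound[OF assms] by (simp add: power2_sum abs_le_iff)
  finally show ?thesis by (rule power2_le_imp_le) (simp add: nrm_nonneg)
qed

lemma nrm_tendsto_0:
  assumes c: "l2 c" and le: "\<And>h e. e \<in> E \<Longrightarrow> cmod (a h e) \<le> K * cmod (c e)"
    and lim: "\<And>e. e \<in> E \<Longrightarrow> ((\<lambda>h. a h e) \<longlongrightarrow> 0) Fl"
  shows "((\<lambda>h. nrm (a h)) \<longlongrightarrow> 0) Fl"
proof -
  have "((\<lambda>h. infsum (\<lambda>e. (cmod (a h e))\<^sup>2) E) \<longlongrightarrow> 0) Fl"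
  proof (rule infsum_dominated_tendsto_0)
    show "(\<lambda>e. K\<^sup>2 * (cmod (c e))\<^sup>2) summable_on E"
      using c unfolding l2_def by (rule summable_on_cmult_right)
    show "\<bar>(cmod (a h e))\<^sup>2\<bar> \<le> K\<^sup>2 * (cmod (c e))\<^sup>2" if "e \<in> E" for h e
      using power_mono[OF le[OF that], of h 2] by (simp add: power_mult_distrib)
    show "((\<lambda>h. (cmod (a h e))\<^sup>2) \<longlongrightarrow> 0) Fl" if "e \<in> E" for e
      using tendsto_power[OF tendsto_norm[OF lim[OF that]], of 2] by simp
  qed
  from tendsto_real_sqrt[OF this] show ?thesis unfolding nrm_def by simp
qed

section \<open>The group in coordinates and its generator\<close>

text \<open>\<open>V\<close> and \<open>D\<close> are the form domain and the operator domain,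
  described by weighted coefficients; they are identified with \<open>H1\<close> and
  \<open>op_D\<close> later.\<close>

definition V :: "'a set" where "V = {u. (\<lambda>e. lam e * (inner u e)\<^sup>2) summable_on E}"
definition D :: "'a set" where "D = {u. (\<lambda>e. (lam e)\<^sup>2 * (inner u e)\<^sup>2) summable_on E}"
definition X :: "('a \<times> 'a) set" where "X = V \<times> UNIV"
definition synth :: "('a \<Rightarrow> real) \<Rightarrow> 'a" where "synth c = (THE u. \<forall>e\<in>E. inner u e = c e)"
definition Aop :: "'a \<Rightarrow> 'a" where "Aop u = synth (\<lambda>e. - lam e * inner u e)"
definition coef :: "'a \<times> 'a \<Rightarrow> 'a \<Rightarrow> complex" where
  "coef U e = Complex (om e * inner (fst U) e) (inner (snd U) e)"
text \<open>In the complex coordinates \<open>coef\<close> the energy norm is the norm of \<open>\<ell>\<^sup>2\<close> and the wave group multiplies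
  the coordinate of \<open>e\<close> by \<open>cis (- om e * t)\<close>.\<close>

definition mk :: "('a \<Rightarrow> complex) \<Rightarrow> 'a \<times> 'a" where
  "mk c = (synth (\<lambda>e. Re (c e) / om e), synth (\<lambda>e. Im (c e)))"
definition EN :: "'a \<times> 'a \<Rightarrow> real" where "EN U = nrm (coef U)"
definition wgroup :: "real \<Rightarrow> 'a \<times> 'a \<Rightarrow> 'a \<times> 'a" where
  "wgroup t U = mk (\<lambda>e. cis (- om e * t) * coef U e)"
definition gen :: "'a \<times> 'a \<Rightarrow> 'a \<times> 'a" where "gen = (\<lambda>(u, v). (v, Aop u))"

lemma synth:
  assumes "(\<lambda>e. (c e)\<^sup>2) summable_on E" "e \<in> E" shows "inner (synth c) e = c e"
  using theI'[OF synthesis_coeff[OF assms(1)]] assms(2) unfolding synth_def by blast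

lemma X_iff: "U \<in> X \<longleftrightarrow> l2 (coef U)"
proof -
  have im: "(\<lambda>e. (inner (snd U) e)\<^sup>2) summable_on E" by (rule coeff_summable)
  have eq: "(cmod (coef U e))\<^sup>2 = lam e * (inner (fst U) e)\<^sup>2 + (inner (snd U) e)\<^sup>2" if "e \<in> E" for e
    using that by (simp add: coef_def cmod_power2 power_mult_distrib om_sq)
  show ?thesis
  proof
    assume "U \<in> X"
    then have "(\<lambda>e. lam e * (inner (fst U) e)\<^sup>2 + (inner (snd U) e)\<^sup>2) summable_on E"
      by (intro summable_on_add im) (auto simp: X_def V_def)
    then show "l2 (coef U)" unfolding l2_def using eq by (subst summable_on_cong) auto
  next
    assume "l2 (coef U)"
    then have "(\<lambda>e. lam e * (inner (fst U) e)\<^sup>2) summable_on E"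
      unfolding l2_def by (rule summable_on_real_comparison) (use eq lam_pos in \<open>auto simp: less_imp_le\<close>)
    then show "U \<in> X" by (cases U) (simp add: X_def V_def)
  qed
qed

lemma X_eqI: "(\<And>e. e \<in> E \<Longrightarrow> coef U e = coef U' e) \<Longrightarrow> U = U'"
proof (rule prod_eqI)
  assume h: "\<And>e. e \<in> E \<Longrightarrow> coef U e = coef U' e"
  show "fst U = fst U'" by (rule eqI) (use h om_pos in \<open>force simp: coef_def\<close>)
  show "snd U = snd U'" by (rule eqI) (use h in \<open>simp add: coef_def\<close>)
qed

lemma coef_add: "coef (U + U') e = coef U e + coef U' e"
  and coef_diff: "coef (U - U') e = coef U e - coef U' e"
  and coef_scale: "coef (k *\<^sub>R U) e = of_real k * coef U e"
  and coef_0: "coef 0 e = 0"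
  by (auto simp: coef_def complex_eq_iff inner_add_left inner_diff_left algebra_simps)

lemma coef_mk:
  assumes c: "l2 c" and e: "e \<in> E" shows "coef (mk c) e = c e"
proof -
  have "(\<lambda>e. (Im (c e))\<^sup>2) summable_on E"
    using c unfolding l2_def by (rule summable_on_real_comparison) (simp add: cmod_power2)
  moreover have "(\<lambda>e. (Re (c e) / om e)\<^sup>2) summable_on E"
  proof (rule summable_on_real_comparison)
    show "(\<lambda>e. 1 / c0 * (cmod (c e))\<^sup>2) summable_on E" using c unfolding l2_def by (rule summable_on_cmult_right)
    show "\<bar>(Re (c e) / om e)\<^sup>2\<bar> \<le> 1 / c0 * (cmod (c e))\<^sup>2" if "e \<in> E" for e
    proof -
      have "(Re (c e))\<^sup>2 / lam e \<le> (cmod (c e))\<^sup>2 / c0"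
        using lam[OF that] c0 by (intro frac_le) (auto simp: cmod_power2)
      then show ?thesis using that lam_pos[OF that] by (simp add: power_divide om_sq)
    qed
  qed
  ultimately show ?thesis using synth e om_pos[OF e] by (simp add: coef_def mk_def complex_eq_iff)
qed

lemma mk_X: "l2 c \<Longrightarrow> mk c \<in> X"
  unfolding X_iff using l2_cong[of "coef (mk c)" c] coef_mk by blast

lemma wgroup_l2: "U \<in> X \<Longrightarrow> l2 (\<lambda>e. cis (- om e * t) * coef U e)"
  unfolding X_iff by (rule l2_mult[where K=1]) auto

lemma wgroup_X: "U \<in> X \<Longrightarrow> wgroup t U \<in> X"
  unfolding wgroup_def by (rule mk_X) (rule wgroup_l2)

lemma coef_wgroup: "U \<in> X \<Longrightarrow> e \<in> E \<Longrightarrow> coef (wgroup t U) e = cis (- om e * t) * coef U e"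
  unfolding wgroup_def by (rule coef_mk) (rule wgroup_l2)

lemma X_add: "U \<in> X \<Longrightarrow> U' \<in> X \<Longrightarrow> U + U' \<in> X"
  and X_diff: "U \<in> X \<Longrightarrow> U' \<in> X \<Longrightarrow> U - U' \<in> X"
  and X_scale: "U \<in> X \<Longrightarrow> k *\<^sub>R U \<in> X"
  and X_0: "0 \<in> X"
  unfolding X_iff coef_add[abs_def] coef_diff[abs_def] coef_scale[abs_def]
  by (auto simp: coef_add coef_diff coef_scale coef_0 intro: l2_add l2_diff l2_scale l2_finite[of "{}"])

lemma EN_wgroup: "U \<in> X \<Longrightarrow> EN (wgroup t U) = EN U"
  unfolding EN_def nrm_def by (rule arg_cong[where f=sqrt], rule infsum_cong) (simp add: coef_wgroup norm_mult)

lemma EN_nonneg: "0 \<le> EN U" by (simp add: EN_def nrm_nonneg)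

lemma DV_iff: "U \<in> D \<times> V \<longleftrightarrow> l2 (\<lambda>e. om e * coef U e)"
proof -
  have eq: "(cmod (om e * coef U e))\<^sup>2 = (lam e)\<^sup>2 * (inner (fst U) e)\<^sup>2 + lam e * (inner (snd U) e)\<^sup>2" if "e \<in> E" for e
    using that by (simp add: coef_def norm_mult power_mult_distrib cmod_power2 om_sq algebra_simps)
      (simp add: power2_eq_square om_sq[unfolded power2_eq_square] algebra_simps)
  show ?thesis
  proof
    assume "U \<in> D \<times> V"
    then have "(\<lambda>e. (lam e)\<^sup>2 * (inner (fst U) e)\<^sup>2 + lam e * (inner (snd U) e)\<^sup>2) summable_on E"
      by (intro summable_on_add) (auto simp: D_def V_def)
    then show "l2 (\<lambda>e. om e * coef U e)" unfolding l2_def using eq by (subst summable_on_cong) auto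
  next
    assume l: "l2 (\<lambda>e. om e * coef U e)"
    have "(\<lambda>e. (lam e)\<^sup>2 * (inner (fst U) e)\<^sup>2) summable_on E"
      using l unfolding l2_def by (rule summable_on_real_comparison) (use eq lam_pos in \<open>auto simp: less_imp_le\<close>)
    moreover have "(\<lambda>e. lam e * (inner (snd U) e)\<^sup>2) summable_on E"
      using l unfolding l2_def by (rule summable_on_real_comparison) (use eq lam_pos in \<open>auto simp: less_imp_le\<close>)
    ultimately show "U \<in> D \<times> V" by (cases U) (simp add: D_def V_def)
  qed
qed

lemma D_sub_V: "D \<subseteq> V"
proof
  fix u assume "u \<in> D"
  then have "(\<lambda>e. 1 / c0 * ((lam e)\<^sup>2 * (inner u e)\<^sup>2)) summable_on E"
    unfolding D_def by (intro summable_on_cmult_right) auto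
  then have "(\<lambda>e. lam e * (inner u e)\<^sup>2) summable_on E"
  proof (rule summable_on_real_comparison)
    fix e assume e: "e \<in> E"
    have "c0 * lam e \<le> (lam e)\<^sup>2" unfolding power2_eq_square using lam[OF e] lam_pos[OF e] by (intro mult_right_mono) auto
    then have "lam e \<le> (lam e)\<^sup>2 / c0" using c0 by (simp add: field_simps)
    then have "lam e * (inner u e)\<^sup>2 \<le> (lam e)\<^sup>2 / c0 * (inner u e)\<^sup>2" by (intro mult_right_mono) auto
    then show "\<bar>lam e * (inner u e)\<^sup>2\<bar> \<le> 1 / c0 * ((lam e)\<^sup>2 * (inner u e)\<^sup>2)"
      using lam_pos[OF e] by (simp add: abs_mult)
  qed
  then show "u \<in> V" by (simp add: V_def)
qed

lemma DV_X: "U \<in> D \<times> V \<Longrightarrow> U \<in> X"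
  using D_sub_V by (auto simp: X_def)

lemma inner_Aop: "u \<in> D \<Longrightarrow> e \<in> E \<Longrightarrow> inner (Aop u) e = - lam e * inner u e"
  unfolding Aop_def by (rule synth) (auto simp: D_def power_mult_distrib)

lemma coef_gen:
  assumes "U \<in> D \<times> V" "e \<in> E" shows "coef (gen U) e = - \<i> * (om e * coef U e)"
  using assms om_sq[OF assms(2)] by (auto simp: gen_def coef_def inner_Aop complex_eq_iff power2_eq_square)

lemma gen_X: assumes U: "U \<in> D \<times> V" shows "gen U \<in> X"
proof -
  have "l2 (\<lambda>e. - \<i> * (om e * coef U e))" by (rule l2_scale) (use U in \<open>simp add: DV_iff\<close>)
  then show ?thesis unfolding X_iff using l2_cong[OF coef_gen[OF U]] by simp
qed

text \<open>Norm convergence of the difference quotient forces each coordinate of the limit to be -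
  i times the frequency times that of U, and membership of the limit in \<open>X\<close> then puts U
  into the domain. Conversely, on the domain the quotients are dominated by the weighted
  coordinates.\<close>

lemma wgroup_generates: "generates_C0_group X EN (D \<times> V) gen wgroup"
  unfolding generates_C0_group_def C0_group_def
proof (intro conjI allI ballI)
  fix s t k :: real and U U' assume U: "U \<in> X"
  show "wgroup t U \<in> X" by (rule wgroup_X[OF U])
  show "wgroup t (k *\<^sub>R U) = k *\<^sub>R wgroup t U"
    by (rule X_eqI) (simp add: coef_wgroup X_scale U coef_scale)
  show "wgroup 0 U = U" by (rule X_eqI) (simp add: coef_wgroup U)
  show "wgroup (s + t) U = wgroup s (wgroup t U)"
  proof (rule X_eqI)
    fix e assume e: "e \<in> E"
    have "cis (- om e * (s + t)) = cis (- om e * s) * cis (- om e * t)" by (simp add: cis_mult distrib_left)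
    then show "coef (wgroup (s + t) U) e = coef (wgroup s (wgroup t U)) e"
      by (simp add: coef_wgroup U wgroup_X e mult.assoc)
  qed
  show "((\<lambda>t. EN (wgroup t U - U)) \<longlongrightarrow> 0) (at 0)"
  proof -
    have "((\<lambda>t. nrm (\<lambda>e. (cis (- om e * t) - 1) * coef U e)) \<longlongrightarrow> 0) (at 0)"
    proof (rule nrm_tendsto_0[where c="coef U" and K=2])
      show "l2 (coef U)" using U by (simp add: X_iff)
      show "cmod ((cis (- om e * h) - 1) * coef U e) \<le> 2 * cmod (coef U e)" for e h
        using norm_triangle_ineq4[of "cis (- om e * h)" 1] by (auto simp: norm_mult intro!: mult_right_mono)
      show "((\<lambda>h. (cis (- om e * h) - 1) * coef U e) \<longlongrightarrow> 0) (at 0)" for e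
      proof -
        have "((\<lambda>h. (cis (- om e * h) - 1) * coef U e) \<longlongrightarrow> (cis (- om e * 0) - 1) * coef U e) (at 0)"
          by (intro tendsto_intros)
        then show ?thesis by simp
      qed
    qed
    also have "(\<lambda>t. nrm (\<lambda>e. (cis (- om e * t) - 1) * coef U e)) = (\<lambda>t. EN (wgroup t U - U))"
      unfolding EN_def by (intro ext nrm_cong) (simp add: coef_diff coef_wgroup U algebra_simps)
    finally show ?thesis .
  qed
  fix U' assume U': "U' \<in> X"
  show "wgroup t (U + U') = wgroup t U + wgroup t U'"
    by (rule X_eqI) (simp add: coef_wgroup X_add U U' coef_add distrib_left)
next
  fix t show "\<exists>C. \<forall>U\<in>X. EN (wgroup t U) \<le> C * EN U"
    by (rule exI[of _ 1]) (simp add: EN_wgroup)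
next
  fix U W assume U: "U \<in> X" and W: "W \<in> X"
  define q where "q h e = ((cis (- om e * h) - 1) / of_real h) * coef U e - coef W e" for h e
  have cq: "coef ((wgroup h U - U) /\<^sub>R h - W) e = q h e" if "e \<in> E" for h e
    unfolding coef_diff coef_scale coef_wgroup[OF U that] q_def by (simp add: divide_inverse algebra_simps)
  have q: "EN ((wgroup h U - U) /\<^sub>R h - W) = nrm (q h)" for h
    unfolding EN_def by (rule nrm_cong) (rule cq)
  have lq: "l2 (q h)" for h
  proof -
    have "(wgroup h U - U) /\<^sub>R h - W \<in> X" by (intro X_diff X_scale wgroup_X U W)
    then show ?thesis unfolding X_iff using l2_cong[of "coef ((wgroup h U - U) /\<^sub>R h - W)" "q h"] cq by blast
  qed
  have ql: "((\<lambda>h. q h e) \<longlongrightarrow> - \<i> * (om e * coef U e) - coef W e) (at 0)" for e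
  proof -
    have "((\<lambda>h. q h e) \<longlongrightarrow> (- \<i> * of_real (om e)) * coef U e - coef W e) (at 0)"
      unfolding q_def by (intro tendsto_intros cis_derivative_0)
    then show ?thesis by (simp add: mult.assoc)
  qed
  show "((\<lambda>h. EN ((wgroup h U - U) /\<^sub>R h - W)) \<longlongrightarrow> 0) (at 0) \<longleftrightarrow> U \<in> D \<times> V \<and> W = gen U"
    unfolding q
  proof
    assume lim: "((\<lambda>h. nrm (q h)) \<longlongrightarrow> 0) (at 0)"
    have W_eq: "coef W e = - \<i> * (om e * coef U e)" if e: "e \<in> E" for e
    proof -
      have "((\<lambda>h. q h e) \<longlongrightarrow> 0) (at 0)"
        by (rule Lim_null_comparison[OF _ lim]) (use cmod_le_nrm[OF lq e] in auto)
      from tendsto_unique[OF _ ql this] show ?thesis by simp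
    qed
    have "l2 (\<lambda>e. \<i> * coef W e)" by (rule l2_scale) (use W in \<open>simp add: X_iff\<close>)
    then have "l2 (\<lambda>e. om e * coef U e)" by (subst (asm) l2_cong[of _ "\<lambda>e. om e * coef U e"]) (auto simp: W_eq)
    then have U': "U \<in> D \<times> V" by (simp add: DV_iff)
    moreover have "W = gen U" by (rule X_eqI) (simp only: W_eq coef_gen[OF U'])
    ultimately show "U \<in> D \<times> V \<and> W = gen U" by blast
  next
    assume "U \<in> D \<times> V \<and> W = gen U"
    then have U': "U \<in> D \<times> V" and Wg: "W = gen U" by auto
    show "((\<lambda>h. nrm (q h)) \<longlongrightarrow> 0) (at 0)"
    proof (rule nrm_tendsto_0[where c="\<lambda>e. om e * coef U e" and K=2])
      show "l2 (\<lambda>e. om e * coef U e)" using U' by (simp add: DV_iff)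
      fix e assume e: "e \<in> E"
      have cW: "coef W e = - \<i> * (om e * coef U e)" unfolding Wg by (rule coef_gen[OF U' e])
      show "((\<lambda>h. q h e) \<longlongrightarrow> 0) (at 0)" using ql[of e] by (simp add: cW)
      show "cmod (q h e) \<le> 2 * cmod (om e * coef U e)" for h
      proof -
        \<comment> \<open>A chord is at most its arc. The value h = 0 is covered because division by
          zero gives zero.\<close>
        have "cmod ((cis (- om e * h) - 1) / of_real h) \<le> om e"
        proof (cases "h = 0")
          case False
          have "cmod (cis (- om e * h) - 1) \<le> om e * \<bar>h\<bar>"
            using cmod_cis_diff[of "- om e * h"] om_pos[OF e] by (simp add: abs_mult)
          then show ?thesis using False by (simp add: norm_divide field_simps)
        qed (use om_pos[OF e] in simp)
        then have "cmod (((cis (- om e * h) - 1) / of_real h) * coef U e) \<le> om e * cmod (coef U e)"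
          unfolding norm_mult by (rule mult_right_mono) simp
        moreover have "cmod (coef W e) = om e * cmod (coef U e)" "cmod (om e * coef U e) = om e * cmod (coef U e)"
          using om_pos[OF e] by (simp_all add: cW norm_mult)
        ultimately show ?thesis unfolding q_def using norm_triangle_ineq4 order_trans by (smt (verit))
      qed
    qed
  qed
qed

section \<open>Spectral truncation and uniqueness of the group\<close>

definition restr :: "'a set \<Rightarrow> 'a \<times> 'a \<Rightarrow> 'a \<times> 'a" where
  "restr F U = mk (\<lambda>e. if e \<in> F then coef U e else 0)"

lemma coef_restr:
  assumes "finite F" "F \<subseteq> E" "e \<in> E" shows "coef (restr F U) e = (if e \<in> F then coef U e else 0)"
  unfolding restr_def by (rule coef_mk[OF _ assms(3)], rule l2_finite[OF assms(1,2)]) auto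

lemma restr_DV: assumes "finite F" "F \<subseteq> E" shows "restr F U \<in> D \<times> V"
proof -
  have "l2 (\<lambda>e. om e * coef (restr F U) e)"
    by (rule l2_finite[OF assms]) (simp add: coef_restr[OF assms])
  then show ?thesis by (simp add: DV_iff)
qed

lemma restr_X: "finite F \<Longrightarrow> F \<subseteq> E \<Longrightarrow> restr F U \<in> X"
  by (rule DV_X[OF restr_DV])

lemma nrm_restr_tendsto:
  assumes c: "l2 c"
  shows "((\<lambda>F. nrm (\<lambda>e. if e \<in> F then 0 else c e)) \<longlongrightarrow> 0) (finite_subsets_at_top E)"
proof (rule nrm_tendsto_0[OF c, of _ 1])
  show "((\<lambda>F. if e \<in> F then 0 else c e) \<longlongrightarrow> 0) (finite_subsets_at_top E)" if "e \<in> E" for e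
    by (rule tendsto_eventually)
      (use that in \<open>auto simp: eventually_finite_subsets_at_top intro!: exI[of _ "{e}"]\<close>)
qed auto

lemma EN_restr_tendsto:
  assumes U: "U \<in> X"
  shows "((\<lambda>F. EN (U - restr F U)) \<longlongrightarrow> 0) (finite_subsets_at_top E)"
proof (rule Lim_transform_eventually[OF nrm_restr_tendsto[of "coef U"]])
  show "l2 (coef U)" using U by (simp add: X_iff)
  show "\<forall>\<^sub>F F in finite_subsets_at_top E. nrm (\<lambda>e. if e \<in> F then 0 else coef U e) = EN (U - restr F U)"
    by (rule eventually_finite_subsets_at_top_weakI)
      (auto simp: EN_def coef_diff coef_restr intro!: nrm_cong)
qed

lemma cmod_coef_le: "U \<in> X \<Longrightarrow> e \<in> E \<Longrightarrow> cmod (coef U e) \<le> EN U"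
  unfolding EN_def X_iff by (rule cmod_le_nrm)

text \<open>Evaluation of a coordinate is bounded by the energy norm, so each coordinate of an orbit
  solves c' = - i om c. This matters because \<open>backward_solution\<close> admits any group with
  the prescribed generator.\<close>

lemma generator_unique_DV:
  assumes S: "generates_C0_group X EN (D \<times> V) gen S" and U: "U \<in> D \<times> V" and e: "e \<in> E"
  shows "coef (S t U) e = cis (- om e * t) * coef U e"
proof -
  note S' = S[unfolded generates_C0_group_def C0_group_def]
  have SX: "\<And>t U. U \<in> X \<Longrightarrow> S t U \<in> X" and Sadd: "\<And>t U W. U \<in> X \<Longrightarrow> W \<in> X \<Longrightarrow> S t (U + W) = S t U + S t W"
    and Ssc: "\<And>t c U. U \<in> X \<Longrightarrow> S t (c *\<^sub>R U) = c *\<^sub>R S t U"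
    and Sbd: "\<And>t. \<exists>C. \<forall>U\<in>X. EN (S t U) \<le> C * EN U" and S0: "\<And>U. U \<in> X \<Longrightarrow> S 0 U = U"
    and Sgr: "\<And>s t U. U \<in> X \<Longrightarrow> S (s + t) U = S s (S t U)"
    and Sgen: "\<And>U W. U \<in> X \<Longrightarrow> W \<in> X \<Longrightarrow> ((\<lambda>h. EN ((S h U - U) /\<^sub>R h - W)) \<longlongrightarrow> 0) (at 0) \<longleftrightarrow> U \<in> D \<times> V \<and> W = gen U"
    using S' by blast+
  have UX: "U \<in> X" by (rule DV_X[OF U])
  have gX: "gen U \<in> X" by (rule gen_X[OF U])
  have Sdiff: "S t (A - B) = S t A - S t B" if "A \<in> X" "B \<in> X" for t A B
    using Sadd[OF that(1) X_scale[OF that(2), of "-1"], of t] Ssc[OF that(2), of t "-1"] by simp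
  have lim: "((\<lambda>h. EN ((S h (S t U) - S t U) /\<^sub>R h - S t (gen U))) \<longlongrightarrow> 0) (at 0)" for t
  proof -
    obtain C where C: "\<And>U. U \<in> X \<Longrightarrow> EN (S t U) \<le> C * EN U" using Sbd by blast
    have l0: "((\<lambda>h. C * EN ((S h U - U) /\<^sub>R h - gen U)) \<longlongrightarrow> 0) (at 0)"
      using tendsto_mult_right_zero[OF Sgen[OF UX gX, THEN iffD2], of C] U by simp
    have "EN ((S h (S t U) - S t U) /\<^sub>R h - S t (gen U)) \<le> C * EN ((S h U - U) /\<^sub>R h - gen U)" for h
    proof -
      have "S h (S t U) = S t (S h U)" using Sgr[OF UX, of h t] Sgr[OF UX, of t h] by (simp add: add.commute)
      then have "(S h (S t U) - S t U) /\<^sub>R h - S t (gen U) = S t ((S h U - U) /\<^sub>R h - gen U)"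
        by (simp add: Sdiff Ssc X_diff X_scale SX UX gX)
      then show ?thesis using C[of "(S h U - U) /\<^sub>R h - gen U"] by (simp add: X_diff X_scale SX UX gX)
    qed
    then show ?thesis
      by (intro Lim_null_comparison[OF _ l0]) (auto simp: EN_nonneg)
  qed
  have DV: "S t U \<in> D \<times> V" "S t (gen U) = gen (S t U)" for t
    using Sgen[OF SX[OF UX] SX[OF gX], of t t] lim[of t] by auto
  define c where "c t = coef (S t U) e" for t
  have cd: "(c has_vector_derivative - \<i> * (om e * c t)) (at t)" for t
  proof -
    have "((\<lambda>h. (c (t + h) - c t) /\<^sub>R h - (- \<i> * (om e * c t))) \<longlongrightarrow> 0) (at 0)"
    proof (rule Lim_null_comparison[OF always_eventually[OF allI] lim[of t]])
      fix h
      have "(c (t + h) - c t) /\<^sub>R h - (- \<i> * (om e * c t)) = coef ((S h (S t U) - S t U) /\<^sub>R h - S t (gen U)) e"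
        unfolding c_def DV(2) coef_diff coef_scale coef_gen[OF DV(1) e] Sgr[OF UX, of h t, symmetric]
        by (simp add: add.commute scaleR_conv_of_real)
      also have "cmod \<dots> \<le> EN ((S h (S t U) - S t U) /\<^sub>R h - S t (gen U))"
        by (intro cmod_coef_le e X_diff X_scale SX UX gX)
      finally show "norm ((c (t + h) - c t) /\<^sub>R h - (- \<i> * (om e * c t))) \<le> EN ((S h (S t U) - S t U) /\<^sub>R h - S t (gen U))" .
    qed
    then have "((\<lambda>h. (c (t + h) - c t) /\<^sub>R h) \<longlongrightarrow> - \<i> * (om e * c t)) (at 0)" by (rule LIM_zero_cancel)
    then show ?thesis by (rule has_vector_derivative_quotient[THEN iffD2])
  qed
  define w where "w t = cis (om e * t) * c t" for t
  have "(w has_vector_derivative 0) (at t)" for t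
  proof -
    from has_vector_derivative_mult[OF cis_has_vector_derivative cd] show ?thesis
      unfolding w_def by (rule has_vector_derivative_eq_rhs) (simp add: scaleR_conv_of_real algebra_simps)
  qed
  then obtain k where k: "\<And>t. w t = k"
    using has_vector_derivative_zero_constant[of UNIV w] by auto
  have "c t = cis (- om e * t) * w t" by (simp add: w_def mult.assoc[symmetric] cis_mult)
  also have "w t = c 0" using k[of t] k[of 0] by (simp add: w_def)
  finally show ?thesis by (simp add: c_def S0 UX)
qed

text \<open>Boundedness of \<open>S t\<close> extends the coordinate formula from truncations, which
  lie in the domain, to all of \<open>X\<close>.\<close>

lemma generator_unique:
  assumes S: "generates_C0_group X EN (D \<times> V) gen S" and U: "U \<in> X"
  shows "S t U = wgroup t U"
proof (rule X_eqI)
  fix e assume e: "e \<in> E"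
  note S' = S[unfolded generates_C0_group_def C0_group_def]
  have SX: "\<And>t U. U \<in> X \<Longrightarrow> S t U \<in> X" and Sadd: "\<And>t U W. U \<in> X \<Longrightarrow> W \<in> X \<Longrightarrow> S t (U + W) = S t U + S t W"
    using S' by blast+
  have "\<forall>t. \<exists>C. \<forall>U\<in>X. EN (S t U) \<le> C * EN U" using S' by (elim conjE)
  then obtain C where C: "\<And>U. U \<in> X \<Longrightarrow> EN (S t U) \<le> C * EN U" by blast
  have le: "cmod (coef (S t U) e - coef (wgroup t U) e) \<le> (C + 1) * EN (U - restr F U)" if F: "finite F" "F \<subseteq> E" for F
  proof -
    note rX = restr_X[OF F, of U]
    have dX: "U - restr F U \<in> X" by (rule X_diff[OF U rX])
    have "S t U = S t (U - restr F U) + S t (restr F U)" using Sadd[OF dX rX, of t] by simp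
    then have "coef (S t U) e - coef (wgroup t U) e
        = coef (S t (U - restr F U)) e - cis (- om e * t) * coef (U - restr F U) e"
      using generator_unique_DV[OF S restr_DV[OF F] e]
      by (simp add: coef_add coef_wgroup U e coef_diff algebra_simps)
    also have "cmod \<dots> \<le> cmod (coef (S t (U - restr F U)) e) + cmod (cis (- om e * t) * coef (U - restr F U) e)"
      by (rule norm_triangle_ineq4)
    also have "\<dots> \<le> C * EN (U - restr F U) + EN (U - restr F U)"
      using order_trans[OF cmod_coef_le[OF SX[OF dX] e] C[OF dX]] cmod_coef_le[OF dX e]
      by (intro add_mono) (auto simp: norm_mult)
    finally show ?thesis by (simp add: algebra_simps)
  qed
  have "((\<lambda>F. (C + 1) * EN (U - restr F U)) \<longlongrightarrow> 0) (finite_subsets_at_top E)"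
    by (rule tendsto_mult_right_zero[OF EN_restr_tendsto[OF U]])
  then have "cmod (coef (S t U) e - coef (wgroup t U) e) \<le> 0"
    by (rule tendsto_lowerbound) (auto intro!: eventually_finite_subsets_at_top_weakI le)
  then show "coef (S t U) e = coef (wgroup t U) e" by simp
qed

end

section \<open>Square integrable functions on intervals\<close>

lemma square_integrable_cauchy_schwarz:
  assumes f: "f \<in> square_integrable S" and g: "g \<in> square_integrable S"
  shows "(LINT x|lebesgue_on S. f x * g x)\<^sup>2 \<le> (LINT x|lebesgue_on S. (f x)\<^sup>2) * (LINT x|lebesgue_on S. (g x)\<^sup>2)"
proof -
  define A B C where "A = (LINT x|lebesgue_on S. (f x)\<^sup>2)" and "B = (LINT x|lebesgue_on S. f x * g x)"
    and "C = (LINT x|lebesgue_on S. (g x)\<^sup>2)"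
  have i: "integrable (lebesgue_on S) (\<lambda>x. (f x)\<^sup>2)" "integrable (lebesgue_on S) (\<lambda>x. (g x)\<^sup>2)"
    "integrable (lebesgue_on S) (\<lambda>x. f x * g x)"
    using f g square_integrable_mult[OF f g] by (auto simp: square_integrable_def)
  have q: "0 \<le> A + 2 * t * B + t\<^sup>2 * C" for t
  proof -
    have "0 \<le> (LINT x|lebesgue_on S. (f x + t * g x)\<^sup>2)" by simp
    also have "\<dots> = (LINT x|lebesgue_on S. (f x)\<^sup>2 + (2 * t) * (f x * g x) + t\<^sup>2 * (g x)\<^sup>2)"
      by (rule Bochner_Integration.integral_cong) (auto simp: power2_eq_square algebra_simps)
    also have "\<dots> = A + 2 * t * B + t\<^sup>2 * C" unfolding A_def B_def C_def using i by simp
    finally show ?thesis .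
  qed
  have C: "0 \<le> C" by (simp add: C_def)
  show ?thesis
  proof (cases "C = 0")
    case True
    have "B = 0"
    proof (rule ccontr)
      assume B: "B \<noteq> 0"
      \<comment> \<open>For C = 0 the expression is affine in t, and this t gives it the value
        -1.\<close>
      show False using q[of "- (A + 1) / (2 * B)"] True B by (simp add: field_simps)
    qed
    then show ?thesis using C unfolding A_def[symmetric] B_def[symmetric] C_def[symmetric] by (simp add: True)
  next
    case False
    have "0 \<le> A + 2 * (- B / C) * B + (- B / C)\<^sup>2 * C" by (rule q)
    also have "\<dots> = A - B\<^sup>2 / C" using False by (simp add: field_simps power2_eq_square)
    finally have "B\<^sup>2 / C \<le> A" by simp
    then show ?thesis unfolding A_def[symmetric] B_def[symmetric] C_def[symmetric]
      using False C by (simp add: pos_divide_le_eq)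
  qed
qed

lemma integrable_Ioo_has_integral:
  fixes h :: "real \<Rightarrow> real"
  assumes "integrable (lebesgue_on {a<..<b}) h"
  shows "(h has_integral (LINT t|lebesgue_on {a<..<b}. h t)) {a..b}"
  using has_integral_integral_lebesgue_on[OF assms] by (simp add: has_integral_Icc_iff_Ioo)

lemma integral_Ioo_eq:
  fixes h :: "real \<Rightarrow> real"
  assumes "integrable (lebesgue_on {a<..<b}) h"
  shows "(LINT t|lebesgue_on {a<..<b}. h t) = integral {a..b} h" "h integrable_on {a..b}"
  using integrable_Ioo_has_integral[OF assms] by (auto simp: integral_unique integrable_on_def)

lemma continuous_square_integrable_Ioo:
  fixes g :: "real \<Rightarrow> real"
  assumes g: "continuous_on {a..b} g" shows "g \<in> square_integrable {a<..<b}"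
proof -
  have "compact (g ` {a..b})" by (rule compact_continuous_image[OF g]) simp
  then obtain C where C: "\<And>x. x \<in> {a..b} \<Longrightarrow> norm (g x) \<le> C" by (metis bounded_iff compact_imp_bounded imageI)
  have m: "g \<in> borel_measurable (lebesgue_on {a<..<b})"
    by (rule continuous_imp_measurable_on_sets_lebesgue[OF continuous_on_subset[OF g]]) auto
  have "(\<lambda>x. 1) \<in> square_integrable {a<..<b}"
    by (simp add: square_integrable_def finite_measure.integrable_const finite_measure_lebesgue_on)
  from square_integrable_bounded_mult[OF this m, of C] C show ?thesis by simp
qed

text \<open>Traces and the transposition identity use Lebesgue integrals over open intervals; the
  Duhamel computations use gauge integrals over closed ones, which are combined at intermediate
  times. The facts here translate between the two.\<close>

locale control_function =
  fixes f :: "real \<Rightarrow> real" and T :: real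
  assumes f: "f \<in> square_integrable {0<..<T}"
begin

lemma f_sub: "0 \<le> a \<Longrightarrow> b \<le> T \<Longrightarrow> f \<in> square_integrable {a<..<b}"
  by (rule square_integrable_restrict[OF f]) auto

lemma f_mult_integrable:
  assumes "0 \<le> a" "b \<le> T" "continuous_on {a..b} g"
  shows "integrable (lebesgue_on {a<..<b}) (\<lambda>t. f t * g t)" "(\<lambda>t. f t * g t) integrable_on {a..b}"
    "(LINT t|lebesgue_on {a<..<b}. f t * g t) = integral {a..b} (\<lambda>t. f t * g t)"
proof -
  show i: "integrable (lebesgue_on {a<..<b}) (\<lambda>t. f t * g t)"
    by (intro square_integrable_mult f_sub continuous_square_integrable_Ioo assms)
  show "(\<lambda>t. f t * g t) integrable_on {a..b}" "(LINT t|lebesgue_on {a<..<b}. f t * g t) = integral {a..b} (\<lambda>t. f t * g t)"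
    by (rule integral_Ioo_eq[OF i])+
qed

lemma f2_integrable:
  assumes "0 \<le> a" "b \<le> T"
  shows "(\<lambda>t. (f t)\<^sup>2) integrable_on {a..b}" "(LINT t|lebesgue_on {a<..<b}. (f t)\<^sup>2) = integral {a..b} (\<lambda>t. (f t)\<^sup>2)"
  using integral_Ioo_eq[of a b "\<lambda>t. (f t)\<^sup>2"] f_sub[OF assms] by (auto simp: square_integrable_def)

lemma f_abs_integrable:
  assumes "0 \<le> a" "b \<le> T" shows "(\<lambda>t. \<bar>f t\<bar>) integrable_on {a..b}"
proof -
  have "integrable (lebesgue_on {a<..<b}) (\<lambda>t. f t * 1)" by (rule f_mult_integrable(1)[OF assms]) auto
  then have "integrable (lebesgue_on {a<..<b}) (\<lambda>t. \<bar>f t\<bar>)" by simp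
  then show ?thesis by (rule integral_Ioo_eq(2))
qed

lemma f_cauchy_schwarz:
  assumes "0 \<le> a" "b \<le> T" "continuous_on {a..b} g"
  shows "(integral {a..b} (\<lambda>t. f t * g t))\<^sup>2 \<le> integral {a..b} (\<lambda>t. (f t)\<^sup>2) * integral {a..b} (\<lambda>t. (g t)\<^sup>2)"
proof -
  note g = continuous_square_integrable_Ioo[OF assms(3)]
  have "integrable (lebesgue_on {a<..<b}) (\<lambda>t. (g t)\<^sup>2)" using g by (simp add: square_integrable_def)
  from integral_Ioo_eq(1)[OF this] show ?thesis
    using square_integrable_cauchy_schwarz[OF f_sub[OF assms(1,2)] g]
    by (simp add: f_mult_integrable(3)[OF assms] f2_integrable(2)[OF assms(1,2)])
qed

end

section \<open>Observability\<close>

text \<open>\<open>th\<close> represents the boundary trace, as u \<mapsto>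
  \<open>inner (Aop u) th\<close>, and \<open>mult\<close> is the multiplier. The three facts
  \<open>mult_norm\<close>, \<open>mult_skew\<close> and \<open>pohozaev\<close> are what
  observability takes from the concrete equation.\<close>

locale observed_wave_system = wave_system E lam c0
  for E :: "'a::{real_inner, complete_space} set" and lam c0 +
  fixes th :: 'a and mult :: "'a \<Rightarrow> 'a" and \<kappa> :: real
  assumes \<kappa>: "0 < \<kappa>"
    and mult_add: "u \<in> V \<Longrightarrow> v \<in> V \<Longrightarrow> mult (u + v) = mult u + mult v"
    and mult_scale: "u \<in> V \<Longrightarrow> mult (k *\<^sub>R u) = k *\<^sub>R mult u"
    and mult_norm: "u \<in> V \<Longrightarrow> (norm (mult u))\<^sup>2 \<le> infsum (\<lambda>e. lam e * (inner u e)\<^sup>2) E"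
    and mult_skew: "u \<in> V \<Longrightarrow> inner u (mult u) = - \<kappa> * (norm u)\<^sup>2"
    and pohozaev: "u \<in> D \<Longrightarrow> inner (Aop u) (mult u) = (inner (Aop u) th)\<^sup>2 / 2 - \<kappa> * infsum (\<lambda>e. lam e * (inner u e)\<^sup>2) E"
begin

lemma V_subspace: "u \<in> V \<Longrightarrow> v \<in> V \<Longrightarrow> u + v \<in> V" "u \<in> V \<Longrightarrow> k *\<^sub>R u \<in> V" "0 \<in> V"
proof -
  have r: "u \<in> V \<longleftrightarrow> (u, 0) \<in> X" for u by (simp add: X_def)
  show "u \<in> V \<Longrightarrow> v \<in> V \<Longrightarrow> u + v \<in> V" unfolding r using X_add[of "(u, 0)" "(v, 0)"] by simp
  show "u \<in> V \<Longrightarrow> k *\<^sub>R u \<in> V" unfolding r using X_scale[of "(u, 0)" k] by simp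
  show "0 \<in> V" unfolding r using X_0 by (simp add: zero_prod_def)
qed

lemma basis_V: "e \<in> E \<Longrightarrow> e \<in> V"
proof -
  assume e: "e \<in> E"
  have "l2 (coef (e, 0))" by (rule l2_finite[of "{e}"]) (use e orth in \<open>auto simp: coef_def complex_eq_iff\<close>)
  then show "e \<in> V" unfolding X_iff[symmetric] by (simp add: X_def)
qed

lemma mult_sum:
  assumes "finite F" "F \<subseteq> E"
  shows "mult (\<Sum>e\<in>F. x e *\<^sub>R e) = (\<Sum>e\<in>F. x e *\<^sub>R mult e) \<and> (\<Sum>e\<in>F. x e *\<^sub>R e) \<in> V"
  using assms
proof (induction F rule: finite_induct)
  case empty
  have "mult 0 = 0" using mult_scale[OF V_subspace(3), of 0] by simp
  then show ?case by (simp add: V_subspace)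
next
  case (insert a F)
  then have "a \<in> V" using basis_V by auto
  with insert show ?case by (simp add: mult_add mult_scale V_subspace)
qed

lemma EN_sq: "U \<in> X \<Longrightarrow> (EN U)\<^sup>2 = infsum (\<lambda>e. lam e * (inner (fst U) e)\<^sup>2) E + (norm (snd U))\<^sup>2"
proof -
  assume U: "U \<in> X"
  have "(EN U)\<^sup>2 = infsum (\<lambda>e. lam e * (inner (fst U) e)\<^sup>2 + (inner (snd U) e)\<^sup>2) E"
    unfolding EN_def nrm_sq by (rule infsum_cong) (simp add: coef_def cmod_power2 power_mult_distrib om_sq)
  also have "\<dots> = infsum (\<lambda>e. lam e * (inner (fst U) e)\<^sup>2) E + infsum (\<lambda>e. (inner (snd U) e)\<^sup>2) E"
    by (rule infsum_add[OF _ coeff_summable]) (use U in \<open>auto simp: X_def V_def\<close>)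
  finally show ?thesis using infsumI[OF parseval_norm] by simp
qed

text \<open>The boundary trace of the eigenvector e divided by its frequency: the weight with which
  mode e enters the trace in the coordinates \<open>coef\<close>.\<close>

definition \<beta> :: "'a \<Rightarrow> real" where "\<beta> e = - om e * inner th e"
definition thc :: "'a \<Rightarrow> complex" where "thc e = of_real (inner th e)"
text \<open>The boundary trace at time t of the orbit of U, as a series over the modes. It is
  meaningful for U in \<open>D \<times> V\<close>, where the coordinates weighted by
  \<open>om\<close> are square summable.\<close>

definition gt :: "'a \<times> 'a \<Rightarrow> real \<Rightarrow> real" where
  "gt U t = pr thc (\<lambda>e. - of_real (om e) * (cis (- om e * t) * coef U e))"

lemma l2_thc: "l2 thc"
  unfolding l2_def thc_def using coeff_summable[of th] by simp

lemma l2_gt: "U \<in> D \<times> V \<Longrightarrow> l2 (\<lambda>e. - of_real (om e) * (cis (- om e * t) * coef U e))"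
  by (rule l2_comparison[of "\<lambda>e. om e * coef U e" _ 1]) (auto simp: DV_iff norm_mult)

lemma gt_bound:
  assumes U: "U \<in> D \<times> V" shows "\<bar>gt U t\<bar> \<le> nrm thc * nrm (\<lambda>e. om e * coef U e)"
proof -
  have "\<bar>gt U t\<bar> \<le> nrm thc * nrm (\<lambda>e. - of_real (om e) * (cis (- om e * t) * coef U e))"
    unfolding gt_def by (rule pr_bound[OF l2_thc l2_gt[OF U]])
  also have "nrm (\<lambda>e. - of_real (om e) * (cis (- om e * t) * coef U e)) \<le> nrm (\<lambda>e. om e * coef U e)"
    by (rule nrm_mono) (use U in \<open>auto simp: DV_iff norm_mult\<close>)
  finally show ?thesis by (simp add: mult_left_mono nrm_nonneg)
qed

lemma DV_add: "U \<in> D \<times> V \<Longrightarrow> U' \<in> D \<times> V \<Longrightarrow> U + U' \<in> D \<times> V"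
  and DV_scale: "U \<in> D \<times> V \<Longrightarrow> k *\<^sub>R U \<in> D \<times> V"
proof -
  show "U \<in> D \<times> V \<Longrightarrow> U' \<in> D \<times> V \<Longrightarrow> U + U' \<in> D \<times> V"
    unfolding DV_iff coef_add[abs_def] using l2_add[of "\<lambda>e. om e * coef U e" "\<lambda>e. om e * coef U' e"] by (simp add: distrib_left)
  show "U \<in> D \<times> V \<Longrightarrow> k *\<^sub>R U \<in> D \<times> V"
    unfolding DV_iff coef_scale[abs_def] using l2_scale[of "\<lambda>e. om e * coef U e" "of_real k"] by (simp add: mult.left_commute)
qed

lemma gt_add: "U \<in> D \<times> V \<Longrightarrow> U' \<in> D \<times> V \<Longrightarrow> gt (U + U') t = gt U t + gt U' t"
  unfolding gt_def pr_add_right[OF l2_thc l2_gt l2_gt, symmetric]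
  by (rule pr_cong) (simp_all only: coef_add distrib_left)

lemma gt_scale: "U \<in> D \<times> V \<Longrightarrow> gt (k *\<^sub>R U) t = k * gt U t"
  unfolding gt_def pr_scale_right[OF l2_thc l2_gt, symmetric]
  by (rule pr_cong) (simp_all only: coef_scale mult_ac)

lemma gt_diff: "U \<in> D \<times> V \<Longrightarrow> U' \<in> D \<times> V \<Longrightarrow> gt (U - U') t = gt U t - gt U' t"
  using gt_add[OF _ DV_scale[of U' "-1"], of U t] gt_scale[of U' "-1" t] by simp

lemma wgroup_DV: "U \<in> D \<times> V \<Longrightarrow> wgroup t U \<in> D \<times> V"
proof -
  assume U: "U \<in> D \<times> V"
  have "l2 (\<lambda>e. om e * coef (wgroup t U) e)"
    by (rule l2_comparison[of "\<lambda>e. om e * coef U e" _ 1]) (use U in \<open>auto simp: coef_wgroup[OF DV_X[OF U]] norm_mult DV_iff[symmetric]\<close>)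
  then show ?thesis by (simp add: DV_iff)
qed

lemma gt_wgroup: "U \<in> X \<Longrightarrow> gt (wgroup s U) t = gt U (t + s)"
  unfolding gt_def
proof (rule pr_cong[OF refl])
  fix e assume U: "U \<in> X" and e: "e \<in> E"
  have "cis (- om e * (t + s)) = cis (- om e * t) * cis (- om e * s)" by (simp add: cis_mult distrib_left)
  then show "- of_real (om e) * (cis (- om e * t) * coef (wgroup s U) e) = - of_real (om e) * (cis (- om e * (t + s)) * coef U e)"
    by (simp add: coef_wgroup[OF U e])
qed

lemma gt_eq_inner:
  assumes U: "U \<in> D \<times> V" shows "gt U t = inner (Aop (fst (wgroup t U))) th"
proof -
  have W: "fst (wgroup t U) \<in> D" using wgroup_DV[OF U, of t] by auto
  have "((\<lambda>e. inner (Aop (fst (wgroup t U))) e * inner th e) has_sum inner (Aop (fst (wgroup t U))) th) E" by (rule parseval)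
  then have "inner (Aop (fst (wgroup t U))) th = infsum (\<lambda>e. inner (Aop (fst (wgroup t U))) e * inner th e) E" by (simp add: infsumI)
  also have "\<dots> = gt U t"
    unfolding gt_def pr_def
  proof (rule infsum_cong)
    fix e assume e: "e \<in> E"
    have "Re (coef (wgroup t U) e) = om e * inner (fst (wgroup t U)) e" by (simp add: coef_def)
    then have "om e * inner (fst (wgroup t U)) e = Re (cis (- om e * t) * coef U e)"
      unfolding coef_wgroup[OF DV_X[OF U] e] by simp
    then have a1: "- lam e * inner (fst (wgroup t U)) e = - om e * Re (cis (- om e * t) * coef U e)"
      unfolding om_sq[OF e, symmetric] by (simp add: power2_eq_square)
    have a2: "Re (cnj (thc e) * (- of_real (om e) * z)) = (- om e * Re z) * inner th e" for z
      by (simp add: thc_def)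
    show "inner (Aop (fst (wgroup t U))) e * inner th e
        = Re (cnj (thc e) * (- of_real (om e) * (cis (- om e * t) * coef U e)))"
      unfolding inner_Aop[OF W e] a1 a2 ..
  qed
  finally show ?thesis by simp
qed

lemma gt_continuous: assumes U: "U \<in> D \<times> V" shows "continuous_on S (gt U)"
proof -
  have "isCont (gt U) t" for t
  proof -
    have l: "((\<lambda>s. nrm (\<lambda>e. (cis (- om e * s) - cis (- om e * t)) * (om e * coef U e))) \<longlongrightarrow> 0) (at t)"
    proof (rule nrm_tendsto_0[where c="\<lambda>e. om e * coef U e" and K=2])
      show "l2 (\<lambda>e. om e * coef U e)" using U by (simp add: DV_iff)
      show "cmod ((cis (- om e * h) - cis (- om e * t)) * (om e * coef U e)) \<le> 2 * cmod (om e * coef U e)" for e h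
        using norm_triangle_ineq4[of "cis (- om e * h)" "cis (- om e * t)"] by (auto simp: norm_mult intro!: mult_right_mono)
      show "((\<lambda>h. (cis (- om e * h) - cis (- om e * t)) * (om e * coef U e)) \<longlongrightarrow> 0) (at t)" for e
      proof -
        have "((\<lambda>h. (cis (- om e * h) - cis (- om e * t)) * (om e * coef U e)) \<longlongrightarrow> (cis (- om e * t) - cis (- om e * t)) * (om e * coef U e)) (at t)"
          by (intro tendsto_intros)
        then show ?thesis by simp
      qed
    qed
    have "((\<lambda>s. gt U s - gt U t) \<longlongrightarrow> 0) (at t)"
    proof (rule Lim_null_comparison[OF always_eventually[OF allI] tendsto_mult_right_zero[OF l, of "nrm thc"]])
      fix s
      have ls: "l2 (\<lambda>e. - ((cis (- om e * s) - cis (- om e * t)) * (om e * coef U e)))"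
        using l2_diff[OF l2_gt[OF U, of s] l2_gt[OF U, of t]] by (simp add: algebra_simps)
      have "gt U s = pr thc (\<lambda>e. - of_real (om e) * (cis (- om e * t) * coef U e) + - ((cis (- om e * s) - cis (- om e * t)) * (om e * coef U e)))"
        unfolding gt_def by (rule pr_cong) (simp_all add: algebra_simps)
      also have "\<dots> = gt U t + pr thc (\<lambda>e. - ((cis (- om e * s) - cis (- om e * t)) * (om e * coef U e)))"
        unfolding gt_def by (rule pr_add_right[OF l2_thc l2_gt[OF U] ls])
      finally have "\<bar>gt U s - gt U t\<bar> \<le> nrm thc * nrm (\<lambda>e. - ((cis (- om e * s) - cis (- om e * t)) * (om e * coef U e)))"
        using pr_bound[OF l2_thc ls] by simp
      then show "norm (gt U s - gt U t) \<le> nrm thc * nrm (\<lambda>e. (cis (- om e * s) - cis (- om e * t)) * (om e * coef U e))"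
        by (simp add: nrm_def)
    qed
    then show ?thesis by (simp add: isCont_def LIM_zero_iff)
  qed
  then show ?thesis by (simp add: continuous_at_imp_continuous_on)
qed

section \<open>The multiplier identity on finite combinations of eigenvectors\<close>

definition fin :: "'a \<times> 'a \<Rightarrow> bool" where
  "fin U \<longleftrightarrow> (\<exists>F. finite F \<and> F \<subseteq> E \<and> (\<forall>e\<in>E - F. coef U e = 0))"

lemma fin_DV: "fin U \<Longrightarrow> U \<in> D \<times> V"
  unfolding fin_def DV_iff by (auto intro!: l2_finite)

lemma fin_wgroup: "fin U \<Longrightarrow> fin (wgroup t U)"
proof -
  assume U: "fin U"
  have "U \<in> X" using U by (intro DV_X fin_DV)
  then show ?thesis using U unfolding fin_def by (metis DiffD1 coef_wgroup mult_zero_right)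
qed

lemma fin_restr: "finite F \<Longrightarrow> F \<subseteq> E \<Longrightarrow> fin (restr F U)"
  unfolding fin_def by (intro exI[of _ F]) (auto simp: coef_restr)

lemma fin_subspace: "subspace {U. fin U}"
  unfolding subspace_def mem_Collect_eq
proof (intro conjI ballI allI impI)
  show "fin 0" unfolding fin_def by (intro exI[of _ "{}"]) (simp add: coef_0)
  show "fin (c *\<^sub>R U)" if "U \<in> {U. fin U}" for c U
    using that by (auto simp: fin_def coef_scale)
  show "fin (U + U')" if "U \<in> {U. fin U}" "U' \<in> {U. fin U}" for U U'
  proof -
    have "fin U" "fin U'" using that by auto
    from \<open>fin U\<close> obtain F where "finite F" "F \<subseteq> E" "\<forall>e\<in>E - F. coef U e = 0"
      unfolding fin_def by (elim exE conjE)
    moreover from \<open>fin U'\<close> obtain F' where "finite F'" "F' \<subseteq> E" "\<forall>e\<in>E - F'. coef U' e = 0"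
      unfolding fin_def by (elim exE conjE)
    ultimately show ?thesis unfolding fin_def by (intro exI[of _ "F \<union> F'"]) (auto simp: coef_add)
  qed
qed

text \<open>The derivative of \<open>\<langle>w\<^sub>t, mult w\<rangle>\<close> along the flow is half the squared trace minus \<open>\<kappa>\<close> times the
  energy, while the pairing itself is bounded by half the energy.\<close>

lemma energy_identity:
  assumes U: "fin U" and ab: "a \<le> b"
  shows "\<bar>integral {a..b} (\<lambda>t. (gt U t)\<^sup>2) / 2 - \<kappa> * (b - a) * (EN U)\<^sup>2\<bar> \<le> (EN U)\<^sup>2"
proof -
  obtain F where F: "finite F" "F \<subseteq> E" and F0: "\<And>e. e \<in> E - F \<Longrightarrow> coef U e = 0" using U unfolding fin_def by blast
  have UDV: "U \<in> D \<times> V" by (rule fin_DV[OF U])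
  have UX: "U \<in> X" by (rule DV_X[OF UDV])
  define x where "x t e = cos (om e * t) * Re (coef U e) + sin (om e * t) * Im (coef U e)" for t e
  define y where "y t e = cos (om e * t) * Im (coef U e) - sin (om e * t) * Re (coef U e)" for t e
  have xy: "cis (- om e * t) * coef U e = Complex (x t e) (y t e)" for t e
    by (simp add: complex_eq_iff x_def y_def)
  define u where "u t = fst (wgroup t U)" for t
  define v where "v t = snd (wgroup t U)" for t
  have cW: "coef (u t, v t) e = Complex (x t e) (y t e)" if "e \<in> E" for t e
    unfolding u_def v_def prod.collapse coef_wgroup[OF UX that] xy ..
  have ux: "om e * inner (u t) e = x t e" and vy: "inner (v t) e = y t e" if "e \<in> E" for t e
    using cW[OF that, of t] by (simp_all add: coef_def complex_eq_iff)
  have zero: "x t e = 0" "y t e = 0" if "e \<in> E - F" for t e using F0[OF that] by (simp_all add: x_def y_def)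
  have uD: "u t \<in> D" and vV: "v t \<in> V" for t using wgroup_DV[OF UDV, of t] by (auto simp: u_def v_def mem_Times_iff)
  have uV: "u t \<in> V" for t using uD D_sub_V by blast
  \<comment> \<open>The orbit is a finite sum with trigonometric coefficients, so
    \<open>mult\<close> passes through by linearity and the time derivatives are elementary.\<close>
  have u_sum: "u t = (\<Sum>e\<in>F. (x t e / om e) *\<^sub>R e)" for t
  proof (rule eqI)
    fix e assume e: "e \<in> E"
    have "inner (u t) e = x t e / om e" using ux[OF e, of t] om_pos[OF e] by (simp add: field_simps)
    then show "inner (u t) e = inner (\<Sum>e\<in>F. (x t e / om e) *\<^sub>R e) e"
      using zero[of e t] e by (simp add: inner_sum[OF F e])
  qed
  have v_sum: "v t = (\<Sum>e\<in>F. y t e *\<^sub>R e)" for t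
    by (rule eqI) (use zero vy in \<open>auto simp: inner_sum[OF F]\<close>)
  have A_sum: "Aop (u t) = (\<Sum>e\<in>F. (- om e * x t e) *\<^sub>R e)" for t
  proof (rule eqI)
    fix e assume e: "e \<in> E"
    have "inner (Aop (u t)) e = - (om e)\<^sup>2 * inner (u t) e" unfolding inner_Aop[OF uD e] om_sq[OF e] ..
    also have "\<dots> = - om e * x t e" unfolding ux[OF e, symmetric] by (simp add: power2_eq_square)
    finally show "inner (Aop (u t)) e = inner (\<Sum>e\<in>F. (- om e * x t e) *\<^sub>R e) e"
      unfolding inner_sum[OF F e] using zero[of e t] e by simp
  qed
  have mu_sum: "mult (u t) = (\<Sum>e\<in>F. (x t e / om e) *\<^sub>R mult e)" for t
    using mult_sum[OF F, of "\<lambda>e. x t e / om e"] by (simp only: u_sum)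
  have mv_sum: "mult (v t) = (\<Sum>e\<in>F. y t e *\<^sub>R mult e)" for t
    using mult_sum[OF F, of "\<lambda>e. y t e"] by (simp only: v_sum)
  have dx: "((\<lambda>t. x t e / om e) has_real_derivative y t e) (at t)" if "e \<in> F" for t e
  proof -
    have "om e \<noteq> 0" using om_pos[of e] that F by auto
    then show ?thesis unfolding x_def y_def by (auto intro!: derivative_eq_intros simp: field_simps)
  qed
  have dy: "((\<lambda>t. y t e) has_real_derivative - om e * x t e) (at t)" for t e
    unfolding x_def y_def by (auto intro!: derivative_eq_intros simp: field_simps)
  have sc: "((\<lambda>t. r t *\<^sub>R z) has_vector_derivative r' *\<^sub>R z) (at t)" if "(r has_real_derivative r') (at t)" for r r' t and z :: 'a
    using has_vector_derivative_scaleR[OF that has_vector_derivative_const[of z]] by simp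
  have dv: "(v has_vector_derivative Aop (u t)) (at t)" for t
    unfolding v_sum[abs_def] A_sum by (intro has_vector_derivative_sum sc dy)
  have dmu: "((\<lambda>t. mult (u t)) has_vector_derivative mult (v t)) (at t)" for t
    unfolding mu_sum mv_sum by (intro has_vector_derivative_sum sc dx)
  define \<Phi> where "\<Phi> t = inner (v t) (mult (u t))" for t
  have gtA: "gt U t = inner (Aop (u t)) th" for t unfolding u_def by (rule gt_eq_inner[OF UDV])
  have en: "(EN U)\<^sup>2 = infsum (\<lambda>e. lam e * (inner (u t) e)\<^sup>2) E + (norm (v t))\<^sup>2" for t
    using EN_sq[OF wgroup_X[OF UX, of t]] EN_wgroup[OF UX, of t] by (simp add: u_def v_def)
  have d\<Phi>: "(\<Phi> has_vector_derivative (gt U t)\<^sup>2 / 2 - \<kappa> * (EN U)\<^sup>2) (at t)" for t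
  proof -
    have "(\<Phi> has_vector_derivative (inner (v t) (mult (v t)) + inner (Aop (u t)) (mult (u t)))) (at t)"
      unfolding \<Phi>_def by (rule bounded_bilinear.has_vector_derivative[OF bounded_bilinear_inner dv dmu])
    also have "inner (v t) (mult (v t)) + inner (Aop (u t)) (mult (u t)) = (gt U t)\<^sup>2 / 2 - \<kappa> * (EN U)\<^sup>2"
      unfolding mult_skew[OF vV] pohozaev[OF uD] gtA en[of t] by (simp add: algebra_simps)
    finally show ?thesis .
  qed
  \<comment> \<open>Kinetic energy bounds one factor and, by \<open>mult_norm\<close>, potential
    energy the other; their sum is conserved.\<close>
  have \<Phi>_le: "\<bar>\<Phi> t\<bar> \<le> (EN U)\<^sup>2 / 2" for t
  proof -
    have "\<bar>\<Phi> t\<bar> \<le> norm (v t) * norm (mult (u t))" unfolding \<Phi>_def by (rule Cauchy_Schwarz_ineq2)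
    also have "\<dots> \<le> ((norm (v t))\<^sup>2 + (norm (mult (u t)))\<^sup>2) / 2"
      using sum_squares_bound[of "norm (v t)" "norm (mult (u t))"] by simp
    also have "\<dots> \<le> (EN U)\<^sup>2 / 2" using mult_norm[OF uV[of t]] en[of t] by simp
    finally show ?thesis .
  qed
  have "((\<lambda>t. (gt U t)\<^sup>2 / 2 - \<kappa> * (EN U)\<^sup>2) has_integral \<Phi> b - \<Phi> a) {a..b}"
    by (rule fundamental_theorem_of_calculus[OF ab]) (rule has_vector_derivative_at_within[OF d\<Phi>])
  moreover have "((\<lambda>t. (gt U t)\<^sup>2 / 2 - \<kappa> * (EN U)\<^sup>2) has_integral integral {a..b} (\<lambda>t. (gt U t)\<^sup>2) / 2 - \<kappa> * (EN U)\<^sup>2 * (b - a)) {a..b}"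
  proof (rule has_integral_diff)
    have "(\<lambda>t. (gt U t)\<^sup>2) integrable_on {a..b}"
      by (intro integrable_continuous_interval continuous_intros gt_continuous UDV)
    then show "((\<lambda>t. (gt U t)\<^sup>2 / 2) has_integral integral {a..b} (\<lambda>t. (gt U t)\<^sup>2) / 2) {a..b}"
      by (intro has_integral_divide integrable_integral)
    show "((\<lambda>t. \<kappa> * (EN U)\<^sup>2) has_integral \<kappa> * (EN U)\<^sup>2 * (b - a)) {a..b}"
      using has_integral_const_real[of "\<kappa> * (EN U)\<^sup>2" a b] ab by (simp add: mult.commute)
  qed
  ultimately have "integral {a..b} (\<lambda>t. (gt U t)\<^sup>2) / 2 - \<kappa> * (EN U)\<^sup>2 * (b - a) = \<Phi> b - \<Phi> a"
    by (rule has_integral_unique[rotated])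
  then have "\<bar>integral {a..b} (\<lambda>t. (gt U t)\<^sup>2) / 2 - \<kappa> * (b - a) * (EN U)\<^sup>2\<bar> = \<bar>\<Phi> b - \<Phi> a\<bar>"
    by (simp add: mult_ac)
  also have "\<dots> \<le> (EN U)\<^sup>2" using \<Phi>_le[of a] \<Phi>_le[of b] by linarith
  finally show ?thesis .
qed

text \<open>The upper half of the energy identity. It bounds the trace by the energy norm alone,
  although the pointwise trace asks for the operator domain; by duality it makes the Duhamel term
  square summable.\<close>

lemma hidden_regularity:
  assumes "fin U" "a \<le> b"
  shows "integral {a..b} (\<lambda>t. (gt U t)\<^sup>2) \<le> (2 + 2 * \<kappa> * (b - a)) * (EN U)\<^sup>2"
  using energy_identity[OF assms] by (simp add: abs_le_iff algebra_simps)

text \<open>The lower half. Its factor is positive exactly when the interval is longer than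
  1/\<kappa>.\<close>

lemma observability:
  assumes "fin U" "a \<le> b"
  shows "(2 * \<kappa> * (b - a) - 2) * (EN U)\<^sup>2 \<le> integral {a..b} (\<lambda>t. (gt U t)\<^sup>2)"
  using energy_identity[OF assms] by (simp add: abs_le_iff algebra_simps)

section \<open>From observability to the control\<close>

text \<open>The control is the L2 limit of the traces of a minimizing sequence, for the form
  \<gamma> given by the inner product of traces over (0, T). Taking the limit of traces rather than
  of states dispenses with a minimizer; the Euler equation passes to the limit and becomes the
  moment equation for f.\<close>

lemma hilbert_uniqueness_method:
  assumes T: "1 / \<kappa> < T" and Y0: "l2 Y0"
  obtains f where "f \<in> square_integrable {0<..<T}"
    "\<And>W. fin W \<Longrightarrow> (LINT t|lebesgue_on {0<..<T}. f t * gt W t) = pr Y0 (coef W)"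
proof -
  have T0: "0 < T" using T \<kappa> by (smt (verit) zero_less_divide_1_iff)
  let ?M = "lebesgue_on {0<..<T}"
  have gs: "gt W \<in> square_integrable {0<..<T}" if "fin W" for W
    by (intro continuous_square_integrable_Ioo gt_continuous fin_DV that)
  define \<gamma> where "\<gamma> W W' = (LINT t|?M. gt W t * gt W' t)" for W W'
  define k where "k = 2 * \<kappa> * T - 2"
  have k: "0 < k" using T \<kappa> by (simp add: k_def field_simps)
  have sq: "\<gamma> W W = integral {0..T} (\<lambda>t. (gt W t)\<^sup>2)" if "fin W" for W
    unfolding \<gamma>_def power2_eq_square by (rule integral_Ioo_eq(1)[OF square_integrable_mult[OF gs gs]]) (rule that)+
  have obs: "k * (EN W)\<^sup>2 \<le> \<gamma> W W" if "fin W" for W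
    using observability[OF that, of 0 T] T0 by (simp add: sq[OF that] k_def)
  note P = fin_subspace
  have sub: "fin (u + v)" "fin (c *\<^sub>R u)" "fin (u - v)" if "fin u" "fin v" for u v c
    using subspace_add[OF P, of u v] subspace_scale[OF P, of u c] subspace_diff[OF P, of u v] that by auto
  obtain U where U: "\<And>n. fin (U n)"
    and cau: "\<And>e. e > 0 \<Longrightarrow> \<exists>N. \<forall>m\<ge>N. \<forall>n\<ge>N. \<gamma> (U m - U n) (U m - U n) < e"
    and lim: "\<And>W. fin W \<Longrightarrow> (\<lambda>n. \<gamma> (U n) W) \<longlonglongrightarrow> pr Y0 (coef W)"
  proof (rule riesz_minimizing_sequence[OF P, of \<gamma> "\<lambda>W. pr Y0 (coef W)" "(nrm Y0)\<^sup>2 / k"])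
    fix u v w :: "'a \<times> 'a" and c :: real
    assume "u \<in> {U. fin U}"
    then have u: "fin u" by simp
    have lu: "l2 (coef u)" using u DV_X[OF fin_DV] by (simp add: X_iff)
    show "0 \<le> \<gamma> u u" by (simp add: \<gamma>_def)
    show "pr Y0 (coef (c *\<^sub>R u)) = c * pr Y0 (coef u)"
      unfolding coef_scale[abs_def] by (rule pr_scale_right[OF Y0 lu])
    \<comment> \<open>Cauchy-Schwarz combined with observability; here k > 0, that is T >
      1/\<kappa>, enters.\<close>
    show "(pr Y0 (coef u))\<^sup>2 \<le> (nrm Y0)\<^sup>2 / k * \<gamma> u u"
    proof -
      have "(pr Y0 (coef u))\<^sup>2 \<le> (nrm Y0 * EN u)\<^sup>2"
        using pr_bound[OF Y0 lu] by (intro power2_le_iff_abs_le[THEN iffD2]) (auto simp: EN_def nrm_nonneg)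
      also have "\<dots> = (nrm Y0)\<^sup>2 / k * (k * (EN u)\<^sup>2)" using k by (simp add: power_mult_distrib)
      also have "\<dots> \<le> (nrm Y0)\<^sup>2 / k * \<gamma> u u" using k by (intro mult_left_mono obs u) auto
      finally show ?thesis .
    qed
    assume "v \<in> {U. fin U}"
    then have v: "fin v" by simp
    have lv: "l2 (coef v)" using v DV_X[OF fin_DV] by (simp add: X_iff)
    show "\<gamma> u v = \<gamma> v u" by (simp add: \<gamma>_def mult.commute)
    show "\<gamma> (c *\<^sub>R u) v = c * \<gamma> u v"
      unfolding \<gamma>_def using gt_scale[OF fin_DV[OF u]] by (simp add: mult.assoc)
    show "pr Y0 (coef (u + v)) = pr Y0 (coef u) + pr Y0 (coef v)"
      unfolding coef_add[abs_def] by (rule pr_add_right[OF Y0 lu lv])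
    assume "w \<in> {U. fin U}"
    then have w: "fin w" by simp
    show "\<gamma> (u + v) w = \<gamma> u w + \<gamma> v w"
      unfolding \<gamma>_def using gt_add[OF fin_DV[OF u] fin_DV[OF v]] square_integrable_mult[OF gs[OF u] gs[OF w]]
        square_integrable_mult[OF gs[OF v] gs[OF w]]
      by (simp add: distrib_right)
  qed auto
  have "\<exists>f\<in>square_integrable {0<..<T}. (\<lambda>n. LINT t|?M. (gt (U n) t - f t)\<^sup>2) \<longlonglongrightarrow> 0"
  proof (rule square_integrable_complete[OF gs[OF U]])
    fix e :: real assume e: "0 < e"
    have eq: "\<gamma> (U m - U n) (U m - U n) = (LINT t|?M. (gt (U m) t - gt (U n) t)\<^sup>2)" for m n
      unfolding \<gamma>_def gt_diff[OF fin_DV[OF U] fin_DV[OF U]] by (simp add: power2_eq_square)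
    show "\<exists>N. \<forall>m\<ge>N. \<forall>n\<ge>N. (LINT t|?M. (gt (U m) t - gt (U n) t)\<^sup>2) < e"
      using cau[OF e] unfolding eq .
  qed
  then obtain f where f: "f \<in> square_integrable {0<..<T}"
    and fl: "(\<lambda>n. LINT t|?M. (gt (U n) t - f t)\<^sup>2) \<longlonglongrightarrow> 0" by blast
  show ?thesis
  proof
    show "f \<in> square_integrable {0<..<T}" by (rule f)
    fix W assume W: "fin W"
    let ?I = "LINT t|?M. f t * gt W t"
    have "(\<lambda>n. sqrt ((LINT t|?M. (gt (U n) t - f t)\<^sup>2) * (LINT t|?M. (gt W t)\<^sup>2))) \<longlonglongrightarrow> sqrt (0 * (LINT t|?M. (gt W t)\<^sup>2))"
      by (intro tendsto_real_sqrt tendsto_mult fl tendsto_const)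
    then have z: "(\<lambda>n. sqrt ((LINT t|?M. (gt (U n) t - f t)\<^sup>2) * (LINT t|?M. (gt W t)\<^sup>2))) \<longlonglongrightarrow> 0" by simp
    have "(\<lambda>n. \<gamma> (U n) W - ?I) \<longlonglongrightarrow> 0"
    proof (rule Lim_null_comparison[OF always_eventually[OF allI] z])
      fix n
      have "\<gamma> (U n) W - ?I = (LINT t|?M. (gt (U n) t - f t) * gt W t)"
        unfolding \<gamma>_def using square_integrable_mult[OF gs[OF U] gs[OF W]] square_integrable_mult[OF f gs[OF W]]
        by (simp add: left_diff_distrib)
      then show "norm (\<gamma> (U n) W - ?I) \<le> sqrt ((LINT t|?M. (gt (U n) t - f t)\<^sup>2) * (LINT t|?M. (gt W t)\<^sup>2))"
        using square_integrable_cauchy_schwarz[OF square_integrable_diff[OF gs[OF U] f] gs[OF W]]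
        by (intro real_le_rsqrt) simp
    qed
    then have "(\<lambda>n. \<gamma> (U n) W) \<longlonglongrightarrow> ?I" by (rule LIM_zero_cancel)
    then show "?I = pr Y0 (coef W)" using lim[OF W] by (rule LIMSEQ_unique)
  qed
qed

end

section \<open>The controlled solution\<close>

lemma infsum_finite_support:
  fixes g :: "'a \<Rightarrow> real"
  assumes "finite F" "F \<subseteq> E" "\<And>e. e \<in> E - F \<Longrightarrow> g e = 0"
  shows "infsum g E = sum g F"
proof -
  have "infsum g E = infsum g F" by (rule infsum_cong_neutral) (use assms in auto)
  then show ?thesis using assms(1) by simp
qed

locale controlled_wave = observed_wave_system E lam c0 th mult \<kappa> + control_function f T
  for E :: "'a::{real_inner, complete_space} set" and lam c0 th mult \<kappa> f T +
  fixes Y0 :: "'a \<Rightarrow> complex"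
  assumes Y0: "l2 Y0"
begin

text \<open>\<open>Z a b\<close> is Duhamel's integral of the control over \<open>{a..b}\<close>, and \<open>Y\<close> collects the coordinates of the
  controlled solution: its derivative has the coordinates \<open>om e * Re (Y t e)\<close>, and the solution itself
  \<open>- Im (Y t e)\<close>.\<close>

definition Cs :: "real \<Rightarrow> real \<Rightarrow> 'a \<Rightarrow> real" where
  "Cs a b e = integral {a..b} (\<lambda>t. f t * cos (om e * (b - t)))"
definition Sn :: "real \<Rightarrow> real \<Rightarrow> 'a \<Rightarrow> real" where
  "Sn a b e = integral {a..b} (\<lambda>t. f t * sin (om e * (b - t)))"
definition Z :: "real \<Rightarrow> real \<Rightarrow> 'a \<Rightarrow> complex" where
  "Z a b e = Complex (- \<beta> e * Cs a b e) (\<beta> e * Sn a b e)"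
definition Y :: "real \<Rightarrow> 'a \<Rightarrow> complex" where
  "Y t e = cis (- om e * t) * Y0 e + Z 0 t e"

lemma cs_integrable:
  assumes "0 \<le> a" "b \<le> T"
  shows "(\<lambda>t. f t * cos (w * (c - t))) integrable_on {a..b}" "(\<lambda>t. f t * sin (w * (c - t))) integrable_on {a..b}"
  by (intro f_mult_integrable(2)[OF assms] continuous_intros)+

section \<open>Duhamel coordinates and their duality with traces\<close>

text \<open>\<open>Z a b e\<close> is minus \<open>\<beta> e\<close> times the integral of
  \<open>f t * cis (- om e * (b - t))\<close>. Splitting the interval at s and factoring out the
  rotation from s to t gives the claim; in real form these are the addition theorems for sine and
  cosine.\<close>

lemma Z_cocycle:
  assumes "0 \<le> s" "s \<le> t" "t \<le> T"
  shows "Z 0 t e = cis (- om e * (t - s)) * Z 0 s e + Z s t e"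
proof -
  let ?x = "om e * (t - s)"
  note i = cs_integrable[of 0 t, OF order_refl assms(3)] and i' = cs_integrable[of 0 s, OF order_refl order_trans[OF assms(2,3)]]
  have arg: "om e * (t - r) = ?x + om e * (s - r)" for r by (simp add: algebra_simps)
  have c1: "integral {0..s} (\<lambda>r. f r * cos (om e * (t - r))) = cos ?x * Cs 0 s e - sin ?x * Sn 0 s e"
  proof -
    have "integral {0..s} (\<lambda>r. f r * cos (om e * (t - r)))
        = integral {0..s} (\<lambda>r. cos ?x * (f r * cos (om e * (s - r))) - sin ?x * (f r * sin (om e * (s - r))))"
      by (rule integral_cong) (subst arg, simp only: cos_add right_diff_distrib mult_ac)
    then show ?thesis unfolding Cs_def Sn_def using i'
      by (simp add: integral_diff integrable_on_mult_right)
  qed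
  have s1: "integral {0..s} (\<lambda>r. f r * sin (om e * (t - r))) = sin ?x * Cs 0 s e + cos ?x * Sn 0 s e"
  proof -
    have "integral {0..s} (\<lambda>r. f r * sin (om e * (t - r)))
        = integral {0..s} (\<lambda>r. sin ?x * (f r * cos (om e * (s - r))) + cos ?x * (f r * sin (om e * (s - r))))"
      by (rule integral_cong) (subst arg, simp only: sin_add distrib_left mult_ac)
    then show ?thesis unfolding Cs_def Sn_def using i'
      by (simp add: integral_add integrable_on_mult_right)
  qed
  have "Cs 0 t e = (cos ?x * Cs 0 s e - sin ?x * Sn 0 s e) + Cs s t e"
    using Henstock_Kurzweil_Integration.integral_combine[OF assms(1,2) i(1)[of "om e" t]] unfolding c1 by (simp add: Cs_def)
  moreover have "Sn 0 t e = (sin ?x * Cs 0 s e + cos ?x * Sn 0 s e) + Sn s t e"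
    using Henstock_Kurzweil_Integration.integral_combine[OF assms(1,2) i(2)[of "om e" t]] unfolding s1 by (simp add: Sn_def)
  moreover have "cis (- om e * (t - s)) = Complex (cos ?x) (- sin ?x)" by (simp add: complex_eq_iff)
  moreover have "Complex (- b * (C * x - S * y + u)) (b * (S * x + C * y + v)) = Complex C (- S) * Complex (- b * x) (b * y) + Complex (- b * u) (b * v)" for b C S x y u v
    by (simp add: complex_eq_iff algebra_simps)
  ultimately show ?thesis by (simp only: Z_def)
qed

lemma Y_cocycle:
  assumes "0 \<le> s" "s \<le> t" "t \<le> T"
  shows "Y t e = cis (- om e * (t - s)) * Y s e + Z s t e"
proof -
  have "cis (- om e * t) = cis (- om e * (t - s)) * cis (- om e * s)" by (simp add: cis_mult algebra_simps)
  then show ?thesis unfolding Y_def Z_cocycle[OF assms] by (simp add: algebra_simps)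
qed

text \<open>Links Duhamel's formula with transposition: \<open>gt U (t - b)\<close> is the trace at
  time t of the backward solution that equals U at time b.\<close>

lemma Z_pairing:
  assumes U: "fin U" and ab: "0 \<le> a" "b \<le> T"
  shows "pr (Z a b) (coef U) = - integral {a..b} (\<lambda>t. f t * gt U (t - b))"
proof -
  obtain F where F: "finite F" "F \<subseteq> E" and F0: "\<And>e. e \<in> E - F \<Longrightarrow> coef U e = 0" using U unfolding fin_def by blast
  have "pr (Z a b) (coef U) = (\<Sum>e\<in>F. Re (cnj (Z a b e) * coef U e))"
    unfolding pr_def by (rule infsum_finite_support[OF F]) (simp add: F0)
  also have "\<dots> = - (\<Sum>e\<in>F. \<beta> e * (Re (coef U e) * Cs a b e - Im (coef U e) * Sn a b e))"
    unfolding sum_negf[symmetric] by (rule sum.cong) (simp_all add: Z_def algebra_simps)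
  also have "(\<Sum>e\<in>F. \<beta> e * (Re (coef U e) * Cs a b e - Im (coef U e) * Sn a b e)) = (\<Sum>e\<in>F. integral {a..b} (\<lambda>t. f t * (\<beta> e * Re (cis (- om e * (t - b)) * coef U e))))"
  proof (rule sum.cong[OF refl])
    fix e
    have "integral {a..b} (\<lambda>t. f t * (\<beta> e * Re (cis (- om e * (t - b)) * coef U e)))
      = integral {a..b} (\<lambda>t. \<beta> e * (Re (coef U e) * (f t * cos (om e * (b - t))) - Im (coef U e) * (f t * sin (om e * (b - t)))))"
    proof (rule integral_cong)
      fix t
      have "- om e * (t - b) = om e * (b - t)" by (simp add: algebra_simps)
      then show "f t * (\<beta> e * Re (cis (- om e * (t - b)) * coef U e))
        = \<beta> e * (Re (coef U e) * (f t * cos (om e * (b - t))) - Im (coef U e) * (f t * sin (om e * (b - t))))"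
        by (simp only:) (simp add: algebra_simps)
    qed
    also have "\<dots> = \<beta> e * (Re (coef U e) * Cs a b e - Im (coef U e) * Sn a b e)"
      unfolding Cs_def Sn_def using cs_integrable[OF ab]
      by (simp add: integral_diff integrable_on_mult_right)
    finally show "\<beta> e * (Re (coef U e) * Cs a b e - Im (coef U e) * Sn a b e) = integral {a..b} (\<lambda>t. f t * (\<beta> e * Re (cis (- om e * (t - b)) * coef U e)))" ..
  qed
  also have "\<dots> = integral {a..b} (\<lambda>t. \<Sum>e\<in>F. f t * (\<beta> e * Re (cis (- om e * (t - b)) * coef U e)))"
  proof (rule integral_sum[symmetric])
    fix e
    have "continuous_on {a..b} (\<lambda>t. \<beta> e * Re (cis (- om e * (t - b)) * coef U e))"
      by (auto intro!: continuous_intros)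
    then show "(\<lambda>t. f t * (\<beta> e * Re (cis (- om e * (t - b)) * coef U e))) integrable_on {a..b}"
      by (rule f_mult_integrable(2)[OF ab])
  qed (rule F(1))
  also have "\<dots> = integral {a..b} (\<lambda>t. f t * gt U (t - b))"
  proof (rule integral_cong)
    fix t
    have "gt U (t - b) = (\<Sum>e\<in>F. Re (cnj (thc e) * (- of_real (om e) * (cis (- om e * (t - b)) * coef U e))))"
      unfolding gt_def pr_def by (rule infsum_finite_support[OF F]) (simp add: F0)
    also have "\<dots> = (\<Sum>e\<in>F. \<beta> e * Re (cis (- om e * (t - b)) * coef U e))"
      by (rule sum.cong) (simp_all add: thc_def \<beta>_def algebra_simps)
    finally show "(\<Sum>e\<in>F. f t * (\<beta> e * Re (cis (- om e * (t - b)) * coef U e))) = f t * gt U (t - b)"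
      by (simp add: sum_distrib_left)
  qed
  finally show ?thesis .
qed

text \<open>The hidden-regularity constant of the whole interval, which dominates those of its
  subintervals.\<close>

definition K :: real where "K = 2 + 2 * \<kappa> * T"

text \<open>By duality with hidden regularity: the left-hand side is the pairing of \<open>Z a b\<close> with its own
  truncation, hence an integral of \<open>f\<close> against the trace of a finite combination of eigenfunctions.\<close>

lemma Z_finite_bound:
  assumes ab: "0 \<le> a" "a \<le> b" "b \<le> T" and F: "finite F" "F \<subseteq> E"
  shows "(\<Sum>e\<in>F. (cmod (Z a b e))\<^sup>2) \<le> K * integral {a..b} (\<lambda>t. (f t)\<^sup>2)"
proof -
  define S where "S = (\<Sum>e\<in>F. (cmod (Z a b e))\<^sup>2)"
  have S: "0 \<le> S" by (simp add: S_def sum_nonneg)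
  define c where "c e = (if e \<in> F then Z a b e else 0)" for e
  have lc: "l2 c" by (rule l2_finite[OF F]) (simp add: c_def)
  define U where "U = mk c"
  have cU: "coef U e = c e" if "e \<in> E" for e unfolding U_def by (rule coef_mk[OF lc that])
  have fU: "fin U" unfolding fin_def using F cU by (intro exI[of _ F]) (auto simp: c_def)
  have UX: "U \<in> X" by (rule DV_X[OF fin_DV[OF fU]])
  have ENU: "(EN U)\<^sup>2 = S"
    unfolding EN_def nrm_sq S_def
    by (subst infsum_finite_support[OF F]) (use cU F in \<open>auto simp: c_def intro!: sum.cong\<close>)
  have "pr (Z a b) (coef U) = (\<Sum>e\<in>F. Re (cnj (Z a b e) * coef U e))"
    unfolding pr_def by (rule infsum_finite_support[OF F]) (use cU in \<open>simp add: c_def\<close>)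
  also have "\<dots> = S" unfolding S_def
  proof (rule sum.cong[OF refl])
    fix e assume e: "e \<in> F"
    have "coef U e = Z a b e" using cU[of e] e F by (auto simp: c_def)
    then show "Re (cnj (Z a b e) * coef U e) = (cmod (Z a b e))\<^sup>2" unfolding cmod_power2 by (simp add: power2_eq_square)
  qed
  finally have "pr (Z a b) (coef U) = S" .
  then have "S = - integral {a..b} (\<lambda>t. f t * gt (wgroup (- b) U) t)"
    using Z_pairing[OF fU ab(1,3)] by (simp add: gt_wgroup[OF UX])
  then have "S\<^sup>2 = (integral {a..b} (\<lambda>t. f t * gt (wgroup (- b) U) t))\<^sup>2" by simp
  also have "\<dots> \<le> integral {a..b} (\<lambda>t. (f t)\<^sup>2) * integral {a..b} (\<lambda>t. (gt (wgroup (- b) U) t)\<^sup>2)"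
    by (intro f_cauchy_schwarz ab gt_continuous wgroup_DV fin_DV fU)
  also have "\<dots> \<le> integral {a..b} (\<lambda>t. (f t)\<^sup>2) * (K * S)"
  proof (rule mult_left_mono)
    have "integral {a..b} (\<lambda>t. (gt (wgroup (- b) U) t)\<^sup>2) \<le> (2 + 2 * \<kappa> * (b - a)) * S"
      using hidden_regularity[OF fin_wgroup[OF fU] ab(2), of "- b"] by (simp add: EN_wgroup[OF UX] ENU)
    also have "\<dots> \<le> K * S" unfolding K_def using ab \<kappa> S by (intro mult_right_mono add_left_mono mult_left_mono) auto
    finally show "integral {a..b} (\<lambda>t. (gt (wgroup (- b) U) t)\<^sup>2) \<le> K * S" .
    show "0 \<le> integral {a..b} (\<lambda>t. (f t)\<^sup>2)" by (rule Henstock_Kurzweil_Integration.integral_nonneg[OF f2_integrable(1)[OF ab(1,3)]]) simp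
  qed
  finally have "S * S \<le> (K * integral {a..b} (\<lambda>t. (f t)\<^sup>2)) * S" by (simp add: power2_eq_square mult_ac)
  moreover have "0 \<le> K * integral {a..b} (\<lambda>t. (f t)\<^sup>2)"
    using ab \<kappa> Henstock_Kurzweil_Integration.integral_nonneg[OF f2_integrable(1)[OF ab(1,3)]] by (simp add: K_def)
  ultimately have "S \<le> K * integral {a..b} (\<lambda>t. (f t)\<^sup>2)"
    using S by (cases "S = 0") (auto simp: mult_le_cancel_right)
  then show ?thesis by (simp add: S_def)
qed

lemma Z_l2:
  assumes ab: "0 \<le> a" "a \<le> b" "b \<le> T"
  shows "l2 (Z a b)" "nrm (Z a b) \<le> sqrt (K * integral {a..b} (\<lambda>t. (f t)\<^sup>2))"
proof -
  show l: "l2 (Z a b)" unfolding l2_def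
    by (rule nonneg_bdd_above_summable_on)
      (auto intro!: bdd_aboveI[of _ "K * integral {a..b} (\<lambda>t. (f t)\<^sup>2)"] Z_finite_bound[OF ab])
  show "nrm (Z a b) \<le> sqrt (K * integral {a..b} (\<lambda>t. (f t)\<^sup>2))"
    unfolding nrm_def using l unfolding l2_def
    by (intro real_sqrt_le_mono infsum_le_finite_sums Z_finite_bound[OF ab])
qed

lemma Y_l2: "0 \<le> t \<Longrightarrow> t \<le> T \<Longrightarrow> l2 (Y t)"
  unfolding Y_def[abs_def] by (intro l2_add Z_l2(1) l2_mult[OF Y0, of _ 1]) auto

lemma pr_Y0_wgroup:
  assumes U: "U \<in> X"
  shows "pr (\<lambda>e. cis (- om e * t) * Y0 e) (coef U) = pr Y0 (coef (wgroup (- t) U))"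
  unfolding pr_def
proof (rule infsum_cong)
  fix e assume e: "e \<in> E"
  show "Re (cnj (cis (- om e * t) * Y0 e) * coef U e) = Re (cnj (Y0 e) * coef (wgroup (- t) U) e)"
    unfolding coef_wgroup[OF U e] by (simp add: cis_cnj mult_ac)
qed

lemma Y_pairing_fin:
  assumes U: "fin U" and t: "0 \<le> t" "t \<le> T"
  shows "pr (Y t) (coef U) = pr Y0 (coef (wgroup (- t) U)) - integral {0..t} (\<lambda>s. f s * gt U (s - t))"
proof -
  have UX: "U \<in> X" by (rule DV_X[OF fin_DV[OF U]])
  have "pr (Y t) (coef U) = pr (\<lambda>e. cis (- om e * t) * Y0 e) (coef U) + pr (Z 0 t) (coef U)"
    unfolding Y_def[abs_def] using UX t by (intro pr_add_left Z_l2(1) l2_mult[OF Y0, of _ 1]) (auto simp: X_iff)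
  then show ?thesis unfolding pr_Y0_wgroup[OF UX] Z_pairing[OF U order_refl t(2)] by simp
qed

text \<open>Spectral truncation extends the identity from finite combinations to the operator
  domain, where classical traces are defined.\<close>

lemma Y_pairing:
  assumes U: "U \<in> D \<times> V" and t: "0 \<le> t" "t \<le> T"
  shows "pr (Y t) (coef U) = pr Y0 (coef (wgroup (- t) U)) - integral {0..t} (\<lambda>s. f s * gt U (s - t))"
proof -
  have UX: "U \<in> X" by (rule DV_X[OF U])
  let ?Fl = "finite_subsets_at_top E"
  define I where "I = integral {0..t} (\<lambda>s. (f s)\<^sup>2)"
  have I: "0 \<le> I" unfolding I_def
    by (rule Henstock_Kurzweil_Integration.integral_nonneg[OF f2_integrable(1)]) (use t in auto)
  define R where "R = pr (Y t) (coef U) - (pr Y0 (coef (wgroup (- t) U)) - integral {0..t} (\<lambda>s. f s * gt U (s - t)))"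
  \<comment> \<open>The truncation errors of the state at time t, of the initial term and of the
    trace. The first two are measured in the energy norm, the third in the norm weighted by
    \<open>om\<close>, which is why U lies in \<open>D \<times> V\<close>.\<close>
  define h where "h F = nrm (Y t) * EN (U - restr F U) + nrm Y0 * EN (U - restr F U)
    + sqrt I * sqrt (t * (nrm thc * nrm (\<lambda>e. om e * coef (U - restr F U) e))\<^sup>2)" for F
  have le: "\<bar>R\<bar> \<le> h F" if F: "finite F" "F \<subseteq> E" for F
  proof -
    define A B where "A = restr F U" and "B = U - restr F U"
    have A: "A \<in> D \<times> V" unfolding A_def by (rule restr_DV[OF F])
    have B: "B \<in> D \<times> V" unfolding B_def using DV_add[OF U DV_scale[OF restr_DV[OF F], of "-1"]] by simp
    have AX: "A \<in> X" and BX: "B \<in> X" using A B DV_X by auto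
    have UAB: "U = A + B" by (simp add: A_def B_def)
    have p: "pr a (coef U) = pr a (coef A) + pr a (coef B)" if "l2 a" for a
      unfolding UAB coef_add[abs_def] using that AX BX by (intro pr_add_right) (auto simp: X_iff)
    have w: "pr Y0 (coef (wgroup (- t) U)) = pr Y0 (coef (wgroup (- t) A)) + pr Y0 (coef (wgroup (- t) B))"
      using p[OF l2_mult[OF Y0, of "\<lambda>e. cis (- om e * t)" 1]] pr_Y0_wgroup[OF UX, of t] pr_Y0_wgroup[OF AX, of t] pr_Y0_wgroup[OF BX, of t]
      by simp
    have gc: "continuous_on {0..t} (\<lambda>s. gt W (s - t))" if "W \<in> D \<times> V" for W
      by (rule continuous_on_compose2[OF gt_continuous[OF that, of UNIV]]) (auto intro!: continuous_intros)
    have "integral {0..t} (\<lambda>s. f s * gt U (s - t)) = integral {0..t} (\<lambda>s. f s * gt A (s - t) + f s * gt B (s - t))"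
      unfolding UAB by (simp add: gt_add[OF A B] distrib_left)
    also have "\<dots> = integral {0..t} (\<lambda>s. f s * gt A (s - t)) + integral {0..t} (\<lambda>s. f s * gt B (s - t))"
      by (intro integral_add f_mult_integrable(2) gc A B order_refl t)
    finally have "R = pr (Y t) (coef B) - pr Y0 (coef (wgroup (- t) B)) + integral {0..t} (\<lambda>s. f s * gt B (s - t))"
      unfolding R_def w p[OF Y_l2[OF t]] using Y_pairing_fin[OF fin_restr[OF F, of U] t] by (simp add: A_def)
    moreover have "\<bar>pr (Y t) (coef B)\<bar> \<le> nrm (Y t) * EN B"
      unfolding EN_def using BX by (intro pr_bound Y_l2 t) (simp add: X_iff)
    moreover have "\<bar>pr Y0 (coef (wgroup (- t) B))\<bar> \<le> nrm Y0 * EN B"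
      using pr_bound[OF Y0, of "coef (wgroup (- t) B)"] wgroup_X[OF BX, of "- t"] EN_wgroup[OF BX, of "- t"]
      by (simp add: X_iff EN_def)
    moreover have "\<bar>integral {0..t} (\<lambda>s. f s * gt B (s - t))\<bar> \<le> sqrt I * sqrt (t * (nrm thc * nrm (\<lambda>e. om e * coef B e))\<^sup>2)"
    proof -
      have "integral {0..t} (\<lambda>s. (gt B (s - t))\<^sup>2) \<le> integral {0..t} (\<lambda>s. (nrm thc * nrm (\<lambda>e. om e * coef B e))\<^sup>2)"
      proof (rule integral_le)
        show "(\<lambda>s. (gt B (s - t))\<^sup>2) integrable_on {0..t}"
          by (intro integrable_continuous_interval continuous_intros gc B)
        show "(gt B (s - t))\<^sup>2 \<le> (nrm thc * nrm (\<lambda>e. om e * coef B e))\<^sup>2" for s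
          using gt_bound[OF B, of "s - t"] by (intro power2_le_iff_abs_le[THEN iffD2]) (auto simp: nrm_nonneg)
      qed auto
      also have "\<dots> = t * (nrm thc * nrm (\<lambda>e. om e * coef B e))\<^sup>2" using t by simp
      finally have b: "integral {0..t} (\<lambda>s. (gt B (s - t))\<^sup>2) \<le> t * (nrm thc * nrm (\<lambda>e. om e * coef B e))\<^sup>2" .
      have "(integral {0..t} (\<lambda>s. f s * gt B (s - t)))\<^sup>2 \<le> I * integral {0..t} (\<lambda>s. (gt B (s - t))\<^sup>2)"
        unfolding I_def by (intro f_cauchy_schwarz gc B order_refl t)
      also have "\<dots> \<le> I * (t * (nrm thc * nrm (\<lambda>e. om e * coef B e))\<^sup>2)" by (intro mult_left_mono b I)
      finally show ?thesis unfolding real_sqrt_mult[symmetric] by (intro real_le_rsqrt) simp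
    qed
    ultimately show ?thesis unfolding h_def B_def[symmetric] by linarith
  qed
  have n0: "((\<lambda>F. nrm (\<lambda>e. om e * coef (U - restr F U) e)) \<longlongrightarrow> 0) ?Fl"
  proof (rule Lim_transform_eventually[OF nrm_restr_tendsto[of "\<lambda>e. om e * coef U e"]])
    show "l2 (\<lambda>e. om e * coef U e)" using U by (simp add: DV_iff)
    show "\<forall>\<^sub>F F in ?Fl. nrm (\<lambda>e. if e \<in> F then 0 else om e * coef U e) = nrm (\<lambda>e. om e * coef (U - restr F U) e)"
      by (rule eventually_finite_subsets_at_top_weakI) (auto simp: coef_diff coef_restr intro!: nrm_cong)
  qed
  have "(h \<longlongrightarrow> nrm (Y t) * 0 + nrm Y0 * 0 + sqrt I * sqrt (t * (nrm thc * 0)\<^sup>2)) ?Fl"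
    unfolding h_def by (intro tendsto_intros EN_restr_tendsto[OF UX] n0)
  then have h0: "(h \<longlongrightarrow> 0) ?Fl" by simp
  have "\<bar>R\<bar> \<le> 0"
    by (rule tendsto_lowerbound[OF h0]) (auto intro!: eventually_finite_subsets_at_top_weakI le)
  then show ?thesis by (simp add: R_def)
qed

section \<open>Continuity and differentiability in time\<close>

definition Fi :: "real \<Rightarrow> real" where "Fi x = integral {0..x} (\<lambda>t. (f t)\<^sup>2)"

lemma Fi_diff:
  assumes "0 \<le> s" "s \<le> t" "t \<le> T" shows "integral {s..t} (\<lambda>t. (f t)\<^sup>2) = \<bar>Fi t - Fi s\<bar>"
proof -
  have "Fi s + integral {s..t} (\<lambda>t. (f t)\<^sup>2) = Fi t"
    unfolding Fi_def by (rule Henstock_Kurzweil_Integration.integral_combine[OF assms(1,2) f2_integrable(1)]) (use assms in auto)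
  moreover have "0 \<le> integral {s..t} (\<lambda>t. (f t)\<^sup>2)"
    by (rule Henstock_Kurzweil_Integration.integral_nonneg[OF f2_integrable(1)]) (use assms in auto)
  ultimately show ?thesis by linarith
qed

text \<open>For s after t this is the cocycle. For s before t the cocycle is solved for
  \<open>Y s\<close>: the rotation by s - t inverts the one by t - s and, being of modulus one, does
  not enlarge the Duhamel term.\<close>

lemma Y_close:
  assumes s: "s \<in> {0..T}" and t: "t \<in> {0..T}"
  shows "nrm (\<lambda>e. Y s e - Y t e) \<le> nrm (\<lambda>e. (cis (- om e * (s - t)) - 1) * Y t e) + sqrt (K * \<bar>Fi s - Fi t\<bar>)"
proof -
  have lt: "l2 (\<lambda>e. (cis (- om e * (s - t)) - 1) * Y t e)"
  proof (rule l2_mult[where K=2])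
    show "l2 (Y t)" using t by (intro Y_l2) auto
    show "cmod (cis (- om e * (s - t)) - 1) \<le> 2" for e
      using norm_triangle_ineq4[of "cis (- om e * (s - t))" 1] by simp
  qed
  show ?thesis
  proof (cases "t \<le> s")
    case True
    have ts: "0 \<le> t" "t \<le> s" "s \<le> T" using s t True by auto
    have "nrm (\<lambda>e. Y s e - Y t e) = nrm (\<lambda>e. (cis (- om e * (s - t)) - 1) * Y t e + Z t s e)"
      by (rule nrm_cong) (simp add: Y_cocycle[OF ts] algebra_simps)
    also have "\<dots> \<le> nrm (\<lambda>e. (cis (- om e * (s - t)) - 1) * Y t e) + nrm (Z t s)"
      by (rule nrm_triangle[OF lt Z_l2(1)[OF ts]])
    finally show ?thesis using Z_l2(2)[OF ts] by (simp add: Fi_diff[OF ts])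
  next
    case False
    have st: "0 \<le> s" "s \<le> t" "t \<le> T" using s t False by auto
    let ?z = "\<lambda>e. (- cis (- om e * (s - t))) * Z s t e"
    have lz: "l2 ?z" by (rule l2_mult[OF Z_l2(1)[OF st], of _ 1]) simp
    have "nrm (\<lambda>e. Y s e - Y t e) = nrm (\<lambda>e. (cis (- om e * (s - t)) - 1) * Y t e + ?z e)"
    proof (rule nrm_cong)
      fix e
      have c: "cis (- om e * (s - t)) * cis (- om e * (t - s)) = 1" by (simp add: cis_mult algebra_simps)
      have "cis (- om e * (s - t)) * Y t e = (cis (- om e * (s - t)) * cis (- om e * (t - s))) * Y s e + cis (- om e * (s - t)) * Z s t e"
        unfolding Y_cocycle[OF st] by (simp only: distrib_left mult.assoc)
      then show "Y s e - Y t e = (cis (- om e * (s - t)) - 1) * Y t e + ?z e" unfolding c by (simp add: algebra_simps)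
    qed
    also have "\<dots> \<le> nrm (\<lambda>e. (cis (- om e * (s - t)) - 1) * Y t e) + nrm ?z"
      by (rule nrm_triangle[OF lt lz])
    also have "nrm ?z \<le> nrm (Z s t)" by (rule nrm_mono[OF Z_l2(1)[OF st]]) (simp add: norm_mult)
    also have "nrm (Z s t) \<le> sqrt (K * \<bar>Fi s - Fi t\<bar>)"
      using Z_l2(2)[OF st] unfolding Fi_diff[OF st] by (simp add: abs_minus_commute)
    finally show ?thesis by simp
  qed
qed

lemma Y_continuous:
  assumes t: "t \<in> {0..T}"
  shows "((\<lambda>s. nrm (\<lambda>e. Y s e - Y t e)) \<longlongrightarrow> 0) (at t within {0..T})"
proof (rule Lim_null_comparison)
  let ?h = "\<lambda>s. nrm (\<lambda>e. (cis (- om e * (s - t)) - 1) * Y t e) + sqrt (K * \<bar>Fi s - Fi t\<bar>)"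
  show "\<forall>\<^sub>F s in at t within {0..T}. norm (nrm (\<lambda>e. Y s e - Y t e)) \<le> ?h s"
    unfolding eventually_at_filter using Y_close[OF _ t] by (auto simp: nrm_nonneg)
  have 1: "((\<lambda>s. nrm (\<lambda>e. (cis (- om e * (s - t)) - 1) * Y t e)) \<longlongrightarrow> 0) (at t within {0..T})"
  proof (rule nrm_tendsto_0[where c="Y t" and K=2])
    show "l2 (Y t)" using t by (intro Y_l2) auto
    show "cmod ((cis (- om e * (h - t)) - 1) * Y t e) \<le> 2 * cmod (Y t e)" for e h
      using norm_triangle_ineq4[of "cis (- om e * (h - t))" 1] by (auto simp: norm_mult intro!: mult_right_mono)
    show "((\<lambda>h. (cis (- om e * (h - t)) - 1) * Y t e) \<longlongrightarrow> 0) (at t within {0..T})" for e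
    proof -
      have "((\<lambda>h. (cis (- om e * (h - t)) - 1) * Y t e) \<longlongrightarrow> (cis (- om e * (t - t)) - 1) * Y t e) (at t within {0..T})"
        by (intro tendsto_intros)
      then show ?thesis by simp
    qed
  qed
  have "continuous_on {0..T} Fi"
    unfolding Fi_def[abs_def] by (rule indefinite_integral_continuous_1[OF f2_integrable(1)]) auto
  then have Fl: "(Fi \<longlongrightarrow> Fi t) (at t within {0..T})" using t by (simp add: continuous_on_def)
  have "(?h \<longlongrightarrow> 0 + sqrt (K * \<bar>Fi t - Fi t\<bar>)) (at t within {0..T})"
    by (intro tendsto_add 1 tendsto_real_sqrt tendsto_mult tendsto_const tendsto_rabs tendsto_diff Fl)
  then show "(?h \<longlongrightarrow> 0) (at t within {0..T})" by simp
qed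

definition Fa :: "real \<Rightarrow> real" where "Fa x = integral {0..x} (\<lambda>t. \<bar>f t\<bar>)"

lemma Fa_diff:
  assumes "0 \<le> s" "s \<le> t" "t \<le> T" shows "integral {s..t} (\<lambda>t. \<bar>f t\<bar>) = \<bar>Fa t - Fa s\<bar>"
proof -
  have "Fa s + integral {s..t} (\<lambda>t. \<bar>f t\<bar>) = Fa t"
    unfolding Fa_def by (rule Henstock_Kurzweil_Integration.integral_combine[OF assms(1,2) f_abs_integrable]) (use assms in auto)
  moreover have "0 \<le> integral {s..t} (\<lambda>t. \<bar>f t\<bar>)"
    by (rule Henstock_Kurzweil_Integration.integral_nonneg[OF f_abs_integrable]) (use assms in auto)
  ultimately show ?thesis by linarith
qed

text \<open>The sine vanishes at r = c, which gains a factor of the length of the interval. The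
  remaining integral of the absolute value of f tends to 0 with the length, so the total is of
  smaller order than the length.\<close>

lemma sin_integral_bound:
  assumes st: "0 \<le> s" "s \<le> t" "t \<le> T" and c: "c \<in> {s..t}" and w: "0 \<le> w"
  shows "\<bar>integral {s..t} (\<lambda>r. f r * sin (w * (c - r)))\<bar> \<le> w * \<bar>t - s\<bar> * \<bar>Fa t - Fa s\<bar>"
proof -
  have i: "(\<lambda>r. f r * sin (w * (c - r))) integrable_on {s..t}"
    by (rule cs_integrable) (use st in auto)
  have a: "(\<lambda>r. w * \<bar>t - s\<bar> * \<bar>f r\<bar>) integrable_on {s..t}"
    by (intro integrable_on_mult_right f_abs_integrable) (use st in auto)
  have "norm (integral {s..t} (\<lambda>r. f r * sin (w * (c - r)))) \<le> integral {s..t} (\<lambda>r. w * \<bar>t - s\<bar> * \<bar>f r\<bar>)"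
  proof (rule Henstock_Kurzweil_Integration.integral_norm_bound_integral[OF i a])
    fix r assume r: "r \<in> {s..t}"
    have "\<bar>sin (w * (c - r))\<bar> \<le> \<bar>w * (c - r)\<bar>" by (rule abs_sin_x_le_abs_x)
    also have "\<dots> = w * \<bar>c - r\<bar>" using w by (simp add: abs_mult)
    also have "\<dots> \<le> w * \<bar>t - s\<bar>" by (rule mult_left_mono[OF _ w]) (use r c in auto)
    finally show "norm (f r * sin (w * (c - r))) \<le> w * \<bar>t - s\<bar> * \<bar>f r\<bar>"
      by (simp add: abs_mult mult.commute mult_left_mono)
  qed
  also have "\<dots> = w * \<bar>t - s\<bar> * \<bar>Fa t - Fa s\<bar>" by (simp add: Fa_diff[OF st])
  finally show ?thesis by simp
qed

text \<open>The control is merely square integrable and drives the real part, the velocity,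
  directly; the imaginary part, the displacement, sees it only through a sine. This makes the
  displacement differentiable at every time.\<close>

lemma Y_derivative:
  assumes t: "t \<in> {0..T}" and e: "e \<in> E"
  shows "((\<lambda>s. - Im (Y s e)) has_real_derivative om e * Re (Y t e)) (at t within {0..T})"
proof -
  \<comment> \<open>The deviation at time s from the uncontrolled continuation of the state at time
    t; it carries the whole effect of the control.\<close>
  define R where "R s = Y s e - cis (- om e * (s - t)) * Y t e" for s
  define M where "M = \<bar>\<beta> e\<bar> * om e"
  have ome: "0 \<le> om e" using om_pos[OF e] by simp
  have R: "\<bar>Im (R s)\<bar> \<le> M * \<bar>s - t\<bar> * \<bar>Fa s - Fa t\<bar>" if s: "s \<in> {0..T}" for s
  proof (cases "t \<le> s")
    case True
    have ts: "0 \<le> t" "t \<le> s" "s \<le> T" using s t True by auto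
    have "Im (R s) = \<beta> e * integral {t..s} (\<lambda>r. f r * sin (om e * (s - r)))"
      unfolding R_def Y_cocycle[OF ts] by (simp add: Z_def Sn_def)
    then have "\<bar>Im (R s)\<bar> = \<bar>\<beta> e\<bar> * \<bar>integral {t..s} (\<lambda>r. f r * sin (om e * (s - r)))\<bar>" by (simp add: abs_mult)
    also have "\<dots> \<le> \<bar>\<beta> e\<bar> * (om e * \<bar>s - t\<bar> * \<bar>Fa s - Fa t\<bar>)"
      by (intro mult_left_mono sin_integral_bound[OF ts _ ome]) (use ts in auto)
    finally show ?thesis by (simp add: M_def mult.assoc)
  next
    case False
    have st: "0 \<le> s" "s \<le> t" "t \<le> T" using s t False by auto
    have c: "cis (- om e * (s - t)) * cis (- om e * (t - s)) = 1" by (simp add: cis_mult algebra_simps)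
    have "cis (- om e * (s - t)) * Y t e = (cis (- om e * (s - t)) * cis (- om e * (t - s))) * Y s e + cis (- om e * (s - t)) * Z s t e"
      unfolding Y_cocycle[OF st] by (simp only: distrib_left mult.assoc)
    then have "R s = - (cis (- om e * (s - t)) * Z s t e)" unfolding c R_def by simp
    moreover have "- om e * (s - t) = om e * (t - s)" by (simp add: algebra_simps)
    ultimately have Rs: "R s = - (cis (om e * (t - s)) * Z s t e)" by simp
    let ?x = "om e * (t - s)"
    \<comment> \<open>For s before t, undoing the rotation moves the reference time in the sine from
      t to s, so that the bound applies with c = s.\<close>
    have "integral {s..t} (\<lambda>r. f r * sin (om e * (s - r))) = cos ?x * Sn s t e - sin ?x * Cs s t e"
    proof -
      have "integral {s..t} (\<lambda>r. f r * sin (om e * (s - r)))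
        = integral {s..t} (\<lambda>r. cos ?x * (f r * sin (om e * (t - r))) - sin ?x * (f r * cos (om e * (t - r))))"
      proof (rule integral_cong)
        fix r
        have "om e * (s - r) = om e * (t - r) - ?x" by (simp add: algebra_simps)
        then show "f r * sin (om e * (s - r)) = cos ?x * (f r * sin (om e * (t - r))) - sin ?x * (f r * cos (om e * (t - r)))"
          by (simp only: sin_diff) (simp add: algebra_simps)
      qed
      then show ?thesis unfolding Cs_def Sn_def using cs_integrable[OF st(1,3)]
        by (simp add: integral_diff integrable_on_mult_right)
    qed
    moreover have "Im (R s) = - (cos ?x * (\<beta> e * Sn s t e) + sin ?x * (- \<beta> e * Cs s t e))"
      unfolding Rs by (simp add: Z_def)
    ultimately have "Im (R s) = - \<beta> e * integral {s..t} (\<lambda>r. f r * sin (om e * (s - r)))"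
      by (simp only:) (simp add: algebra_simps)
    then have "\<bar>Im (R s)\<bar> = \<bar>\<beta> e\<bar> * \<bar>integral {s..t} (\<lambda>r. f r * sin (om e * (s - r)))\<bar>" by (simp add: abs_mult)
    also have "\<dots> \<le> \<bar>\<beta> e\<bar> * (om e * \<bar>t - s\<bar> * \<bar>Fa t - Fa s\<bar>)"
      by (intro mult_left_mono sin_integral_bound[OF st _ ome]) (use st in auto)
    finally show ?thesis by (simp add: M_def mult.assoc abs_minus_commute)
  qed
  have Rt: "Im (R t) = 0" by (simp add: R_def)
  have "((\<lambda>s. Im (R s)) has_real_derivative 0) (at t within {0..T})"
    unfolding has_field_derivative_iff
  proof (rule Lim_null_comparison)
    show "\<forall>\<^sub>F s in at t within {0..T}. norm ((Im (R s) - Im (R t)) / (s - t)) \<le> M * \<bar>Fa s - Fa t\<bar>"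
      unfolding eventually_at_filter
    proof (intro always_eventually allI impI)
      fix s assume "s \<noteq> t" "s \<in> {0..T}"
      with R[of s] show "norm ((Im (R s) - Im (R t)) / (s - t)) \<le> M * \<bar>Fa s - Fa t\<bar>"
        by (simp add: Rt abs_divide pos_divide_le_eq mult_ac)
    qed
    have "continuous_on {0..T} Fa"
      unfolding Fa_def[abs_def] by (rule indefinite_integral_continuous_1[OF f_abs_integrable]) auto
    then have Fl: "(Fa \<longlongrightarrow> Fa t) (at t within {0..T})" using t by (simp add: continuous_on_def)
    have "((\<lambda>s. M * \<bar>Fa s - Fa t\<bar>) \<longlongrightarrow> M * \<bar>Fa t - Fa t\<bar>) (at t within {0..T})"
      by (intro tendsto_intros Fl)
    then show "((\<lambda>s. M * \<bar>Fa s - Fa t\<bar>) \<longlongrightarrow> 0) (at t within {0..T})" by simp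
  qed
  moreover have "((\<lambda>s. Im (cis (- om e * (s - t)) * Y t e)) has_real_derivative - (om e * Re (Y t e))) (at t within {0..T})"
  proof -
    have "((\<lambda>s. cos (om e * (s - t)) * Im (Y t e) - sin (om e * (s - t)) * Re (Y t e)) has_real_derivative - (om e * Re (Y t e))) (at t within {0..T})"
      by (auto intro!: derivative_eq_intros)
    then show ?thesis by simp
  qed
  ultimately have "((\<lambda>s. - (Im (R s) + Im (cis (- om e * (s - t)) * Y t e))) has_real_derivative - (0 + - (om e * Re (Y t e)))) (at t within {0..T})"
    by (intro DERIV_minus DERIV_add)
  moreover have "- (Im (R s) + Im (cis (- om e * (s - t)) * Y t e)) = - Im (Y s e)" for s
    unfolding plus_complex.sel(2)[symmetric] by (simp only: R_def diff_add_cancel)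
  ultimately show ?thesis by simp
qed

text \<open>Mean value inequality for the pairing minus its linearization at t. The bound is
  proportional to the energy norm of v, and this uniformity turns coordinatewise differentiability
  into differentiability in the dual norm. Finite partial sums may be differentiated termwise, and
  their bound survives the limit.\<close>

lemma Y_C1:
  assumes s: "s \<in> {0..T}" and t: "t \<in> {0..T}" and v: "v \<in> V" and \<eta>: "0 \<le> \<eta>"
    and close: "\<And>r. r \<in> closed_segment t s \<Longrightarrow> nrm (\<lambda>e. Y r e - Y t e) \<le> \<eta>"
  shows "\<bar>(- pr (Y s) (coef (0, v)) + pr (Y t) (coef (0, v))) - (s - t) * pr (Y t) (coef (v, 0))\<bar> \<le> \<eta> * EN (v, 0) * \<bar>s - t\<bar>"
proof -
  have seg: "closed_segment t s \<subseteq> {0..T}" using s t by (auto simp: closed_segment_eq_real_ivl split: if_splits)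
  have v0: "l2 (coef (v, 0))" using v unfolding X_iff[symmetric] by (simp add: X_def)
  have v1: "l2 (coef (0, v))" unfolding X_iff[symmetric] by (simp add: X_def V_subspace)
  have lY: "l2 (Y r)" if "r \<in> {0..T}" for r using that by (intro Y_l2) auto
  \<comment> \<open>A coordinate of the solution minus its linear part with slope frozen at t; the
    derivative stays small as long as \<open>Y r\<close> is close to \<open>Y t\<close>.\<close>
  define G where "G r e = - (Im (Y r e) * inner v e) - r * (om e * Re (Y t e) * inner v e)" for r e
  have p1: "Re (cnj (Y r e) * coef (0, v) e) = Im (Y r e) * inner v e" for r e by (simp add: coef_def)
  have p0: "Re (cnj (Y r e) * coef (v, 0) e) = om e * Re (Y r e) * inner v e" for r e by (simp add: coef_def)
  have s1: "(\<lambda>e. Im (Y r e) * inner v e) summable_on E" if "r \<in> {0..T}" for r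
    using pr_summable[OF lY[OF that] v1] unfolding p1 .
  have s0: "(\<lambda>e. om e * Re (Y t e) * inner v e) summable_on E"
    using pr_summable[OF lY[OF t] v0] unfolding p0 .
  have Gs: "((\<lambda>e. G r e) has_sum (- pr (Y r) (coef (0, v)) - r * pr (Y t) (coef (v, 0)))) E" if r: "r \<in> {0..T}" for r
  proof -
    have "((\<lambda>e. (-1) * (Im (Y r e) * inner v e) + (- r) * (om e * Re (Y t e) * inner v e)) has_sum
       ((-1) * pr (Y r) (coef (0, v)) + (- r) * pr (Y t) (coef (v, 0)))) E"
      unfolding pr_def p1 p0
      by (intro has_sum_add has_sum_cmult_right has_sum_infsum s1[OF r] s0)
    then show ?thesis by (simp add: G_def)
  qed
  have fin_le: "\<bar>(\<Sum>e\<in>F. G s e) - (\<Sum>e\<in>F. G t e)\<bar> \<le> \<eta> * EN (v, 0) * \<bar>s - t\<bar>" if F: "finite F" "F \<subseteq> E" for F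
  proof -
    define g' where "g' r = (\<Sum>e\<in>F. (om e * Re (Y r e) - om e * Re (Y t e)) * inner v e)" for r
    have dG: "((\<lambda>r. \<Sum>e\<in>F. G r e) has_real_derivative g' r) (at r within closed_segment t s)" if r: "r \<in> closed_segment t s" for r
      unfolding g'_def
    proof (rule DERIV_sum)
      fix e assume e: "e \<in> F"
      have "((\<lambda>r. - Im (Y r e)) has_real_derivative om e * Re (Y r e)) (at r within closed_segment t s)"
        by (rule DERIV_subset[OF Y_derivative seg]) (use r seg e F in auto)
      then have "((\<lambda>r. (- Im (Y r e)) * inner v e - r * (om e * Re (Y t e) * inner v e)) has_real_derivative
          om e * Re (Y r e) * inner v e - 1 * (om e * Re (Y t e) * inner v e)) (at r within closed_segment t s)"
        by (intro DERIV_diff DERIV_cmult_right DERIV_ident)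
      then show "((\<lambda>r. G r e) has_real_derivative (om e * Re (Y r e) - om e * Re (Y t e)) * inner v e) (at r within closed_segment t s)"
        by (simp add: G_def left_diff_distrib)
    qed
    have g'b: "norm (g' r) \<le> \<eta> * EN (v, 0)" if r: "r \<in> closed_segment t s" for r
    proof -
      have rT: "r \<in> {0..T}" using r seg by auto
      define a where "a e = (if e \<in> F then Y r e - Y t e else 0)" for e
      have ld: "l2 (\<lambda>e. Y r e - Y t e)" by (intro l2_diff lY rT t)
      have la: "l2 a" by (rule l2_finite[OF F]) (simp add: a_def)
      have "g' r = pr a (coef (v, 0))"
        unfolding pr_def g'_def
        by (subst infsum_finite_support[OF F]) (auto simp: a_def coef_def algebra_simps intro!: sum.cong)
      then have "norm (g' r) \<le> nrm a * EN (v, 0)" using pr_bound[OF la v0] by (simp add: EN_def)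
      also have "nrm a \<le> \<eta>"
        by (rule order_trans[OF nrm_mono[OF ld] close[OF r]]) (simp add: a_def)
      finally show ?thesis by (simp add: mult_right_mono EN_nonneg)
    qed
    have "norm ((\<Sum>e\<in>F. G s e) - (\<Sum>e\<in>F. G t e)) \<le> \<eta> * EN (v, 0) * norm (s - t)"
      by (rule field_differentiable_bound[of "closed_segment t s" "\<lambda>r. \<Sum>e\<in>F. G r e" g', OF convex_closed_segment dG g'b]) auto
    then show ?thesis by simp
  qed
  have "((\<lambda>F. \<bar>(\<Sum>e\<in>F. G s e) - (\<Sum>e\<in>F. G t e)\<bar>) \<longlongrightarrow>
      \<bar>(- pr (Y s) (coef (0, v)) - s * pr (Y t) (coef (v, 0))) - (- pr (Y t) (coef (0, v)) - t * pr (Y t) (coef (v, 0)))\<bar>) (finite_subsets_at_top E)"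
    using Gs[OF s] Gs[OF t] unfolding has_sum_def by (intro tendsto_rabs tendsto_diff)
  then have "\<bar>(- pr (Y s) (coef (0, v)) - s * pr (Y t) (coef (v, 0))) - (- pr (Y t) (coef (0, v)) - t * pr (Y t) (coef (v, 0)))\<bar> \<le> \<eta> * EN (v, 0) * \<bar>s - t\<bar>"
    by (rule tendsto_upperbound) (auto intro!: eventually_finite_subsets_at_top_weakI fin_le)
  then show ?thesis by (simp add: algebra_simps)
qed

end

section \<open>The degenerate wave equation\<close>

lemma generates_C0_group_cong:
  assumes X: "\<And>U V. U \<in> X \<Longrightarrow> V \<in> X \<Longrightarrow> U - V \<in> X" "\<And>c U. U \<in> X \<Longrightarrow> c *\<^sub>R U \<in> X"
    and N: "\<And>U. U \<in> X \<Longrightarrow> N U = N' U" and B: "\<And>U. U \<in> Dom \<Longrightarrow> B U = B' U"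
    and S: "generates_C0_group X N Dom B S"
  shows "generates_C0_group X N' Dom B' S"
proof -
  have SX: "S t U \<in> X" if "U \<in> X" for t U
    using S that by (simp add: generates_C0_group_def C0_group_def)
  have 1: "N' (S t U - U) = N (S t U - U)" if "U \<in> X" for t U
    using N[OF X(1)[OF SX[OF that] that]] by simp
  have 2: "N' ((S h U - U) /\<^sub>R h - V) = N ((S h U - U) /\<^sub>R h - V)" if "U \<in> X" "V \<in> X" for h U V
    by (rule N[symmetric]) (intro X SX that)
  have 3: "N' U = N U" "N' (S t U) = N (S t U)" if "U \<in> X" for t U
    using N[OF that] N[OF SX[OF that]] by simp_all
  have "C0_group X N' S"
    using S unfolding generates_C0_group_def C0_group_def by (simp add: 1 3)
  moreover have "((\<lambda>h. N' ((S h U - U) /\<^sub>R h - V)) \<longlongrightarrow> 0) (at 0) \<longleftrightarrow> U \<in> Dom \<and> V = B' U"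
    if "U \<in> X" "V \<in> X" for U V
    using S that B unfolding generates_C0_group_def by (auto simp: 2[OF that])
  ultimately show ?thesis by (simp add: generates_C0_group_def)
qed

section \<open>Identification of the degenerate equation with the abstract system\<close>

locale hardy_eigenbasis = hardy_factorization \<alpha> b + orthonormal_basis E
  for \<alpha> b :: real and E :: "L2 set" +
  assumes eigenvector: "e \<in> E \<Longrightarrow> \<exists>k>0. G (Gs e) = k *\<^sub>R e"
begin

sublocale G: bounded_linear G by (rule bounded_linear_G)
sublocale Gs: bounded_linear Gs by (rule bounded_linear_Gs)

text \<open>The eigenvalue of -A at e: pairing the eigenvector equation of \<open>G (Gs e)\<close>
  with e shows that the factor k is the squared norm of \<open>Gs e\<close>.\<close>

definition lam :: "L2 \<Rightarrow> real" where "lam e = 1 / (norm (Gs e))\<^sup>2"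

lemma norm_Gs_pos: "e \<in> E \<Longrightarrow> 0 < norm (Gs e)"
  using Gs_eq_0[of e] unit[of e] by auto

lemma lam_pos: "e \<in> E \<Longrightarrow> 0 < lam e"
  using norm_Gs_pos[of e] by (simp add: lam_def)

lemma G_Gs_basis: assumes e: "e \<in> E" shows "lam e *\<^sub>R G (Gs e) = e"
proof -
  obtain k where k: "G (Gs e) = k *\<^sub>R e" using eigenvector[OF e] by blast
  have "k = inner (G (Gs e)) e" using unit[OF e] by (simp add: k)
  also have "\<dots> = (norm (Gs e))\<^sup>2" by (simp add: adjoint power2_norm_eq_inner)
  finally show ?thesis using norm_Gs_pos[OF e] by (simp add: k lam_def)
qed

lemma inner_G_Gs_basis: assumes e: "e \<in> E" shows "lam e * inner (G (Gs f)) e = inner f e"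
proof -
  have "inner (G (Gs f)) e = inner f (G (Gs e))" by (metis adjoint inner_commute)
  then have "lam e * inner (G (Gs f)) e = inner f (lam e *\<^sub>R G (Gs e))" by simp
  then show ?thesis unfolding G_Gs_basis[OF e] .
qed

text \<open>The spectral lower bound restates the Hardy-Poincare inequality in the form
  \<open>norm (Gs e) \<le> 1 / \<delta>\<close>.\<close>

sublocale W: wave_system E lam "\<delta>\<^sup>2"
proof
  show "0 < \<delta>\<^sup>2" using \<alpha> by simp
  fix e assume e: "e \<in> E"
  have "norm (Gs e) \<le> 1 / \<delta>" using Gs_norm[of e] unit[OF e] by (simp add: norm_eq_sqrt_inner)
  then have "(norm (Gs e))\<^sup>2 \<le> (1 / \<delta>)\<^sup>2" by (rule power_mono) simp
  also have "(1 / \<delta>)\<^sup>2 = 1 / \<delta>\<^sup>2" by (simp add: power_divide)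
  finally have *: "(norm (Gs e))\<^sup>2 \<le> 1 / \<delta>\<^sup>2" .
  have d: "0 < \<delta>\<^sup>2" using \<alpha> by simp
  have "\<delta>\<^sup>2 * (norm (Gs e))\<^sup>2 \<le> 1" using mult_left_mono[OF *, of "\<delta>\<^sup>2"] d by simp
  then show "\<delta>\<^sup>2 \<le> lam e" using norm_Gs_pos[OF e] by (simp add: lam_def pos_le_divide_eq)
qed

text \<open>The normalized vectors \<open>Gs e\<close> form a second orthonormal basis, in which the coordinates of \<open>p\<close> are
  those of \<open>G p\<close> weighted by \<open>om e\<close>.\<close>

definition hb :: "L2 \<Rightarrow> L2" where "hb e = W.om e *\<^sub>R Gs e"

lemma inner_hb: "inner p (hb e) = W.om e * inner (G p) e"
  by (simp add: hb_def adjoint)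

lemma om_G_hb: assumes e: "e \<in> E" shows "W.om e *\<^sub>R G (hb e) = e"
proof -
  have "W.om e *\<^sub>R G (hb e) = (W.om e)\<^sup>2 *\<^sub>R G (Gs e)" by (simp add: hb_def G.scaleR power2_eq_square)
  then show ?thesis unfolding W.om_sq[OF e] G_Gs_basis[OF e] .
qed

lemma inner_hb_hb: assumes e: "e \<in> E" shows "inner (hb e) (hb e') = W.om e' / W.om e * inner e e'"
proof -
  have "W.om e * inner (G (hb e)) e' = inner e e'" using om_G_hb[OF e] by (metis inner_scaleR_left)
  then have "inner (G (hb e)) e' = inner e e' / W.om e" using W.om_pos[OF e] by (simp add: field_simps)
  then show ?thesis by (simp add: inner_hb)
qed

lemma inj_hb: "inj_on hb E"
proof (rule inj_onI, rule ccontr)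
  fix e e' assume e: "e \<in> E" "e' \<in> E" "hb e = hb e'" "e \<noteq> e'"
  then have "inner (hb e) (hb e) = 0" using inner_hb_hb[of e e'] orth[of e e'] by simp
  then show False using inner_hb_hb[OF e(1), of e] unit[OF e(1)] W.om_pos[OF e(1)] by simp
qed

sublocale H: orthonormal_basis "hb ` E"
proof
  show "inner x x = 1" if "x \<in> hb ` E" for x
    using that by (auto simp: inner_hb_hb unit) (use W.om_pos in force)
  show "inner x y = 0" if "x \<in> hb ` E" "y \<in> hb ` E" "x \<noteq> y" for x y
    using that by (auto simp: inner_hb_hb) (metis orth)
  show "p = 0" if p: "\<And>x. x \<in> hb ` E \<Longrightarrow> inner p x = 0" for p
  proof (rule G_eq_0, rule total)
    fix e assume e: "e \<in> E"
    then show "inner (G p) e = 0" using p[of "hb e"] W.om_pos[OF e] by (simp add: inner_hb)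
  qed
qed

lemma parseval_hb: "((\<lambda>e. inner p (hb e) * inner q (hb e)) has_sum inner p q) E"
  using H.parseval[of p q] unfolding has_sum_reindex[OF inj_hb] by (simp add: comp_def)

lemma lam_inner_G: "e \<in> E \<Longrightarrow> lam e * (inner (G p) e)\<^sup>2 = (inner p (hb e))\<^sup>2"
  by (simp add: inner_hb power_mult_distrib W.om_sq)

lemma norm_G_series: "((\<lambda>e. lam e * (inner (G p) e)\<^sup>2) has_sum (norm p)\<^sup>2) E"
  using parseval_hb[of p p] by (subst has_sum_cong[OF lam_inner_G]) (simp_all add: power2_eq_square power2_norm_eq_inner flip: power2_norm_eq_inner)

text \<open>Square summability of the weighted coordinates of u is square summability of
  coefficients in the basis of the vectors \<open>hb e\<close>; synthesis in that basis produces a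
  preimage of u under \<open>G\<close>.\<close>

lemma V_eq: "W.V = range G"
proof
  show "range G \<subseteq> W.V" unfolding W.V_def using norm_G_series has_sum_imp_summable by blast
  show "W.V \<subseteq> range G"
  proof
    fix u assume u: "u \<in> W.V"
    define c where "c x = inner u (inv_into E hb x) * W.om (inv_into E hb x)" for x
    have ch: "c (hb e) = W.om e * inner u e" if "e \<in> E" for e
      using that by (simp add: c_def inj_hb)
    have "(\<lambda>e. (c (hb e))\<^sup>2) summable_on E"
      using u unfolding W.V_def mem_Collect_eq
      by (rule summable_on_cong[THEN iffD1, rotated]) (simp add: ch power_mult_distrib W.om_sq)
    then have "(\<lambda>x. (c x)\<^sup>2) summable_on hb ` E"
      unfolding summable_on_reindex[OF inj_hb] by (simp add: comp_def)
    then obtain p where p: "\<And>v. ((\<lambda>x. c x * inner v x) has_sum inner p v) (hb ` E)" by (rule H.synthesis) blast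
    have "u = G p"
    proof (rule eqI)
      fix e assume e: "e \<in> E"
      have "inner p (hb e) = c (hb e)" by (rule H.coeff_of_synthesis[OF p]) (use e in simp)
      then show "inner u e = inner (G p) e" using W.om_pos[OF e] by (simp add: ch[OF e] inner_hb)
    qed
    then show "u \<in> range G" by simp
  qed
qed

lemma G_Gs_D: "G (Gs f) \<in> W.D"
  unfolding W.D_def mem_Collect_eq
  by (rule summable_on_cong[THEN iffD2, OF _ coeff_summable[of f]])
    (simp add: inner_G_Gs_basis flip: power_mult_distrib)

lemma D_eq: "W.D = range (\<lambda>f. G (Gs f))"
proof
  show "range (\<lambda>f. G (Gs f)) \<subseteq> W.D" using G_Gs_D by blast
  show "W.D \<subseteq> range (\<lambda>f. G (Gs f))"
  proof
    fix u assume "u \<in> W.D"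
    then have s: "(\<lambda>e. (lam e * inner u e)\<^sup>2) summable_on E" by (simp add: W.D_def power_mult_distrib)
    define f where "f = W.synth (\<lambda>e. lam e * inner u e)"
    have "u = G (Gs f)"
    proof (rule eqI)
      fix e assume e: "e \<in> E"
      have "lam e * inner (G (Gs f)) e = lam e * inner u e"
        unfolding inner_G_Gs_basis[OF e] f_def by (rule W.synth[OF s e])
      then show "inner u e = inner (G (Gs f)) e" using lam_pos[OF e] by simp
    qed
    then show "u \<in> range (\<lambda>f. G (Gs f))" by simp
  qed
qed

lemma Aop_G_Gs: "W.Aop (G (Gs f)) = - f"
  by (rule eqI) (simp add: W.inner_Aop[OF G_Gs_D] inner_G_Gs_basis)

definition mult :: "L2 \<Rightarrow> L2" where "mult u = Bop (inv G u)"

lemma mult_G: "mult (G p) = Bop p"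
  using inv_f_f[of G p] by (simp add: mult_def inj_def G_inject)

sublocale W: observed_wave_system E lam "\<delta>\<^sup>2" \<theta> mult \<kappa>
proof
  show "0 < \<kappa>" using \<alpha> by simp
  show "mult (u + v) = mult u + mult v" if "u \<in> W.V" "v \<in> W.V" for u v
    using that by (auto simp: V_eq mult_G linear_add[OF linear_Bop] simp flip: G.add)
  show "mult (k *\<^sub>R u) = k *\<^sub>R mult u" if "u \<in> W.V" for u k
    using that by (auto simp: V_eq mult_G linear_scale[OF linear_Bop] simp flip: G.scaleR)
  show "(norm (mult u))\<^sup>2 \<le> infsum (\<lambda>e. lam e * (inner u e)\<^sup>2) E" if "u \<in> W.V" for u
    using that norm_Bop by (auto simp: V_eq mult_G infsumI[OF norm_G_series] power_mono)
  show "inner u (mult u) = - \<kappa> * (norm u)\<^sup>2" if "u \<in> W.V" for u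
    using that inner_G_Bop by (auto simp: V_eq mult_G)
  show "inner (W.Aop u) (mult u) = (inner (W.Aop u) \<theta>)\<^sup>2 / 2 - \<kappa> * infsum (\<lambda>e. lam e * (inner u e)\<^sup>2) E"
    if "u \<in> W.D" for u
    using that pohozaev by (auto simp: D_eq Aop_G_Gs mult_G infsumI[OF norm_G_series])
qed

lemma H1_V: "H1 \<alpha> \<mu> = W.V" by (simp add: H1_eq V_eq)
lemma op_D_D: "op_D \<alpha> \<mu> = W.D" by (simp add: op_D_eq D_eq)
lemma energy_space_X: "energy_space \<alpha> \<mu> = W.X" by (simp add: energy_space_def W.X_def H1_V)

lemma energy_norm_EN: assumes U: "U \<in> W.X" shows "energy_norm \<alpha> \<mu> U = W.EN U"
proof -
  obtain p where p: "fst U = G p" using U by (auto simp: W.X_def V_eq)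
  have "(W.EN U)\<^sup>2 = (norm p)\<^sup>2 + (norm (snd U))\<^sup>2"
    unfolding W.EN_sq[OF U] p infsumI[OF norm_G_series] ..
  then show ?thesis unfolding energy_norm_def p H1_norm_G
    by (metis W.EN_nonneg real_sqrt_abs abs_of_nonneg)
qed

lemma H1_norm_EN: assumes "v \<in> W.V" shows "H1_norm \<alpha> \<mu> v = W.EN (v, 0)"
proof -
  have "0 \<le> H1_norm \<alpha> \<mu> v" using assms by (auto simp: V_eq H1_norm_G)
  then show ?thesis using energy_norm_EN[of "(v, 0)"] assms by (simp add: energy_norm_def W.X_def)
qed

lemma op_A_Aop: "u \<in> W.D \<Longrightarrow> op_A \<alpha> \<mu> u = W.Aop u"
  by (auto simp: D_eq Aop_G_Gs op_A_G_Gs)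

lemma wave_group_iff: "wave_group \<alpha> \<mu> S \<longleftrightarrow> generates_C0_group W.X W.EN (W.D \<times> W.V) W.gen S"
  unfolding wave_group_def energy_space_X op_D_D H1_V W.gen_def
  by (intro iffI; rule generates_C0_group_cong[rotated -1], assumption)
    (auto simp: energy_norm_EN op_A_Aop W.X_diff W.X_scale)

lemma backward_solutionI: "backward_solution \<alpha> \<mu> \<tau> U (\<lambda>t. W.wgroup (t - \<tau>) U)"
  unfolding backward_solution_def using W.wgroup_generates wave_group_iff by blast

lemma backward_solutionD:
  assumes "backward_solution \<alpha> \<mu> \<tau> U W" "U \<in> W.X" "t \<in> {0..\<tau>}" shows "W t = W.wgroup (t - \<tau>) U"
  using assms unfolding backward_solution_def wave_group_iff by (metis W.generator_unique)

lemma trace_Aop: "u \<in> W.D \<Longrightarrow> has_trace_at_1 u (inner (W.Aop u) \<theta>)"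
  using trace_G_Gs by (auto simp: D_eq Aop_G_Gs)

lemma trace_gt: assumes U: "U \<in> W.D \<times> W.V" shows "has_trace_at_1 (fst (W.wgroup t U)) (W.gt U t)"
proof -
  have "fst (W.wgroup t U) \<in> W.D" using W.wgroup_DV[OF U, of t] by (simp add: mem_Times_iff)
  then show ?thesis unfolding W.gt_eq_inner[OF U] by (rule trace_Aop)
qed

lemma classical_traceI:
  assumes U: "U \<in> W.D \<times> W.V" shows "classical_trace \<alpha> \<mu> \<tau> U (\<lambda>t. W.gt U (t - \<tau>))"
  unfolding classical_trace_def op_D_D H1_V
proof (intro conjI U exI ballI)
  show "(\<lambda>t. W.gt U (t - \<tau>)) \<in> square_integrable {0<..<\<tau>}"
    by (intro continuous_square_integrable_Ioo continuous_on_compose2[OF W.gt_continuous[OF U, of UNIV]] continuous_intros) auto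
  show "backward_solution \<alpha> \<mu> \<tau> U (\<lambda>t. W.wgroup (t - \<tau>) U)" by (rule backward_solutionI)
  show "has_trace_at_1 (fst (W.wgroup (t - \<tau>) U)) (W.gt U (t - \<tau>))" for t by (rule trace_gt[OF U])
qed

lemma classical_traceD:
  assumes "classical_trace \<alpha> \<mu> \<tau> U g"
  shows "U \<in> W.D \<times> W.V" "g \<in> square_integrable {0<..<\<tau>}" "\<And>t. t \<in> {0<..<\<tau>} \<Longrightarrow> g t = W.gt U (t - \<tau>)"
proof -
  show U: "U \<in> W.D \<times> W.V" and "g \<in> square_integrable {0<..<\<tau>}"
    using assms by (auto simp: classical_trace_def op_D_D H1_V)
  obtain W where W: "backward_solution \<alpha> \<mu> \<tau> U W" "\<And>t. t \<in> {0<..<\<tau>} \<Longrightarrow> has_trace_at_1 (fst (W t)) (g t)"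
    using assms by (auto simp: classical_trace_def)
  fix t assume t: "t \<in> {0<..<\<tau>}"
  have "W t = W.wgroup (t - \<tau>) U" by (rule backward_solutionD[OF W(1) W.DV_X[OF U]]) (use t in auto)
  then show "g t = W.gt U (t - \<tau>)" using W(2)[OF t] trace_gt[OF U] has_trace_at_1_unique by metis
qed

lemma boundary_trace_classical:
  assumes "U \<in> W.D \<times> W.V" shows "boundary_trace \<alpha> \<mu> \<tau> U (\<lambda>t. W.gt U (t - \<tau>))"
  unfolding boundary_trace_def
proof (intro conjI exI allI)
  show "classical_trace \<alpha> \<mu> \<tau> U (\<lambda>t. W.gt U (t - \<tau>))" by (rule classical_traceI[OF assms])
  then show "(\<lambda>t. W.gt U (t - \<tau>)) \<in> square_integrable {0<..<\<tau>}" by (rule classical_traceD)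
  have "W.EN (U - U) = 0" by (simp add: W.EN_def W.nrm_def W.coef_0)
  then show "(\<lambda>n. energy_norm \<alpha> \<mu> (U - U)) \<longlonglongrightarrow> 0"
    using energy_norm_EN[OF W.X_0] by simp
qed simp

lemma H1_dual_riesz:
  assumes y: "y \<in> H1_dual \<alpha> \<mu>" obtains q where "\<And>p. y (G p) = inner q p"
proof -
  obtain C where C: "\<And>p. \<bar>y (G p)\<bar> \<le> C * norm p"
    using y unfolding H1_dual_def H1_eq by (auto simp: H1_norm_G)
  obtain q where "\<And>p. inner q p = y (G p)"
  proof (rule riesz_representation[of UNIV "\<lambda>p. y (G p)" "C\<^sup>2"])
    show "y (G (u + v)) = y (G u) + y (G v)" for u v
      using y unfolding H1_dual_def H1_eq G.add by blast
    show "y (G (c *\<^sub>R u)) = c * y (G u)" for c u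
      using y unfolding H1_dual_def H1_eq G.scaleR by blast
    show "(y (G u))\<^sup>2 \<le> C\<^sup>2 * (norm u)\<^sup>2" for u
      using power_mono[OF C[of u] abs_ge_zero, of 2] by (simp add: power_mult_distrib)
  qed auto
  then show thesis using that by metis
qed

lemma riesz_coefficient:
  assumes "\<And>p. y (G p) = inner q p" "y \<in> H1_dual \<alpha> \<mu>" "e \<in> E" shows "y e = W.om e * inner q (hb e)"
proof -
  have "y e = y (G (W.om e *\<^sub>R hb e))" using om_G_hb[OF assms(3)] by (simp add: G.scaleR)
  then show ?thesis unfolding assms(1) by simp
qed

text \<open>The set under the supremum contains the value at 0 and is bounded by M, so both
  inequalities are available; together they let dual norms be squeezed to 0.\<close>

lemma H1_dual_norm_bound:
  assumes M: "0 \<le> M" and F: "\<And>v. v \<in> W.V \<Longrightarrow> \<bar>F v\<bar> \<le> M * W.EN (v, 0)"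
  shows "0 \<le> H1_dual_norm \<alpha> \<mu> F" "H1_dual_norm \<alpha> \<mu> F \<le> M"
proof -
  let ?A = "{v \<in> H1 \<alpha> \<mu>. H1_norm \<alpha> \<mu> v \<le> 1}"
  have b: "\<bar>F v\<bar> \<le> M" if "v \<in> ?A" for v
  proof -
    have v: "v \<in> W.V" "W.EN (v, 0) \<le> 1" using that by (simp_all add: H1_V flip: H1_norm_EN)
    show ?thesis using F[OF v(1)] mult_left_mono[OF v(2) M] by simp
  qed
  have 0: "0 \<in> ?A" using H1_norm_G[of 0] by (auto simp: H1_eq G.zero intro: range_eqI[of _ _ 0])
  show "H1_dual_norm \<alpha> \<mu> F \<le> M"
    unfolding H1_dual_norm_def by (rule cSUP_least) (use 0 b in auto)
  have "bdd_above ((\<lambda>v. \<bar>F v\<bar>) ` ?A)" by (rule bdd_aboveI[of _ M]) (use b in auto)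
  then have "\<bar>F 0\<bar> \<le> H1_dual_norm \<alpha> \<mu> F" unfolding H1_dual_norm_def by (rule cSUP_upper[OF 0])
  then show "0 \<le> H1_dual_norm \<alpha> \<mu> F" by linarith
qed

end

section \<open>The solution by transposition for given data and control\<close>

locale transposition = hardy_eigenbasis \<alpha> b E + control_function f T
  for \<alpha> b :: real and E :: "L2 set" and f :: "real \<Rightarrow> real" and T :: real +
  fixes y\<^sub>0 :: L2 and y\<^sub>1 :: "L2 \<Rightarrow> real"
  assumes T: "0 < T" and y\<^sub>1: "y\<^sub>1 \<in> H1_dual \<alpha> \<mu>"
begin

text \<open>Coordinates of the functional
  \<open>y\<^sub>1 (fst U) - inner y\<^sub>0 (snd U)\<close>, the initial data as they enter the
  transposition identity. The division compensates the weight \<open>om\<close> in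
  \<open>coef\<close>.\<close>

definition Y0 :: "L2 \<Rightarrow> complex" where "Y0 e = Complex (y\<^sub>1 e / W.om e) (- inner y\<^sub>0 e)"

lemma Y0_riesz:
  obtains q where "\<And>p. y\<^sub>1 (G p) = inner q p" "\<And>e. e \<in> E \<Longrightarrow> Y0 e = Complex (inner q (hb e)) (- inner y\<^sub>0 e)"
proof -
  obtain q where q: "\<And>p. y\<^sub>1 (G p) = inner q p" by (rule H1_dual_riesz[OF y\<^sub>1]) blast
  have "Y0 e = Complex (inner q (hb e)) (- inner y\<^sub>0 e)" if "e \<in> E" for e
    using W.om_pos[OF that] by (simp add: Y0_def riesz_coefficient[OF q y\<^sub>1 that])
  then show thesis using that q by blast
qed

lemma l2_Y0: "W.l2 Y0"
proof -
  obtain q where q: "\<And>e. e \<in> E \<Longrightarrow> Y0 e = Complex (inner q (hb e)) (- inner y\<^sub>0 e)" by (rule Y0_riesz) blast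
  have "(\<lambda>e. (inner q (hb e))\<^sup>2 + (inner y\<^sub>0 e)\<^sup>2) summable_on E"
    using has_sum_imp_summable[OF parseval_hb[of q q]] coeff_summable[of y\<^sub>0]
    by (intro summable_on_add) (simp_all add: power2_eq_square)
  then show ?thesis unfolding W.l2_def
    by (rule summable_on_cong[THEN iffD2, rotated]) (simp add: q cmod_power2)
qed

lemma pr_Y0: assumes U: "U \<in> W.X" shows "W.pr Y0 (W.coef U) = y\<^sub>1 (fst U) - inner y\<^sub>0 (snd U)"
proof -
  obtain q where q: "\<And>p. y\<^sub>1 (G p) = inner q p" "\<And>e. e \<in> E \<Longrightarrow> Y0 e = Complex (inner q (hb e)) (- inner y\<^sub>0 e)"
    by (rule Y0_riesz) blast
  obtain p where p: "fst U = G p" using U by (auto simp: W.X_def V_eq)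
  have "((\<lambda>e. inner q (hb e) * inner p (hb e) + inner (- y\<^sub>0) e * inner (snd U) e) has_sum (inner q p + inner (- y\<^sub>0) (snd U))) E"
    by (intro has_sum_add parseval_hb parseval)
  then have "((\<lambda>e. Re (cnj (Y0 e) * W.coef U e)) has_sum (inner q p + inner (- y\<^sub>0) (snd U))) E"
    by (rule has_sum_cong[THEN iffD1, rotated]) (simp add: q W.coef_def p inner_hb)
  then show ?thesis unfolding W.pr_def by (simp add: infsumI p q)
qed

sublocale C: controlled_wave E lam "\<delta>\<^sup>2" \<theta> mult \<kappa> f T Y0
  by unfold_locales (rule l2_Y0)

text \<open>The minus sign corresponds to the sign with which the displacement is paired with the
  second component of the test state in the transposition identity.\<close>

definition y :: "real \<Rightarrow> L2" where "y t = W.synth (\<lambda>e. - Im (C.Y t e))"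
definition y' :: "real \<Rightarrow> L2 \<Rightarrow> real" where "y' t v = W.pr (C.Y t) (W.coef (v, 0))"

lemma coef_l2: "W.l2 (W.coef (0, w))" "v \<in> W.V \<Longrightarrow> W.l2 (W.coef (v, 0))"
  by (simp_all add: W.X_def W.V_subspace flip: W.X_iff)

lemma inner_y: assumes t: "t \<in> {0..T}" shows "inner (y t) w = - W.pr (C.Y t) (W.coef (0, w))"
proof -
  have l: "W.l2 (C.Y t)" using t by (intro C.Y_l2) auto
  have s: "(\<lambda>e. (- Im (C.Y t e))\<^sup>2) summable_on E"
    by (rule summable_on_real_comparison[OF l[unfolded W.l2_def]]) (simp add: cmod_power2)
  have "((\<lambda>e. inner (- y t) e * inner w e) has_sum inner (- y t) w) E"
    by (rule parseval)
  then have "((\<lambda>e. Re (cnj (C.Y t e) * W.coef (0, w) e)) has_sum inner (- y t) w) E"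
    by (rule has_sum_cong[THEN iffD1, rotated]) (simp add: y_def W.synth[OF s] W.coef_def)
  then show ?thesis unfolding W.pr_def by (simp add: infsumI)
qed

lemma Y_diff_l2: "s \<in> {0..T} \<Longrightarrow> t \<in> {0..T} \<Longrightarrow> W.l2 (\<lambda>e. C.Y s e - C.Y t e)"
  by (intro W.l2_diff C.Y_l2) auto

lemma pr_Y_diff:
  assumes s: "s \<in> {0..T}" and t: "t \<in> {0..T}" and c: "W.l2 c"
  shows "W.pr (\<lambda>e. C.Y s e - C.Y t e) c = W.pr (C.Y s) c - W.pr (C.Y t) c"
proof -
  have "W.pr (\<lambda>e. (C.Y s e - C.Y t e) + C.Y t e) c = W.pr (\<lambda>e. C.Y s e - C.Y t e) c + W.pr (C.Y t) c"
    by (rule W.pr_add_left[OF Y_diff_l2[OF s t] _ c]) (use t in \<open>auto intro: C.Y_l2\<close>)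
  then show ?thesis by simp
qed

lemma y_pairing:
  assumes t: "t \<in> {0..T}" and U: "U \<in> W.X" shows "y' t (fst U) - inner (y t) (snd U) = W.pr (C.Y t) (W.coef U)"
proof -
  have v: "fst U \<in> W.V" using U by (auto simp: W.X_def)
  have c: "W.coef U e = W.coef (fst U, 0) e + W.coef (0, snd U) e" for e
    by (simp add: W.coef_def complex_eq_iff)
  have "W.pr (C.Y t) (\<lambda>e. W.coef (fst U, 0) e + W.coef (0, snd U) e) = y' t (fst U) + W.pr (C.Y t) (W.coef (0, snd U))"
    unfolding y'_def by (intro W.pr_add_right coef_l2 v C.Y_l2) (use t in auto)
  then show ?thesis by (simp add: inner_y[OF t] c[abs_def])
qed

lemma y_diff_norm:
  assumes s: "s \<in> {0..T}" and t: "t \<in> {0..T}"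
  shows "norm (y s - y t) \<le> W.nrm (\<lambda>e. C.Y s e - C.Y t e)"
proof -
  define w where "w = y s - y t"
  have "W.EN (0, w) = norm w"
    using W.EN_sq[of "(0, w)"] W.EN_nonneg[of "(0, w)"] by (simp add: W.X_def W.V_subspace power2_eq_iff_nonneg)
  moreover have "(norm w)\<^sup>2 = - W.pr (\<lambda>e. C.Y s e - C.Y t e) (W.coef (0, w))"
    unfolding pr_Y_diff[OF s t coef_l2(1)] power2_norm_eq_inner
    by (subst (1) w_def) (simp add: inner_diff_left inner_y[OF s] inner_y[OF t])
  moreover have "\<bar>W.pr (\<lambda>e. C.Y s e - C.Y t e) (W.coef (0, w))\<bar> \<le> W.nrm (\<lambda>e. C.Y s e - C.Y t e) * W.EN (0, w)"
    unfolding W.EN_def by (rule W.pr_bound[OF Y_diff_l2[OF s t] coef_l2(1)])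
  ultimately have "norm w * norm w \<le> W.nrm (\<lambda>e. C.Y s e - C.Y t e) * norm w" by (simp add: power2_eq_square)
  then have "norm w \<le> W.nrm (\<lambda>e. C.Y s e - C.Y t e)"
    by (cases "w = 0") (simp_all add: W.nrm_nonneg)
  then show ?thesis by (simp add: w_def)
qed

lemma y_continuous: "continuous_on {0..T} y"
  unfolding continuous_on_def
proof
  fix t assume t: "t \<in> {0..T}"
  show "(y \<longlongrightarrow> y t) (at t within {0..T})"
    by (rule LIM_zero_cancel, rule Lim_null_comparison[OF _ C.Y_continuous[OF t]])
      (simp add: eventually_at_filter y_diff_norm[OF _ t])
qed

lemma y'_dual: assumes t: "t \<in> {0..T}" shows "y' t \<in> H1_dual \<alpha> \<mu>"
  unfolding H1_dual_def H1_V mem_Collect_eq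
proof (intro conjI ballI allI exI)
  have l: "W.l2 (C.Y t)" using t by (intro C.Y_l2) auto
  fix v assume v: "v \<in> W.V"
  have "W.coef (u + v, 0) = (\<lambda>e. W.coef (u, 0) e + W.coef (v, 0) e)" for u
    using W.coef_add[of "(u, 0)" "(v, 0)"] by auto
  then show "y' t (u + v) = y' t u + y' t v" if "u \<in> W.V" for u
    unfolding y'_def using that v by (simp add: W.pr_add_right l coef_l2)
  have "W.coef (c *\<^sub>R v, 0) = (\<lambda>e. of_real c * W.coef (v, 0) e)" for c
    using W.coef_scale[of c "(v, 0)"] by auto
  then show "y' t (c *\<^sub>R v) = c * y' t v" for c
    unfolding y'_def using v by (simp add: W.pr_scale_right l coef_l2)
  show "\<bar>y' t v\<bar> \<le> W.nrm (C.Y t) * H1_norm \<alpha> \<mu> v"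
    unfolding y'_def H1_norm_EN[OF v] W.EN_def by (rule W.pr_bound[OF l coef_l2(2)[OF v]])
qed

lemma y_C1_dual: "C1_dual \<alpha> \<mu> T y y'"
  unfolding C1_dual_def
proof (intro ballI conjI)
  fix t assume t: "t \<in> {0..T}"
  let ?\<eta> = "\<lambda>s. W.nrm (\<lambda>e. C.Y s e - C.Y t e)"
  show "y' t \<in> H1_dual \<alpha> \<mu>" by (rule y'_dual[OF t])
  show "((\<lambda>s. H1_dual_norm \<alpha> \<mu> (\<lambda>v. y' s v - y' t v)) \<longlongrightarrow> 0) (at t within {0..T})"
  proof (rule Lim_null_comparison[OF _ C.Y_continuous[OF t]])
    have "norm (H1_dual_norm \<alpha> \<mu> (\<lambda>v. y' s v - y' t v)) \<le> ?\<eta> s" if s: "s \<in> {0..T}" for s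
    proof -
      have "\<bar>y' s v - y' t v\<bar> \<le> ?\<eta> s * W.EN (v, 0)" if "v \<in> W.V" for v
        using W.pr_bound[OF Y_diff_l2[OF s t] coef_l2(2)[OF that]]
        unfolding y'_def W.EN_def pr_Y_diff[OF s t coef_l2(2)[OF that]] .
      from H1_dual_norm_bound[OF W.nrm_nonneg this] show ?thesis by simp
    qed
    then show "\<forall>\<^sub>F s in at t within {0..T}. norm (H1_dual_norm \<alpha> \<mu> (\<lambda>v. y' s v - y' t v)) \<le> ?\<eta> s"
      by (simp add: eventually_at_filter)
  qed
  show "((\<lambda>s. H1_dual_norm \<alpha> \<mu> (\<lambda>v. inner ((y s - y t) /\<^sub>R (s - t)) v - y' t v)) \<longlongrightarrow> 0) (at t within {0..T})"
    unfolding Lim_within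
  proof (intro allI impI)
    fix \<epsilon> :: real assume \<epsilon>: "0 < \<epsilon>"
    then have e2: "0 < \<epsilon> / 2" "0 \<le> \<epsilon> / 2" by simp_all
    obtain d where d: "0 < d" and dY: "\<And>s. s \<in> {0..T} \<Longrightarrow> 0 < dist s t \<Longrightarrow> dist s t < d \<Longrightarrow> dist (?\<eta> s) 0 < \<epsilon> / 2"
      using C.Y_continuous[OF t, unfolded Lim_within, rule_format, OF e2(1)] by blast
    \<comment> \<open>The closed segment from t to s contains t itself, which the punctured limit
      leaves out.\<close>
    have small: "?\<eta> r \<le> \<epsilon> / 2" if r: "r \<in> {0..T}" "dist r t < d" for r
    proof (cases "r = t")
      case True
      then show ?thesis using \<epsilon> by (simp add: W.nrm_def)
    next
      case False
      then show ?thesis using dY[OF r(1) _ r(2)] by simp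
    qed
    show "\<exists>d>0. \<forall>s\<in>{0..T}. 0 < dist s t \<and> dist s t < d \<longrightarrow>
      dist (H1_dual_norm \<alpha> \<mu> (\<lambda>v. inner ((y s - y t) /\<^sub>R (s - t)) v - y' t v)) 0 < \<epsilon>"
    proof (intro exI[of _ d] conjI d ballI impI)
      fix s assume s: "s \<in> {0..T}" and sd: "0 < dist s t \<and> dist s t < d"
      then have st: "s \<noteq> t" by auto
      have "\<bar>inner ((y s - y t) /\<^sub>R (s - t)) v - y' t v\<bar> \<le> \<epsilon> / 2 * W.EN (v, 0)" if v: "v \<in> W.V" for v
      proof -
        have "\<bar>(- W.pr (C.Y s) (W.coef (0, v)) + W.pr (C.Y t) (W.coef (0, v))) - (s - t) * W.pr (C.Y t) (W.coef (v, 0))\<bar>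
            \<le> \<epsilon> / 2 * W.EN (v, 0) * \<bar>s - t\<bar>"
        proof (rule C.Y_C1[OF s t v e2(2)])
          fix r assume r: "r \<in> closed_segment t s"
          show "?\<eta> r \<le> \<epsilon> / 2"
            by (rule small) (use r s t sd in \<open>auto simp: closed_segment_eq_real_ivl dist_real_def split: if_splits\<close>)
        qed
        then have "\<bar>inner (y s - y t) v - (s - t) * y' t v\<bar> \<le> \<epsilon> / 2 * W.EN (v, 0) * \<bar>s - t\<bar>"
          by (simp add: inner_diff_left inner_y[OF s] inner_y[OF t] y'_def)
        moreover have "inner ((y s - y t) /\<^sub>R (s - t)) v - y' t v = (inner (y s - y t) v - (s - t) * y' t v) / (s - t)"
        proof -
          have "inverse c * x - z = (x - c * z) / c" if "c \<noteq> 0" for c x z :: real using that by (simp add: field_simps)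
          then show ?thesis unfolding inner_scaleR_left using st by simp
        qed
        ultimately show ?thesis using st by (simp add: abs_divide pos_divide_le_eq)
      qed
      from H1_dual_norm_bound[OF e2(2) this]
      show "dist (H1_dual_norm \<alpha> \<mu> (\<lambda>v. inner ((y s - y t) /\<^sub>R (s - t)) v - y' t v)) 0 < \<epsilon>"
        using \<epsilon> by simp
    qed
  qed
qed

lemma classical_identity:
  assumes tr: "classical_trace \<alpha> \<mu> \<tau> U g" and \<tau>: "0 < \<tau>" "\<tau> \<le> T"
  shows "W.pr (C.Y \<tau>) (W.coef U) = W.pr Y0 (W.coef (W.wgroup (- \<tau>) U)) - (LINT t|lebesgue_on {0<..<\<tau>}. f t * g t)"
proof -
  note U = classical_traceD(1)[OF tr]
  have c: "continuous_on {0..\<tau>} (\<lambda>t. W.gt U (t - \<tau>))"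
    by (intro continuous_on_compose2[OF W.gt_continuous[OF U, of UNIV]] continuous_intros) auto
  have "(LINT t|lebesgue_on {0<..<\<tau>}. f t * g t) = (LINT t|lebesgue_on {0<..<\<tau>}. f t * W.gt U (t - \<tau>))"
    by (rule Bochner_Integration.integral_cong) (simp_all add: classical_traceD(3)[OF tr])
  also have "\<dots> = integral {0..\<tau>} (\<lambda>t. f t * W.gt U (t - \<tau>))"
    by (rule f_mult_integrable(3)[OF order_refl \<tau>(2) c])
  finally show ?thesis using C.Y_pairing[OF U] \<tau> by simp
qed

text \<open>General data have a trace only as an L2 limit along approximating data in the domain.
  Both sides are continuous for this convergence: the pairings in the energy norm, the integral
  against f in L2 of the time interval.\<close>

lemma transposition_identity:
  assumes \<tau>: "0 < \<tau>" "\<tau> \<le> T" and U: "U \<in> W.X" and tr: "boundary_trace \<alpha> \<mu> \<tau> U g"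
  shows "W.pr (C.Y \<tau>) (W.coef U) = W.pr Y0 (W.coef (W.wgroup (- \<tau>) U)) - (LINT t|lebesgue_on {0<..<\<tau>}. f t * g t)"
proof -
  obtain Us gs where c: "\<And>n. classical_trace \<alpha> \<mu> \<tau> (Us n) (gs n)"
    and en: "(\<lambda>n. energy_norm \<alpha> \<mu> (Us n - U)) \<longlonglongrightarrow> 0"
    and l2: "(\<lambda>n. LINT t|lebesgue_on {0<..<\<tau>}. (gs n t - g t)\<^sup>2) \<longlonglongrightarrow> 0"
    and g: "g \<in> square_integrable {0<..<\<tau>}"
    using tr unfolding boundary_trace_def by blast
  have UX: "Us n \<in> W.X" for n using W.DV_X[OF classical_traceD(1)[OF c]] .
  have gs: "gs n \<in> square_integrable {0<..<\<tau>}" for n by (rule classical_traceD(2)[OF c])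
  have en: "(\<lambda>n. W.EN (Us n - U)) \<longlonglongrightarrow> 0" using en by (simp add: energy_norm_EN W.X_diff UX U)
  have pr: "(\<lambda>n. W.pr a (W.coef (Us n))) \<longlonglongrightarrow> W.pr a (W.coef U)" if a: "W.l2 a" for a
  proof (rule LIM_zero_cancel, rule Lim_null_comparison)
    show "\<forall>\<^sub>F n in sequentially. norm (W.pr a (W.coef (Us n)) - W.pr a (W.coef U)) \<le> W.nrm a * W.EN (Us n - U)"
    proof (intro always_eventually allI)
      fix n
      have l: "W.l2 (W.coef (Us n - U))" "W.l2 (W.coef U)" using W.X_diff[OF UX U] U by (simp_all add: W.X_iff)
      have "W.coef (Us n) = (\<lambda>e. W.coef (Us n - U) e + W.coef U e)" by (simp add: W.coef_diff)
      then have "W.pr a (W.coef (Us n)) = W.pr a (W.coef (Us n - U)) + W.pr a (W.coef U)"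
        using W.pr_add_right[OF a l] by simp
      then show "norm (W.pr a (W.coef (Us n)) - W.pr a (W.coef U)) \<le> W.nrm a * W.EN (Us n - U)"
        using W.pr_bound[OF a l(1)] by (simp add: W.EN_def)
    qed
    show "(\<lambda>n. W.nrm a * W.EN (Us n - U)) \<longlonglongrightarrow> 0" using tendsto_mult_right_zero[OF en] .
  qed
  have fs: "f \<in> square_integrable {0<..<\<tau>}" by (rule f_sub) (use \<tau> in auto)
  have int: "(\<lambda>n. LINT t|lebesgue_on {0<..<\<tau>}. f t * gs n t) \<longlonglongrightarrow> (LINT t|lebesgue_on {0<..<\<tau>}. f t * g t)"
  proof (rule LIM_zero_cancel, rule Lim_null_comparison)
    let ?C = "LINT t|lebesgue_on {0<..<\<tau>}. (f t)\<^sup>2"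
    show "\<forall>\<^sub>F n in sequentially. norm ((LINT t|lebesgue_on {0<..<\<tau>}. f t * gs n t) - (LINT t|lebesgue_on {0<..<\<tau>}. f t * g t))
      \<le> sqrt (?C * (LINT t|lebesgue_on {0<..<\<tau>}. (gs n t - g t)\<^sup>2))"
    proof (intro always_eventually allI)
      fix n
      have "(LINT t|lebesgue_on {0<..<\<tau>}. f t * (gs n t - g t)) = (LINT t|lebesgue_on {0<..<\<tau>}. f t * gs n t) - (LINT t|lebesgue_on {0<..<\<tau>}. f t * g t)"
        by (simp add: right_diff_distrib Bochner_Integration.integral_diff square_integrable_mult fs gs g)
      then show "norm ((LINT t|lebesgue_on {0<..<\<tau>}. f t * gs n t) - (LINT t|lebesgue_on {0<..<\<tau>}. f t * g t))
        \<le> sqrt (?C * (LINT t|lebesgue_on {0<..<\<tau>}. (gs n t - g t)\<^sup>2))"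
        using square_integrable_cauchy_schwarz[OF fs square_integrable_diff[OF gs g], of n]
        by (simp add: real_le_rsqrt del: real_sqrt_mult)
    qed
    have "(\<lambda>n. sqrt (?C * (LINT t|lebesgue_on {0<..<\<tau>}. (gs n t - g t)\<^sup>2))) \<longlonglongrightarrow> sqrt (?C * 0)"
      by (intro tendsto_intros l2)
    then show "(\<lambda>n. sqrt (?C * (LINT t|lebesgue_on {0<..<\<tau>}. (gs n t - g t)\<^sup>2))) \<longlonglongrightarrow> 0" by simp
  qed
  let ?Y0 = "\<lambda>e. cis (- W.om e * \<tau>) * Y0 e"
  have "W.l2 ?Y0" by (rule W.l2_mult[OF l2_Y0, of _ 1]) simp
  from tendsto_diff[OF pr[OF this] int]
  have "(\<lambda>n. W.pr (C.Y \<tau>) (W.coef (Us n))) \<longlonglongrightarrow> W.pr ?Y0 (W.coef U) - (LINT t|lebesgue_on {0<..<\<tau>}. f t * g t)"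
    unfolding classical_identity[OF c \<tau>] C.pr_Y0_wgroup[OF UX] .
  moreover have "(\<lambda>n. W.pr (C.Y \<tau>) (W.coef (Us n))) \<longlonglongrightarrow> W.pr (C.Y \<tau>) (W.coef U)"
    by (rule pr, rule C.Y_l2) (use \<tau> in auto)
  ultimately show ?thesis unfolding C.pr_Y0_wgroup[OF U, symmetric] using LIMSEQ_unique by blast
qed

theorem transposition_solution_exists: "transposition_solution \<alpha> \<mu> T f y\<^sub>0 y\<^sub>1 y y'"
  unfolding transposition_solution_def
proof (intro conjI allI impI y_continuous y_C1_dual)
  fix \<tau> w\<^sub>0 w\<^sub>1 W g
  assume \<tau>: "0 < \<tau>" "\<tau> \<le> T" and U: "(w\<^sub>0, w\<^sub>1) \<in> energy_space \<alpha> \<mu>"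
    and W: "backward_solution \<alpha> \<mu> \<tau> (w\<^sub>0, w\<^sub>1) W" and g: "boundary_trace \<alpha> \<mu> \<tau> (w\<^sub>0, w\<^sub>1) g"
  have UX: "(w\<^sub>0, w\<^sub>1) \<in> W.X" using U by (simp add: energy_space_X)
  have "W 0 = W.wgroup (- \<tau>) (w\<^sub>0, w\<^sub>1)" using backward_solutionD[OF W UX, of 0] \<tau> by simp
  then show "y' \<tau> w\<^sub>0 - inner (y \<tau>) w\<^sub>1 =
          y\<^sub>1 (fst (W 0)) - inner y\<^sub>0 (snd (W 0)) - (LINT t|lebesgue_on {0<..<\<tau>}. f t * g t)"
    using y_pairing[OF _ UX, of \<tau>] transposition_identity[OF \<tau> UX g] pr_Y0[OF W.wgroup_X[OF UX]] \<tau> by simp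
qed

text \<open>At time T the right-hand side of the identity is the difference of the two sides of the
  moment equation, at the state obtained by carrying U back to time 0. The terminal functional thus
  vanishes on finite combinations, and states with one nonzero component isolate the individual
  coefficients.\<close>

theorem transposition_solution_vanishes:
  assumes hum: "\<And>U. W.fin U \<Longrightarrow> (LINT t|lebesgue_on {0<..<T}. f t * W.gt U t) = W.pr Y0 (W.coef U)"
    and sol: "transposition_solution \<alpha> \<mu> T f y\<^sub>0 y\<^sub>1 z z'"
  shows "z T = 0" "v \<in> H1 \<alpha> \<mu> \<Longrightarrow> z' T v = 0"
proof -
  have z': "z' T \<in> H1_dual \<alpha> \<mu>"
    using sol T unfolding transposition_solution_def C1_dual_def by auto
  have fin: "z' T (fst U) - inner (z T) (snd U) = 0" if U: "W.fin U" for U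
  proof -
    have UD: "U \<in> W.D \<times> W.V" by (rule W.fin_DV[OF U])
    have UX: "U \<in> W.X" by (rule W.DV_X[OF UD])
    have "z' T (fst U) - inner (z T) (snd U) = y\<^sub>1 (fst (W.wgroup (- T) U)) - inner y\<^sub>0 (snd (W.wgroup (- T) U))
        - (LINT t|lebesgue_on {0<..<T}. f t * W.gt U (t - T))"
      using sol[unfolded transposition_solution_def, THEN conjunct2, THEN conjunct2, rule_format,
          of T "fst U" "snd U" "\<lambda>t. W.wgroup (t - T) U" "\<lambda>t. W.gt U (t - T)"]
        T UX backward_solutionI[of T U] boundary_trace_classical[OF UD, of T]
      by (simp add: energy_space_X)
    also have "\<dots> = W.pr Y0 (W.coef (W.wgroup (- T) U)) - (LINT t|lebesgue_on {0<..<T}. f t * W.gt (W.wgroup (- T) U) t)"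
      by (simp add: pr_Y0 W.wgroup_X UX W.gt_wgroup)
    also have "\<dots> = 0" using hum[OF W.fin_wgroup[OF U]] by simp
    finally show ?thesis .
  qed
  have fin_basis: "W.fin (k *\<^sub>R e, l *\<^sub>R e)" if e: "e \<in> E" for k l e
    unfolding W.fin_def by (rule exI[of _ "{e}"]) (use e orth in \<open>auto simp: W.coef_def complex_eq_iff\<close>)
  obtain q where q: "\<And>p. z' T (G p) = inner q p" by (rule H1_dual_riesz[OF z']) blast
  have z0: "z' T 0 = 0" using q[of 0] by (simp add: G.zero)
  show "z T = 0" by (rule total) (use fin[OF fin_basis, of _ 0 1] z0 in simp)
  have "q = 0"
  proof (rule H.total)
    fix x assume "x \<in> hb ` E"
    then obtain e where e: "e \<in> E" "x = hb e" by blast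
    have "z' T e = 0" using fin[OF fin_basis[OF e(1), of 1 0]] by simp
    then show "inner q x = 0" using riesz_coefficient[OF q z' e(1)] W.om_pos[OF e(1)] e by simp
  qed
  then show "z' T v = 0" if "v \<in> H1 \<alpha> \<mu>" using that q by (auto simp: H1_eq)
qed

end

section \<open>Construction of the control and conclusion\<close>

lemma (in hardy_factorization) null_controllability:
  assumes T: "T > 4 / (2 - \<alpha>)" and y\<^sub>1: "y\<^sub>1 \<in> H1_dual \<alpha> \<mu>"
  shows "\<exists>f\<in>square_integrable {0<..<T}.
    (\<exists>y y'. transposition_solution \<alpha> \<mu> T f y\<^sub>0 y\<^sub>1 y y') \<and>
    (\<forall>y y'. transposition_solution \<alpha> \<mu> T f y\<^sub>0 y\<^sub>1 y y' \<longrightarrow> y T = 0 \<and> (\<forall>v\<in>H1 \<alpha> \<mu>. y' T v = 0))"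
proof -
  obtain E where E: "orthonormal_basis E" "\<And>e. e \<in> E \<Longrightarrow> \<exists>k>0. G (Gs e) = k *\<^sub>R e" by (rule eigenbasis) blast
  interpret B: hardy_eigenbasis \<alpha> b E
    by (intro hardy_eigenbasis.intro hardy_factorization_axioms E hardy_eigenbasis_axioms.intro)
  have T0: "0 < T" using T \<alpha> by (smt (verit) divide_nonneg_pos)
  \<comment> \<open>The locale fixes a control, but \<open>Y0\<close> depends on the initial data
    alone. The instance with zero control supplies \<open>Y0\<close> and its square summability
    before the actual control is known.\<close>
  have "(\<lambda>_. 0) \<in> square_integrable {0<..<T}" by (rule square_integrable_0)
  then interpret T0: transposition \<alpha> b E "\<lambda>_. 0" T y\<^sub>0 y\<^sub>1
    by unfold_locales (use T0 y\<^sub>1 in auto)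
  have "1 / \<kappa> < T" using T by simp
  then obtain f where f: "f \<in> square_integrable {0<..<T}"
    and hum: "\<And>U. B.W.fin U \<Longrightarrow> (LINT t|lebesgue_on {0<..<T}. f t * B.W.gt U t) = B.W.pr T0.Y0 (B.W.coef U)"
    using B.W.hilbert_uniqueness_method[OF _ T0.l2_Y0] by metis
  interpret T: transposition \<alpha> b E f T y\<^sub>0 y\<^sub>1
    by unfold_locales (use f T0 y\<^sub>1 in auto)
  show ?thesis
    using f T.transposition_solution_exists T.transposition_solution_vanishes[OF hum] by blast
qed

theorem theorem5p1:
  fixes \<alpha> \<mu> T :: real and y\<^sub>0 :: L2 and y\<^sub>1 :: "L2 \<Rightarrow> real"
  assumes "0 \<le> \<alpha>" and "\<alpha> < 2" and "\<alpha> \<noteq> 1"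
    and "\<mu> \<le> (1 - \<alpha>)\<^sup>2 / 4"
    and "T > 4 / (2 - \<alpha>)"
    and "y\<^sub>1 \<in> H1_dual \<alpha> \<mu>"
  shows "\<exists>f\<in>square_integrable {0<..<T}.
    (\<exists>y y'. transposition_solution \<alpha> \<mu> T f y\<^sub>0 y\<^sub>1 y y') \<and>
    (\<forall>y y'. transposition_solution \<alpha> \<mu> T f y\<^sub>0 y\<^sub>1 y y' \<longrightarrow>
       y T = 0 \<and> (\<forall>v\<in>H1 \<alpha> \<mu>. y' T v = 0))"
proof -
  \<comment> \<open>With b = 1/2 + r the exponent is \<sigma> = (1 - \<alpha>)/2 + r, the larger
    root; the radicand is nonnegative by the assumption on \<mu>.\<close>
  define r where "r = sqrt ((1 - \<alpha>)\<^sup>2 / 4 - \<mu>)"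
  have r: "0 \<le> r" "r\<^sup>2 = (1 - \<alpha>)\<^sup>2 / 4 - \<mu>" using assms(4) by (simp_all add: r_def)
  interpret hardy_factorization \<alpha> "1/2 + r"
    by unfold_locales (use assms(1,2) r in auto)
  have "hardy_factorization.\<mu> \<alpha> (1/2 + r) = (1 - \<alpha>)\<^sup>2 / 4 - r\<^sup>2"
    unfolding \<mu>_def by (simp add: power2_eq_square field_simps)
  then have "hardy_factorization.\<mu> \<alpha> (1/2 + r) = \<mu>" using r by simp
  then show ?thesis using null_controllability[OF assms(5), of y\<^sub>1 y\<^sub>0] assms(6) by simp
qed

end
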